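(* Let $T>0$ and suppose that $A_1^{-1}g\in H^2(\Omega)$ for all $g\in L^2(\Omega)$. For each $i=1,2$, let $u_0^i\in X\cap V$ and $f^i\in L^2(Q_T)$, where $Q_T=\Omega\times(0,T)$, be such that there exists $f^*\in L^2(\Omega)$ satisfying $$f^i(x,t)\le f^*(x)\quad\text{for a.e. }(x,t)\in Q_T.$$ For $i=1,2$, let $u^i=u^i(x,t)$ be the unique strong solution on $[0,T]$ of $$\partial_t u=(\Delta u+f)_+ \ \text{in } \Omega\times(0,T),\quad u=0 \text{ on } \Gamma_D\times(0,T),\quad \partial_\nu u=0 \text{ on } \Gamma_N\times(0,T),\quad u|_{t=0}=u_0 \text{ in }\Omega$$ with $u_0=u_0^i$ and $f=f^i$. If $u_0^1\le u_0^2$ a.e. in $\Omega$ and $f^1\le f^2$ a.e. in $Q_T$, then $u^1\le u^2$ a.e. in $Q_T$.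
   Context: $\Omega\subset\mathbb{R}^n$ ($n\in\mathbb{N}$) is a bounded Lipschitz domain whose boundary $\Gamma$ is the disjoint union of $\Gamma_D$ (relatively open in $\Gamma$) and $\Gamma_N$; one of these may be empty, in which case the corresponding boundary condition is ignored. $\nu$ is the outward unit normal, $\gamma_0$ is the trace operator, $\mathcal{H}^{n-1}$ is the $(n-1)$-dimensional Hausdorff measure, $\partial_\nu u=\gamma_0(\nabla u)\cdot\nu$, and $(s)_+=\max\{s,0\}$. $V:=\{v\in H^1(\Omega):\gamma_0 v=0\ \mathcal{H}^{n-1}\text{-a.e. on }\Gamma_D\}$ with the $H^1(\Omega)$ norm, and $X:=\{v\in H^2(\Omega):\gamma_0(\nabla v)\cdot\nu=0\ \mathcal{H}^{n-1}\text{-a.e. on }\Gamma_N\}$ with the $H^2(\Omega)$ norm. $A_1:V\to V'$ is the isomorphism given by $\langle A_1u,v\rangle_V=\int_\Omega(\nabla u\cdot\nabla v+uv)\,dx$ for $u,v\in V$; for $g\in L^2(\Omega)$, $A_1^{-1}g$ is the unique $u\in V$ with $\int_\Omega(\nabla u\cdot\nabla v+uv)\,dx=\int_\Omega gv\,dx$ for all $v\in V$. Strong solution on $[0,T]$: a function $u\in C([0,T];L^2(\Omega))$ such that (i) $u\in W^{1,2}(0,T;L^2(\Omega))\cap L^2(0,T;X\cap V)$; (ii) $\partial_t u=(\Delta u+f)_+$ holds a.e. in $Q_T$; (iii) $u|_{t=0}=u_0$ a.e. in $\Omega$. *)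

theory Defs
  imports "HOL-Analysis.Analysis"
begin

section \<open>Hausdorff measure\<close>

text \<open>The empty set is treated separately so that \<open>s = 0\<close> gives counting measure
  (note that \<open>(0::real) ^ 0 = 1\<close>).\<close>

definition hausdorff_gauge :: "nat \<Rightarrow> 'a::metric_space set \<Rightarrow> ennreal" where
  "hausdorff_gauge s C =
     (if C = {} then 0 else ennreal (unit_ball_vol (real s) * (diameter C / 2) ^ s))"

definition hausdorff_content :: "nat \<Rightarrow> real \<Rightarrow> 'a::metric_space set \<Rightarrow> ennreal" where
  "hausdorff_content s \<delta> A =
     (INF C\<in>{C :: nat \<Rightarrow> 'a set. A \<subseteq> (\<Union>i. C i) \<and> (\<forall>i. bounded (C i) \<and> diameter (C i) \<le> \<delta>)}.
        \<Sum>i. hausdorff_gauge s (C i))"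

definition hausdorff_outer :: "nat \<Rightarrow> 'a::metric_space set \<Rightarrow> ennreal" where
  "hausdorff_outer s A = (SUP \<delta>\<in>{0<..}. hausdorff_content s \<delta> A)"

text \<open>That \<open>measure_of\<close> does not collapse to the zero measure here is
  lemma \<open>emeasure_hausdorff_measure\<close> below.\<close>

definition hausdorff_measure :: "nat \<Rightarrow> 'a::metric_space measure" where
  "hausdorff_measure s = measure_of UNIV (sets borel) (hausdorff_outer s)"

lemma hausdorff_content_le:
  assumes "A \<subseteq> (\<Union>i. C i)" "\<And>i. bounded (C i)" "\<And>i. diameter (C i) \<le> \<delta>"
  shows "hausdorff_content s \<delta> A \<le> (\<Sum>i. hausdorff_gauge s (C i))"
  unfolding hausdorff_content_def using assms by (intro INF_lower) auto

lemma hausdorff_content_mono: "A \<subseteq> B \<Longrightarrow> hausdorff_content s \<delta> A \<le> hausdorff_content s \<delta> B"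
  unfolding hausdorff_content_def by (rule INF_superset_mono) auto

lemma hausdorff_content_antimono: "\<delta> \<le> \<epsilon> \<Longrightarrow> hausdorff_content s \<epsilon> A \<le> hausdorff_content s \<delta> A"
  unfolding hausdorff_content_def by (rule INF_superset_mono) (auto intro: order_trans)

lemma hausdorff_outer_mono: "A \<subseteq> B \<Longrightarrow> hausdorff_outer s A \<le> hausdorff_outer s B"
  unfolding hausdorff_outer_def by (intro SUP_mono) (auto intro: hausdorff_content_mono)

lemma hausdorff_content_UN:
  fixes A :: "nat \<Rightarrow> 'a::metric_space set"
  shows "hausdorff_content s \<delta> (\<Union>i. A i) \<le> (\<Sum>i. hausdorff_content s \<delta> (A i))"
proof (rule ennreal_le_epsilon)
  fix e :: real
  assume e: "0 < e" and fin: "(\<Sum>i. hausdorff_content s \<delta> (A i)) < top"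
  have "\<exists>C. A i \<subseteq> (\<Union>j. C j) \<and> (\<forall>j. bounded (C j) \<and> diameter (C j) \<le> \<delta>) \<and>
      (\<Sum>j. hausdorff_gauge s (C j)) \<le> hausdorff_content s \<delta> (A i) + e * (1/2) ^ Suc i" for i
  proof -
    have lt: "hausdorff_content s \<delta> (A i) < top"
      using fin by (metis ennreal_suminf_lessD)
    have "hausdorff_content s \<delta> (A i) < hausdorff_content s \<delta> (A i) + e * (1/2) ^ Suc i"
      using ennreal_add_left_cancel_less[of "hausdorff_content s \<delta> (A i)" 0 "e * (1/2) ^ Suc i"] lt e
      by (simp add: less_top[symmetric] ennreal_zero_less_mult_iff)
    then show ?thesis
      by (subst (asm) (1) hausdorff_content_def) (auto simp: INF_less_iff intro: less_imp_le)
  qed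
  then obtain C where C: "\<And>i. A i \<subseteq> (\<Union>j. C i j)"
      "\<And>i j. bounded (C i j)" "\<And>i j. diameter (C i j) \<le> \<delta>"
      "\<And>i. (\<Sum>j. hausdorff_gauge s (C i j)) \<le> hausdorff_content s \<delta> (A i) + e * (1/2) ^ Suc i"
    by metis
  define D where "D k = (case prod_decode k of (i, j) \<Rightarrow> C i j)" for k
  have "(\<Union>i. A i) \<subseteq> (\<Union>k. D k)"
  proof
    fix x assume "x \<in> (\<Union>i. A i)"
    then obtain i j where "x \<in> C i j" using C(1) by blast
    then have "x \<in> D (prod_encode (i, j))" by (simp add: D_def)
    then show "x \<in> (\<Union>k. D k)" by blast
  qed
  then have "hausdorff_content s \<delta> (\<Union>i. A i) \<le> (\<Sum>k. hausdorff_gauge s (D k))"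
    by (rule hausdorff_content_le) (auto simp: D_def C split: prod.split)
  also have "\<dots> = (\<Sum>k. (\<lambda>(i,j). hausdorff_gauge s (C i j)) (prod_decode k))"
    by (intro arg_cong[where f=suminf] ext) (auto simp: D_def split: prod.split)
  also have "\<dots> = (\<Sum>i. \<Sum>j. hausdorff_gauge s (C i j))"
    by (rule suminf_ennreal_2dimen) auto
  also have "\<dots> \<le> (\<Sum>i. hausdorff_content s \<delta> (A i) + e * (1/2) ^ Suc i)"
    by (intro suminf_le C summableI)
  also have "\<dots> = (\<Sum>i. hausdorff_content s \<delta> (A i)) + (\<Sum>i. ennreal e * ennreal ((1/2) ^ Suc i))"
    using e by (subst suminf_add[symmetric])
      (auto simp del: ennreal_suminf_cmult simp add: ennreal_mult[symmetric])
  also have "\<dots> = (\<Sum>i. hausdorff_content s \<delta> (A i)) + e"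
    unfolding ennreal_suminf_cmult
    by (subst suminf_ennreal_eq[OF zero_le_power power_half_series]) auto
  finally show "hausdorff_content s \<delta> (\<Union>i. A i) \<le> (\<Sum>i. hausdorff_content s \<delta> (A i)) + ennreal e" .
qed

lemma hausdorff_outer_space:
  "outer_measure_space UNIV (hausdorff_outer s :: 'a::metric_space set \<Rightarrow> ennreal)"
proof -
  have "hausdorff_content s \<delta> ({} :: 'a set) \<le> (\<Sum>i. hausdorff_gauge s ({} :: 'a set))" if "\<delta> > 0" for \<delta>
    using that hausdorff_content_le[of "{}" "\<lambda>i. {} :: 'a set" \<delta> s] by simp
  then have "hausdorff_outer s ({} :: 'a set) = 0"
    unfolding hausdorff_outer_def by (intro SUP_eq_const antisym) (auto simp: hausdorff_gauge_def)
  moreover have "hausdorff_outer s (\<Union>i. A i) \<le> (\<Sum>i. hausdorff_outer s (A i))" for A :: "nat \<Rightarrow> 'a set"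
    unfolding hausdorff_outer_def
  proof (rule SUP_least)
    fix \<delta> :: real assume "\<delta> \<in> {0<..}"
    then show "hausdorff_content s \<delta> (\<Union>i. A i) \<le> (\<Sum>i. SUP \<delta>\<in>{0<..}. hausdorff_content s \<delta> (A i))"
      by (intro order_trans[OF hausdorff_content_UN] suminf_le summableI SUP_upper)
  qed
  ultimately show ?thesis
    by (auto simp: outer_measure_space_def positive_def increasing_def countably_subadditive_def
        intro: hausdorff_outer_mono)
qed

lemma hausdorff_outer_Un_le:
  fixes A B :: "'a::metric_space set"
  shows "hausdorff_outer s (A \<union> B) \<le> hausdorff_outer s A + hausdorff_outer s B"
proof -
  interpret sigma_algebra UNIV "UNIV :: 'a set set" by (simp add: sigma_algebra_iff2)
  have "subadditive UNIV (hausdorff_outer s :: 'a set \<Rightarrow> _)"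
    using hausdorff_outer_space[of s]
    by (intro countably_subadditive_subadditive) (auto simp: outer_measure_space_def)
  then have dj: "A \<inter> B = {} \<Longrightarrow> hausdorff_outer s (A \<union> B) \<le> hausdorff_outer s A + hausdorff_outer s B"
    for A B :: "'a set"
    by (auto simp: subadditive_def)
  show ?thesis
    using dj[of A "B - A"] hausdorff_outer_mono[of "B - A" B s]
    by (simp) (meson add_left_mono order_trans)
qed

lemma hausdorff_content_separated:
  fixes A B :: "'a::metric_space set"
  assumes d: "0 < \<delta>" "\<delta> < d" and sep: "\<And>x y. x \<in> A \<Longrightarrow> y \<in> B \<Longrightarrow> d \<le> dist x y"
  shows "hausdorff_content s \<delta> A + hausdorff_content s \<delta> B \<le> hausdorff_content s \<delta> (A \<union> B)"
  unfolding hausdorff_content_def[of s \<delta> "A \<union> B"]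
proof (rule INF_greatest, clarify)
  fix C :: "nat \<Rightarrow> 'a set"
  assume cov: "A \<union> B \<subseteq> (\<Union>i. C i)" and C: "\<forall>i. bounded (C i) \<and> diameter (C i) \<le> \<delta>"
  define CA where "CA i = (if C i \<inter> A = {} then {} else C i)" for i
  define CB where "CB i = (if C i \<inter> A = {} then C i else {})" for i
  have "B \<subseteq> (\<Union>i. CB i)"
  proof
    fix y assume y: "y \<in> B"
    then obtain i where i: "y \<in> C i" using cov by blast
    have "C i \<inter> A = {}"
    proof (rule ccontr)
      assume "C i \<inter> A \<noteq> {}"
      then obtain x where "x \<in> C i" "x \<in> A" by blast
      then have "d \<le> dist x y" "dist x y \<le> diameter (C i)"
        using sep y C i by (auto intro: diameter_bounded_bound)
      then show False using C d by (metis order_trans not_less)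
    qed
    then show "y \<in> (\<Union>i. CB i)" using i by (auto simp: CB_def)
  qed
  then have B: "hausdorff_content s \<delta> B \<le> (\<Sum>i. hausdorff_gauge s (CB i))"
    using C d by (intro hausdorff_content_le) (auto simp: CB_def)
  have "A \<subseteq> (\<Union>i. CA i)" using cov by (auto simp: CA_def) blast
  then have A: "hausdorff_content s \<delta> A \<le> (\<Sum>i. hausdorff_gauge s (CA i))"
    using C d by (intro hausdorff_content_le) (auto simp: CA_def)
  have "hausdorff_content s \<delta> A + hausdorff_content s \<delta> B
      \<le> (\<Sum>i. hausdorff_gauge s (CA i)) + (\<Sum>i. hausdorff_gauge s (CB i))"
    by (intro add_mono A B)
  also have "\<dots> = (\<Sum>i. hausdorff_gauge s (CA i) + hausdorff_gauge s (CB i))"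
    by (intro suminf_add summableI)
  also have "\<dots> = (\<Sum>i. hausdorff_gauge s (C i))"
    by (intro arg_cong[where f=suminf] ext) (auto simp: CA_def CB_def hausdorff_gauge_def)
  finally show "hausdorff_content s \<delta> A + hausdorff_content s \<delta> B \<le> (\<Sum>i. hausdorff_gauge s (C i))" .
qed

lemma hausdorff_outer_separated:
  fixes A B :: "'a::metric_space set"
  assumes d: "0 < d" and sep: "\<And>x y. x \<in> A \<Longrightarrow> y \<in> B \<Longrightarrow> d \<le> dist x y"
  shows "hausdorff_outer s A + hausdorff_outer s B \<le> hausdorff_outer s (A \<union> B)"
proof -
  have "hausdorff_outer s A + hausdorff_outer s B
      = (SUP \<delta>\<in>{0<..}. hausdorff_content s \<delta> A + hausdorff_content s \<delta> B)"
    unfolding hausdorff_outer_def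
  proof (rule SUP_add_directed_ennreal[symmetric])
    show "\<exists>k\<in>{0<..}. hausdorff_content s i A + hausdorff_content s j B
        \<le> hausdorff_content s k A + hausdorff_content s k B"
      if "i \<in> {0<..}" "j \<in> {0<..}" for i j
      using that by (intro bexI[of _ "min i j"] add_mono hausdorff_content_antimono) auto
  qed
  also have "\<dots> \<le> hausdorff_outer s (A \<union> B)"
  proof (rule SUP_least)
    fix \<delta> :: real assume \<delta>: "\<delta> \<in> {0<..}"
    define \<epsilon> where "\<epsilon> = min \<delta> (d / 2)"
    have \<epsilon>: "0 < \<epsilon>" "\<epsilon> < d" "\<epsilon> \<le> \<delta>" using \<delta> d by (auto simp: \<epsilon>_def)
    have "hausdorff_content s \<delta> A + hausdorff_content s \<delta> B
        \<le> hausdorff_content s \<epsilon> A + hausdorff_content s \<epsilon> B"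
      using \<epsilon> by (intro add_mono hausdorff_content_antimono)
    also have "\<dots> \<le> hausdorff_content s \<epsilon> (A \<union> B)"
      using \<epsilon> sep by (intro hausdorff_content_separated)
    also have "\<dots> \<le> hausdorff_outer s (A \<union> B)"
      unfolding hausdorff_outer_def using \<epsilon> by (intro SUP_upper) auto
    finally show "hausdorff_content s \<delta> A + hausdorff_content s \<delta> B \<le> hausdorff_outer s (A \<union> B)" .
  qed
  finally show ?thesis .
qed


lemma hausdorff_outer_closed:
  fixes F X :: "'a::metric_space set"
  assumes F: "closed F"
  shows "hausdorff_outer s (X \<inter> F) + hausdorff_outer s (X - F) \<le> hausdorff_outer s X"
proof (cases "F = {} \<or> hausdorff_outer s X = top")
  case True
  then show ?thesis
    using hausdorff_outer_space[of s, where 'a='a]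
    by (auto simp: outer_measure_space_def positive_def)
next
  case False
  then have ne: "F \<noteq> {}" and fin: "hausdorff_outer s X < top" by (auto simp: less_top)
  define E where "E n = {x \<in> X - F. 1 / real (Suc n) \<le> infdist x F}" for n
  define R where "R k = E (Suc k) - E k" for k
  define f where "f k = hausdorff_outer s (R (Suc k))" for k
  have E_mono: "E m \<subseteq> E n" if "m \<le> n" for m n
  proof -
    have "1 / real (Suc n) \<le> 1 / real (Suc m)"
      using that by (intro divide_left_mono) auto
    then show ?thesis by (auto simp: E_def)
  qed
  have sep: "hausdorff_outer s (E k) + hausdorff_outer s S \<le> hausdorff_outer s (E k \<union> S)"
    if S: "S \<inter> E (Suc k) = {}" "S \<subseteq> X - F" for S k
  proof (rule hausdorff_outer_separated)
    show "0 < 1 / real (Suc k) - 1 / real (Suc (Suc k))" by (simp add: frac_less2)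
    fix x y assume "x \<in> E k" "y \<in> S"
    then have "1 / real (Suc k) \<le> infdist x F" "infdist y F < 1 / real (Suc (Suc k))"
      using S by (auto simp: E_def not_le)
    then show "1 / real (Suc k) - 1 / real (Suc (Suc k)) \<le> dist x y"
      using infdist_triangle[of x F y] by linarith
  qed
  have sepF: "hausdorff_outer s (X \<inter> F) + hausdorff_outer s (E n) \<le> hausdorff_outer s X" for n
  proof -
    have "hausdorff_outer s (X \<inter> F) + hausdorff_outer s (E n) \<le> hausdorff_outer s (X \<inter> F \<union> E n)"
    proof (rule hausdorff_outer_separated)
      show "0 < 1 / real (Suc n)" by simp
      fix x y assume "x \<in> X \<inter> F" "y \<in> E n"
      then show "1 / real (Suc n) \<le> dist x y"
        using infdist_le[of x F y] by (auto simp: E_def dist_commute)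
    qed
    also have "\<dots> \<le> hausdorff_outer s X"
      by (intro hausdorff_outer_mono) (auto simp: E_def)
    finally show ?thesis .
  qed
  have E_le: "hausdorff_outer s (E n) \<le> hausdorff_outer s X" for n
    by (intro hausdorff_outer_mono) (auto simp: E_def)
  have alt: "(\<Sum>k<n. f (2 * k + p)) \<le> hausdorff_outer s (E (2 * n + p))" for n p
  proof (induction n)
    case (Suc n)
    have "(\<Sum>k<Suc n. f (2 * k + p)) \<le> hausdorff_outer s (E (2 * n + p)) + f (2 * n + p)"
      using Suc by (simp add: add_right_mono)
    also have "\<dots> \<le> hausdorff_outer s (E (2 * n + p) \<union> R (Suc (2 * n + p)))"
      unfolding f_def by (rule sep) (auto simp: R_def, auto simp: E_def)
    also have "\<dots> \<le> hausdorff_outer s (E (2 * Suc n + p))"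
      using E_mono[of "2 * n + p" "2 * Suc n + p"]
      by (intro hausdorff_outer_mono) (auto simp: R_def)
    finally show ?case .
  qed simp
  have "(\<Sum>k<n. f k) \<le> hausdorff_outer s X + hausdorff_outer s X" for n
  proof -
    have "(\<Sum>k<n. f k) \<le> (\<Sum>k<2 * n. f k)" by (intro sum_mono2) auto
    also have "\<dots> = (\<Sum>k<n. f (2 * k + 0)) + (\<Sum>k<n. f (2 * k + 1))"
      by (induction n) (auto simp: algebra_simps)
    also have "\<dots> \<le> hausdorff_outer s X + hausdorff_outer s X"
      by (intro add_mono order_trans[OF alt] E_le)
    finally show ?thesis .
  qed
  then have "(\<Sum>k. f k) \<le> hausdorff_outer s X + hausdorff_outer s X"
    by (intro suminf_le_const summableI)
  also have "\<dots> < top" using fin by simp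
  finally have f_fin: "(\<Sum>k. f k) < top" .
  have cover: "X - F \<subseteq> E (Suc n) \<union> (\<Union>k. R (Suc (k + n)))" for n
  proof
    fix x assume x: "x \<in> X - F"
    then have "0 < infdist x F" using infdist_pos_not_in_closed[OF F ne] by auto
    then obtain m where "inverse (real (Suc m)) < infdist x F" using reals_Archimedean by blast
    then have "x \<in> E m" using x by (auto simp: E_def inverse_eq_divide)
    define m0 where "m0 = (LEAST m. x \<in> E m)"
    have m0: "x \<in> E m0" unfolding m0_def using \<open>x \<in> E m\<close> by (rule LeastI)
    show "x \<in> E (Suc n) \<union> (\<Union>k. R (Suc (k + n)))"
    proof (cases "m0 \<le> Suc n")
      case True
      then show ?thesis using m0 E_mono by blast
    next
      case False
      then obtain k where k: "m0 = Suc (Suc (k + n))"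
        by (metis Suc_le_D Suc_le_mono add.commute le_Suc_ex not_less_eq_eq)
      then have "x \<notin> E (Suc (k + n))" using not_less_Least[of "Suc (k + n)" "\<lambda>m. x \<in> E m"]
        by (auto simp: m0_def)
      then show ?thesis using m0 k by (auto simp: R_def)
    qed
  qed
  let ?c = "hausdorff_outer s (X \<inter> F) + hausdorff_outer s (X - F)"
  have bound: "?c + (\<Sum>k<n. f k) \<le> hausdorff_outer s X + (\<Sum>k. f k)" for n
  proof -
    have csa: "hausdorff_outer s (\<Union>k. R (Suc (k + n))) \<le> (\<Sum>k. f (k + n))"
    proof -
      have "disjoint_family (\<lambda>k. R (Suc (k + n)))"
      proof -
        have "R i \<inter> R j = {}" if "i < j" for i j
          using E_mono[of "Suc i" j] that by (auto simp: R_def)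
        then have "R i \<inter> R j = {}" if "i \<noteq> j" for i j
          using that by (metis Int_commute nat_neq_iff)
        then show ?thesis by (auto simp: disjoint_family_on_def)
      qed
      then show ?thesis
        using hausdorff_outer_space[of s, where 'a='a]
        by (auto simp: outer_measure_space_def countably_subadditive_def f_def)
    qed
    have "hausdorff_outer s (X - F) \<le> hausdorff_outer s (E (Suc n) \<union> (\<Union>k. R (Suc (k + n))))"
      by (intro hausdorff_outer_mono cover)
    also have "\<dots> \<le> hausdorff_outer s (E (Suc n)) + (\<Sum>k. f (k + n))"
      by (rule order_trans[OF hausdorff_outer_Un_le]) (intro add_left_mono csa)
    finally have "?c + (\<Sum>k<n. f k) \<le> hausdorff_outer s (X \<inter> F) + (hausdorff_outer s (E (Suc n))
        + (\<Sum>k. f (k + n))) + (\<Sum>k<n. f k)"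
      by (intro add_mono) auto
    also have "\<dots> = (hausdorff_outer s (X \<inter> F) + hausdorff_outer s (E (Suc n)))
        + ((\<Sum>k. f (k + n)) + (\<Sum>k<n. f k))"
      by (simp add: ac_simps)
    also have "(\<Sum>k. f (k + n)) + (\<Sum>k<n. f k) = (\<Sum>k. f k)"
      using suminf_offset[of f n] by (simp add: add.commute)
    also have "hausdorff_outer s (X \<inter> F) + hausdorff_outer s (E (Suc n)) + (\<Sum>k. f k)
        \<le> hausdorff_outer s X + (\<Sum>k. f k)"
      by (intro add_right_mono sepF)
    finally show ?thesis .
  qed
  have "?c + (\<Sum>k. f k) = (SUP n. ?c + (\<Sum>k<n. f k))"
    by (simp add: suminf_eq_SUP ennreal_SUP_add_right)
  also have "\<dots> \<le> hausdorff_outer s X + (\<Sum>k. f k)"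
    by (intro SUP_least bound)
  finally show ?thesis
    using f_fin by (metis add.commute ennreal_add_left_cancel_le infinity_ennreal_def less_irrefl)
qed

lemma emeasure_hausdorff_measure:
  fixes A :: "'a::metric_space set"
  assumes "A \<in> sets borel"
  shows "emeasure (hausdorff_measure s) A = hausdorff_outer s A"
proof -
  interpret U: sigma_algebra UNIV "UNIV :: 'a set set" by (simp add: sigma_algebra_iff2)
  let ?L = "lambda_system UNIV UNIV (hausdorff_outer s :: 'a set \<Rightarrow> ennreal)"
  have ms: "measure_space UNIV ?L (hausdorff_outer s)"
    by (rule U.caratheodory_lemma[OF hausdorff_outer_space])
  then interpret L: sigma_algebra UNIV ?L by (simp add: measure_space_def)
  have "F \<in> ?L" if "closed F" for F
  proof -
    have "hausdorff_outer s x \<le> hausdorff_outer s (x \<inter> F) + hausdorff_outer s (x - F)" for x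
      using hausdorff_outer_Un_le[of s "x \<inter> F" "x - F"] by (simp add: Int_Diff_Un)
    then show ?thesis
      using hausdorff_outer_closed[OF that] by (auto simp: U.lambda_system_eq intro!: antisym)
  qed
  then have "sets borel \<subseteq> ?L"
    using L.sigma_sets_subset[of "Collect closed"] by (auto simp: borel_eq_closed)
  then have "countably_additive (sets borel) (hausdorff_outer s :: 'a set \<Rightarrow> ennreal)"
    using ms unfolding measure_space_def countably_additive_def
    by (metis L.countable_UN subset_trans)
  moreover have "positive (sets borel) (hausdorff_outer s :: 'a set \<Rightarrow> ennreal)"
    using ms by (auto simp: measure_space_def positive_def)
  ultimately show ?thesis
    using assms by (intro emeasure_measure_of[OF hausdorff_measure_def])
      (auto simp: hausdorff_measure_def sets.sigma_sets_eq[of borel, simplified])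
qed



section \<open>Lipschitz domains\<close>

definition bounded_Lipschitz_domain :: "'a::euclidean_space set \<Rightarrow> bool" where
  "bounded_Lipschitz_domain \<Omega> \<longleftrightarrow> open \<Omega> \<and> connected \<Omega> \<and> \<Omega> \<noteq> {} \<and> bounded \<Omega> \<and>
     (\<forall>p\<in>frontier \<Omega>. \<exists>r>0. \<exists>e \<phi> C. norm e = 1 \<and> C-lipschitz_on {y. y \<bullet> e = 0} \<phi> \<and>
        \<Omega> \<inter> ball p r = {y \<in> ball p r. y \<bullet> e < \<phi> (y - (y \<bullet> e) *\<^sub>R e)})"

definition surface_measure :: "'a::euclidean_space set \<Rightarrow> 'a measure" where
  "surface_measure \<Omega> = restrict_space (hausdorff_measure (DIM('a) - 1)) (frontier \<Omega>)"

text \<open>Near \<open>p\<close> the set lies, up to first order, on the side of the tangent hyperplane opposite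
  to \<open>\<nu>\<close>. On the boundary of a Lipschitz domain such a \<open>\<nu>\<close> exists exactly where a local graph
  function is differentiable, hence almost everywhere, and it is then unique; on the remaining
  null set \<open>outward_normal\<close> is unspecified.\<close>

definition is_outward_normal :: "'a::euclidean_space set \<Rightarrow> 'a \<Rightarrow> 'a \<Rightarrow> bool" where
  "is_outward_normal \<Omega> p \<nu> \<longleftrightarrow> norm \<nu> = 1 \<and>
     (\<forall>\<epsilon>>0. \<forall>\<^sub>F y in at p.
        ((y - p) \<bullet> \<nu> \<le> - \<epsilon> * norm (y - p) \<longrightarrow> y \<in> \<Omega>) \<and>
        ((y - p) \<bullet> \<nu> \<ge> \<epsilon> * norm (y - p) \<longrightarrow> y \<notin> \<Omega>))"

definition outward_normal :: "'a::euclidean_space set \<Rightarrow> 'a \<Rightarrow> 'a" where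
  "outward_normal \<Omega> p = (THE \<nu>. is_outward_normal \<Omega> p \<nu>)"


section \<open>Sobolev spaces\<close>

text \<open>Elements of function spaces are represented by functions; two representatives of the
  same class agree almost everywhere.\<close>

definition L2 :: "'b measure \<Rightarrow> ('b \<Rightarrow> 'c::euclidean_space) set" where
  "L2 M = {f \<in> borel_measurable M. integrable M (\<lambda>x. (norm (f x))\<^sup>2)}"

definition L2_sqnorm :: "'b measure \<Rightarrow> ('b \<Rightarrow> 'c::euclidean_space) \<Rightarrow> ennreal" where
  "L2_sqnorm M f = (\<integral>\<^sup>+x. ennreal ((norm (f x))\<^sup>2) \<partial>M)"

definition partial :: "'a::euclidean_space \<Rightarrow> ('a \<Rightarrow> real) \<Rightarrow> 'a \<Rightarrow> real" where
  "partial i f x = frechet_derivative f (at x) i"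

primrec C_k :: "nat \<Rightarrow> ('a::euclidean_space \<Rightarrow> real) \<Rightarrow> bool" where
  "C_k 0 f \<longleftrightarrow> continuous_on UNIV f"
| "C_k (Suc k) f \<longleftrightarrow> f differentiable_on UNIV \<and> (\<forall>i\<in>Basis. C_k k (partial i f))"

definition smooth :: "('a::euclidean_space \<Rightarrow> real) \<Rightarrow> bool" where
  "smooth f \<longleftrightarrow> (\<forall>k. C_k k f)"

definition test_functions :: "'a::euclidean_space set \<Rightarrow> ('a \<Rightarrow> real) set" where
  "test_functions \<Omega> =
     {\<phi>. smooth \<phi> \<and> compact (closure {x. \<phi> x \<noteq> 0}) \<and> closure {x. \<phi> x \<noteq> 0} \<subseteq> \<Omega>}"

definition is_weak_grad :: "'a::euclidean_space set \<Rightarrow> ('a \<Rightarrow> real) \<Rightarrow> ('a \<Rightarrow> 'a) \<Rightarrow> bool" where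
  "is_weak_grad \<Omega> u G \<longleftrightarrow> G \<in> L2 (lebesgue_on \<Omega>) \<and>
     (\<forall>\<phi>\<in>test_functions \<Omega>. \<forall>i\<in>Basis.
        (LINT x|lebesgue_on \<Omega>. u x * partial i \<phi> x) = - (LINT x|lebesgue_on \<Omega>. (G x \<bullet> i) * \<phi> x))"

definition weak_grad :: "'a::euclidean_space set \<Rightarrow> ('a \<Rightarrow> real) \<Rightarrow> 'a \<Rightarrow> 'a" where
  "weak_grad \<Omega> u = (SOME G. is_weak_grad \<Omega> u G)"

definition H1 :: "'a::euclidean_space set \<Rightarrow> ('a \<Rightarrow> real) set" where
  "H1 \<Omega> = {u \<in> L2 (lebesgue_on \<Omega>). \<exists>G. is_weak_grad \<Omega> u G}"

definition H1_sqnorm :: "'a::euclidean_space set \<Rightarrow> ('a \<Rightarrow> real) \<Rightarrow> ennreal" where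
  "H1_sqnorm \<Omega> u = L2_sqnorm (lebesgue_on \<Omega>) u + L2_sqnorm (lebesgue_on \<Omega>) (weak_grad \<Omega> u)"

definition H2 :: "'a::euclidean_space set \<Rightarrow> ('a \<Rightarrow> real) set" where
  "H2 \<Omega> = {u \<in> H1 \<Omega>. \<forall>i\<in>Basis. (\<lambda>x. weak_grad \<Omega> u x \<bullet> i) \<in> H1 \<Omega>}"

definition H2_sqnorm :: "'a::euclidean_space set \<Rightarrow> ('a \<Rightarrow> real) \<Rightarrow> ennreal" where
  "H2_sqnorm \<Omega> u = H1_sqnorm \<Omega> u +
     (\<Sum>i\<in>Basis. L2_sqnorm (lebesgue_on \<Omega>) (weak_grad \<Omega> (\<lambda>x. weak_grad \<Omega> u x \<bullet> i)))"

definition laplacian :: "'a::euclidean_space set \<Rightarrow> ('a \<Rightarrow> real) \<Rightarrow> 'a \<Rightarrow> real" where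
  "laplacian \<Omega> u x = (\<Sum>i\<in>Basis. weak_grad \<Omega> (\<lambda>y. weak_grad \<Omega> u y \<bullet> i) x \<bullet> i)"

text \<open>The graph of the trace operator \<open>\<gamma>\<^sub>0\<close>, i.e. of the continuous extension to \<open>H\<^sup>1(\<Omega>)\<close> of
  the restriction to the boundary of functions that are smooth up to the boundary. The latter are
  dense in \<open>H\<^sup>1(\<Omega>)\<close> for a bounded Lipschitz domain, so every \<open>u\<close> in \<open>H\<^sup>1(\<Omega>)\<close> has exactly one
  trace up to surface null sets.\<close>

definition has_trace :: "'a::euclidean_space set \<Rightarrow> ('a \<Rightarrow> real) \<Rightarrow> ('a \<Rightarrow> real) \<Rightarrow> bool" where
  "has_trace \<Omega> u g \<longleftrightarrow> u \<in> H1 \<Omega> \<and> g \<in> L2 (surface_measure \<Omega>) \<and>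
     (\<exists>\<phi>. (\<forall>k::nat. smooth (\<phi> k)) \<and>
        (\<lambda>k. H1_sqnorm \<Omega> (\<lambda>x. \<phi> k x - u x)) \<longlonglongrightarrow> 0 \<and>
        (\<lambda>k. L2_sqnorm (surface_measure \<Omega>) (\<lambda>x. \<phi> k x - g x)) \<longlonglongrightarrow> 0)"

definition space_V :: "'a::euclidean_space set \<Rightarrow> 'a set \<Rightarrow> ('a \<Rightarrow> real) set" where
  "space_V \<Omega> \<Gamma>\<^sub>D = {v \<in> H1 \<Omega>. \<exists>g. has_trace \<Omega> v g \<and>
     (AE x in surface_measure \<Omega>. x \<in> \<Gamma>\<^sub>D \<longrightarrow> g x = 0)}"

definition space_X :: "'a::euclidean_space set \<Rightarrow> 'a set \<Rightarrow> ('a \<Rightarrow> real) set" where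
  "space_X \<Omega> \<Gamma>\<^sub>N = {v \<in> H2 \<Omega>. \<exists>g.
     (\<forall>i\<in>Basis. has_trace \<Omega> (\<lambda>x. weak_grad \<Omega> v x \<bullet> i) (\<lambda>x. g x \<bullet> i)) \<and>
     (AE x in surface_measure \<Omega>. x \<in> \<Gamma>\<^sub>N \<longrightarrow> g x \<bullet> outward_normal \<Omega> x = 0)}"

text \<open>\<open>is_A1_inv \<Omega> \<Gamma>\<^sub>D g u\<close> says that \<open>u\<close> represents \<open>A\<^sub>1\<^sup>-\<^sup>1 g\<close>.\<close>

definition is_A1_inv :: "'a::euclidean_space set \<Rightarrow> 'a set \<Rightarrow> ('a \<Rightarrow> real) \<Rightarrow> ('a \<Rightarrow> real) \<Rightarrow> bool" where
  "is_A1_inv \<Omega> \<Gamma>\<^sub>D g u \<longleftrightarrow> u \<in> space_V \<Omega> \<Gamma>\<^sub>D \<and>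
     (\<forall>v\<in>space_V \<Omega> \<Gamma>\<^sub>D.
        (LINT x|lebesgue_on \<Omega>. weak_grad \<Omega> u x \<bullet> weak_grad \<Omega> v x + u x * v x) =
        (LINT x|lebesgue_on \<Omega>. g x * v x))"


section \<open>Functions of space and time\<close>

text \<open>A function of time with values in a space of functions on \<open>\<Omega>\<close> is written
  \<open>u (x, t)\<close>, its value at time \<open>t\<close> being \<open>\<lambda>x. u (x, t)\<close>. The space \<open>L\<^sup>2(0, T; L\<^sup>2(\<Omega>))\<close> is
  identified with \<open>L\<^sup>2(\<Omega> \<times> (0, T))\<close>.\<close>

abbreviation cylinder :: "'a set \<Rightarrow> real \<Rightarrow> ('a \<times> real) set" where
  "cylinder \<Omega> T \<equiv> \<Omega> \<times> {0<..<T}"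

definition C_time_L2 :: "'a::euclidean_space set \<Rightarrow> real \<Rightarrow> ('a \<times> real \<Rightarrow> real) set" where
  "C_time_L2 \<Omega> T = {u. \<forall>t\<in>{0..T}. (\<lambda>x. u (x, t)) \<in> L2 (lebesgue_on \<Omega>) \<and>
     ((\<lambda>s. L2_sqnorm (lebesgue_on \<Omega>) (\<lambda>x. u (x, s) - u (x, t))) \<longlongrightarrow> 0) (at t within {0..T})}"

text \<open>The Bochner integrals in the definition of the weak time derivative are evaluated
  pointwise, as an identity in \<open>L\<^sup>2(\<Omega>)\<close>.\<close>

definition is_time_deriv ::
    "'a::euclidean_space set \<Rightarrow> real \<Rightarrow> ('a \<times> real \<Rightarrow> real) \<Rightarrow> ('a \<times> real \<Rightarrow> real) \<Rightarrow> bool" where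
  "is_time_deriv \<Omega> T u v \<longleftrightarrow> v \<in> L2 (lebesgue_on (cylinder \<Omega> T)) \<and>
     (\<forall>\<psi>\<in>test_functions {0<..<T}. AE x in lebesgue_on \<Omega>.
        (LINT t|lebesgue_on {0<..<T}. u (x, t) * deriv \<psi> t) =
        - (LINT t|lebesgue_on {0<..<T}. v (x, t) * \<psi> t))"

definition W12_time_L2 :: "'a::euclidean_space set \<Rightarrow> real \<Rightarrow> ('a \<times> real \<Rightarrow> real) set" where
  "W12_time_L2 \<Omega> T =
     {u \<in> L2 (lebesgue_on (cylinder \<Omega> T)). \<exists>v. is_time_deriv \<Omega> T u v}"

text \<open>The Bochner space \<open>L\<^sup>2(0, T; S)\<close> for a space \<open>S\<close> of functions with squared norm \<open>N\<close>;
  strong measurability is approximability almost everywhere by \<open>S\<close>-valued simple functions.\<close>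

definition L2_time ::
    "real \<Rightarrow> ('a \<Rightarrow> real) set \<Rightarrow> (('a \<Rightarrow> real) \<Rightarrow> ennreal) \<Rightarrow> ('a \<times> real \<Rightarrow> real) set" where
  "L2_time T S N = {u.
     (AE t in lebesgue_on {0<..<T}. (\<lambda>x. u (x, t)) \<in> S) \<and>
     (\<exists>s. (\<forall>k::nat. simple_function (lebesgue_on {0<..<T}) (s k) \<and> s k ` {0<..<T} \<subseteq> S) \<and>
          (AE t in lebesgue_on {0<..<T}. (\<lambda>k. N (\<lambda>x. s k t x - u (x, t))) \<longlonglongrightarrow> 0)) \<and>
     (\<integral>\<^sup>+t. N (\<lambda>x. u (x, t)) \<partial>lebesgue_on {0<..<T}) < \<infinity>}"

text \<open>In the equation \<open>v\<close> is \<open>\<partial>\<^sub>t u\<close>, and \<open>w\<close> is a jointly measurable representative of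
  \<open>\<Delta>u\<close>; choosing \<open>laplacian \<Omega> (u(t))\<close> separately for each \<open>t\<close> need not yield one.\<close>

definition strong_solution ::
    "'a::euclidean_space set \<Rightarrow> 'a set \<Rightarrow> 'a set \<Rightarrow> real \<Rightarrow> ('a \<Rightarrow> real) \<Rightarrow>
     ('a \<times> real \<Rightarrow> real) \<Rightarrow> ('a \<times> real \<Rightarrow> real) \<Rightarrow> bool" where
  "strong_solution \<Omega> \<Gamma>\<^sub>D \<Gamma>\<^sub>N T u\<^sub>0 f u \<longleftrightarrow>
     u \<in> C_time_L2 \<Omega> T \<and>
     u \<in> W12_time_L2 \<Omega> T \<and>
     u \<in> L2_time T (space_X \<Omega> \<Gamma>\<^sub>N \<inter> space_V \<Omega> \<Gamma>\<^sub>D) (H2_sqnorm \<Omega>) \<and>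
     (\<exists>v w. is_time_deriv \<Omega> T u v \<and>
        w \<in> L2 (lebesgue_on (cylinder \<Omega> T)) \<and>
        (AE t in lebesgue_on {0<..<T}. AE x in lebesgue_on \<Omega>.
           w (x, t) = laplacian \<Omega> (\<lambda>y. u (y, t)) x) \<and>
        (AE z in lebesgue_on (cylinder \<Omega> T). v z = max (w z + f z) 0)) \<and>
     (AE x in lebesgue_on \<Omega>. u (x, 0) = u\<^sub>0 x)"

end

theory Submission
  imports Defs
begin

text \<open>Let \<open>w = u\<^sub>1 - u\<^sub>2\<close>. Since \<open>f\<^sub>1 \<le> f\<^sub>2\<close>, the two equations give \<open>\<partial>\<^sub>t w \<le> (\<Delta>w)\<^sub>+\<close>, so for every
  \<open>\<epsilon> > 0\<close> the functions \<open>h = (\<partial>\<^sub>t w - \<epsilon>)\<^sub>+\<close> and \<open>r = (\<epsilon> - \<Delta>w)\<^sub>+\<close> satisfy \<open>r h = 0\<close> a.e. As \<open>\<partial>\<^sub>t w\<close> is only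
  square integrable it cannot be used as a test function in \<open>V\<close>. Instead, on a time grid \<open>t\<^sub>k\<close> of width
  \<open>\<tau>\<close>, let \<open>d\<^sub>k = (w(t\<^sub>k) - \<epsilon> t\<^sub>k - m\<^sub>k\<^sub>-\<^sub>1)\<^sub>+\<close> be the increments of the running maximum
  \<open>m\<^sub>k = m\<^sub>k\<^sub>-\<^sub>1 + d\<^sub>k\<close>. They belong to \<open>V\<close>, and testing \<open>-\<Delta>w(t\<^sub>k)\<close> with \<open>d\<^sub>k\<close> yields
  \<open>\<bar>\<nabla>m\<^sub>k\<bar>\<^sup>2 / 2 - \<bar>\<nabla>m\<^sub>k\<^sub>-\<^sub>1\<bar>\<^sup>2 / 2 \<le> - \<integral> \<Delta>w(t\<^sub>k) d\<^sub>k\<close>, while \<open>d\<^sub>k\<close> is at most the integral of \<open>h\<close> over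
  \<open>(t\<^sub>k - \<tau>, t\<^sub>k)\<close>. Summation bounds \<open>\<epsilon> \<integral> (w(t) - \<epsilon> t)\<^sub>+\<close> by the integrals of \<open>r(t\<^sub>j)\<close> against these
  integrals of \<open>h\<close>. Averaged over all grids, this is \<open>T\<close> times the mean over \<open>0 < s < \<tau>\<close> of
  \<open>\<integral> r(x, t) h(x, t - s)\<close>, which tends to \<open>\<integral> r h = 0\<close> as \<open>\<tau> \<rightarrow> 0\<close>. Finally \<open>\<epsilon> \<rightarrow> 0\<close>.

  Green's formula behind the energy estimate is reduced by a partition of unity to the region below a
  Lipschitz graph, where Rademacher's theorem gives the outward normal almost everywhere.\<close>

section \<open>Smooth functions\<close>

text \<open>Testing with the positive part of \<open>w\<close> leads nowhere: (\<Delta>w)_+ w_+ is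
  nonnegative and uncontrolled. The natural multiplier of -\<Delta>w is (\<partial>_t w)_+, which
  formally turns the gradient term into a time derivative; the increments of the running maximum are
  its discrete substitute, built from values of \<open>w\<close> alone. The \<epsilon> has two
  tasks. Where \<partial>_t w > \<epsilon>, the inequality forces \<Delta>w \<ge> \<partial>_t w >
  \<epsilon>, whence \<open>r h = 0\<close>. It also produces the term \<epsilon> \<integral> m,
  which controls the maximum itself even if \<Gamma>_D is empty and gradients do not see constants.
  Averaging over grids is forced as well: membership in the spaces and the equation are known only
  for almost every time, and the product of r with a delayed h is small only in the mean over the
  cylinder. The remaining obstacle is Green's formula for traces that are mere limits of boundary
  values of smooth functions, on a boundary whose normal exists only almost everywhere.\<close>

lemma partial_eqI: "(f has_derivative D) (at x) \<Longrightarrow> partial i f x = D i"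
  unfolding partial_def by (metis frechet_derivative_at)

lemma sum_inner_Basis:
  fixes g :: "'a::euclidean_space \<Rightarrow> real"
  shows "i \<in> Basis \<Longrightarrow> (\<Sum>j\<in>Basis. (i \<bullet> j) * g j) = g i"
  by (simp add: inner_Basis if_distrib[where f="\<lambda>z. z * _"] cong: if_cong)

text \<open>The closure rules for \<open>C_k\<close> follow one pattern: a
  \<open>has_derivative\<close> rule supplies \<open>D\<close>, \<open>sum_inner_Basis\<close>
  collapses \<open>D x i\<close> to an expression in first partial derivatives, and the induction
  hypothesis, general in the functions, applies to it one order lower.\<close>

lemma C_k_SucI:
  assumes "\<And>x. (f has_derivative D x) (at x)" "\<And>i. i \<in> Basis \<Longrightarrow> C_k k (\<lambda>x. D x i)"
  shows "C_k (Suc k) f"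
proof -
  have "partial i f = (\<lambda>x. D x i)" for i
    using assms(1) by (auto intro!: ext partial_eqI)
  then show ?thesis
    using assms by (auto simp: differentiable_on_def intro: differentiableI)
qed

lemma C_k_Suc_has_derivative:
  assumes "C_k (Suc k) f"
  shows "(f has_derivative (\<lambda>h. \<Sum>i\<in>Basis. (h \<bullet> i) * partial i f x)) (at x)"
proof -
  have "f differentiable (at x)"
    using assms by (auto simp: differentiable_on_def)
  then have d: "(f has_derivative frechet_derivative f (at x)) (at x)"
    by (simp add: frechet_derivative_works)
  then have "linear (frechet_derivative f (at x))" by (rule has_derivative_linear)
  then have "frechet_derivative f (at x) h = (\<Sum>i\<in>Basis. (h \<bullet> i) * partial i f x)" for h
    unfolding partial_def
    by (subst euclidean_representation[of h, symmetric]) (simp add: linear_sum linear_scale)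
  then have "frechet_derivative f (at x) = (\<lambda>h. \<Sum>i\<in>Basis. (h \<bullet> i) * partial i f x)" by blast
  then show ?thesis using d by metis
qed

lemma C_k_Suc_partial: "C_k (Suc k) f \<Longrightarrow> i \<in> Basis \<Longrightarrow> C_k k (partial i f)"
  by simp

lemma C_k_Suc_imp: "C_k (Suc k) f \<Longrightarrow> C_k k f"
proof (induction k arbitrary: f)
  case 0
  then show ?case by (auto intro: differentiable_imp_continuous_on)
next
  case (Suc k)
  show ?case
    using Suc.prems by (auto intro: Suc.IH)
qed

lemma C_k_const [simp]: "C_k k (\<lambda>x. c)"
proof (induction k arbitrary: c)
  case (Suc k)
  show ?case by (rule C_k_SucI[where D="\<lambda>x h. 0"]) (auto intro: Suc)
qed simp

lemma C_k_add: "C_k k f \<Longrightarrow> C_k k g \<Longrightarrow> C_k k (\<lambda>x. f x + g x)"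
proof (induction k arbitrary: f g)
  case 0
  then show ?case by (auto intro: continuous_on_add)
next
  case (Suc k)
  show ?case
    by (rule C_k_SucI[OF has_derivative_add[OF Suc.prems[THEN C_k_Suc_has_derivative]]])
       (use Suc in \<open>simp add: sum_inner_Basis\<close>)
qed

lemma C_k_mult: "C_k k f \<Longrightarrow> C_k k g \<Longrightarrow> C_k k (\<lambda>x. f x * g x)"
proof (induction k arbitrary: f g)
  case 0
  then show ?case by (auto intro: continuous_on_mult)
next
  case (Suc k)
  show ?case
  proof (rule C_k_SucI[OF has_derivative_mult[OF Suc.prems[THEN C_k_Suc_has_derivative]]])
    fix i :: 'a assume "i \<in> Basis"
    then show "C_k k (\<lambda>x. f x * (\<Sum>ia\<in>Basis. i \<bullet> ia * partial ia g x) +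
                  (\<Sum>ia\<in>Basis. i \<bullet> ia * partial ia f x) * g x)"
      by (simp only: sum_inner_Basis)
        (intro C_k_add Suc.IH Suc.prems[THEN C_k_Suc_imp] Suc.prems[THEN C_k_Suc_partial])
  qed
qed

lemma C_k_minus: "C_k k f \<Longrightarrow> C_k k (\<lambda>x. - f x)"
  using C_k_mult[of k "\<lambda>x. -1" f] by simp

lemma C_k_diff: "C_k k f \<Longrightarrow> C_k k g \<Longrightarrow> C_k k (\<lambda>x. f x - g x)"
  using C_k_add[OF _ C_k_minus, of k f g] by simp

lemma C_k_sum: "(\<And>j. j \<in> J \<Longrightarrow> C_k k (f j)) \<Longrightarrow> C_k k (\<lambda>x. \<Sum>j\<in>J. f j x)"
  by (induction J rule: infinite_finite_induct) (auto intro: C_k_add)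

lemma C_k_inner_const: "C_k k (\<lambda>x. x \<bullet> a)"
proof (cases k)
  case (Suc j)
  show ?thesis unfolding Suc
    by (rule C_k_SucI[where D="\<lambda>x h. h \<bullet> a"]) (auto intro!: derivative_eq_intros)
qed (auto intro!: continuous_intros)

lemma C_k_compose:
  fixes h :: "real \<Rightarrow> real" and f :: "'a::euclidean_space \<Rightarrow> real"
  shows "C_k k h \<Longrightarrow> C_k k f \<Longrightarrow> C_k k (\<lambda>x. h (f x))"
proof (induction k arbitrary: f h)
  case 0
  then show ?case by (auto intro: continuous_on_compose2)
next
  case (Suc k)
  have d: "((\<lambda>x. h (f x)) has_derivative
      (\<lambda>v. (\<Sum>i\<in>Basis. (v \<bullet> i) * partial i f x) * partial 1 h (f x))) (at x)" for x
    using has_derivative_compose[OF C_k_Suc_has_derivative[OF Suc.prems(2)]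
        C_k_Suc_has_derivative[OF Suc.prems(1)]] by simp
  show ?case
  proof (rule C_k_SucI[OF d])
    fix i :: 'a assume i: "i \<in> Basis"
    then show "C_k k (\<lambda>x. (\<Sum>j\<in>Basis. i \<bullet> j * partial j f x) * partial 1 h (f x))"
      by (simp only: sum_inner_Basis)
        (intro C_k_mult Suc.prems(2)[THEN C_k_Suc_partial] Suc.IH[of "partial 1 h" f]
          Suc.prems(2)[THEN C_k_Suc_imp] Suc.prems(1)[THEN C_k_Suc_partial]; simp)
  qed
qed

lemma C_k_inverse: "C_k k f \<Longrightarrow> (\<And>x. f x \<noteq> 0) \<Longrightarrow> C_k k (\<lambda>x. inverse (f x))"
proof (induction k arbitrary: f)
  case 0
  then show ?case by (auto intro: continuous_on_inverse)
next
  case (Suc k)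
  show ?case
  proof (rule C_k_SucI[OF Deriv.has_derivative_inverse[OF Suc.prems(2) C_k_Suc_has_derivative[OF Suc.prems(1)]]])
    fix i :: 'a assume "i \<in> Basis"
    then show "C_k k (\<lambda>x. - (inverse (f x) * (\<Sum>ia\<in>Basis. i \<bullet> ia * partial ia f x) * inverse (f x)))"
      by (simp only: sum_inner_Basis)
        (intro C_k_minus C_k_mult Suc.IH Suc.prems(1)[THEN C_k_Suc_imp] Suc.prems(2)
           Suc.prems(1)[THEN C_k_Suc_partial])
  qed
qed

lemma C_k_sqrt: "C_k k f \<Longrightarrow> (\<And>x. f x > 0) \<Longrightarrow> C_k k (\<lambda>x. sqrt (f x))"
proof (induction k arbitrary: f)
  case 0
  then show ?case by (auto intro: continuous_on_real_sqrt)
next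
  case (Suc k)
  have d: "((\<lambda>x. sqrt (f x)) has_derivative
      (\<lambda>v. (\<Sum>i\<in>Basis. (v \<bullet> i) * partial i f x) * (inverse (sqrt (f x)) / 2))) (at x)" for x
    by (rule derivative_eq_intros C_k_Suc_has_derivative[OF Suc.prems(1)] refl Suc.prems(2))+
  have sq: "C_k k (\<lambda>x. inverse (sqrt (f x)) * (1/2))"
    by (intro C_k_mult C_k_inverse Suc.IH C_k_const Suc.prems(1)[THEN C_k_Suc_imp] Suc.prems(2))
      (use Suc.prems(2) in \<open>simp add: less_imp_neq[THEN not_sym]\<close>)
  show ?case
  proof (rule C_k_SucI[OF d])
    fix i :: 'a assume "i \<in> Basis"
    then show "C_k k (\<lambda>x. (\<Sum>ia\<in>Basis. i \<bullet> ia * partial ia f x) * (inverse (sqrt (f x)) / 2))"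
      using C_k_mult[OF Suc.prems(1)[THEN C_k_Suc_partial] sq, of i] by (simp only: sum_inner_Basis) simp
  qed
qed

lemma C_k_realI:
  fixes f :: "real \<Rightarrow> real"
  assumes "\<And>x. (f has_real_derivative f' x) (at x)" "C_k k f'"
  shows "C_k (Suc k) f"
  using assms by (intro C_k_SucI[where D="\<lambda>x h. f' x * h"]) (auto simp: has_field_derivative_def)

lemma C_k_exp: "C_k k (exp :: real \<Rightarrow> real)"
proof (induction k)
  case (Suc k)
  then show ?case by (intro C_k_realI[where f'=exp]) auto
qed (auto intro!: continuous_intros)

lemma smooth_const [simp]: "smooth (\<lambda>x. c)"
  and smooth_add: "smooth f \<Longrightarrow> smooth g \<Longrightarrow> smooth (\<lambda>x. f x + g x)"
  and smooth_mult: "smooth f \<Longrightarrow> smooth g \<Longrightarrow> smooth (\<lambda>x. f x * g x)"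
  and smooth_minus: "smooth f \<Longrightarrow> smooth (\<lambda>x. - f x)"
  and smooth_diff: "smooth f \<Longrightarrow> smooth g \<Longrightarrow> smooth (\<lambda>x. f x - g x)"
  and smooth_sum: "(\<And>j. j \<in> J \<Longrightarrow> smooth (p j)) \<Longrightarrow> smooth (\<lambda>x. \<Sum>j\<in>J. p j x)"
  and smooth_inner_const: "smooth (\<lambda>x. x \<bullet> a)"
  and smooth_compose: "smooth h \<Longrightarrow> smooth f \<Longrightarrow> smooth (\<lambda>x. h (f x))"
  and smooth_inverse: "smooth f \<Longrightarrow> (\<And>x. f x \<noteq> 0) \<Longrightarrow> smooth (\<lambda>x. inverse (f x))"
  and smooth_sqrt: "smooth f \<Longrightarrow> (\<And>x. f x > 0) \<Longrightarrow> smooth (\<lambda>x. sqrt (f x))"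
  and smooth_exp: "smooth (exp :: real \<Rightarrow> real)"
  by (auto simp: smooth_def C_k_add C_k_mult C_k_minus C_k_diff C_k_sum C_k_inner_const
      C_k_compose C_k_inverse C_k_sqrt C_k_exp)

lemma smooth_id: "smooth (\<lambda>x::real. x)"
  using smooth_inner_const[of "1::real"] by simp

lemma smooth_partial: "smooth f \<Longrightarrow> i \<in> Basis \<Longrightarrow> smooth (partial i f)"
  unfolding smooth_def by (metis C_k_Suc_partial)

lemma smooth_has_derivative:
  "smooth f \<Longrightarrow> (f has_derivative (\<lambda>h. \<Sum>i\<in>Basis. (h \<bullet> i) * partial i f x)) (at x)"
  unfolding smooth_def by (metis C_k_Suc_has_derivative)

lemma smooth_continuous_on: "smooth f \<Longrightarrow> continuous_on A f"
  unfolding smooth_def by (metis C_k.simps(1) continuous_on_subset subset_UNIV)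

lemma smooth_norm_sq: "smooth (\<lambda>x. (norm (x - p))\<^sup>2)"
proof -
  have "(norm (x - p))\<^sup>2 = (\<Sum>i\<in>Basis. (x \<bullet> i - p \<bullet> i) * (x \<bullet> i - p \<bullet> i))" for x
    unfolding power2_norm_eq_inner by (subst euclidean_inner) (simp add: inner_diff_left)
  then show ?thesis
    by (auto intro!: smooth_sum smooth_mult smooth_diff smooth_inner_const)
qed

lemma partial_mult:
  assumes "smooth f" "smooth g" "i \<in> Basis"
  shows "partial i (\<lambda>x. f x * g x) x = f x * partial i g x + partial i f x * g x"
  by (rule partial_eqI[OF has_derivative_mult[OF assms(1,2)[THEN smooth_has_derivative]], THEN trans])
    (use assms(3) in \<open>simp add: sum_inner_Basis\<close>)

lemma partial_diff:
  assumes "smooth f" "smooth g" "i \<in> Basis"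
  shows "partial i (\<lambda>x. f x - g x) x = partial i f x - partial i g x"
  by (rule partial_eqI[OF has_derivative_diff[OF assms(1,2)[THEN smooth_has_derivative]], THEN trans])
    (use assms(3) in \<open>simp add: sum_inner_Basis\<close>)

lemma partial_add:
  assumes "smooth f" "smooth g" "i \<in> Basis"
  shows "partial i (\<lambda>x. f x + g x) x = partial i f x + partial i g x"
  by (rule partial_eqI[OF has_derivative_add[OF assms(1,2)[THEN smooth_has_derivative]], THEN trans])
    (use assms(3) in \<open>simp add: sum_inner_Basis\<close>)

lemma partial_scale:
  assumes "smooth g" "i \<in> Basis"
  shows "partial i (\<lambda>x. c * g x) x = c * partial i g x"
  by (rule partial_eqI[OF has_derivative_mult_right[OF smooth_has_derivative[OF assms(1)]], THEN trans])
    (use assms(2) in \<open>simp add: sum_inner_Basis\<close>)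

lemma partial_compose:
  assumes h: "(h has_real_derivative h') (at (f x))" and "smooth f" "i \<in> Basis"
  shows "partial i (\<lambda>x. h (f x)) x = h' * partial i f x"
proof -
  have "(h has_derivative (*) h') (at (f x))" using h by (simp add: has_field_derivative_def)
  from has_derivative_compose[OF smooth_has_derivative[OF assms(2)] this]
  show ?thesis
    by (rule partial_eqI[THEN trans])
      (use assms(3) in \<open>simp add: sum_inner_Basis\<close>)
qed

subsection \<open>Cutoff functions\<close>

text \<open>This is exp(-1/s) s^(-n) for s > 0. The family in \<open>n\<close> is closed under
  differentiation up to linear combinations, so one induction on the order gives smoothness of all
  members; the cutoffs are built from \<open>n = 0\<close>.\<close>

definition exp_recip :: "nat \<Rightarrow> real \<Rightarrow> real" where
  "exp_recip n s = (if s \<le> 0 then 0 else exp (- inverse s) * inverse s ^ n)"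

lemma exp_recip_tendsto_0: "(exp_recip n \<longlongrightarrow> 0) (at 0)"
proof -
  have "((\<lambda>x::real. x ^ n / exp x) \<longlongrightarrow> 0) at_top" by (rule tendsto_power_div_exp_0)
  then have "((\<lambda>s::real. inverse s ^ n / exp (inverse s)) \<longlongrightarrow> 0) (at_right 0)"
    by (rule filterlim_compose[OF _ filterlim_inverse_at_top_right])
  moreover have "\<forall>\<^sub>F s in at_right (0::real). inverse s ^ n / exp (inverse s) = exp_recip n s"
    unfolding eventually_at_filter
    by (rule always_eventually) (auto simp: exp_recip_def exp_minus field_simps)
  ultimately have r: "(exp_recip n \<longlongrightarrow> 0) (at_right 0)" by (rule Lim_transform_eventually)
  have "\<forall>\<^sub>F s in at_left (0::real). 0 = exp_recip n s"
    unfolding eventually_at_filter by (rule always_eventually) (auto simp: exp_recip_def)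
  then have l: "(exp_recip n \<longlongrightarrow> 0) (at_left 0)" by (rule Lim_transform_eventually[OF tendsto_const])
  show ?thesis using l r by (rule filterlim_split_at)
qed

lemma exp_recip_has_derivative:
  "(exp_recip n has_real_derivative (exp_recip (n + 2) s - real n * exp_recip (n + 1) s)) (at s)"
proof -
  consider "s < 0" | "s > 0" | "s = 0" by linarith
  then show ?thesis
  proof cases
    case 1
    have "(exp_recip n has_real_derivative 0) (at s)"
      by (rule has_field_derivative_transform_within_open[OF DERIV_const[of 0], of "{..<0}"])
        (use 1 in \<open>auto simp: exp_recip_def\<close>)
    then show ?thesis using 1 by (simp add: exp_recip_def)
  next
    case 2
    have "((\<lambda>s. exp (- inverse s) * inverse s ^ n) has_real_derivative
        (exp_recip (n + 2) s - real n * exp_recip (n + 1) s)) (at s)"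
      using 2 by (cases n; auto intro!: derivative_eq_intros simp: exp_recip_def;
        simp add: field_simps power2_eq_square; simp add: power_eq_if)
    then show ?thesis
      by (rule has_field_derivative_transform_within_open[of _ _ _ "{0<..}"])
        (use 2 in \<open>auto simp: exp_recip_def\<close>)
  next
    case 3
    \<comment> \<open>The difference quotient at 0 is again a member of the family, with index
      \<open>Suc n\<close>.\<close>
    have "((\<lambda>h. (exp_recip n (0 + h) - exp_recip n 0) / h) \<longlongrightarrow> 0) (at 0)"
    proof (rule Lim_transform_eventually[OF exp_recip_tendsto_0[of "Suc n"]])
      show "\<forall>\<^sub>F h in at 0. exp_recip (Suc n) h = (exp_recip n (0 + h) - exp_recip n 0) / h"
        unfolding eventually_at_filter by (rule always_eventually) (auto simp: exp_recip_def field_simps)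
    qed
    then show ?thesis unfolding 3 DERIV_def by (simp add: exp_recip_def)
  qed
qed

lemma smooth_exp_recip: "smooth (exp_recip n)"
proof -
  have "C_k k (exp_recip n)" for k
  proof (induction k arbitrary: n)
    case 0
    have "isCont (exp_recip n) s" for s using exp_recip_has_derivative by (rule DERIV_isCont)
    then show ?case by (simp add: continuous_on_eq_continuous_at)
  next
    case (Suc k)
    show ?case
      by (rule C_k_realI[OF exp_recip_has_derivative]) (intro C_k_diff C_k_mult C_k_const Suc)
  qed
  then show ?thesis by (simp add: smooth_def)
qed

definition bump :: "'a::euclidean_space \<Rightarrow> real \<Rightarrow> 'a \<Rightarrow> real" where
  "bump p r x = exp_recip 0 (r\<^sup>2 - (norm (x - p))\<^sup>2)"

lemma smooth_bump: "smooth (bump p r)"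
  unfolding bump_def
  by (intro smooth_compose[OF smooth_exp_recip] smooth_diff smooth_const smooth_norm_sq)

lemma bump_nonneg: "0 \<le> bump p r x"
  by (simp add: bump_def exp_recip_def)

lemma bump_pos_iff: "r > 0 \<Longrightarrow> bump p r x > 0 \<longleftrightarrow> x \<in> ball p r"
  by (auto simp: bump_def exp_recip_def dist_norm norm_minus_commute abs_le_square_iff[symmetric] not_le)

text \<open>As \<open>s\<close> and \<open>1 - s\<close> are never both nonpositive, the denominator
  is positive everywhere; the quotient is exactly 0 for s \<le> 0 and exactly 1 for s \<ge>
  1.\<close>

definition smooth_step :: "real \<Rightarrow> real" where
  "smooth_step s = exp_recip 0 s * inverse (exp_recip 0 s + exp_recip 0 (1 - s))"

lemma exp_recip_sum_pos: "exp_recip 0 s + exp_recip 0 (1 - s) > 0"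
  by (auto simp: exp_recip_def add_pos_pos)

lemma smooth_smooth_step: "smooth smooth_step"
  unfolding smooth_step_def
  by (intro smooth_mult smooth_exp_recip smooth_inverse smooth_add
     smooth_compose[OF smooth_exp_recip] smooth_diff smooth_const smooth_id)
    (use exp_recip_sum_pos in \<open>auto simp: less_imp_neq[THEN not_sym]\<close>)

lemma smooth_step_eq_0: "s \<le> 0 \<Longrightarrow> smooth_step s = 0"
  and smooth_step_eq_1: "1 \<le> s \<Longrightarrow> smooth_step s = 1"
  by (auto simp: smooth_step_def exp_recip_def)

lemma smooth_step_bounds: "0 \<le> smooth_step s" "smooth_step s \<le> 1"
proof -
  have "0 \<le> exp_recip 0 s" "0 \<le> exp_recip 0 (1 - s)" by (auto simp: exp_recip_def)
  then show "0 \<le> smooth_step s" "smooth_step s \<le> 1"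
    using exp_recip_sum_pos[of s] by (auto simp: smooth_step_def field_simps)
qed

text \<open>Clearing the positive denominators leaves e(s) e(1 - t) \<le> e(t) e(1 - s) for e =
  \<open>exp_recip 0\<close>, which is nonnegative and nondecreasing.\<close>

lemma smooth_step_mono: "s \<le> t \<Longrightarrow> smooth_step s \<le> smooth_step t"
proof -
  assume st: "s \<le> t"
  have m: "exp_recip 0 a \<le> exp_recip 0 b" if "a \<le> b" for a b
    using that by (auto simp: exp_recip_def field_simps)
  have nn: "0 \<le> exp_recip 0 a" for a by (auto simp: exp_recip_def)
  have "exp_recip 0 s * exp_recip 0 (1 - t) \<le> exp_recip 0 t * exp_recip 0 (1 - s)"
    using st by (intro mult_mono m nn) auto
  then show ?thesis
    using exp_recip_sum_pos[of s] exp_recip_sum_pos[of t]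
    by (simp add: smooth_step_def divide_inverse[symmetric] divide_simps) (simp add: algebra_simps)
qed

section \<open>The fundamental lemma of the calculus of variations\<close>

lemma integral_translate_lborel:
  fixes f :: "'a::euclidean_space \<Rightarrow> real"
  assumes "f \<in> borel_measurable borel"
  shows "(LINT x|lborel. f (x + c)) = (LINT x|lborel. f x)"
proof -
  have "(LINT x|lborel. f x) = (LINT x|distr lborel borel ((+) c). f x)"
    by (simp add: lborel_distr_plus)
  also have "\<dots> = (LINT x|lborel. f (c + x))"
    using assms by (subst integral_distr) auto
  finally show ?thesis by (simp add: add.commute)
qed

lemma smooth_borel_measurable: "smooth f \<Longrightarrow> f \<in> borel_measurable borel"
  by (intro borel_measurable_continuous_onI smooth_continuous_on)

lemma partial_eq_0_outside:
  fixes f :: "'a::euclidean_space \<Rightarrow> real"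
  assumes "\<And>x. R < norm x \<Longrightarrow> f x = 0" "R < norm x"
  shows "partial i f x = 0"
proof -
  have "open {x::'a. R < norm x}" by (intro open_Collect_less continuous_intros)
  then have "(f has_derivative (\<lambda>h. 0)) (at x)"
    using assms
    by (intro has_derivative_transform_within_open[OF has_derivative_const[of 0]]) auto
  then show ?thesis by (rule partial_eqI)
qed

lemma smooth_compact_support_bounded:
  fixes f :: "'a::euclidean_space \<Rightarrow> real"
  assumes "smooth f" "\<And>x. R < norm x \<Longrightarrow> f x = 0"
  shows "\<exists>M\<ge>0. \<forall>x. \<bar>f x\<bar> \<le> M"
proof -
  have "bounded (f ` cball 0 R)"
    by (intro compact_imp_bounded compact_continuous_image smooth_continuous_on assms(1)) simp
  then obtain M where "\<forall>x\<in>cball 0 R. \<bar>f x\<bar> \<le> M"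
    by (auto simp: bounded_iff)
  then have "\<bar>f x\<bar> \<le> max M 0" for x
    using assms(2)[of x] by (cases "R < norm x") (auto simp: not_less max.coboundedI1)
  then show ?thesis by (intro exI[of _ "max M 0"]) auto
qed

lemma smooth_compact_support_Lipschitz:
  fixes f :: "'a::euclidean_space \<Rightarrow> real"
  assumes "smooth f" "\<And>x. R < norm x \<Longrightarrow> f x = 0"
  shows "\<exists>L\<ge>0. \<forall>x y. \<bar>f x - f y\<bar> \<le> L * norm (x - y)"
proof -
  have "\<forall>i\<in>Basis. \<exists>M\<ge>0. \<forall>x. \<bar>partial i f x\<bar> \<le> M"
  proof
    fix i :: 'a assume i: "i \<in> Basis"
    show "\<exists>M\<ge>0. \<forall>x. \<bar>partial i f x\<bar> \<le> M"
      by (rule smooth_compact_support_bounded[OF smooth_partial[OF assms(1) i]])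
        (rule partial_eq_0_outside[OF assms(2)])
  qed
  then obtain M where M: "\<And>i x. i \<in> Basis \<Longrightarrow> \<bar>partial i f x\<bar> \<le> M i" "\<And>i. i \<in> Basis \<Longrightarrow> 0 \<le> M i"
    by metis
  define L where "L = sum M Basis"
  have on: "onorm (\<lambda>h. \<Sum>i\<in>Basis. (h \<bullet> i) * partial i f x) \<le> L" for x
  proof (rule onorm_le)
    fix h :: 'a
    have "norm (\<Sum>i\<in>Basis. (h \<bullet> i) * partial i f x) \<le> (\<Sum>i\<in>Basis. norm h * M i)"
    proof (rule sum_norm_le)
      fix i :: 'a assume "i \<in> Basis"
      then have "\<bar>h \<bullet> i\<bar> * \<bar>partial i f x\<bar> \<le> norm h * M i"
        by (intro mult_mono M Basis_le_norm) auto
      then show "norm (h \<bullet> i * partial i f x) \<le> norm h * M i"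
        by (simp add: abs_mult)
    qed
    then show "norm (\<Sum>i\<in>Basis. (h \<bullet> i) * partial i f x) \<le> L * norm h"
      by (simp add: L_def sum_distrib_left mult.commute)
  qed
  have "norm (f x - f y) \<le> L * norm (x - y)" for x y
    by (rule differentiable_bound[where S=UNIV and f'="\<lambda>x h. \<Sum>i\<in>Basis. (h \<bullet> i) * partial i f x"])
      (use on smooth_has_derivative[OF assms(1)] in \<open>auto\<close>)
  moreover have "0 \<le> L" unfolding L_def by (intro sum_nonneg M)
  ultimately show ?thesis by auto
qed

section \<open>Difference quotients under the integral\<close>

lemma difference_quotient_tendsto:
  fixes f :: "'a::real_normed_vector \<Rightarrow> real"
  assumes "(f has_derivative D) (at x)"
  shows "(\<lambda>n. real (Suc n) * (f (x + v /\<^sub>R real (Suc n)) - f x)) \<longlonglongrightarrow> D v"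
proof -
  have "((\<lambda>t. x + t *\<^sub>R v) has_derivative (\<lambda>t. t *\<^sub>R v)) (at 0)"
    by (auto intro!: derivative_eq_intros)
  from has_derivative_compose[OF this, of f D]
  have "((\<lambda>t. f (x + t *\<^sub>R v)) has_derivative (\<lambda>t. D (t *\<^sub>R v))) (at 0)"
    using assms by simp
  also have "(\<lambda>t. D (t *\<^sub>R v)) = (*) (D v)"
    using has_derivative_linear[OF assms] by (auto simp: linear_scale)
  finally have "((\<lambda>t. f (x + t *\<^sub>R v)) has_real_derivative D v) (at 0)"
    by (simp add: has_field_derivative_def)
  then have *: "((\<lambda>t. (f (x + t *\<^sub>R v) - f x) / t) \<longlongrightarrow> D v) (at 0)"
    by (simp add: DERIV_def)
  have "filterlim (\<lambda>n. inverse (real (Suc n))) (at 0) sequentially"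
    using LIMSEQ_inverse_real_of_nat by (simp add: filterlim_at del: of_nat_Suc)
  from filterlim_compose[OF * this] show ?thesis
    by (simp add: divide_inverse mult.commute)
qed

text \<open>The quotients are bounded by L |v| and vanish outside the ball of radius R + |v|, so
  dominated convergence applies. The weight \<open>g\<close> is general because three are needed:
  the constant 1, a Lipschitz function, and the indicator of a region.\<close>

lemma difference_quotient_integral_tendsto:
  fixes f g :: "'a::euclidean_space \<Rightarrow> real"
  assumes f: "smooth f" "\<And>x. R < norm x \<Longrightarrow> f x = 0"
    and g: "g \<in> borel_measurable borel" "\<And>x. norm x \<le> R + norm v \<Longrightarrow> \<bar>g x\<bar> \<le> M"
  shows "(\<lambda>n. LINT x|lborel. real (Suc n) * (f (x + v /\<^sub>R real (Suc n)) - f x) * g x)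
    \<longlonglongrightarrow> (LINT x|lborel. (\<Sum>i\<in>Basis. (v \<bullet> i) * partial i f x) * g x)"
proof -
  obtain L where L: "L \<ge> 0" "\<And>x y. \<bar>f x - f y\<bar> \<le> L * norm (x - y)"
    using smooth_compact_support_Lipschitz[where R=R, OF f] by auto
  have [measurable]: "f \<in> borel_measurable borel" "g \<in> borel_measurable borel"
    using f(1) g(1) by (auto intro: smooth_borel_measurable)
  have pm: "(\<lambda>x. \<Sum>i\<in>Basis. (v \<bullet> i) * partial i f x) \<in> borel_measurable borel"
    by (intro borel_measurable_sum borel_measurable_times borel_measurable_const
        smooth_borel_measurable smooth_partial f)
  show ?thesis
  proof (rule integral_dominated_convergence[where w="\<lambda>x. indicator (cball 0 (R + norm v)) x * (L * norm v * M)"])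
    show "(\<lambda>x. (\<Sum>i\<in>Basis. (v \<bullet> i) * partial i f x) * g x) \<in> borel_measurable lborel"
      using pm by measurable
    show "integrable lborel (\<lambda>x. indicator (cball 0 (R + norm v)) x * (L * norm v * M) :: real)"
      by (intro integrable_mult_left integrable_real_indicator emeasure_bounded_finite) auto
    show "AE x in lborel. (\<lambda>n. real (Suc n) * (f (x + v /\<^sub>R real (Suc n)) - f x) * g x)
         \<longlonglongrightarrow> (\<Sum>i\<in>Basis. (v \<bullet> i) * partial i f x) * g x"
      by (intro AE_I2 tendsto_mult tendsto_const difference_quotient_tendsto smooth_has_derivative f)
    show "AE x in lborel. norm (real (Suc n) * (f (x + v /\<^sub>R real (Suc n)) - f x) * g x)
         \<le> indicator (cball 0 (R + norm v)) x * (L * norm v * M)" for n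
    proof (rule AE_I2)
      fix x :: 'a
      show "norm (real (Suc n) * (f (x + v /\<^sub>R real (Suc n)) - f x) * g x)
         \<le> indicator (cball 0 (R + norm v)) x * (L * norm v * M)"
      proof (cases "norm x \<le> R + norm v")
        case True
        have "real (Suc n) * \<bar>f (x + v /\<^sub>R real (Suc n)) - f x\<bar> \<le> real (Suc n) * (L * norm (v /\<^sub>R real (Suc n)))"
          using L(2)[of "x + v /\<^sub>R real (Suc n)" x] by (intro mult_left_mono) auto
        also have "\<dots> = L * norm v" by simp
        finally show ?thesis
          using True g(2)[OF True] L by (auto simp: abs_mult intro!: mult_mono)
      next
        case False
        have "norm (v /\<^sub>R real (Suc n)) \<le> norm v" by (auto simp: field_simps mult_le_cancel_left1)
        then have "R < norm (x + v /\<^sub>R real (Suc n))"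
          using norm_diff_ineq[of x "v /\<^sub>R real (Suc n)"] False by linarith
        moreover have "R < norm x" using False norm_ge_zero[of v] by linarith
        ultimately have "f (x + v /\<^sub>R real (Suc n)) = 0" "f x = 0" using f(2) by auto
        then show ?thesis using False by simp
      qed
    qed
  qed (use pm in measurable)
qed

text \<open>By translation invariance every difference quotient of \<open>f\<close> has integral 0,
  and the limit inherits this. No iterated integral in the direction \<open>i\<close> is
  taken.\<close>

lemma integral_partial_eq_0:
  fixes f :: "'a::euclidean_space \<Rightarrow> real"
  assumes f: "smooth f" "\<And>x. R < norm x \<Longrightarrow> f x = 0" and i: "i \<in> Basis"
  shows "(LINT x|lborel. partial i f x) = 0"
proof -
  obtain M where M: "\<And>x. \<bar>f x\<bar> \<le> M" "M \<ge> 0" using smooth_compact_support_bounded[where R=R, OF f] by auto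
  have [measurable]: "f \<in> borel_measurable borel" using f(1) by (rule smooth_borel_measurable)
  have int: "integrable lborel f"
  proof (rule Bochner_Integration.integrable_bound)
    show "integrable lborel (\<lambda>x. indicator (cball 0 R) x * M :: real)"
      by (intro integrable_mult_left integrable_real_indicator emeasure_bounded_finite) auto
    show "AE x in lborel. norm (f x) \<le> norm (indicator (cball 0 R) x * M :: real)"
      using M f(2) by (auto simp: indicator_def not_le)
  qed auto
  have "(LINT x|lborel. real (Suc n) * (f (x + i /\<^sub>R real (Suc n)) - f x) * 1) = 0" for n
  proof -
    have "integrable (distr lborel borel ((+) (i /\<^sub>R real (Suc n)))) f"
      using int by (simp add: lborel_distr_plus)
    then have "integrable lborel (\<lambda>x. f (i /\<^sub>R real (Suc n) + x))"
      by (rule integrable_distr[rotated]) simp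
    then show ?thesis
      using integral_translate_lborel[of f "i /\<^sub>R real (Suc n)"] int
      by (simp add: add.commute Bochner_Integration.integral_diff)
  qed
  then have "(LINT x|lborel. (\<Sum>j\<in>Basis. (i \<bullet> j) * partial j f x) * 1) = 0"
    using difference_quotient_integral_tendsto[where R=R, OF f, where g="\<lambda>x. 1" and M=1 and v=i]
    by (auto intro: LIMSEQ_unique)
  then show ?thesis using i by (simp add: sum_inner_Basis)
qed

lemma test_functions_compact_support:
  assumes "\<phi> \<in> test_functions \<Omega>"
  shows "smooth \<phi>" "\<exists>R. \<forall>x. R < norm x \<longrightarrow> \<phi> x = 0" "x \<notin> \<Omega> \<Longrightarrow> \<phi> x = 0"
proof -
  show "smooth \<phi>" using assms by (simp add: test_functions_def)
  have "bounded (closure {x. \<phi> x \<noteq> 0})"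
    using assms by (auto simp: test_functions_def compact_imp_bounded)
  then obtain R where "\<forall>x\<in>closure {x. \<phi> x \<noteq> 0}. norm x \<le> R" by (auto simp: bounded_iff)
  then show "\<exists>R. \<forall>x. R < norm x \<longrightarrow> \<phi> x = 0"
    using closure_subset[of "{x. \<phi> x \<noteq> 0}"] by (intro exI[of _ R]) force
  show "x \<notin> \<Omega> \<Longrightarrow> \<phi> x = 0"
    using assms closure_subset[of "{x. \<phi> x \<noteq> 0}"] by (auto simp: test_functions_def)
qed

lemma partial_test_function_outside:
  assumes "\<phi> \<in> test_functions \<Omega>" "x \<notin> \<Omega>"
  shows "partial i \<phi> x = 0"
proof -
  have "open (- closure {x. \<phi> x \<noteq> 0})" "x \<in> - closure {x. \<phi> x \<noteq> 0}"
    using assms by (auto simp: test_functions_def)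
  then have "(\<phi> has_derivative (\<lambda>h. 0)) (at x)"
    using closure_subset[of "{x. \<phi> x \<noteq> 0}"]
    by (intro has_derivative_transform_within_open[OF has_derivative_const[of 0]]) auto
  then show ?thesis by (rule partial_eqI)
qed

text \<open>Countably many balls whose closures lie in \<open>U\<close> cover \<open>U\<close>. With
  S_n the sum of the first n bumps, 1 - exp(-n S_n) is smooth with values in [0, 1], is supported in
  finitely many of the closed balls, and tends to 1 exactly where some bump is positive.\<close>

lemma open_indicator_test_functions:
  fixes U :: "'a::euclidean_space set"
  assumes "open U"
  obtains \<phi> :: "nat \<Rightarrow> 'a \<Rightarrow> real" where
    "\<And>n. \<phi> n \<in> test_functions U" "\<And>n x. 0 \<le> \<phi> n x" "\<And>n x. \<phi> n x \<le> 1"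
    "\<And>x. (\<lambda>n. \<phi> n x) \<longlonglongrightarrow> indicator U x"
proof (cases "U = {}")
  case True
  have "(\<lambda>x. 0) \<in> test_functions U" by (simp add: test_functions_def)
  then show thesis using True by (intro that[of "\<lambda>n x. 0"]) auto
next
  case False
  define F where "F = {ball p r | p r. r > 0 \<and> cball p r \<subseteq> U}"
  have "\<Union>F = U"
  proof
    show "U \<subseteq> \<Union>F"
    proof
      fix x assume "x \<in> U"
      then obtain r where "r > 0" "cball x r \<subseteq> U" using assms open_contains_cball by blast
      then show "x \<in> \<Union>F" unfolding F_def by (intro UnionI[of "ball x r"]) auto
    qed
  qed (auto simp: F_def intro: subsetD[OF _ subsetD[OF ball_subset_cball]])
  moreover have "\<And>S. S \<in> F \<Longrightarrow> open S" by (auto simp: F_def)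
  ultimately obtain F' where F': "F' \<subseteq> F" "countable F'" "\<Union>F' = U" by (metis Lindelof)
  then have ne: "F' \<noteq> {}" using False by auto
  have "\<exists>p r. r > 0 \<and> cball p r \<subseteq> U \<and> from_nat_into F' n = ball p r" for n
    using subsetD[OF F'(1) from_nat_into[OF ne, of n]] unfolding F_def by auto
  then obtain p r where pr: "\<And>n. r n > 0" "\<And>n. cball (p n) (r n) \<subseteq> U"
      "\<And>n. from_nat_into F' n = ball (p n) (r n)" by metis
  have U: "U = (\<Union>n. ball (p n) (r n))"
  proof -
    have "U = \<Union>(range (from_nat_into F'))"
      using F'(3) range_from_nat_into[OF ne F'(2)] by simp
    then show ?thesis by (simp add: pr(3))
  qed
  define S where "S n x = (\<Sum>j<n. bump (p j) (r j) x)" for n x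
  define \<phi> where "\<phi> n x = 1 - exp (- (real n * S n x))" for n x
  have S0: "0 \<le> S n x" for n x by (auto simp: S_def intro: sum_nonneg bump_nonneg)
  show thesis
  proof
    show "\<phi> n \<in> test_functions U" for n
    proof -
      let ?K = "\<Union>j<n. cball (p j) (r j)"
      have "smooth (\<phi> n)" unfolding \<phi>_def S_def
        by (intro smooth_diff smooth_const smooth_compose[OF smooth_exp] smooth_minus smooth_mult
            smooth_sum smooth_bump)
      moreover have K: "compact ?K" "?K \<subseteq> U" using pr(2) by auto
      moreover have "{x. \<phi> n x \<noteq> 0} \<subseteq> ?K"
      proof clarify
        fix x assume nz: "\<phi> n x \<noteq> 0"
        have "S n x \<noteq> 0" using nz by (auto simp: \<phi>_def)
        then obtain j where "j < n" "bump (p j) (r j) x \<noteq> 0"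
          unfolding S_def by (meson lessThan_iff sum.not_neutral_contains_not_neutral)
        then show "x \<in> ?K" using bump_nonneg[of "p j" "r j" x] bump_pos_iff[OF pr(1), of "p j" j x]
          by (force simp: less_le)
      qed
      then have cl: "closure {x. \<phi> n x \<noteq> 0} \<subseteq> ?K"
        using K(1) by (intro closure_minimal compact_imp_closed)
      have "bounded {x. \<phi> n x \<noteq> 0}"
        by (rule bounded_subset[OF compact_imp_bounded[OF K(1)] order_trans[OF closure_subset cl]])
      ultimately show ?thesis using K(2) cl unfolding test_functions_def
        by (simp add: compact_closure)
    qed
    show "0 \<le> \<phi> n x" "\<phi> n x \<le> 1" for n x using S0[of n x] by (auto simp: \<phi>_def)
    show "(\<lambda>n. \<phi> n x) \<longlonglongrightarrow> indicator U x" for x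
    proof (cases "x \<in> U")
      case True
      then obtain j where "x \<in> ball (p j) (r j)" using U by auto
      then have b: "bump (p j) (r j) x > 0" by (rule bump_pos_iff[OF pr(1), THEN iffD2])
      have lim: "(\<lambda>n. exp (- (real n * bump (p j) (r j) x))) \<longlonglongrightarrow> 0"
      proof -
        have "filterlim (\<lambda>n. real n * bump (p j) (r j) x) at_top sequentially"
          by (rule filterlim_at_top_mult_tendsto_pos[OF tendsto_const b filterlim_real_sequentially])
        then have "filterlim (\<lambda>n. - (real n * bump (p j) (r j) x)) at_bot sequentially"
          by (rule filterlim_compose[OF filterlim_uminus_at_bot_at_top])
        then show ?thesis by (rule filterlim_compose[OF exp_at_bot])
      qed
      have "(\<lambda>n. exp (- (real n * S n x))) \<longlonglongrightarrow> 0"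
      proof (rule tendsto_sandwich[OF _ _ tendsto_const lim])
        show "\<forall>\<^sub>F n in sequentially. exp (- (real n * S n x)) \<le> exp (- (real n * bump (p j) (r j) x))"
          using eventually_gt_at_top[of j]
        proof eventually_elim
          case (elim n)
          have "bump (p j) (r j) x \<le> S n x"
            unfolding S_def by (rule member_le_sum) (use elim bump_nonneg in auto)
          then show ?case by (simp add: mult_left_mono)
        qed
      qed auto
      then have "(\<lambda>n. \<phi> n x) \<longlonglongrightarrow> 1 - 0" unfolding \<phi>_def by (intro tendsto_diff tendsto_const)
      then show ?thesis using True by simp
    next
      case False
      then have "bump (p j) (r j) x = 0" for j
        using U bump_nonneg[of "p j" "r j" x] bump_pos_iff[OF pr(1), of "p j" j x] by (auto simp: less_le)
      then show ?thesis using False by (simp add: \<phi>_def S_def)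
    qed
  qed
qed

lemma fundamental_lemma_open:
  fixes f :: "'a::euclidean_space \<Rightarrow> real"
  assumes \<Omega>: "open \<Omega>" and f: "integrable (lebesgue_on \<Omega>) f"
    and 0: "\<And>\<phi>. \<phi> \<in> test_functions \<Omega> \<Longrightarrow> (LINT x|lebesgue_on \<Omega>. f x * \<phi> x) = 0"
    and U: "open U" "U \<subseteq> \<Omega>"
  shows "(LINT x|lebesgue_on \<Omega>. f x * indicator U x) = 0"
proof -
  obtain \<phi> :: "nat \<Rightarrow> 'a \<Rightarrow> real" where \<phi>:
    "\<And>n. \<phi> n \<in> test_functions U" "\<And>n x. 0 \<le> \<phi> n x" "\<And>n x. \<phi> n x \<le> 1"
    "\<And>x. (\<lambda>n. \<phi> n x) \<longlonglongrightarrow> indicator U x"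
    using open_indicator_test_functions[OF U(1)] by metis
  have [measurable]: "f \<in> borel_measurable (lebesgue_on \<Omega>)" using f by auto
  have sm: "\<phi> n \<in> borel_measurable (lebesgue_on \<Omega>)" for n
    using \<phi>(1)[of n] test_functions_compact_support(1)[of "\<phi> n" U]
    by (intro measurable_restrict_space1 measurable_completion) (auto intro: smooth_borel_measurable)
  have "(\<lambda>n. LINT x|lebesgue_on \<Omega>. f x * \<phi> n x) \<longlonglongrightarrow> (LINT x|lebesgue_on \<Omega>. f x * indicator U x)"
  proof (rule integral_dominated_convergence[where w="\<lambda>x. norm (f x)"])
    show "AE x in lebesgue_on \<Omega>. (\<lambda>n. f x * \<phi> n x) \<longlonglongrightarrow> f x * indicator U x"
      by (intro AE_I2 tendsto_mult tendsto_const \<phi>)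
    show "AE x in lebesgue_on \<Omega>. norm (f x * \<phi> n x) \<le> norm (f x)" for n
      using \<phi>(2,3)[of n] by (auto simp: abs_mult intro!: AE_I2 mult_left_le)
    have "indicat_real U \<in> borel_measurable (lebesgue_on \<Omega>)"
      by (intro measurable_restrict_space1 borel_measurable_indicator) (use U in auto)
    then show "(\<lambda>x. f x * indicator U x) \<in> borel_measurable (lebesgue_on \<Omega>)" by measurable
  qed (use f sm in auto)
  moreover have "\<phi> n \<in> test_functions \<Omega>" for n
    using \<phi>(1)[of n] U(2) by (auto simp: test_functions_def)
  ultimately show ?thesis using 0 by (auto intro: LIMSEQ_unique)
qed

lemma AE_lebesgue_on_iff:
  assumes "\<Omega> \<in> sets lebesgue"
  shows "(AE x in lebesgue_on \<Omega>. P x) \<longleftrightarrow> (AE x in lebesgue. x \<in> \<Omega> \<longrightarrow> P x)"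
  by (rule AE_restrict_space_iff) (use assms in simp)

lemma sets_lebesgue_level_set:
  fixes f :: "'a::euclidean_space \<Rightarrow> real"
  assumes "\<Omega> \<in> sets lebesgue" "f \<in> borel_measurable (lebesgue_on \<Omega>)"
  shows "{x\<in>\<Omega>. f x > 0} \<in> sets lebesgue"
proof -
  have "{x \<in> space (lebesgue_on \<Omega>). f x > 0} \<in> sets (lebesgue_on \<Omega>)"
    using assms(2) by (rule borel_measurable_less[OF borel_measurable_const])
  moreover have "{x \<in> space (lebesgue_on \<Omega>). f x > 0} = {x\<in>\<Omega>. f x > 0}"
    by (simp add: space_restrict_space)
  moreover have "\<Omega> \<inter> space lebesgue \<in> sets lebesgue" using assms(1) by simp
  ultimately show ?thesis by (metis sets_restrict_space_iff)
qed

lemma integrable_mult_indicator_subset: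
  fixes f :: "'a::euclidean_space \<Rightarrow> real"
  assumes "integrable (lebesgue_on \<Omega>) f" "\<Omega> \<in> sets lebesgue" "A \<in> sets lebesgue" "A \<subseteq> \<Omega>"
  shows "integrable (lebesgue_on \<Omega>) (\<lambda>x. f x * indicator A x)"
proof -
  have "A \<in> sets (lebesgue_on \<Omega>)" using assms by (simp add: sets_restrict_space_iff)
  from integrable_mult_indicator[OF this assms(1)] show ?thesis by (simp add: mult.commute)
qed

lemma emeasure_eq_0_closed_subsets:
  fixes S :: "'a::euclidean_space set"
  assumes S: "S \<in> sets lebesgue" and T0: "\<And>T. closed T \<Longrightarrow> T \<subseteq> S \<Longrightarrow> emeasure lebesgue T = 0"
  shows "emeasure lebesgue S = 0"
proof -
  have "emeasure lebesgue S \<le> ennreal e" if "e > 0" for e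
  proof -
    obtain T where T: "closed T" "T \<subseteq> S" "emeasure lebesgue (S - T) < ennreal e"
      using sets_lebesgue_inner_closed[OF S \<open>e > 0\<close>] by metis
    have "emeasure lebesgue (T \<union> (S - T)) \<le> emeasure lebesgue T + emeasure lebesgue (S - T)"
      by (rule emeasure_subadditive) (use T(1) S in auto)
    moreover have "T \<union> (S - T) = S" using T(2) by auto
    ultimately show ?thesis using T0[OF T(1,2)] T(3) by (metis add_0 less_imp_le order_trans)
  qed
  then have "emeasure lebesgue S \<le> 0 + ennreal e" if "e > 0" for e
    using that by (metis add_0)
  then have "emeasure lebesgue S \<le> 0" by (rule ennreal_le_epsilon)
  then show ?thesis by simp
qed

text \<open>For a closed T inside {f > 0} both \<Omega> and \<Omega> - T are open, so the integrals
  of \<open>f\<close> over them vanish. Hence so does the integral over T, and T is null because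
  \<open>f\<close> is positive there. Inner regularity passes from closed subsets to the whole
  set.\<close>

lemma fundamental_lemma_null_pos:
  fixes f :: "'a::euclidean_space \<Rightarrow> real"
  assumes \<Omega>: "open \<Omega>" and f: "integrable (lebesgue_on \<Omega>) f"
    and 0: "\<And>\<phi>. \<phi> \<in> test_functions \<Omega> \<Longrightarrow> (LINT x|lebesgue_on \<Omega>. f x * \<phi> x) = 0"
  shows "emeasure lebesgue {x\<in>\<Omega>. f x > 0} = 0"
proof -
  let ?S = "{x\<in>\<Omega>. f x > 0}"
  have [measurable]: "f \<in> borel_measurable (lebesgue_on \<Omega>)" using f by auto
  have \<Omega>s: "\<Omega> \<in> sets lebesgue" using \<Omega> by auto
  have S: "?S \<in> sets lebesgue"
    using \<Omega>s f by (intro sets_lebesgue_level_set) auto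
  have T0: "emeasure lebesgue T = 0" if T: "closed T" "T \<subseteq> ?S" for T
  proof -
    have U: "open (\<Omega> - T)" using \<Omega> T by auto
    have Ts: "T \<in> sets lebesgue" using T by auto
    have i1: "integrable (lebesgue_on \<Omega>) (\<lambda>x. f x * indicator T x)"
      by (rule integrable_mult_indicator_subset[OF f \<Omega>s Ts]) (use T in auto)
    have eq: "f x * indicator \<Omega> x - f x * indicator (\<Omega> - T) x = f x * indicator T x" if "x \<in> \<Omega>" for x
      using that T by (auto simp: indicator_def)
    have i2: "integrable (lebesgue_on \<Omega>) (\<lambda>x. f x * indicator \<Omega> x)"
      "integrable (lebesgue_on \<Omega>) (\<lambda>x. f x * indicator (\<Omega> - T) x)"
      by (rule integrable_mult_indicator_subset[OF f \<Omega>s]; use \<Omega>s Ts in auto)+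
    have "(LINT x|lebesgue_on \<Omega>. f x * indicator T x) =
        (LINT x|lebesgue_on \<Omega>. f x * indicator \<Omega> x - f x * indicator (\<Omega> - T) x)"
      by (intro Bochner_Integration.integral_cong) (use eq in \<open>auto simp: space_restrict_space\<close>)
    also have "\<dots> = 0"
      using fundamental_lemma_open[OF \<Omega> f 0 \<Omega>] fundamental_lemma_open[OF \<Omega> f 0 U] i2 by simp
    finally have z: "(LINT x|lebesgue_on \<Omega>. f x * indicator T x) = 0" .
    have "AE x in lebesgue_on \<Omega>. f x * indicator T x = 0"
      by (subst integral_nonneg_eq_0_iff_AE[OF i1, symmetric])
        (use z T in \<open>auto simp: indicator_def space_restrict_space intro!: AE_I2\<close>)
    then have "AE x in lebesgue_on \<Omega>. x \<notin> T"
      by eventually_elim (use T in \<open>force simp: indicator_def split: if_splits\<close>)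
    then have "AE x in lebesgue. x \<in> \<Omega> \<longrightarrow> x \<notin> T"
      by (simp only: AE_lebesgue_on_iff[OF \<Omega>s])
    then have "AE x in lebesgue. x \<notin> T" by eventually_elim (use T in auto)
    then show ?thesis using Ts by (auto simp: AE_iff_measurable[OF _ refl])
  qed
  show ?thesis by (rule emeasure_eq_0_closed_subsets[OF S T0])
qed

lemma fundamental_lemma:
  fixes f :: "'a::euclidean_space \<Rightarrow> real"
  assumes \<Omega>: "open \<Omega>" and f: "integrable (lebesgue_on \<Omega>) f"
    and 0: "\<And>\<phi>. \<phi> \<in> test_functions \<Omega> \<Longrightarrow> (LINT x|lebesgue_on \<Omega>. f x * \<phi> x) = 0"
  shows "AE x in lebesgue_on \<Omega>. f x = 0"
proof -
  have f': "integrable (lebesgue_on \<Omega>) (\<lambda>x. - f x)" using f by simp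
  have 1: "emeasure lebesgue {x\<in>\<Omega>. f x > 0} = 0"
    by (rule fundamental_lemma_null_pos[OF \<Omega> f 0])
  have 2: "emeasure lebesgue {x\<in>\<Omega>. - f x > 0} = 0"
    by (rule fundamental_lemma_null_pos[OF \<Omega> f']) (simp add: 0)
  have m: "{x\<in>\<Omega>. f x > 0} \<in> sets lebesgue" "{x\<in>\<Omega>. - f x > 0} \<in> sets lebesgue"
    by (rule sets_lebesgue_level_set; use \<Omega> f f' in auto)+
  have "AE x in lebesgue. x \<in> \<Omega> \<longrightarrow> f x = 0"
  proof (rule AE_I)
    show "{x \<in> space lebesgue. \<not> (x \<in> \<Omega> \<longrightarrow> f x = 0)} \<subseteq> {x\<in>\<Omega>. f x > 0} \<union> {x\<in>\<Omega>. - f x > 0}"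
      by auto
    show "emeasure lebesgue ({x\<in>\<Omega>. f x > 0} \<union> {x\<in>\<Omega>. - f x > 0}) = 0"
      using 1 2 m by (metis emeasure_Un_null_set null_setsI)
    show "{x\<in>\<Omega>. f x > 0} \<union> {x\<in>\<Omega>. - f x > 0} \<in> sets lebesgue"
      using m by (rule sets.Un)
  qed
  moreover have "\<Omega> \<in> sets lebesgue" using \<Omega> by auto
  ultimately show ?thesis by (simp only: AE_lebesgue_on_iff)
qed

section \<open>Convergence in mean square\<close>

abbreviation L2_conv :: "'b measure \<Rightarrow> (nat \<Rightarrow> 'b \<Rightarrow> 'c::euclidean_space) \<Rightarrow> ('b \<Rightarrow> 'c) \<Rightarrow> bool" where
  "L2_conv M F f \<equiv> (\<lambda>n. L2_sqnorm M (\<lambda>x. F n x - f x)) \<longlonglongrightarrow> 0"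

lemma L2_measurable: "f \<in> L2 M \<Longrightarrow> f \<in> borel_measurable M"
  by (simp add: L2_def)

lemma L2_iff: "f \<in> L2 M \<longleftrightarrow> f \<in> borel_measurable M \<and> L2_sqnorm M f < \<infinity>"
  unfolding L2_def L2_sqnorm_def by (auto simp: integrable_iff_bounded)

lemma norm_add_sq_le: "(norm (a + b))\<^sup>2 \<le> 2 * (norm a)\<^sup>2 + 2 * (norm (b::'c::real_normed_vector))\<^sup>2"
proof -
  have "(norm (a + b))\<^sup>2 \<le> (norm a + norm b)\<^sup>2"
    by (intro power_mono norm_triangle_ineq) auto
  also have "\<dots> \<le> 2 * (norm a)\<^sup>2 + 2 * (norm b)\<^sup>2"
    using sum_squares_bound[of "norm a" "norm b"] by (simp add: power2_sum)
  finally show ?thesis .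
qed

lemma L2_sqnorm_add_le:
  assumes [measurable]: "f \<in> borel_measurable M" "g \<in> borel_measurable M"
  shows "L2_sqnorm M (\<lambda>x. f x + g x) \<le> 2 * L2_sqnorm M f + 2 * L2_sqnorm M g"
proof -
  have "L2_sqnorm M (\<lambda>x. f x + g x)
      \<le> (\<integral>\<^sup>+x. 2 * ennreal ((norm (f x))\<^sup>2) + 2 * ennreal ((norm (g x))\<^sup>2) \<partial>M)"
    unfolding L2_sqnorm_def
  proof (rule nn_integral_mono)
    fix x
    show "ennreal ((norm (f x + g x))\<^sup>2) \<le> 2 * ennreal ((norm (f x))\<^sup>2) + 2 * ennreal ((norm (g x))\<^sup>2)"
      using ennreal_leI[OF norm_add_sq_le[of "f x" "g x"]]
      by (simp add: ennreal_plus ennreal_mult)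
  qed
  also have "\<dots> = 2 * L2_sqnorm M f + 2 * L2_sqnorm M g"
    unfolding L2_sqnorm_def by (subst nn_integral_add) (auto simp: nn_integral_cmult)
  finally show ?thesis .
qed

lemma L2_sqnorm_scale:
  assumes "f \<in> borel_measurable M"
  shows "L2_sqnorm M (\<lambda>x. c *\<^sub>R f x) = ennreal (c\<^sup>2) * L2_sqnorm M f"
  unfolding L2_sqnorm_def
  by (subst nn_integral_cmult[symmetric])
    (use assms in \<open>auto simp: power_mult_distrib ennreal_mult\<close>)

lemma L2_sqnorm_cong_AE: "AE x in M. f x = g x \<Longrightarrow> L2_sqnorm M f = L2_sqnorm M g"
  unfolding L2_sqnorm_def by (rule nn_integral_cong_AE) auto

lemma L2_sqnorm_mono:
  "AE x in M. norm (f x) \<le> norm (g x) \<Longrightarrow> L2_sqnorm M f \<le> L2_sqnorm M g"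
  unfolding L2_sqnorm_def by (rule nn_integral_mono_AE) (auto intro!: ennreal_leI power_mono)

lemma L2_zero [simp]: "(\<lambda>x. 0) \<in> L2 M"
  by (simp add: L2_def)

lemma L2_add:
  assumes "f \<in> L2 M" "g \<in> L2 M" shows "(\<lambda>x. f x + g x) \<in> L2 M"
proof -
  have "2 * L2_sqnorm M f + 2 * L2_sqnorm M g < \<infinity>"
    using assms by (auto simp: L2_iff ennreal_mult_less_top)
  moreover have fg: "f \<in> borel_measurable M" "g \<in> borel_measurable M"
    using assms by (auto simp: L2_iff)
  ultimately have "L2_sqnorm M (\<lambda>x. f x + g x) < \<infinity>"
    using L2_sqnorm_add_le le_less_trans by blast
  then show ?thesis using fg by (simp add: L2_iff)
qed

lemma L2_scale:
  assumes "f \<in> L2 M" shows "(\<lambda>x. c *\<^sub>R f x) \<in> L2 M"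
proof -
  have f: "f \<in> borel_measurable M" "L2_sqnorm M f < \<infinity>" using assms by (simp_all add: L2_iff)
  have "L2_sqnorm M (\<lambda>x. c *\<^sub>R f x) < \<infinity>"
    using f(2) unfolding L2_sqnorm_scale[OF f(1)] by (simp add: ennreal_mult_less_top)
  moreover have "(\<lambda>x. c *\<^sub>R f x) \<in> borel_measurable M"
    using f(1) by (intro borel_measurable_scaleR borel_measurable_const)
  ultimately show ?thesis by (simp only: L2_iff)
qed

lemma L2_diff:
  assumes "f \<in> L2 M" "g \<in> L2 M" shows "(\<lambda>x. f x - g x) \<in> L2 M"
  using L2_add[OF assms(1) L2_scale[OF assms(2), of "-1"]] by simp

lemma L2_bound:
  assumes "g \<in> L2 M" "f \<in> borel_measurable M" "AE x in M. norm (f x) \<le> norm (g x)"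
  shows "f \<in> L2 M"
  using assms(1,2) le_less_trans[OF L2_sqnorm_mono[OF assms(3)]] by (simp add: L2_iff)

lemma L2_inner_component: "f \<in> L2 M \<Longrightarrow> i \<in> Basis \<Longrightarrow> (\<lambda>x. f x \<bullet> i) \<in> L2 M"
proof (rule L2_bound[of f M])
  assume "f \<in> L2 M" "i \<in> Basis"
  show "f \<in> L2 M" by fact
  then have "f \<in> borel_measurable M" by (rule L2_measurable)
  then show "(\<lambda>x. f x \<bullet> i) \<in> borel_measurable M" by (intro borel_measurable_inner) simp_all
  show "AE x in M. norm (f x \<bullet> i) \<le> norm (f x)"
    using Basis_le_norm[OF \<open>i \<in> Basis\<close>] by (intro AE_I2) simp
qed

lemma L2_integrable_inner:
  assumes "f \<in> L2 M" "g \<in> L2 M"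
  shows "integrable M (\<lambda>x. f x \<bullet> g x)"
proof (rule Bochner_Integration.integrable_bound)
  show "integrable M (\<lambda>x. (norm (f x))\<^sup>2 + (norm (g x))\<^sup>2)"
    using assms unfolding L2_def by (intro Bochner_Integration.integrable_add) blast+
  show "AE x in M. norm (f x \<bullet> g x) \<le> norm ((norm (f x))\<^sup>2 + (norm (g x))\<^sup>2)"
  proof (rule AE_I2)
    fix x
    have "norm (f x \<bullet> g x) \<le> norm (f x) * norm (g x)"
      using Cauchy_Schwarz_ineq2[of "f x" "g x"] by simp
    also have "\<dots> \<le> (norm (f x))\<^sup>2 + (norm (g x))\<^sup>2"
      using sum_squares_bound[of "norm (f x)" "norm (g x)"]
        mult_nonneg_nonneg[OF norm_ge_zero[of "f x"] norm_ge_zero[of "g x"]] by linarith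
    finally show "norm (f x \<bullet> g x) \<le> norm ((norm (f x))\<^sup>2 + (norm (g x))\<^sup>2)" by simp
  qed
  show "(\<lambda>x. f x \<bullet> g x) \<in> borel_measurable M"
    by (intro borel_measurable_inner L2_measurable assms)
qed

lemma L2_integrable_mult:
  fixes f g :: "'b \<Rightarrow> real"
  shows "f \<in> L2 M \<Longrightarrow> g \<in> L2 M \<Longrightarrow> integrable M (\<lambda>x. f x * g x)"
  using L2_integrable_inner[of f M g] by simp

lemma L2_conv_add:
  assumes F: "L2_conv M F f" and G: "L2_conv M G g"
    and [measurable]: "\<And>n. F n \<in> borel_measurable M" "f \<in> borel_measurable M"
      "\<And>n. G n \<in> borel_measurable M" "g \<in> borel_measurable M"
  shows "L2_conv M (\<lambda>n x. F n x + G n x) (\<lambda>x. f x + g x)"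
proof (rule tendsto_sandwich[OF _ _ tendsto_const])
  show "\<forall>\<^sub>F n in sequentially. L2_sqnorm M (\<lambda>x. F n x + G n x - (f x + g x))
      \<le> 2 * L2_sqnorm M (\<lambda>x. F n x - f x) + 2 * L2_sqnorm M (\<lambda>x. G n x - g x)"
  proof (rule always_eventually, rule allI)
    fix n
    show "L2_sqnorm M (\<lambda>x. F n x + G n x - (f x + g x))
      \<le> 2 * L2_sqnorm M (\<lambda>x. F n x - f x) + 2 * L2_sqnorm M (\<lambda>x. G n x - g x)"
      using L2_sqnorm_add_le[of "\<lambda>x. F n x - f x" M "\<lambda>x. G n x - g x"]
      by (simp add: algebra_simps)
  qed
  have "(\<lambda>n. 2 * L2_sqnorm M (\<lambda>x. F n x - f x) + 2 * L2_sqnorm M (\<lambda>x. G n x - g x))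
    \<longlonglongrightarrow> 2 * 0 + 2 * 0"
    by (intro tendsto_add ennreal_tendsto_cmult F G) auto
  then show "(\<lambda>n. 2 * L2_sqnorm M (\<lambda>x. F n x - f x) + 2 * L2_sqnorm M (\<lambda>x. G n x - g x)) \<longlonglongrightarrow> 0"
    by simp
qed auto

lemma L2_conv_scale:
  assumes F: "L2_conv M F f"
    and [measurable]: "\<And>n. F n \<in> borel_measurable M" "f \<in> borel_measurable M"
  shows "L2_conv M (\<lambda>n x. c *\<^sub>R F n x) (\<lambda>x. c *\<^sub>R f x)"
proof -
  have "(\<lambda>n. ennreal (c\<^sup>2) * L2_sqnorm M (\<lambda>x. F n x - f x)) \<longlonglongrightarrow> ennreal (c\<^sup>2) * 0"
    by (intro ennreal_tendsto_cmult F) auto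
  then show ?thesis
    by (simp add: L2_sqnorm_scale[symmetric] scaleR_diff_right)
qed

lemma L2_conv_component:
  assumes "L2_conv M F f" "i \<in> Basis"
  shows "L2_conv M (\<lambda>n x. F n x \<bullet> i) (\<lambda>x. f x \<bullet> i)"
proof (rule tendsto_sandwich[OF _ _ tendsto_const assms(1)])
  show "\<forall>\<^sub>F n in sequentially. L2_sqnorm M (\<lambda>x. F n x \<bullet> i - f x \<bullet> i) \<le> L2_sqnorm M (\<lambda>x. F n x - f x)"
    using Basis_le_norm[OF assms(2)]
    by (intro always_eventually allI L2_sqnorm_mono AE_I2) (simp add: inner_diff_left[symmetric])
qed auto

lemma L2_conv_subseq: "L2_conv M F f \<Longrightarrow> strict_mono r \<Longrightarrow> L2_conv M (\<lambda>n. F (r n)) f"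
  using LIMSEQ_subseq_LIMSEQ[of "\<lambda>n. L2_sqnorm M (\<lambda>x. F n x - f x)" 0 r] by (simp add: o_def)

lemma L2_conv_dominated:
  assumes [measurable]: "\<And>n. F n \<in> borel_measurable M" "f \<in> borel_measurable M"
    and lim: "AE x in M. (\<lambda>n. F n x) \<longlonglongrightarrow> f x"
    and g: "(g :: _ \<Rightarrow> real) \<in> L2 M" and b: "\<And>n. AE x in M. norm (F n x - f x) \<le> g x"
  shows "L2_conv M F f"
proof -
  have [measurable]: "g \<in> borel_measurable M" using g by (rule L2_measurable)
  have "(\<lambda>n. \<integral>\<^sup>+x. ennreal ((norm (F n x - f x))\<^sup>2) \<partial>M) \<longlonglongrightarrow> (\<integral>\<^sup>+x. 0 \<partial>M)"
  proof (rule nn_integral_dominated_convergence[where w="\<lambda>x. ennreal ((norm (g x))\<^sup>2)"])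
    show "AE x in M. ennreal ((norm (F n x - f x))\<^sup>2) \<le> ennreal ((norm (g x))\<^sup>2)" for n
      using b[of n] by eventually_elim (auto intro!: ennreal_leI power_mono)
    show "(\<integral>\<^sup>+x. ennreal ((norm (g x))\<^sup>2) \<partial>M) < \<infinity>"
      using g unfolding L2_iff L2_sqnorm_def by blast
    show "AE x in M. (\<lambda>n. ennreal ((norm (F n x - f x))\<^sup>2)) \<longlonglongrightarrow> 0"
      using lim
    proof eventually_elim
      case (elim x)
      have "(\<lambda>n. (norm (F n x - f x))\<^sup>2) \<longlonglongrightarrow> (norm (f x - f x))\<^sup>2"
        by (intro tendsto_power tendsto_norm tendsto_diff elim tendsto_const)
      then show ?case using tendsto_ennrealI by fastforce
    qed
  qed (measurable)
  then show ?thesis unfolding L2_sqnorm_def by simp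
qed

lemma L2_conv_AE_subseq:
  assumes c: "L2_conv M F f"
    and F: "\<And>n. F n \<in> L2 M" and f: "f \<in> L2 M"
  obtains r :: "nat \<Rightarrow> nat" where "strict_mono r" "AE x in M. (\<lambda>n. F (r n) x) \<longlonglongrightarrow> f x"
proof -
  have d: "(\<lambda>x. F n x - f x) \<in> L2 M" for n using F f by (intro L2_diff)
  then have i: "integrable M (\<lambda>x. (norm (F n x - f x))\<^sup>2)" for n by (auto simp: L2_def)
  have "(\<lambda>n. ennreal (LINT x|M. norm ((norm (F n x - f x))\<^sup>2))) \<longlonglongrightarrow> 0"
    using c i unfolding L2_sqnorm_def by (simp add: nn_integral_eq_integral)
  then have "(\<lambda>n. LINT x|M. norm ((norm (F n x - f x))\<^sup>2)) \<longlonglongrightarrow> 0"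
    by (subst (asm) ennreal_tendsto_0_iff) auto
  from tendsto_L1_AE_subseq[OF i this] obtain r :: "nat \<Rightarrow> nat" where
    r: "strict_mono r" "AE x in M. (\<lambda>n. (norm (F (r n) x - f x))\<^sup>2) \<longlonglongrightarrow> 0" by blast
  have "AE x in M. (\<lambda>n. F (r n) x) \<longlonglongrightarrow> f x"
    using r(2)
  proof eventually_elim
    case (elim x)
    have "(\<lambda>n. norm (F (r n) x - f x)) \<longlonglongrightarrow> 0"
      using tendsto_real_sqrt[OF elim] by simp
    then show ?case by (simp add: LIM_zero_cancel tendsto_norm_zero_iff)
  qed
  then show thesis using r(1) that by blast
qed

lemma ennreal_tendsto_0_square:
  fixes a :: "nat \<Rightarrow> ennreal"
  assumes "(\<lambda>n. (a n)\<^sup>2) \<longlonglongrightarrow> 0"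
  shows "a \<longlonglongrightarrow> 0"
proof (rule order_tendstoI)
  fix e :: ennreal assume e: "0 < e"
  then obtain d where d: "0 < d" "d < e" using dense[OF e] by blast
  have "\<forall>\<^sub>F n in sequentially. (a n)\<^sup>2 < d * d"
    by (rule order_tendstoD(2)[OF assms]) (use d in \<open>simp add: ennreal_zero_less_mult_iff\<close>)
  then show "\<forall>\<^sub>F n in sequentially. a n < e"
  proof eventually_elim
    case (elim n)
    then have "\<not> d \<le> a n" using mult_mono[of d "a n" d "a n"] by (auto simp: power2_eq_square)
    then show ?case using d(2) by auto
  qed
qed auto

lemma L2_inner_tendsto_0:
  assumes X: "\<And>n. X n \<in> L2 M" and Y: "\<And>n. Y n \<in> L2 M"
    and X0: "(\<lambda>n. L2_sqnorm M (X n)) \<longlonglongrightarrow> 0" and K: "\<And>n. L2_sqnorm M (Y n) \<le> K" "K < \<infinity>"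
  shows "(\<lambda>n. LINT x|M. X n x \<bullet> Y n x) \<longlonglongrightarrow> 0"
proof -
  let ?a = "\<lambda>n. \<integral>\<^sup>+x. ennreal (norm (X n x)) * ennreal (norm (Y n x)) \<partial>M"
  have [measurable]: "\<And>n. X n \<in> borel_measurable M" "\<And>n. Y n \<in> borel_measurable M"
    using X Y by (auto intro: L2_measurable)
  have "(\<lambda>n. (?a n)\<^sup>2) \<longlonglongrightarrow> 0"
  proof (rule tendsto_sandwich[OF _ _ tendsto_const])
    have cs: "(?a n)\<^sup>2 \<le> L2_sqnorm M (X n) * K" for n
    proof -
      have "(?a n)\<^sup>2 \<le> L2_sqnorm M (X n) * L2_sqnorm M (Y n)"
        unfolding L2_sqnorm_def
        using Cauchy_Schwarz_nn_integral[of "\<lambda>x. ennreal (norm (X n x))" M "\<lambda>x. ennreal (norm (Y n x))"]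
        by (simp add: ennreal_power)
      also have "\<dots> \<le> L2_sqnorm M (X n) * K" by (intro mult_left_mono K) auto
      finally show ?thesis .
    qed
    then show "\<forall>\<^sub>F n in sequentially. (?a n)\<^sup>2 \<le> L2_sqnorm M (X n) * K" by simp
    have "(\<lambda>n. K * L2_sqnorm M (X n)) \<longlonglongrightarrow> K * 0"
      using K(2) by (intro ennreal_tendsto_cmult X0) simp
    then show "(\<lambda>n. L2_sqnorm M (X n) * K) \<longlonglongrightarrow> 0" by (simp add: mult.commute)
  qed auto
  then have a: "?a \<longlonglongrightarrow> 0" by (rule ennreal_tendsto_0_square)
  have "(\<lambda>n. ennreal (norm (LINT x|M. X n x \<bullet> Y n x))) \<longlonglongrightarrow> 0"
  proof (rule tendsto_sandwich[OF _ _ tendsto_const a])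
    have "ennreal (norm (LINT x|M. X n x \<bullet> Y n x)) \<le> ?a n" for n
    proof -
      have "ennreal (norm (LINT x|M. X n x \<bullet> Y n x)) \<le> (\<integral>\<^sup>+x. ennreal (norm (X n x \<bullet> Y n x)) \<partial>M)"
        by (intro integral_norm_bound_ennreal L2_integrable_inner X Y)
      also have "\<dots> \<le> ?a n"
        by (intro nn_integral_mono) (auto simp: ennreal_mult[symmetric] Cauchy_Schwarz_ineq2 intro!: ennreal_leI)
      finally show ?thesis .
    qed
    then show "\<forall>\<^sub>F n in sequentially. ennreal (norm (LINT x|M. X n x \<bullet> Y n x)) \<le> ?a n" by simp
  qed auto
  then have "(\<lambda>n. norm (LINT x|M. X n x \<bullet> Y n x)) \<longlonglongrightarrow> 0"
    by (subst (asm) ennreal_tendsto_0_iff) auto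
  then show ?thesis by (rule tendsto_norm_zero_cancel)
qed

lemma L2_inner_tendsto:
  assumes F: "\<And>n. F n \<in> L2 M" and f: "f \<in> L2 M" and G: "\<And>n. G n \<in> L2 M" and g: "g \<in> L2 M"
    and Ff: "L2_conv M F f" and Gg: "L2_conv M G g"
  shows "(\<lambda>n. LINT x|M. F n x \<bullet> G n x) \<longlonglongrightarrow> (LINT x|M. f x \<bullet> g x)"
proof -
  let ?X = "\<lambda>n x. F n x - f x" and ?Y = "\<lambda>n x. G n x - g x"
  have X: "?X n \<in> L2 M" and Y: "?Y n \<in> L2 M" for n using F f G g by (auto intro: L2_diff)
  have gK: "L2_sqnorm M g < \<infinity>" "L2_sqnorm M f < \<infinity>" using f g by (auto simp: L2_iff)
  have 1: "(\<lambda>n. LINT x|M. ?X n x \<bullet> g x) \<longlonglongrightarrow> 0"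
    by (rule L2_inner_tendsto_0[OF X g Ff order_refl gK(1)])
  have 2: "(\<lambda>n. LINT x|M. ?Y n x \<bullet> f x) \<longlonglongrightarrow> 0"
    by (rule L2_inner_tendsto_0[OF Y f Gg order_refl gK(2)])
  \<comment> \<open>The uniform bound on the second error is read off from the tail of the sequence;
    \<open>LIMSEQ_offset\<close> undoes the shift by \<open>N\<close>.\<close>
  obtain N where N: "\<And>n. n \<ge> N \<Longrightarrow> L2_sqnorm M (?Y n) < 1"
    using order_tendstoD(2)[OF Gg, of 1] by (auto simp: eventually_sequentially)
  have "(\<lambda>n. LINT x|M. ?X (n + N) x \<bullet> ?Y (n + N) x) \<longlonglongrightarrow> 0"
    by (rule L2_inner_tendsto_0[OF X Y LIMSEQ_ignore_initial_segment[OF Ff], where K=1])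
      (use N in \<open>auto intro: less_imp_le\<close>)
  then have 3: "(\<lambda>n. LINT x|M. ?X n x \<bullet> ?Y n x) \<longlonglongrightarrow> 0" by (rule LIMSEQ_offset)
  have "(LINT x|M. F n x \<bullet> G n x) = (LINT x|M. f x \<bullet> g x) + ((LINT x|M. ?X n x \<bullet> g x) +
      ((LINT x|M. ?Y n x \<bullet> f x) + (LINT x|M. ?X n x \<bullet> ?Y n x)))" for n
  proof -
    have "(LINT x|M. F n x \<bullet> G n x) =
        (LINT x|M. f x \<bullet> g x + (?X n x \<bullet> g x + (?Y n x \<bullet> f x + ?X n x \<bullet> ?Y n x)))"
      by (intro Bochner_Integration.integral_cong refl)
        (simp add: inner_diff_left inner_diff_right inner_commute)
    also have "\<dots> = (LINT x|M. f x \<bullet> g x) + ((LINT x|M. ?X n x \<bullet> g x) +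
      ((LINT x|M. ?Y n x \<bullet> f x) + (LINT x|M. ?X n x \<bullet> ?Y n x)))"
      by (simp only: Bochner_Integration.integral_add Bochner_Integration.integrable_add
          L2_integrable_inner[OF f g] L2_integrable_inner[OF X g] L2_integrable_inner[OF Y f]
          L2_integrable_inner[OF X Y])
    finally show ?thesis .
  qed
  moreover have "(\<lambda>n. (LINT x|M. f x \<bullet> g x) + ((LINT x|M. ?X n x \<bullet> g x) +
      ((LINT x|M. ?Y n x \<bullet> f x) + (LINT x|M. ?X n x \<bullet> ?Y n x)))) \<longlonglongrightarrow>
      (LINT x|M. f x \<bullet> g x) + (0 + (0 + 0))"
    by (intro tendsto_add tendsto_const 1 2 3)
  ultimately show ?thesis by simp
qed

lemma L2_mult_tendsto:
  fixes f g :: "'b \<Rightarrow> real"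
  assumes "\<And>n. F n \<in> L2 M" "f \<in> L2 M" "\<And>n. G n \<in> L2 M" "g \<in> L2 M"
    and "L2_conv M F f" "L2_conv M G g"
  shows "(\<lambda>n. LINT x|M. F n x * G n x) \<longlonglongrightarrow> (LINT x|M. f x * g x)"
  using L2_inner_tendsto[OF assms] by simp

section \<open>Sobolev functions with traces\<close>

lemma sets_hausdorff_measure [simp]: "sets (hausdorff_measure s :: 'a::metric_space measure) = sets borel"
  unfolding hausdorff_measure_def by (simp add: sets.sigma_sets_eq[of borel, simplified])

lemma space_hausdorff_measure [simp]: "space (hausdorff_measure s :: 'a::metric_space measure) = UNIV"
  unfolding hausdorff_measure_def by (simp add: space_measure_of_conv)

lemma surface_measurable:
  "f \<in> borel_measurable borel \<Longrightarrow> f \<in> borel_measurable (surface_measure \<Omega>)"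
  unfolding surface_measure_def
  by (intro measurable_restrict_space1) (simp add: measurable_cong_sets[OF sets_hausdorff_measure])

lemma lebesgue_on_measurable:
  assumes "f \<in> borel_measurable borel"
  shows "f \<in> borel_measurable (lebesgue_on \<Omega>)"
  by (intro measurable_restrict_space1 measurable_completion) (use assms in simp)

lemma integral_lebesgue_on_eq_lborel:
  fixes f :: "'a::euclidean_space \<Rightarrow> real"
  assumes "\<Omega> \<in> sets lebesgue" "f \<in> borel_measurable borel" "\<And>x. x \<notin> \<Omega> \<Longrightarrow> f x = 0"
  shows "(LINT x|lebesgue_on \<Omega>. f x) = (LINT x|lborel. f x)"
proof -
  have "(LINT x|lebesgue_on \<Omega>. f x) = (LINT x|lebesgue. indicator \<Omega> x *\<^sub>R f x)"
    by (rule integral_restrict_space) (use assms in simp)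
  also have "(\<lambda>x. indicator \<Omega> x *\<^sub>R f x) = f"
  proof
    show "indicator \<Omega> x *\<^sub>R f x = f x" for x
      using assms(3)[of x] by (cases "x \<in> \<Omega>") simp_all
  qed
  also have "(LINT x|lebesgue. f x) = (LINT x|lborel. f x)"
    by (rule integral_completion) (use assms in simp)
  finally show ?thesis .
qed

definition grad :: "('a::euclidean_space \<Rightarrow> real) \<Rightarrow> 'a \<Rightarrow> 'a" where
  "grad f x = (\<Sum>i\<in>Basis. partial i f x *\<^sub>R i)"

lemma grad_inner: "i \<in> Basis \<Longrightarrow> grad f x \<bullet> i = partial i f x"
  by (simp add: grad_def inner_sum_left inner_Basis if_distrib cong: if_cong)

lemma grad_eqI: "(\<And>i. i \<in> Basis \<Longrightarrow> partial i f x = v \<bullet> i) \<Longrightarrow> grad f x = v"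
  by (rule euclidean_eqI) (simp add: grad_inner)

lemma smooth_grad_continuous_on: "smooth f \<Longrightarrow> continuous_on A (grad f)"
  unfolding grad_def by (intro continuous_on_sum continuous_on_scaleR continuous_on_const
      smooth_continuous_on smooth_partial)

lemma smooth_grad_measurable: "smooth f \<Longrightarrow> grad f \<in> borel_measurable borel"
  by (intro borel_measurable_continuous_onI smooth_grad_continuous_on)

locale domain_set =
  fixes \<Omega> :: "'a::euclidean_space set"
begin

abbreviation vol :: "'a measure" ("\<L>") where "\<L> \<equiv> lebesgue_on \<Omega>"

abbreviation surf :: "'a measure" ("\<S>") where "\<S> \<equiv> surface_measure \<Omega>"

text \<open>The closure in \<open>L\<^sup>2\<close> of the triples formed by a smooth function, its gradient and its boundary
  values. Unlike \<open>has_trace\<close> it does not refer to a choice of the weak gradient.\<close>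

definition trace_triple ::
    "('a \<Rightarrow> real) \<Rightarrow> ('a \<Rightarrow> 'a) \<Rightarrow> ('a \<Rightarrow> real) \<Rightarrow> bool" where
  "trace_triple u G g \<longleftrightarrow>
     u \<in> L2 \<L> \<and> G \<in> L2 \<L> \<and> g \<in> L2 \<S> \<and>
     (\<exists>\<phi>. (\<forall>k::nat. smooth (\<phi> k)) \<and> L2_conv \<L> \<phi> u \<and>
        L2_conv \<L> (\<lambda>k. grad (\<phi> k)) G \<and> L2_conv \<S> \<phi> g)"

lemma is_weak_gradD:
  assumes "is_weak_grad \<Omega> u G"
  shows "G \<in> L2 \<L>"
    "\<eta> \<in> test_functions \<Omega> \<Longrightarrow> i \<in> Basis \<Longrightarrow>
      (LINT x|\<L>. u x * partial i \<eta> x) = - (LINT x|\<L>. (G x \<bullet> i) * \<eta> x)"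
  using assms unfolding is_weak_grad_def by blast+

lemma trace_tripleD:
  assumes "trace_triple u G g"
  shows "u \<in> L2 \<L>" "G \<in> L2 \<L>" "g \<in> L2 \<S>"
    "u \<in> borel_measurable \<L>" "G \<in> borel_measurable \<L>"
    "g \<in> borel_measurable \<S>"
proof -
  show *: "u \<in> L2 \<L>" "G \<in> L2 \<L>" "g \<in> L2 \<S>"
    using assms unfolding trace_triple_def by blast+
  show "u \<in> borel_measurable \<L>" "G \<in> borel_measurable \<L>"
    "g \<in> borel_measurable \<S>"
    by (rule *[THEN L2_measurable])+
qed

lemma trace_tripleI:
  assumes "u \<in> L2 \<L>" "G \<in> L2 \<L>" "g \<in> L2 \<S>"
    and "\<And>k::nat. smooth (\<phi> k)" "L2_conv \<L> \<phi> u"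
        "L2_conv \<L> (\<lambda>k. grad (\<phi> k)) G" "L2_conv \<S> \<phi> g"
  shows "trace_triple u G g"
  unfolding trace_triple_def using assms by (intro conjI exI[of _ \<phi>] allI)

lemma trace_tripleE:
  assumes "trace_triple u G g"
  obtains \<phi> where "\<And>k::nat. smooth (\<phi> k)" "L2_conv \<L> \<phi> u"
        "L2_conv \<L> (\<lambda>k. grad (\<phi> k)) G" "L2_conv \<S> \<phi> g"
        "\<And>k. \<phi> k \<in> borel_measurable \<L>" "\<And>k. \<phi> k \<in> borel_measurable \<S>"
        "\<And>k. grad (\<phi> k) \<in> borel_measurable \<L>"
proof -
  obtain \<phi> where \<phi>: "\<And>k::nat. smooth (\<phi> k)" "L2_conv \<L> \<phi> u"
        "L2_conv \<L> (\<lambda>k. grad (\<phi> k)) G" "L2_conv \<S> \<phi> g"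
    using assms unfolding trace_triple_def by blast
  show thesis
    by (rule that[OF \<phi> lebesgue_on_measurable[OF smooth_borel_measurable[OF \<phi>(1)]]
        surface_measurable[OF smooth_borel_measurable[OF \<phi>(1)]]
        lebesgue_on_measurable[OF smooth_grad_measurable[OF \<phi>(1)]]])
qed

lemma L2_conv_trans:
  assumes "(\<lambda>n. L2_sqnorm M (\<lambda>x. F n x - H n x)) \<longlonglongrightarrow> 0" "L2_conv M H f"
    and "\<And>n. F n \<in> borel_measurable M" "f \<in> borel_measurable M" "\<And>n. H n \<in> borel_measurable M"
  shows "L2_conv M F f"
proof -
  have "L2_conv M (\<lambda>n x. (F n x - H n x) + H n x) (\<lambda>x. 0 + f x)"
    by (rule L2_conv_add) (use assms in \<open>simp_all add: borel_measurable_diff\<close>)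
  then show ?thesis by simp
qed

lemma L2_conv_diagonal:
  assumes "\<And>n. L2_sqnorm M (\<lambda>x. F n x - H n x) < inverse (real (Suc n))"
  shows "(\<lambda>n. L2_sqnorm M (\<lambda>x. F n x - H n x)) \<longlonglongrightarrow> 0"
proof (rule tendsto_sandwich[OF _ _ tendsto_const])
  show "\<forall>\<^sub>F n in sequentially. L2_sqnorm M (\<lambda>x. F n x - H n x) \<le> ennreal (inverse (real (Suc n)))"
    by (intro always_eventually allI less_imp_le assms)
  have "(\<lambda>n. ennreal (inverse (real (Suc n)))) \<longlonglongrightarrow> ennreal 0"
    by (intro tendsto_ennrealI LIMSEQ_inverse_real_of_nat)
  then show "(\<lambda>n. ennreal (inverse (real (Suc n)))) \<longlonglongrightarrow> 0" by simp
qed auto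

text \<open>Diagonal choice: for each n a smooth function is taken within 1/(n+1) of the n-th triple
  in all three norms at once. This closedness is what gives nonsmooth truncations a trace.\<close>

lemma trace_triple_limit:
  assumes t: "\<And>n. trace_triple (u n) (G n) (g n)"
    and L: "u' \<in> L2 \<L>" "G' \<in> L2 \<L>" "g' \<in> L2 \<S>"
    and c: "L2_conv \<L> u u'" "L2_conv \<L> G G'" "L2_conv \<S> g g'"
  shows "trace_triple u' G' g'"
proof -
  let ?near = "\<lambda>n \<psi>. L2_sqnorm \<L> (\<lambda>x. \<psi> x - u n x) < inverse (real (Suc n)) \<and>
      L2_sqnorm \<L> (\<lambda>x. grad \<psi> x - G n x) < inverse (real (Suc n)) \<and>
      L2_sqnorm \<S> (\<lambda>x. \<psi> x - g n x) < inverse (real (Suc n))"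
  have "\<exists>\<psi>. smooth \<psi> \<and> ?near n \<psi>" for n
  proof -
    obtain \<phi> where \<phi>: "\<And>k::nat. smooth (\<phi> k)" "L2_conv \<L> \<phi> (u n)"
        "L2_conv \<L> (\<lambda>k. grad (\<phi> k)) (G n)" "L2_conv \<S> \<phi> (g n)"
      by (rule trace_tripleE[OF t[of n]]) blast
    have "0 < ennreal (inverse (real (Suc n)))" by simp
    note e = \<phi>(2-4)[THEN order_tendstoD(2), OF this]
    have "\<forall>\<^sub>F k in sequentially. ?near n (\<phi> k)" using e by eventually_elim blast
    then obtain k where "?near n (\<phi> k)" by (metis (no_types, lifting) eventually_sequentially order_refl)
    then show ?thesis using \<phi>(1)[of k] by blast
  qed
  then obtain \<psi> where *: "\<forall>n. smooth (\<psi> n) \<and> ?near n (\<psi> n)"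
    using choice[where Q="\<lambda>n \<psi>. smooth \<psi> \<and> ?near n \<psi>"] by blast
  then have \<psi>: "\<And>n. smooth (\<psi> n)"
      "\<And>n. L2_sqnorm \<L> (\<lambda>x. \<psi> n x - u n x) < inverse (real (Suc n))"
      "\<And>n. L2_sqnorm \<L> (\<lambda>x. grad (\<psi> n) x - G n x) < inverse (real (Suc n))"
      "\<And>n. L2_sqnorm \<S> (\<lambda>x. \<psi> n x - g n x) < inverse (real (Suc n))"
    by blast+
  have "L2_conv \<L> \<psi> u'"
    by (rule L2_conv_trans[OF L2_conv_diagonal[OF \<psi>(2)] c(1)
        lebesgue_on_measurable[OF smooth_borel_measurable[OF \<psi>(1)]] L2_measurable[OF L(1)] trace_tripleD(4)[OF t]])
  moreover have "L2_conv \<L> (\<lambda>n. grad (\<psi> n)) G'"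
    by (rule L2_conv_trans[OF L2_conv_diagonal[OF \<psi>(3)] c(2)
        lebesgue_on_measurable[OF smooth_grad_measurable[OF \<psi>(1)]] L2_measurable[OF L(2)] trace_tripleD(5)[OF t]])
  moreover have "L2_conv \<S> \<psi> g'"
    by (rule L2_conv_trans[OF L2_conv_diagonal[OF \<psi>(4)] c(3)
        surface_measurable[OF smooth_borel_measurable[OF \<psi>(1)]] L2_measurable[OF L(3)] trace_tripleD(6)[OF t]])
  ultimately show ?thesis by (rule trace_tripleI[OF L \<psi>(1)])
qed

lemma trace_triple_lincomb:
  assumes "trace_triple u G g" "trace_triple v H h"
  shows "trace_triple (\<lambda>x. u x + c *\<^sub>R v x) (\<lambda>x. G x + c *\<^sub>R H x) (\<lambda>x. g x + c *\<^sub>R h x)"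
proof -
  obtain \<phi> where \<phi>: "\<And>k::nat. smooth (\<phi> k)" "L2_conv \<L> \<phi> u"
        "L2_conv \<L> (\<lambda>k. grad (\<phi> k)) G" "L2_conv \<S> \<phi> g"
        "\<And>k. \<phi> k \<in> borel_measurable \<L>" "\<And>k. \<phi> k \<in> borel_measurable \<S>"
        "\<And>k. grad (\<phi> k) \<in> borel_measurable \<L>"
    by (rule trace_tripleE[OF assms(1)]) blast
  obtain \<psi> where \<psi>: "\<And>k::nat. smooth (\<psi> k)" "L2_conv \<L> \<psi> v"
        "L2_conv \<L> (\<lambda>k. grad (\<psi> k)) H" "L2_conv \<S> \<psi> h"
        "\<And>k. \<psi> k \<in> borel_measurable \<L>" "\<And>k. \<psi> k \<in> borel_measurable \<S>"
        "\<And>k. grad (\<psi> k) \<in> borel_measurable \<L>"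
    by (rule trace_tripleE[OF assms(2)]) blast
  note L = trace_tripleD[OF assms(1)] and L' = trace_tripleD[OF assms(2)]
  note sc = borel_measurable_scaleR[OF borel_measurable_const]
  have 1: "L2_conv \<L> (\<lambda>k x. \<phi> k x + c *\<^sub>R \<psi> k x) (\<lambda>x. u x + c *\<^sub>R v x)"
    by (rule L2_conv_add[OF \<phi>(2) L2_conv_scale[OF \<psi>(2,5) L'(4)] \<phi>(5) L(4) sc[OF \<psi>(5)] sc[OF L'(4)]])
  have 2: "L2_conv \<S> (\<lambda>k x. \<phi> k x + c *\<^sub>R \<psi> k x) (\<lambda>x. g x + c *\<^sub>R h x)"
    by (rule L2_conv_add[OF \<phi>(4) L2_conv_scale[OF \<psi>(4,6) L'(6)] \<phi>(6) L(6) sc[OF \<psi>(6)] sc[OF L'(6)]])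
  have 3: "L2_conv \<L> (\<lambda>k x. grad (\<phi> k) x + c *\<^sub>R grad (\<psi> k) x) (\<lambda>x. G x + c *\<^sub>R H x)"
    by (rule L2_conv_add[OF \<phi>(3) L2_conv_scale[OF \<psi>(3,7) L'(5)] \<phi>(7) L(5) sc[OF \<psi>(7)] sc[OF L'(5)]])
  have s: "smooth (\<lambda>x. c * \<psi> k x)" for k by (intro smooth_mult smooth_const \<psi>(1))
  have "grad (\<lambda>x. \<phi> k x + c *\<^sub>R \<psi> k x) = (\<lambda>x. grad (\<phi> k) x + c *\<^sub>R grad (\<psi> k) x)" for k
    using \<phi>(1)[of k] \<psi>(1)[of k] s[of k]
    by (intro ext grad_eqI) (simp add: partial_add partial_scale grad_inner inner_add_left)
  with 3 have 4: "L2_conv \<L> (\<lambda>k. grad (\<lambda>x. \<phi> k x + c *\<^sub>R \<psi> k x)) (\<lambda>x. G x + c *\<^sub>R H x)"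
    by simp
  have "\<And>k. smooth (\<lambda>x. \<phi> k x + c *\<^sub>R \<psi> k x)" unfolding real_scaleR_def by (intro smooth_add \<phi>(1) s)
  from this 1 4 2 show ?thesis
    by (rule trace_tripleI[OF L2_add[OF L(1) L2_scale[OF L'(1)]] L2_add[OF L(2) L2_scale[OF L'(2)]]
          L2_add[OF L(3) L2_scale[OF L'(3)]]])
qed

lemma trace_triple_add:
  assumes "trace_triple u G g" "trace_triple v H h"
  shows "trace_triple (\<lambda>x. u x + v x) (\<lambda>x. G x + H x) (\<lambda>x. g x + h x)"
  using trace_triple_lincomb[OF assms, of 1] by simp

lemma trace_triple_diff:
  assumes "trace_triple u G g" "trace_triple v H h"
  shows "trace_triple (\<lambda>x. u x - v x) (\<lambda>x. G x - H x) (\<lambda>x. g x - h x)"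
  using trace_triple_lincomb[OF assms, of "-1"] by simp

lemma trace_triple_0: "trace_triple (\<lambda>x. 0) (\<lambda>x. 0) (\<lambda>x. 0)"
proof -
  have "grad (\<lambda>x::'a. 0) = (\<lambda>x. 0)"
    by (intro ext grad_eqI) (simp add: partial_eqI[OF has_derivative_const])
  then show ?thesis
    by (intro trace_tripleI[of _ _ _ "\<lambda>k x. 0"] L2_zero) (simp_all add: L2_sqnorm_def)
qed

end

section \<open>Weak gradients and traces on a bounded open set\<close>

locale bounded_open = domain_set \<Omega> for \<Omega> :: "'a::euclidean_space set" +
  assumes open_\<Omega>: "open \<Omega>" and bounded_\<Omega>: "bounded \<Omega>"
begin

lemma \<Omega>_sets: "\<Omega> \<in> sets lebesgue"
  using open_\<Omega> by auto

lemma finite_measure_\<Omega>: "finite_measure \<L>"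
  by (intro finite_measure_lebesgue_on lmeasurable_open open_\<Omega> bounded_\<Omega>)

lemma bounded_L2:
  assumes "f \<in> borel_measurable \<L>" "\<And>x. x \<in> \<Omega> \<Longrightarrow> norm (f x) \<le> K"
  shows "f \<in> L2 \<L>"
proof (rule L2_bound[of "\<lambda>x. K"])
  interpret finite_measure "\<L>" by (rule finite_measure_\<Omega>)
  show "(\<lambda>x. K) \<in> L2 \<L>" by (simp add: L2_def)
  show "AE x in \<L>. norm (f x) \<le> norm K"
    using assms(2) by (intro AE_I2) force
qed (rule assms(1))

lemma continuous_L2:
  assumes "continuous_on UNIV f"
  shows "f \<in> L2 \<L>"
proof -
  have "compact (closure \<Omega>)" using bounded_\<Omega> by simp
  then have "bounded (f ` closure \<Omega>)"
    using assms by (intro compact_imp_bounded compact_continuous_image continuous_on_subset[OF assms]) auto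
  then obtain K where "\<And>x. x \<in> closure \<Omega> \<Longrightarrow> norm (f x) \<le> K" unfolding bounded_iff by blast
  then show ?thesis using closure_subset
    by (intro bounded_L2[of f K] lebesgue_on_measurable borel_measurable_continuous_onI assms) blast
qed

lemma smooth_L2: "smooth f \<Longrightarrow> f \<in> L2 \<L>"
  by (intro continuous_L2 smooth_continuous_on)

lemma smooth_grad_L2: "smooth f \<Longrightarrow> grad f \<in> L2 \<L>"
  by (intro continuous_L2 smooth_grad_continuous_on)

lemma test_function_L2:
  assumes "\<eta> \<in> test_functions \<Omega>"
  shows "\<eta> \<in> L2 \<L>" "i \<in> Basis \<Longrightarrow> partial i \<eta> \<in> L2 \<L>"
  by (rule smooth_L2[OF test_functions_compact_support(1)[OF assms]])
    (rule smooth_L2[OF smooth_partial[OF test_functions_compact_support(1)[OF assms]]])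

lemma integration_by_parts:
  assumes f: "smooth f" and \<eta>: "\<eta> \<in> test_functions \<Omega>" and i: "i \<in> Basis"
  shows "(LINT x|\<L>. f x * partial i \<eta> x) = - (LINT x|\<L>. partial i f x * \<eta> x)"
proof -
  note s = test_functions_compact_support[OF \<eta>]
  obtain R where R: "\<And>x. R < norm x \<Longrightarrow> \<eta> x = 0" using s(2) by blast
  have pm: "partial i (\<lambda>x. f x * \<eta> x) x = f x * partial i \<eta> x + partial i f x * \<eta> x" for x
    using f s(1) i by (rule partial_mult)
  have "(LINT x|\<L>. partial i (\<lambda>x. f x * \<eta> x) x) = (LINT x|lborel. partial i (\<lambda>x. f x * \<eta> x) x)"
  proof (rule integral_lebesgue_on_eq_lborel[OF \<Omega>_sets])
    show "partial i (\<lambda>x. f x * \<eta> x) \<in> borel_measurable borel"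
      by (intro smooth_borel_measurable smooth_partial smooth_mult f s(1) i)
    show "partial i (\<lambda>x. f x * \<eta> x) x = 0" if "x \<notin> \<Omega>" for x
      unfolding pm using that partial_test_function_outside[OF \<eta> that] s(3)[OF that] by simp
  qed
  also have "\<dots> = 0"
    by (rule integral_partial_eq_0[of _ R]) (use f s(1) i R in \<open>auto intro: smooth_mult\<close>)
  finally have "(LINT x|\<L>. f x * partial i \<eta> x + partial i f x * \<eta> x) = 0"
    by (simp only: pm)
  moreover have "integrable \<L> (\<lambda>x. f x * partial i \<eta> x)"
    by (intro L2_integrable_mult smooth_L2 test_function_L2 f \<eta> i)
  moreover have "integrable \<L> (\<lambda>x. partial i f x * \<eta> x)"
    by (intro L2_integrable_mult smooth_L2 test_function_L2 f \<eta> i smooth_partial)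
  ultimately show ?thesis by simp
qed

lemma is_weak_grad_unique:
  assumes G: "is_weak_grad \<Omega> u G" and H: "is_weak_grad \<Omega> u H"
  shows "AE x in \<L>. G x = H x"
proof -
  have L: "G \<in> L2 \<L>" "H \<in> L2 \<L>"
    by (rule G[THEN is_weak_gradD(1)], rule H[THEN is_weak_gradD(1)])
  have "AE x in \<L>. G x \<bullet> i - H x \<bullet> i = 0" if i: "i \<in> Basis" for i
  proof (rule fundamental_lemma[OF open_\<Omega>])
    have d: "(\<lambda>x. G x \<bullet> i - H x \<bullet> i) \<in> L2 \<L>"
      by (intro L2_diff L2_inner_component L i)
    have "(\<lambda>x. 1::real) \<in> L2 \<L>" by (intro continuous_L2 continuous_intros)
    from L2_integrable_mult[OF d this]
    show "integrable \<L> (\<lambda>x. G x \<bullet> i - H x \<bullet> i)" by simp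
    fix \<eta> assume \<eta>: "\<eta> \<in> test_functions \<Omega>"
    have "(LINT x|\<L>. (G x \<bullet> i) * \<eta> x) = (LINT x|\<L>. (H x \<bullet> i) * \<eta> x)"
      using is_weak_gradD(2)[OF G \<eta> i] is_weak_gradD(2)[OF H \<eta> i] by linarith
    moreover have "integrable \<L> (\<lambda>x. (G x \<bullet> i) * \<eta> x)"
      "integrable \<L> (\<lambda>x. (H x \<bullet> i) * \<eta> x)"
      by (intro L2_integrable_mult L2_inner_component L i test_function_L2 \<eta>)+
    ultimately show "(LINT x|\<L>. (G x \<bullet> i - H x \<bullet> i) * \<eta> x) = 0"
      by (simp add: left_diff_distrib)
  qed
  then have "AE x in \<L>. \<forall>i\<in>Basis. G x \<bullet> i - H x \<bullet> i = 0"
    by (intro AE_finite_allI) auto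
  then show ?thesis by eventually_elim (auto intro: euclidean_eqI)
qed

lemma is_weak_grad_weak_grad: "u \<in> H1 \<Omega> \<Longrightarrow> is_weak_grad \<Omega> u (weak_grad \<Omega> u)"
proof -
  assume "u \<in> H1 \<Omega>"
  then have "\<exists>G. is_weak_grad \<Omega> u G" unfolding H1_def by blast
  then show ?thesis unfolding weak_grad_def by (rule someI_ex)
qed

lemma weak_grad_eq: "is_weak_grad \<Omega> u G \<Longrightarrow> AE x in \<L>. weak_grad \<Omega> u x = G x"
  unfolding weak_grad_def by (rule is_weak_grad_unique[OF someI[of "is_weak_grad \<Omega> u"]])

lemma smooth_is_weak_grad:
  assumes "smooth f"
  shows "is_weak_grad \<Omega> f (grad f)"
  unfolding is_weak_grad_def
proof (intro conjI ballI)
  show "grad f \<in> L2 \<L>" using assms by (rule smooth_grad_L2)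
  fix \<eta> and i :: 'a assume "\<eta> \<in> test_functions \<Omega>" "i \<in> Basis"
  then show "(LINT x|\<L>. f x * partial i \<eta> x) = - (LINT x|\<L>. (grad f x \<bullet> i) * \<eta> x)"
    using integration_by_parts[OF assms] by (simp only: grad_inner)
qed

lemma is_weak_grad_diff:
  assumes "is_weak_grad \<Omega> u G" "is_weak_grad \<Omega> v H" "u \<in> L2 \<L>" "v \<in> L2 \<L>"
  shows "is_weak_grad \<Omega> (\<lambda>x. u x - v x) (\<lambda>x. G x - H x)"
  unfolding is_weak_grad_def
proof (intro conjI ballI)
  have L: "G \<in> L2 \<L>" "H \<in> L2 \<L>"
    by (rule assms(1)[THEN is_weak_gradD(1)], rule assms(2)[THEN is_weak_gradD(1)])
  then show "(\<lambda>x. G x - H x) \<in> L2 \<L>" by (rule L2_diff)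
  fix \<eta> i assume \<eta>: "\<eta> \<in> test_functions \<Omega>" and i: "i \<in> (Basis :: 'a set)"
  have "integrable \<L> (\<lambda>x. u x * partial i \<eta> x)"
    "integrable \<L> (\<lambda>x. v x * partial i \<eta> x)"
    by (intro L2_integrable_mult test_function_L2 \<eta> i assms)+
  moreover have "integrable \<L> (\<lambda>x. (G x \<bullet> i) * \<eta> x)"
    "integrable \<L> (\<lambda>x. (H x \<bullet> i) * \<eta> x)"
    by (intro L2_integrable_mult L2_inner_component L i test_function_L2 \<eta>)+
  moreover have "(LINT x|\<L>. u x * partial i \<eta> x) = - (LINT x|\<L>. (G x \<bullet> i) * \<eta> x)"
    "(LINT x|\<L>. v x * partial i \<eta> x) = - (LINT x|\<L>. (H x \<bullet> i) * \<eta> x)"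
    by (rule is_weak_gradD(2)[OF assms(1) \<eta> i] is_weak_gradD(2)[OF assms(2) \<eta> i])+
  ultimately show "(LINT x|\<L>. (u x - v x) * partial i \<eta> x) =
      - (LINT x|\<L>. ((G x - H x) \<bullet> i) * \<eta> x)"
    by (simp add: left_diff_distrib inner_diff_left)
qed

lemma H1_sqnorm_eq:
  assumes "is_weak_grad \<Omega> u G"
  shows "H1_sqnorm \<Omega> u = L2_sqnorm \<L> u + L2_sqnorm \<L> G"
  unfolding H1_sqnorm_def using L2_sqnorm_cong_AE[OF weak_grad_eq[OF assms]] by simp

text \<open>\<open>H1_sqnorm\<close> of \<phi>_k - u refers to a weak gradient chosen for the
  difference. Uniqueness almost everywhere identifies it with \<open>grad (\<phi> k)\<close> minus
  the chosen gradient of \<open>u\<close>, so the norm splits and later arguments are free of that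
  choice.\<close>

lemma has_trace_triple:
  assumes "has_trace \<Omega> u g"
  shows "trace_triple u (weak_grad \<Omega> u) g"
proof -
  have u: "u \<in> H1 \<Omega>" and g: "g \<in> L2 \<S>" using assms by (auto simp: has_trace_def)
  obtain \<phi> where \<phi>: "\<And>k::nat. smooth (\<phi> k)" "(\<lambda>k. H1_sqnorm \<Omega> (\<lambda>x. \<phi> k x - u x)) \<longlonglongrightarrow> 0"
      "L2_conv \<S> \<phi> g"
    using assms unfolding has_trace_def by blast
  note w = is_weak_grad_weak_grad[OF u]
  have uL: "u \<in> L2 \<L>" using u by (simp add: H1_def)
  have wL: "weak_grad \<Omega> u \<in> L2 \<L>" by (rule is_weak_gradD(1)[OF w])
  have eq: "H1_sqnorm \<Omega> (\<lambda>x. \<phi> k x - u x) = L2_sqnorm \<L> (\<lambda>x. \<phi> k x - u x) +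
      L2_sqnorm \<L> (\<lambda>x. grad (\<phi> k) x - weak_grad \<Omega> u x)" for k
    by (rule H1_sqnorm_eq[OF is_weak_grad_diff[OF smooth_is_weak_grad[OF \<phi>(1)] w smooth_L2[OF \<phi>(1)] uL]])
  have "L2_conv \<L> \<phi> u"
    by (rule tendsto_sandwich[OF _ _ tendsto_const \<phi>(2)]) (auto simp: eq)
  moreover have "L2_conv \<L> (\<lambda>k. grad (\<phi> k)) (weak_grad \<Omega> u)"
    by (rule tendsto_sandwich[OF _ _ tendsto_const \<phi>(2)]) (auto simp: eq)
  ultimately show ?thesis using \<phi>(3) by (rule trace_tripleI[OF uL wL g \<phi>(1)])
qed

text \<open>Chain rule by approximation. F(0) = 0 and |F'| \<le> 1 give |F(a)| \<le> |a|, which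
  keeps compositions square integrable also on the boundary, whose measure need not be finite here.
  Among the limits only that of F'(\<phi>_k) G requires more than a Lipschitz bound: it follows by
  domination along a subsequence with \<phi>_k \<rightarrow> u almost everywhere.\<close>

lemma trace_triple_compose:
  assumes t: "trace_triple u G g"
    and F: "smooth F" "\<And>s. (F has_real_derivative F' s) (at s)" "\<And>s. \<bar>F' s\<bar> \<le> 1"
      "continuous_on UNIV F'" "F 0 = 0"
  shows "trace_triple (\<lambda>x. F (u x)) (\<lambda>x. F' (u x) *\<^sub>R G x) (\<lambda>x. F (g x))"
proof -
  obtain \<phi>0 where \<phi>0: "\<And>k::nat. smooth (\<phi>0 k)" "L2_conv \<L> \<phi>0 u"
        "L2_conv \<L> (\<lambda>k. grad (\<phi>0 k)) G" "L2_conv \<S> \<phi>0 g"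
    using t unfolding trace_triple_def by blast
  note L = trace_tripleD(1-3)[OF t]
  obtain r :: "nat \<Rightarrow> nat" where r: "strict_mono r" "AE x in \<L>. (\<lambda>n. \<phi>0 (r n) x) \<longlonglongrightarrow> u x"
    using L2_conv_AE_subseq[OF \<phi>0(2) smooth_L2[OF \<phi>0(1)] L(1)] by metis
  define \<phi> where "\<phi> k = \<phi>0 (r k)" for k
  have \<phi>: "\<And>k::nat. smooth (\<phi> k)" "L2_conv \<L> \<phi> u"
        "L2_conv \<L> (\<lambda>k. grad (\<phi> k)) G" "L2_conv \<S> \<phi> g"
        "AE x in \<L>. (\<lambda>n. \<phi> n x) \<longlonglongrightarrow> u x"
    using \<phi>0(1) L2_conv_subseq[OF \<phi>0(2) r(1)] L2_conv_subseq[OF \<phi>0(3) r(1)]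
      L2_conv_subseq[OF \<phi>0(4) r(1)] r(2) unfolding \<phi>_def by simp_all
  have lip: "\<bar>F a - F b\<bar> \<le> \<bar>a - b\<bar>" for a b
    using field_differentiable_bound[of UNIV F F' 1 a b] F(2,3) by auto
  then have F0: "\<bar>F a\<bar> \<le> \<bar>a\<bar>" for a using F(5) lip[of a 0] by simp
  have mF: "F \<in> borel_measurable borel" using F(1) by (rule smooth_borel_measurable)
  have mF': "F' \<in> borel_measurable borel" using F(4) by (rule borel_measurable_continuous_onI)
  note mL = trace_tripleD(4-6)[OF t]
  have m\<phi>: "\<phi> k \<in> borel_measurable \<L>" "grad (\<phi> k) \<in> borel_measurable \<L>" for k
    using \<phi>(1) by (simp_all add: lebesgue_on_measurable smooth_borel_measurable smooth_grad_measurable)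
  have L': "(\<lambda>x. F (u x)) \<in> L2 \<L>"
    by (rule L2_bound[OF L(1) measurable_compose[OF mL(1) mF]]) (simp add: F0)
  have L'': "(\<lambda>x. F (g x)) \<in> L2 \<S>"
    by (rule L2_bound[OF L(3) measurable_compose[OF mL(3) mF]]) (simp add: F0)
  have le1: "norm (F' a *\<^sub>R v) \<le> norm v" for a and v :: 'a
    using F(3)[of a] by (simp add: mult_left_le_one_le)
  have mFG: "(\<lambda>x. F' (u x) *\<^sub>R G x) \<in> borel_measurable \<L>"
    by (intro borel_measurable_scaleR measurable_compose[OF mL(1) mF'] mL)
  have LG: "(\<lambda>x. F' (u x) *\<^sub>R G x) \<in> L2 \<L>"
    by (rule L2_bound[OF L(2) mFG]) (intro AE_I2 le1)
  have c1: "L2_conv \<L> (\<lambda>k x. F (\<phi> k x)) (\<lambda>x. F (u x))"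
    by (rule tendsto_sandwich[OF _ _ tendsto_const \<phi>(2)])
      (auto intro!: always_eventually L2_sqnorm_mono lip)
  have c2: "L2_conv \<S> (\<lambda>k x. F (\<phi> k x)) (\<lambda>x. F (g x))"
    by (rule tendsto_sandwich[OF _ _ tendsto_const \<phi>(4)])
      (auto intro!: always_eventually L2_sqnorm_mono lip)
  have gr: "grad (\<lambda>x. F (\<phi> k x)) = (\<lambda>x. F' (\<phi> k x) *\<^sub>R grad (\<phi> k) x)" for k
    using \<phi>(1) by (intro ext grad_eqI) (simp add: partial_compose[OF F(2)] grad_inner)
  have a: "(\<lambda>k. L2_sqnorm \<L> (\<lambda>x. F' (\<phi> k x) *\<^sub>R grad (\<phi> k) x - F' (\<phi> k x) *\<^sub>R G x)) \<longlonglongrightarrow> 0"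
  proof (rule tendsto_sandwich[OF _ _ tendsto_const \<phi>(3)])
    show "\<forall>\<^sub>F k in sequentially. L2_sqnorm \<L> (\<lambda>x. F' (\<phi> k x) *\<^sub>R grad (\<phi> k) x - F' (\<phi> k x) *\<^sub>R G x)
        \<le> L2_sqnorm \<L> (\<lambda>x. grad (\<phi> k) x - G x)"
      by (intro always_eventually allI L2_sqnorm_mono AE_I2)
        (simp only: scaleR_diff_right[symmetric] le1)
  qed simp
  have b: "L2_conv \<L> (\<lambda>k x. F' (\<phi> k x) *\<^sub>R G x) (\<lambda>x. F' (u x) *\<^sub>R G x)"
  proof (rule L2_conv_dominated[where g="\<lambda>x. 2 * norm (G x)"])
    show "(\<lambda>x. F' (\<phi> k x) *\<^sub>R G x) \<in> borel_measurable \<L>" for k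
      by (intro borel_measurable_scaleR measurable_compose[OF m\<phi>(1) mF'] mL)
    show "AE x in \<L>. (\<lambda>n. F' (\<phi> n x) *\<^sub>R G x) \<longlonglongrightarrow> F' (u x) *\<^sub>R G x"
      using \<phi>(5)
    proof eventually_elim
      case (elim x)
      show ?case
        by (intro tendsto_scaleR tendsto_const continuous_on_tendsto_compose[OF F(4) elim]) auto
    qed
    have "(\<lambda>x. norm (G x)) \<in> L2 \<L>"
      by (rule L2_bound[OF L(2) measurable_compose[OF mL(2) borel_measurable_norm]]) simp
    from L2_scale[OF this, of 2] show "(\<lambda>x. 2 * norm (G x)) \<in> L2 \<L>" by simp
    show "AE x in \<L>. norm (F' (\<phi> n x) *\<^sub>R G x - F' (u x) *\<^sub>R G x) \<le> 2 * norm (G x)" for n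
    proof (rule AE_I2)
      fix x
      show "norm (F' (\<phi> n x) *\<^sub>R G x - F' (u x) *\<^sub>R G x) \<le> 2 * norm (G x)"
        using norm_triangle_ineq4[of "F' (\<phi> n x) *\<^sub>R G x" "F' (u x) *\<^sub>R G x"]
          le1[of "\<phi> n x" "G x"] le1[of "u x" "G x"] by linarith
    qed
  qed (rule mFG)
  have c3: "L2_conv \<L> (\<lambda>k. grad (\<lambda>x. F (\<phi> k x))) (\<lambda>x. F' (u x) *\<^sub>R G x)"
    unfolding gr
    by (rule L2_conv_trans[OF a b])
      (intro borel_measurable_scaleR measurable_compose[OF m\<phi>(1) mF'] m\<phi> mL mFG)+
  have "\<And>k. smooth (\<lambda>x. F (\<phi> k x))" by (rule smooth_compose[OF F(1) \<phi>(1)])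
  from this c1 c3 c2 show ?thesis by (rule trace_tripleI[OF L' LG L''])
qed

text \<open>The positive part is approximated by (sqrt((s - c)^2 + \<delta>^2) + s - c) / 2, shifted
  so as to vanish at 0; the shift disappears in the limit because c \<ge> 0. The derivatives tend to
  1/2 at s = c, whence the factor (1 + sgn) / 2. Nothing is claimed about the gradient on the level
  set {u = c}: a factor between 0 and 1 is all that is used later.\<close>

lemma trace_triple_pos_part:
  assumes t: "trace_triple u G g" and c: "c \<ge> 0"
  shows "trace_triple (\<lambda>x. max (u x - c) 0) (\<lambda>x. ((1 + sgn (u x - c)) / 2) *\<^sub>R G x)
    (\<lambda>x. max (g x - c) 0)"
proof -
  note L = trace_tripleD(1-3)[OF t]
  note mL = trace_tripleD(4-6)[OF t]
  define \<delta> where "\<delta> n = inverse (real (Suc n))" for n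
  define q where "q n s = sqrt ((s - c)\<^sup>2 + (\<delta> n)\<^sup>2)" for n s
  define F where "F n s = (q n s + (s - c)) / 2 - (q n 0 - c) / 2" for n s
  define F' where "F' n s = ((s - c) / q n s + 1) / 2" for n s
  have \<delta>0: "\<delta> n > 0" "\<delta> \<longlonglongrightarrow> 0" for n
    unfolding \<delta>_def by (simp, rule LIMSEQ_inverse_real_of_nat)
  have pos: "(s - c)\<^sup>2 + (\<delta> n)\<^sup>2 > 0" for s n using \<delta>0(1)[of n] by (simp add: add_nonneg_pos)
  then have q0: "q n s > 0" for n s by (simp add: q_def)
  have qge: "\<bar>s - c\<bar> \<le> q n s" for n s
    unfolding q_def by (rule real_le_rsqrt) simp
  have qlim: "(\<lambda>n. q n s) \<longlonglongrightarrow> \<bar>s - c\<bar>" for s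
  proof -
    have "(\<lambda>n. q n s) \<longlonglongrightarrow> sqrt ((s - c)\<^sup>2 + 0\<^sup>2)"
      unfolding q_def by (intro tendsto_intros \<delta>0)
    then show ?thesis by simp
  qed
  have sF: "smooth (F n)" for n
  proof -
    have "smooth (q n)" unfolding q_def power2_eq_square
      by (intro smooth_sqrt smooth_add smooth_mult smooth_diff smooth_const smooth_id)
        (use pos[of _ n] in \<open>simp add: power2_eq_square\<close>)
    then have "smooth (\<lambda>s. (q n s + (s - c)) * (1/2) - (q n 0 - c) / 2)"
      by (intro smooth_add smooth_mult smooth_diff smooth_const smooth_id)
    moreover have "F n = (\<lambda>s. (q n s + (s - c)) * (1/2) - (q n 0 - c) / 2)"
      by (intro ext) (simp add: F_def)
    ultimately show ?thesis by simp
  qed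
  have dF: "(F n has_real_derivative F' n s) (at s)" for n s
  proof -
    define g where "g s = (s - c)\<^sup>2 + (\<delta> n)\<^sup>2" for s
    have 1: "(g has_real_derivative 2 * (s - c)) (at s)"
      unfolding g_def by (auto intro!: derivative_eq_intros)
    have 2: "(sqrt has_real_derivative inverse (sqrt (g s)) / 2) (at (g s))"
      by (rule DERIV_real_sqrt) (simp only: g_def pos)
    have "((\<lambda>s. sqrt (g s)) has_real_derivative inverse (sqrt (g s)) / 2 * (2 * (s - c))) (at s)"
      by (rule DERIV_chain2[OF 2 1])
    moreover have "q n = (\<lambda>s. sqrt (g s))" by (intro ext) (simp only: q_def g_def)
    moreover have "inverse (sqrt (g s)) / 2 * (2 * (s - c)) = (s - c) / sqrt (g s)"
    proof -
      have "inverse (sqrt (g s)) / 2 * (2 * (s - c)) = (s - c) * inverse (sqrt (g s))" by simp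
      then show ?thesis by (simp only: divide_inverse)
    qed
    ultimately have dq: "(q n has_real_derivative (s - c) / q n s) (at s)" by metis
    show ?thesis unfolding F_def F'_def
      by (rule DERIV_cong[OF DERIV_diff[OF DERIV_cdivide[OF DERIV_add[OF dq
            DERIV_diff[OF DERIV_ident DERIV_const]]] DERIV_const]]) simp
  qed
  have F'01: "0 \<le> F' n s" "F' n s \<le> 1" "\<bar>F' n s\<bar> \<le> 1" for n s
  proof -
    have "\<bar>(s - c) / q n s\<bar> \<le> 1" using qge[of s n] q0[of n s] by simp
    then show "0 \<le> F' n s" "F' n s \<le> 1" "\<bar>F' n s\<bar> \<le> 1" unfolding F'_def abs_le_iff by simp_all
  qed
  have cF': "continuous_on UNIV (F' n)" for n
    unfolding F'_def q_def
    by (intro continuous_intros) (use \<delta>0(1)[of n] in auto)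
  have F0: "F n 0 = 0" for n by (simp add: F_def)
  have tr: "trace_triple (\<lambda>x. F n (u x)) (\<lambda>x. F' n (u x) *\<^sub>R G x) (\<lambda>x. F n (g x))" for n
    by (rule trace_triple_compose[OF t sF[of n] dF[of n] F'01(3)[of n] cF'[of n] F0[of n]])
  have Flim: "(\<lambda>n. F n s) \<longlonglongrightarrow> max (s - c) 0" for s
  proof -
    have "(\<lambda>n. F n s) \<longlonglongrightarrow> (\<bar>s - c\<bar> + (s - c)) / 2 - (\<bar>0 - c\<bar> - c) / 2"
      unfolding F_def by (intro tendsto_intros qlim) simp_all
    also have "(\<bar>s - c\<bar> + (s - c)) / 2 - (\<bar>0 - c\<bar> - c) / 2 = max (s - c) 0"
      using c by (cases "s \<ge> c") simp_all
    finally show ?thesis .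
  qed
  have F'lim: "(\<lambda>n. F' n s) \<longlonglongrightarrow> (1 + sgn (s - c)) / 2" for s
  proof (cases "s = c")
    case True
    then show ?thesis by (simp add: F'_def)
  next
    case False
    have "(\<lambda>n. F' n s) \<longlonglongrightarrow> ((s - c) / \<bar>s - c\<bar> + 1) / 2"
      unfolding F'_def using False by (intro tendsto_intros qlim) auto
    moreover have "(s - c) / \<bar>s - c\<bar> = sgn (s - c)" by (simp only: real_sgn_eq)
    ultimately show ?thesis by (simp add: add.commute)
  qed
  have Fb: "\<bar>F n s\<bar> \<le> \<bar>s\<bar>" for n s
    using field_differentiable_bound[of UNIV "F n" "F' n" 1 s 0] dF F'01 F0 by auto
  have mxb: "\<bar>max (s - c) 0\<bar> \<le> \<bar>s\<bar>" for s using c by auto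
  have dom: "norm (F n s - max (s - c) 0) \<le> 2 * \<bar>s\<bar>" for n s
    using Fb[of n s] mxb[of s] by simp
  have th: "\<bar>(1 + sgn s) / 2\<bar> \<le> 1" for s :: real by (simp add: sgn_real_def)
  have mF: "F n \<in> borel_measurable borel" for n using sF by (rule smooth_borel_measurable)
  have mF': "F' n \<in> borel_measurable borel" for n using cF' by (rule borel_measurable_continuous_onI)
  have mx: "(\<lambda>s. max (s - c) 0) \<in> borel_measurable borel" by measurable
  have msg: "(\<lambda>s. (1 + sgn (s - c)) / 2) \<in> borel_measurable borel" by measurable
  have mG: "(\<lambda>x. ((1 + sgn (u x - c)) / 2) *\<^sub>R G x) \<in> borel_measurable \<L>"
    by (intro borel_measurable_scaleR measurable_compose[OF mL(1) msg] mL)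
  show ?thesis
  proof (rule trace_triple_limit[OF tr])
    show L1: "(\<lambda>x. max (u x - c) 0) \<in> L2 \<L>"
      by (rule L2_bound[OF L(1) measurable_compose[OF mL(1) mx]]) (intro AE_I2, simp only: real_norm_def mxb)
    show "(\<lambda>x. ((1 + sgn (u x - c)) / 2) *\<^sub>R G x) \<in> L2 \<L>"
      by (rule L2_bound[OF L(2) mG])
        (intro AE_I2, simp only: norm_scaleR, intro mult_left_le_one_le norm_ge_zero abs_ge_zero th)
    show "(\<lambda>x. max (g x - c) 0) \<in> L2 \<S>"
      by (rule L2_bound[OF L(3) measurable_compose[OF mL(3) mx]]) (intro AE_I2, simp only: real_norm_def mxb)
    show "L2_conv \<L> (\<lambda>n x. F n (u x)) (\<lambda>x. max (u x - c) 0)"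
    proof (rule L2_conv_dominated[where g="\<lambda>x. 2 * \<bar>u x\<bar>"])
      have "(\<lambda>x. norm (u x)) \<in> L2 \<L>"
        by (rule L2_bound[OF L(1) measurable_compose[OF mL(1) borel_measurable_norm]]) simp
      from L2_scale[OF this, of 2] show "(\<lambda>x. 2 * \<bar>u x\<bar>) \<in> L2 \<L>" by simp
    qed (intro AE_I2 Flim dom measurable_compose[OF mL(1) mF] measurable_compose[OF mL(1) mx])+
    show "L2_conv \<S> (\<lambda>n x. F n (g x)) (\<lambda>x. max (g x - c) 0)"
    proof (rule L2_conv_dominated[where g="\<lambda>x. 2 * \<bar>g x\<bar>"])
      have "(\<lambda>x. norm (g x)) \<in> L2 \<S>"
        by (rule L2_bound[OF L(3) measurable_compose[OF mL(3) borel_measurable_norm]]) simp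
      from L2_scale[OF this, of 2] show "(\<lambda>x. 2 * \<bar>g x\<bar>) \<in> L2 \<S>" by simp
    qed (intro AE_I2 Flim dom measurable_compose[OF mL(3) mF] measurable_compose[OF mL(3) mx])+
    show "L2_conv \<L> (\<lambda>n x. F' n (u x) *\<^sub>R G x) (\<lambda>x. ((1 + sgn (u x - c)) / 2) *\<^sub>R G x)"
    proof (rule L2_conv_dominated[where g="\<lambda>x. 2 * norm (G x)"])
      have "(\<lambda>x. norm (G x)) \<in> L2 \<L>"
        by (rule L2_bound[OF L(2) measurable_compose[OF mL(2) borel_measurable_norm]]) simp
      from L2_scale[OF this, of 2] show "(\<lambda>x. 2 * norm (G x)) \<in> L2 \<L>" by simp
      show "AE x in \<L>. norm (F' n (u x) *\<^sub>R G x - ((1 + sgn (u x - c)) / 2) *\<^sub>R G x) \<le> 2 * norm (G x)" for n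
      proof (rule AE_I2)
        fix x
        have "\<bar>F' n (u x) - (1 + sgn (u x - c)) / 2\<bar> \<le> 2"
          using F'01[of n "u x"] th[of "u x - c"] by linarith
        then show "norm (F' n (u x) *\<^sub>R G x - ((1 + sgn (u x - c)) / 2) *\<^sub>R G x) \<le> 2 * norm (G x)"
          by (simp only: scaleR_diff_left[symmetric] norm_scaleR) (intro mult_right_mono norm_ge_zero)
      qed
      show "(\<lambda>x. F' n (u x) *\<^sub>R G x) \<in> borel_measurable \<L>" for n
        by (intro borel_measurable_scaleR measurable_compose[OF mL(1) mF'] mL)
    qed (intro AE_I2 tendsto_scaleR tendsto_const F'lim mG)+
  qed
qed

end

section \<open>Rademacher's theorem\<close>

lemma Vitali_intervals:
  fixes S :: "real set"
  assumes "\<And>x d. x \<in> S \<Longrightarrow> 0 < d \<Longrightarrow> \<exists>a b. P a b \<and> a < x \<and> x < b \<and> b - a < d"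
  shows "\<exists>C. countable C \<and> (\<forall>a b. (a, b) \<in> C \<longrightarrow> P a b \<and> a < b) \<and>
    disjoint_family_on (\<lambda>(a, b). {a..b}) C \<and> negligible (S - (\<Union>(a, b)\<in>C. {a..b}))"
proof -
  let ?K = "{(a, b). P a b \<and> a < b}"
  \<comment> \<open>An interval is the closed ball about its midpoint, which brings Vitali's
    covering theorem for balls into play.\<close>
  let ?c = "\<lambda>(a, b). (a + b) / 2 :: real" and ?r = "\<lambda>(a, b). (b - a) / 2 :: real"
  have cb: "cball (?c i) (?r i) = (\<lambda>(a, b). {a..b}) i" for i
  proof (cases i)
    case (Pair a b)
    have "(a + b) / 2 - (b - a) / 2 = a" "(a + b) / 2 + (b - a) / 2 = b" by (simp_all add: field_simps)
    then show ?thesis unfolding Pair by (simp add: cball_eq_atLeastAtMost)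
  qed
  show ?thesis
  proof (rule Vitali_covering_theorem_cballs[of ?K ?r S ?c])
    show "0 < ?r i" if "i \<in> ?K" for i using that by auto
    show "\<exists>i. i \<in> ?K \<and> x \<in> cball (?c i) (?r i) \<and> ?r i < d" if xd: "x \<in> S" "0 < d" for x d
    proof -
      obtain a b where "P a b" "a < x" "x < b" "b - a < d" using assms[OF xd] by blast
      then show ?thesis unfolding cb by (intro exI[of _ "(a, b)"]) auto
    qed
    fix C assume C: "countable C" "C \<subseteq> ?K"
     "pairwise (\<lambda>i j. disjnt (cball (?c i) (?r i)) (cball (?c j) (?r j))) C"
     "negligible (S - (\<Union>i \<in> C. cball (?c i) (?r i)))"
    have 1: "disjoint_family_on (\<lambda>(a, b). {a..b}) C"
      unfolding disjoint_family_on_def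
    proof (intro ballI impI)
      fix i j assume ij: "i \<in> C" "j \<in> C" "i \<noteq> j"
      show "(\<lambda>(a, b). {a..b}) i \<inter> (\<lambda>(a, b). {a..b}) j = {}"
        using pairwiseD[OF C(3) ij] unfolding cb disjnt_def .
    qed
    have 2: "negligible (S - (\<Union>(a, b)\<in>C. {a..b}))" using C(4) unfolding cb .
    have 3: "\<forall>a b. (a, b) \<in> C \<longrightarrow> P a b \<and> a < b" using C(2) by blast
    show ?thesis using C(1) 1 2 3 by blast
  qed
qed

text \<open>For disjoint intervals [c, d] the open intervals (F c, F d) are disjoint parts of
  [F a, F b], and their lengths add up to the left-hand side.\<close>

lemma mono_increments_le:
  fixes F :: "real \<Rightarrow> real"
  assumes F: "mono F" and C: "countable C" "disjoint_family_on (\<lambda>(c, d). {c..d}) C"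
    and sub: "\<And>c d. (c, d) \<in> C \<Longrightarrow> a \<le> c \<and> c < d \<and> d \<le> b"
    and "a \<le> b"
  shows "(\<integral>\<^sup>+(c, d). ennreal (F d - F c) \<partial>count_space C) \<le> ennreal (F b - F a)"
proof -
  have dj: "disjoint_family_on (\<lambda>(c, d). {F c<..<F d}) C"
    unfolding disjoint_family_on_def
  proof (intro ballI impI)
    fix i j assume ij: "i \<in> C" "j \<in> C" "i \<noteq> j"
    obtain c d c' d' where cd: "i = (c, d)" "j = (c', d')" by (cases i, cases j)
    have "{c..d} \<inter> {c'..d'} = {}"
      using disjoint_family_onD[OF C(2) ij] unfolding cd by simp
    moreover have "c < d" "c' < d'" using sub[of c d] sub[of c' d'] ij unfolding cd by auto
    ultimately have "d < c' \<or> d' < c" by (auto simp: disjoint_iff)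
    then have "F d \<le> F c' \<or> F d' \<le> F c" by (auto intro: monoD[OF F])
    then show "(\<lambda>(c, d). {F c<..<F d}) i \<inter> (\<lambda>(c, d). {F c<..<F d}) j = {}" unfolding cd by auto
  qed
  have "(\<integral>\<^sup>+(c, d). ennreal (F d - F c) \<partial>count_space C)
      = (\<integral>\<^sup>+i. emeasure lborel ((\<lambda>(c, d). {F c<..<F d}) i) \<partial>count_space C)"
  proof (rule nn_integral_cong)
    fix i assume i: "i \<in> space (count_space C)"
    obtain c d where cd: "i = (c, d)" by (cases i)
    then have "c \<le> d" using i sub[of c d] by simp
    then have "F c \<le> F d" by (rule monoD[OF F])
    then show "(case i of (c, d) \<Rightarrow> ennreal (F d - F c)) = emeasure lborel (case i of (c, d) \<Rightarrow> {F c<..<F d})"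
      by (simp add: cd)
  qed
  also have "\<dots> = emeasure lborel (\<Union>((\<lambda>(c, d). {F c<..<F d}) ` C))"
    by (rule emeasure_UN_countable[symmetric]) (use C(1) dj in auto)
  also have "\<dots> \<le> emeasure lborel {F a..F b}"
  proof (rule emeasure_mono)
    show "(\<Union>((\<lambda>(c, d). {F c<..<F d}) ` C)) \<subseteq> {F a..F b}"
    proof clarify
      fix c d z assume "(c, d) \<in> C" "z \<in> {F c<..<F d}"
      moreover have "F a \<le> F c" "F d \<le> F b"
        using sub[OF \<open>(c, d) \<in> C\<close>] by (auto intro: monoD[OF F])
      ultimately show "z \<in> {F a..F b}" by auto
    qed
  qed simp
  also have "\<dots> = ennreal (F b - F a)" using monoD[OF F \<open>a \<le> b\<close>] by simp
  finally show ?thesis .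
qed

text \<open>\<open>E'\<close> is the part of \<open>E\<close> to which the covering theorem is
  applied; it may miss a null set, such as the end points of an interval.\<close>

lemma emeasure_le_cover:
  fixes E :: "real set"
  assumes E: "E \<in> sets borel" and C: "countable C" "disjoint_family_on (\<lambda>(a, b). {a..b}) C"
    and neg: "negligible (E' - (\<Union>(a, b)\<in>C. {a..b}))" and E': "E' \<subseteq> E" "negligible (E - E')"
  shows "emeasure lborel E \<le> (\<integral>\<^sup>+(a, b). emeasure lborel (E \<inter> {a..b}) \<partial>count_space C)"
proof -
  let ?U = "\<Union>i\<in>C. E \<inter> (\<lambda>(a, b). {a..b}) i"
  have U: "?U \<in> sets borel" using E C(1) by (intro sets.countable_UN'') auto
  have "negligible (E - ?U)"
    by (rule negligible_subset[OF negligible_Un[OF neg E'(2)]]) auto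
  then have "emeasure lborel (E - ?U) = 0"
    using E U by (simp add: negligible_iff_emeasure0 sets.Diff)
  then have "emeasure lborel E \<le> emeasure lborel ?U"
    using emeasure_subadditive[of "?U" lborel "E - ?U"] E U
    by (simp add: Un_absorb1)
  also have "\<dots> = (\<integral>\<^sup>+i. emeasure lborel (E \<inter> (\<lambda>(a, b). {a..b}) i) \<partial>count_space C)"
  proof (rule emeasure_UN_countable)
    show "disjoint_family_on (\<lambda>i. E \<inter> (\<lambda>(a, b). {a..b}) i) C"
      using C(2) unfolding disjoint_family_on_def by blast
  qed (use E C(1) in auto)
  also have "\<dots> = (\<integral>\<^sup>+(a, b). emeasure lborel (E \<inter> {a..b}) \<partial>count_space C)"
    by (intro nn_integral_cong) (simp split: prod.split)
  finally show ?thesis .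
qed

text \<open>The intervals contain \<open>x\<close> in their interior instead of having it as an end
  point. The set of all such \<open>x\<close> is then a countable intersection of open sets, hence
  Borel whatever \<open>Q\<close> is.\<close>

definition straddled :: "(real \<Rightarrow> real \<Rightarrow> bool) \<Rightarrow> real \<Rightarrow> bool" where
  "straddled Q x \<longleftrightarrow> (\<forall>n::nat. \<exists>a b. a < x \<and> x < b \<and> b - a < inverse (real (Suc n)) \<and> Q a b)"

lemma straddledD:
  assumes "straddled Q x" "0 < d"
  shows "\<exists>a b. a < x \<and> x < b \<and> b - a < d \<and> Q a b"
proof -
  obtain n where "inverse (real (Suc n)) < d" using reals_Archimedean[OF assms(2)] by blast
  then show ?thesis using assms(1) unfolding straddled_def by (meson less_trans)
qed

text \<open>Two Vitali coverings. Outside, \<open>E\<close> is covered by intervals of slope below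
  p, contained in an open set of nearly the same measure. Inside each of them, \<open>E\<close> is
  covered by intervals of slope above q, whose total length is at most 1/q times the increment of
  \<open>F\<close>, hence at most p/q times the outer length. So |E| \<le> (p/q) (|E| + e) for all e
  > 0, and p < q forces |E| = 0.\<close>

lemma straddle_null:
  fixes F :: "real \<Rightarrow> real"
  assumes F: "mono F" and E: "E \<in> sets borel" "emeasure lborel E < \<infinity>"
    and pq: "0 < p" "p < q"
    and P: "\<And>x. x \<in> E \<Longrightarrow> straddled (\<lambda>a b. F b - F a < p * (b - a)) x"
    and Q: "\<And>x. x \<in> E \<Longrightarrow> straddled (\<lambda>a b. q * (b - a) < F b - F a) x"
  shows "emeasure lborel E = 0"
proof -
  have inner: "emeasure lborel (E \<inter> {a..b}) \<le> ennreal (p / q) * ennreal (b - a)"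
    if ab: "a < b" "F b - F a < p * (b - a)" for a b
  proof -
    have "\<exists>c d. (a \<le> c \<and> d \<le> b \<and> q * (d - c) < F d - F c) \<and> c < x \<and> x < d \<and> d - c < e"
      if x: "x \<in> E \<inter> {a<..<b}" and e: "0 < e" for x e
    proof -
      have "0 < min e (min (x - a) (b - x))" using x e by simp
      then obtain c d where "c < x" "x < d" "d - c < min e (min (x - a) (b - x))" "q * (d - c) < F d - F c"
        using straddledD[OF Q, of x "min e (min (x - a) (b - x))"] x by blast
      then show ?thesis by (intro exI[of _ c] exI[of _ d]) auto
    qed
    from Vitali_intervals[of "E \<inter> {a<..<b}" "\<lambda>c d. a \<le> c \<and> d \<le> b \<and> q * (d - c) < F d - F c", OF this]
    obtain C where C: "countable C"
        "\<And>c d. (c, d) \<in> C \<Longrightarrow> (a \<le> c \<and> d \<le> b \<and> q * (d - c) < F d - F c) \<and> c < d"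
        "disjoint_family_on (\<lambda>(c, d). {c..d}) C"
        "negligible (E \<inter> {a<..<b} - (\<Union>(c, d)\<in>C. {c..d}))" by blast
    have "negligible (E \<inter> {a..b} - E \<inter> {a<..<b})"
      by (rule negligible_subset[of "{a, b}"]) auto
    then have "emeasure lborel (E \<inter> {a..b})
        \<le> (\<integral>\<^sup>+(c, d). emeasure lborel (E \<inter> {a..b} \<inter> {c..d}) \<partial>count_space C)"
      by (intro emeasure_le_cover[OF _ C(1,3,4)]) (use E(1) in auto)
    also have "\<dots> \<le> (\<integral>\<^sup>+(c, d). ennreal (1 / q) * ennreal (F d - F c) \<partial>count_space C)"
    proof (rule nn_integral_mono, clarsimp)
      fix c d assume cd: "(c, d) \<in> C"
      have "emeasure lborel (E \<inter> {a..b} \<inter> {c..d}) \<le> emeasure lborel {c..d}"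
        by (rule emeasure_mono) auto
      also have "\<dots> = ennreal (d - c)" using C(2)[OF cd] by simp
      also have "\<dots> \<le> ennreal (1 / q * (F d - F c))"
        using C(2)[OF cd] pq by (intro ennreal_leI) (simp add: field_simps)
      also have "\<dots> = ennreal (1 / q) * ennreal (F d - F c)"
        using pq C(2)[OF cd] by (intro ennreal_mult) (auto intro: monoD[OF F])
      finally show "emeasure lborel (E \<inter> {a..b} \<inter> {c..d}) \<le> ennreal (1 / q) * ennreal (F d - F c)" .
    qed
    also have "\<dots> = ennreal (1 / q) * (\<integral>\<^sup>+(c, d). ennreal (F d - F c) \<partial>count_space C)"
      by (subst nn_integral_cmult[symmetric]) (auto intro!: nn_integral_cong)
    also have "\<dots> \<le> ennreal (1 / q) * ennreal (F b - F a)"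
      by (intro mult_left_mono mono_increments_le[OF F C(1,3)]) (use C(2) ab in auto)
    also have "\<dots> \<le> ennreal (1 / q) * ennreal (p * (b - a))"
      using ab by (intro mult_left_mono ennreal_leI) auto
    also have "\<dots> = ennreal (p / q) * ennreal (b - a)"
      using pq ab by (simp add: ennreal_mult[symmetric])
    finally show ?thesis .
  qed
  have main: "emeasure lborel E \<le> ennreal (p / q) * (emeasure lborel E + ennreal e)" if e: "e > 0" for e
  proof -
    obtain U where U: "open U" "E \<subseteq> U" "emeasure lborel (U - E) < ennreal e"
      using outer_regular_lborel[OF E(1) e] by metis
    have "\<exists>a b. ({a..b} \<subseteq> U \<and> F b - F a < p * (b - a)) \<and> a < x \<and> x < b \<and> b - a < d"
      if x: "x \<in> E" and d: "0 < d" for x d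
    proof -
      obtain r where r: "r > 0" "ball x r \<subseteq> U" using U x by (meson openE subsetD)
      obtain a b where "a < x" "x < b" "b - a < min d r" "F b - F a < p * (b - a)"
        using straddledD[OF P[OF x], of "min d r"] r d by auto
      moreover have "{a..b} \<subseteq> ball x r" using calculation by (auto simp: dist_real_def)
      ultimately show ?thesis using r by (intro exI[of _ a] exI[of _ b]) auto
    qed
    from Vitali_intervals[of E "\<lambda>a b. {a..b} \<subseteq> U \<and> F b - F a < p * (b - a)", OF this]
    obtain C where C: "countable C"
        "\<And>a b. (a, b) \<in> C \<Longrightarrow> ({a..b} \<subseteq> U \<and> F b - F a < p * (b - a)) \<and> a < b"
        "disjoint_family_on (\<lambda>(a, b). {a..b}) C" "negligible (E - (\<Union>(a, b)\<in>C. {a..b}))" by blast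
    have "emeasure lborel E \<le> (\<integral>\<^sup>+(a, b). emeasure lborel (E \<inter> {a..b}) \<partial>count_space C)"
      by (rule emeasure_le_cover[OF E(1) C(1,3,4)]) auto
    also have "\<dots> \<le> (\<integral>\<^sup>+i. ennreal (p / q) * emeasure lborel ((\<lambda>(a, b). {a..b}) i) \<partial>count_space C)"
    proof (rule nn_integral_mono, clarsimp)
      fix a b assume "(a, b) \<in> C"
      then show "emeasure lborel (E \<inter> {a..b}) \<le> ennreal (p / q) * emeasure lborel {a..b}"
        using inner[of a b] C(2)[of a b] by simp
    qed
    also have "\<dots> = ennreal (p / q) * (\<integral>\<^sup>+i. emeasure lborel ((\<lambda>(a, b). {a..b}) i) \<partial>count_space C)"
      by (rule nn_integral_cmult) simp
    also have "(\<integral>\<^sup>+i. emeasure lborel ((\<lambda>(a, b). {a..b}) i) \<partial>count_space C)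
        = emeasure lborel (\<Union>((\<lambda>(a, b). {a..b}) ` C))"
      by (rule emeasure_UN_countable[symmetric]) (use C(1,3) in auto)
    also have "\<dots> \<le> emeasure lborel U"
      by (rule emeasure_mono) (use C(2) U(1) in auto)
    also have "emeasure lborel U \<le> emeasure lborel E + ennreal e"
    proof -
      have "emeasure lborel (E \<union> (U - E)) \<le> emeasure lborel E + emeasure lborel (U - E)"
        by (rule emeasure_subadditive) (use E U in auto)
      also have "\<dots> \<le> emeasure lborel E + ennreal e" using U(3) by (intro add_left_mono) auto
      finally show ?thesis using U(2) by (simp add: Un_absorb1)
    qed
    finally show ?thesis by (simp add: mult_left_mono)
  qed
  define m where "m = enn2real (emeasure lborel E)"
  have m: "emeasure lborel E = ennreal m" "m \<ge> 0" using E(2) by (auto simp: m_def)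
  have "m \<le> p / q * m + e" if "e > 0" for e
  proof -
    have "ennreal m \<le> ennreal (p / q * (m + e))"
      using main[OF that] m(2) that pq unfolding m(1)
      by (simp add: ennreal_plus[symmetric] ennreal_mult[symmetric] del: ennreal_plus)
    then have "m \<le> p / q * (m + e)"
      using m(2) that pq by (subst (asm) ennreal_le_iff) auto
    also have "\<dots> \<le> p / q * m + e" using pq that by (simp add: field_simps)
    finally show ?thesis .
  qed
  then have "m \<le> p / q * m" by (rule field_le_epsilon)
  then have "m * (1 - p / q) \<le> 0" by (simp add: algebra_simps)
  moreover have "1 - p / q > 0" using pq by simp
  ultimately have "m = 0" using m(2) by (simp add: mult_le_0_iff)
  then show ?thesis using m by simp
qed

lemma straddled_borel: "{x. straddled Q x} \<in> sets borel"
proof -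
  let ?I = "\<lambda>n::nat. {(a, b). b - a < inverse (real (Suc n)) \<and> Q a b}"
  have "{x. straddled Q x} = (\<Inter>n. \<Union>(a, b)\<in>?I n. {a<..<b})"
    by (auto simp: straddled_def simp del: of_nat_Suc) blast+
  moreover have "open (\<Union>(a, b)\<in>?I n. {a<..<b})" for n
    by (intro open_UN) auto
  ultimately show ?thesis by (simp only:) (intro sets.countable_INT, auto)
qed

lemma straddle_AE:
  fixes F :: "real \<Rightarrow> real"
  assumes F: "mono F" and pq: "0 < p" "p < q"
  shows "AE x in lborel. \<not> straddled (\<lambda>a b. F b - F a < p * (b - a)) x \<or>
    \<not> straddled (\<lambda>a b. q * (b - a) < F b - F a) x"
proof -
  let ?A = "{x. straddled (\<lambda>a b. F b - F a < p * (b - a)) x}"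
  let ?B = "{x. straddled (\<lambda>a b. q * (b - a) < F b - F a) x}"
  have AB: "?A \<inter> ?B \<inter> {- real k..real k} \<in> sets borel" for k
    by (intro sets.Int straddled_borel) simp
  have null: "emeasure lborel (?A \<inter> ?B \<inter> {- real k..real k}) = 0" for k
  proof (rule straddle_null[OF F AB _ pq])
    have "emeasure lborel (?A \<inter> ?B \<inter> {- real k..real k}) \<le> emeasure lborel {- real k..real k}"
      by (rule emeasure_mono) auto
    also have "\<dots> < \<infinity>" by simp
    finally show "emeasure lborel (?A \<inter> ?B \<inter> {- real k..real k}) < \<infinity>" .
  qed blast+
  have "AE x in lborel. \<forall>k::nat. x \<notin> ?A \<inter> ?B \<inter> {- real k..real k}"
    unfolding AE_all_countable using null AB by (intro allI AE_not_in null_setsI) simp_all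
  then show ?thesis
  proof eventually_elim
    case (elim x)
    obtain k where "\<bar>x\<bar> \<le> real k" using real_arch_simple by blast
    then show ?case using elim[rule_format, of k] by (auto simp: abs_le_iff)
  qed
qed

text \<open>The derivative is the supremum D of all p that bound the slopes of short straddling
  intervals from below. Given e, there are rationals D < p < q < D + e; since p is no such bound,
  the assumption makes q an upper bound for short intervals.\<close>

lemma straddle_differentiable:
  fixes F :: "real \<Rightarrow> real"
  assumes F: "mono F" "continuous_on UNIV F" and K: "\<And>a b. a \<le> b \<Longrightarrow> F b - F a \<le> K * (b - a)"
    and x: "\<And>p q. p \<in> \<rat> \<Longrightarrow> q \<in> \<rat> \<Longrightarrow> 0 < p \<Longrightarrow> p < q \<Longrightarrow> 
    \<not> straddled (\<lambda>a b. F b - F a < p * (b - a)) x \<or> \<not> straddled (\<lambda>a b. q * (b - a) < F b - F a) x"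
  shows "\<exists>D. (F has_real_derivative D) (at x)"
proof -
  define lo where "lo p \<delta> \<longleftrightarrow> (\<forall>a b. a < x \<longrightarrow> x < b \<longrightarrow> b - a < \<delta> \<longrightarrow> p * (b - a) \<le> F b - F a)" for p \<delta>
  define hi where "hi p \<delta> \<longleftrightarrow> (\<forall>a b. a < x \<longrightarrow> x < b \<longrightarrow> b - a < \<delta> \<longrightarrow> F b - F a \<le> p * (b - a))" for p \<delta>
  define S where "S = {p. \<exists>\<delta>>0. lo p \<delta>}"
  have bdd: "p \<le> K" if "p \<in> S" for p
  proof -
    obtain \<delta> where \<delta>: "\<delta> > 0" "lo p \<delta>" using \<open>p \<in> S\<close> unfolding S_def by blast
    have "p * (2 * (\<delta> / 4)) \<le> F (x + \<delta> / 4) - F (x - \<delta> / 4)"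
      using \<delta> unfolding lo_def by (elim allE[of _ "x - \<delta> / 4"] allE[of _ "x + \<delta> / 4"]) simp
    also have "\<dots> \<le> K * (2 * (\<delta> / 4))" using K[of "x - \<delta> / 4" "x + \<delta> / 4"] \<delta> by simp
    finally show ?thesis using \<delta>(1) by simp
  qed
  have 0: "0 \<in> S" unfolding S_def lo_def by (auto intro!: exI[of _ 1] monoD[OF F(1)])
  define D where "D = Sup S"
  have bS: "bdd_above S" using bdd by (auto intro!: bdd_aboveI[of _ K])
  have D0: "D \<ge> 0" unfolding D_def using 0 bS by (rule cSup_upper)
  have LO: "\<exists>\<delta>>0. lo (D - e) \<delta>" if e: "e > 0" for e
  proof -
    obtain p where p: "p \<in> S" "D - e < p"
      using less_cSupD[of S "D - e"] 0 e unfolding D_def by auto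
    then obtain \<delta> where \<delta>: "\<delta> > 0" "lo p \<delta>" unfolding S_def by blast
    have "lo (D - e) \<delta>" unfolding lo_def
    proof (intro allI impI)
      fix a b assume ab: "a < x" "x < b" "b - a < \<delta>"
      have "(D - e) * (b - a) \<le> p * (b - a)" using p ab by (intro mult_right_mono) auto
      also have "\<dots> \<le> F b - F a" using \<delta>(2) ab unfolding lo_def by blast
      finally show "(D - e) * (b - a) \<le> F b - F a" .
    qed
    then show ?thesis using \<delta>(1) by blast
  qed
  have HI: "\<exists>\<delta>>0. hi (D + e) \<delta>" if e: "e > 0" for e
  proof -
    obtain p where p: "p \<in> \<rat>" "D < p" "p < D + e" using Rats_dense_in_real[of D "D + e"] e by auto
    obtain q where q: "q \<in> \<rat>" "p < q" "q < D + e" using Rats_dense_in_real[OF p(3)] by auto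
    have "0 < p" using p D0 by simp
    then obtain n where n: "lo p (inverse (real (Suc n))) \<or> hi q (inverse (real (Suc n)))"
      using x[OF p(1) q(1) _ q(2)] unfolding lo_def hi_def straddled_def by (meson not_less)
    define \<delta> where "\<delta> = inverse (real (Suc n))"
    have \<delta>: "0 < \<delta>" "lo p \<delta> \<or> hi q \<delta>" using n by (simp_all add: \<delta>_def)
    have "\<not> lo p \<delta>"
    proof
      assume "lo p \<delta>"
      then have "p \<in> S" using \<delta>(1) unfolding S_def by blast
      then have "p \<le> D" unfolding D_def using bS by (rule cSup_upper)
      then show False using p by simp
    qed
    with \<delta> have h: "hi q \<delta>" by blast
    have "hi (D + e) \<delta>" unfolding hi_def
    proof (intro allI impI)
      fix a b assume ab: "a < x" "x < b" "b - a < \<delta>"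
      have "F b - F a \<le> q * (b - a)" using h ab unfolding hi_def by blast
      also have "\<dots> \<le> (D + e) * (b - a)" using q ab by (intro mult_right_mono) auto
      finally show "F b - F a \<le> (D + e) * (b - a)" .
    qed
    then show ?thesis using \<delta>(1) by blast
  qed
  \<comment> \<open>Differentiability compares intervals with \<open>x\<close> as an end point. They
    are limits of straddling intervals, enlarged by \<open>s n\<close> on both sides, and continuity
    carries the estimate over.\<close>
  have close: "\<exists>\<delta>>0. \<forall>a b. a \<le> x \<longrightarrow> x \<le> b \<longrightarrow> a < b \<longrightarrow> b - a < \<delta> \<longrightarrow> \<bar>F b - F a - D * (b - a)\<bar> \<le> e * (b - a)"
    if e: "e > 0" for e
  proof -
    obtain \<delta>1 \<delta>2 where \<delta>: "\<delta>1 > 0" "lo (D - e) \<delta>1" "\<delta>2 > 0" "hi (D + e) \<delta>2"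
      using LO[OF e] HI[OF e] by blast
    have strict: "\<bar>F b - F a - D * (b - a)\<bar> \<le> e * (b - a)" if ab: "a < x" "x < b" "b - a < min \<delta>1 \<delta>2" for a b
    proof -
      have "(D - e) * (b - a) \<le> F b - F a" "F b - F a \<le> (D + e) * (b - a)"
        using \<delta> ab unfolding lo_def hi_def by auto
      then show ?thesis by (simp add: abs_le_iff algebra_simps)
    qed
    have "\<bar>F b - F a - D * (b - a)\<bar> \<le> e * (b - a)" if ab: "a \<le> x" "x \<le> b" "a < b" "b - a < min \<delta>1 \<delta>2" for a b
    proof -
      define s where "s n = inverse (real (Suc n))" for n
      have s0: "s \<longlonglongrightarrow> 0" unfolding s_def by (rule LIMSEQ_inverse_real_of_nat)
      have lim: "(\<lambda>n. F (y + c * s n)) \<longlonglongrightarrow> F y" for y c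
      proof (rule continuous_on_tendsto_compose[OF F(2)])
        have "(\<lambda>n. y + c * s n) \<longlonglongrightarrow> y + c * 0" by (intro tendsto_intros s0)
        then show "(\<lambda>n. y + c * s n) \<longlonglongrightarrow> y" by simp
      qed auto
      have "\<forall>\<^sub>F n in sequentially. 2 * s n < min \<delta>1 \<delta>2 - (b - a)"
      proof (rule order_tendstoD(2))
        have "(\<lambda>n. 2 * s n) \<longlonglongrightarrow> 2 * 0" by (intro tendsto_intros s0)
        then show "(\<lambda>n. 2 * s n) \<longlonglongrightarrow> 0" by simp
      qed (use ab in simp)
      then have ev: "\<forall>\<^sub>F n in sequentially. \<bar>F (b + 1 * s n) - F (a + (-1) * s n) - D * ((b + s n) - (a - s n))\<bar>
          \<le> e * ((b + s n) - (a - s n))"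
      proof eventually_elim
        case (elim n)
        have "0 < s n" by (simp add: s_def)
        then have "a - s n < x" "x < b + s n" using ab by simp_all
        moreover have "(b + s n) - (a - s n) < min \<delta>1 \<delta>2" using elim by linarith
        ultimately show ?case using strict[of "a - s n" "b + s n"] by simp
      qed
      show ?thesis
      proof (rule tendsto_le[OF _ _ _ ev])
        show "(\<lambda>n. e * ((b + s n) - (a - s n))) \<longlonglongrightarrow> e * (b - a)"
        proof -
          have "(\<lambda>n. e * ((b + s n) - (a - s n))) \<longlonglongrightarrow> e * ((b + 0) - (a - 0))"
            by (intro tendsto_intros s0)
          then show ?thesis by simp
        qed
        have "(\<lambda>n. \<bar>F (b + 1 * s n) - F (a + (-1) * s n) - D * ((b + s n) - (a - s n))\<bar>)
          \<longlonglongrightarrow> \<bar>F b - F a - D * ((b + 0) - (a - 0))\<bar>"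
          by (intro tendsto_intros lim s0)
        then show "(\<lambda>n. \<bar>F (b + 1 * s n) - F (a + (-1) * s n) - D * ((b + s n) - (a - s n))\<bar>)
          \<longlonglongrightarrow> \<bar>F b - F a - D * (b - a)\<bar>" by simp
      qed simp
    qed
    moreover have "min \<delta>1 \<delta>2 > 0" using \<delta> by simp
    ultimately show ?thesis by blast
  qed
  have "(F has_derivative (*) D) (at x)"
    unfolding has_derivative_at_alt
  proof (intro conjI allI impI)
    show "bounded_linear ((*) D)" by (rule bounded_linear_mult_right)
    fix e :: real assume "0 < e"
    from close[OF this] obtain \<delta> where \<delta>: "\<delta> > 0"
      "\<And>a b. a \<le> x \<Longrightarrow> x \<le> b \<Longrightarrow> a < b \<Longrightarrow> b - a < \<delta> \<Longrightarrow> \<bar>F b - F a - D * (b - a)\<bar> \<le> e * (b - a)"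
      by blast
    have "norm (F y - F x - D * (y - x)) \<le> e * norm (y - x)" if y: "norm (y - x) < \<delta>" for y
    proof -
      consider "y < x" | "y = x" | "x < y" by linarith
      then show ?thesis
      proof cases
        case 1
        have "F x - F y - D * (x - y) = - (F y - F x - D * (y - x))" by (simp add: algebra_simps)
        then show ?thesis using \<delta>(2)[of y x] y 1 by simp
      next
        case 3
        then show ?thesis using \<delta>(2)[of x y] y by simp
      qed simp
    qed
    then show "\<exists>d>0. \<forall>y. norm (y - x) < d \<longrightarrow> norm (F y - F x - D * (y - x)) \<le> e * norm (y - x)"
      using \<delta>(1) by blast
  qed
  then show ?thesis by (auto simp: has_field_derivative_def)
qed

text \<open>Adding L x makes \<open>f\<close> nondecreasing with slopes at most 2 L, and does not
  affect differentiability.\<close>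

lemma Lipschitz_differentiable_AE_real:
  fixes f :: "real \<Rightarrow> real"
  assumes L: "\<And>s t. \<bar>f s - f t\<bar> \<le> L * \<bar>s - t\<bar>"
  shows "AE x in lborel. \<exists>D. (f has_real_derivative D) (at x)"
proof -
  define F where "F x = f x + L * x" for x
  have m: "mono F"
  proof (rule monoI)
    fix s t :: real assume "s \<le> t"
    then show "F s \<le> F t" using L[of s t] unfolding F_def by (simp add: abs_le_iff algebra_simps)
  qed
  have "L \<ge> 0" using L[of 0 1] by (simp) 
  then have "L-lipschitz_on UNIV f"
    by (intro lipschitz_onI) (use L in \<open>auto simp: dist_real_def\<close>)
  then have "continuous_on UNIV f" by (rule lipschitz_on_continuous_on)
  then have c: "continuous_on UNIV F" unfolding F_def by (intro continuous_intros)
  have K: "F b - F a \<le> (2 * L) * (b - a)" if "a \<le> b" for a b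
    using L[of b a] that unfolding F_def by (simp add: abs_le_iff algebra_simps)
  have "AE x in lborel. \<forall>p\<in>\<rat> \<inter> {0<..}. \<forall>q\<in>\<rat> \<inter> {p<..}. 
    \<not> straddled (\<lambda>a b. F b - F a < p * (b - a)) x \<or> \<not> straddled (\<lambda>a b. q * (b - a) < F b - F a) x"
    by (intro AE_ball_countable[THEN iffD2] ballI straddle_AE[OF m]) (auto simp: countable_rat)
  then show ?thesis
  proof eventually_elim
    case (elim x)
    have "\<exists>D. (F has_real_derivative D) (at x)"
      by (rule straddle_differentiable[OF m c K]) (use elim in auto)
    then obtain D where D: "(F has_real_derivative D) (at x)" by blast
    have "((\<lambda>x. F x - L * x) has_real_derivative D - L) (at x)"
      by (rule derivative_eq_intros D refl)+ simp
    then show ?case by (auto simp: F_def)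
  qed
qed

section \<open>Directional derivatives in Euclidean space\<close>

lemma AE_directional:
  fixes v :: "'a::euclidean_space"
  assumes A: "A \<in> sets borel" and line: "\<And>y. AE t in lborel. y + t *\<^sub>R v \<in> A"
  shows "AE y in lborel. y \<in> A"
proof -
  define B where "B = - A"
  have B: "B \<in> sets borel" using A by (simp add: B_def)
  have iB: "indicator B \<in> borel_measurable borel" using B by simp
  have tr: "(\<integral>\<^sup>+y. indicator B (y + t *\<^sub>R v) \<partial>lborel) = emeasure lborel B" for t
  proof -
    have "emeasure lborel B = (\<integral>\<^sup>+y. indicator B y \<partial>distr lborel borel ((+) (t *\<^sub>R v)))"
      using B by (simp add: lborel_distr_plus)
    also have "\<dots> = (\<integral>\<^sup>+y. indicator B (t *\<^sub>R v + y) \<partial>lborel)"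
      by (rule nn_integral_distr) (use iB in simp_all)
    finally show ?thesis by (simp add: add.commute)
  qed
  have ln: "(\<integral>\<^sup>+t. indicator B (y + t *\<^sub>R v) * indicator {0..1} t \<partial>lborel) = 0" for y
  proof -
    have "AE t in lborel. (indicator B (y + t *\<^sub>R v) * indicator {0..1} t :: ennreal) = 0"
      using line[of y] by eventually_elim (simp add: B_def)
    then have "(\<integral>\<^sup>+t. indicator B (y + t *\<^sub>R v) * indicator {0..1} t \<partial>lborel) = (\<integral>\<^sup>+t. 0 \<partial>(lborel :: real measure))"
      by (rule nn_integral_cong_AE)
    then show ?thesis by simp
  qed
  have m: "(\<lambda>(y, t). indicator B (y + t *\<^sub>R v) * indicator {0..1} t :: ennreal)
      \<in> borel_measurable (lborel \<Otimes>\<^sub>M lborel)"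
  proof -
    have "(\<lambda>z. fst z + snd z *\<^sub>R v) \<in> borel_measurable (borel :: ('a \<times> real) measure)"
      by (intro borel_measurable_continuous_onI continuous_intros)
    then have "(\<lambda>z. indicator B (fst z + snd z *\<^sub>R v) :: ennreal) \<in> borel_measurable (borel :: ('a \<times> real) measure)"
      by (rule measurable_compose[OF _ iB])
    moreover have "(\<lambda>z. indicator {0..1} (snd z) :: ennreal) \<in> borel_measurable (borel :: ('a \<times> real) measure)"
      by (rule measurable_compose[where f=snd and g="indicator {0..1}" and N=borel],
          rule borel_measurable_continuous_onI, intro continuous_intros, simp)
    ultimately have "(\<lambda>z. indicator B (fst z + snd z *\<^sub>R v) * indicator {0..1} (snd z) :: ennreal)
        \<in> borel_measurable (borel :: ('a \<times> real) measure)" by (rule borel_measurable_times_ennreal)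
    then show ?thesis by (simp add: lborel_prod case_prod_unfold)
  qed
  \<comment> \<open>All translates of the complement \<open>B\<close> along \<open>v\<close> have
    the same measure, so it equals its mean over t in [0, 1]; exchanging the integrals leaves the
    measure of \<open>B\<close> on single lines, which is 0.\<close>
  have "emeasure lborel B = (\<integral>\<^sup>+t. emeasure lborel B * indicator {0..1} t \<partial>(lborel :: real measure))"
    by (simp add: nn_integral_cmult)
  also have "\<dots> = (\<integral>\<^sup>+t. \<integral>\<^sup>+y. indicator B (y + t *\<^sub>R v) * indicator {0..1} t \<partial>lborel \<partial>lborel)"
  proof (rule nn_integral_cong)
    fix t :: real
    have "(\<integral>\<^sup>+y. indicator B (y + t *\<^sub>R v) * indicator {0..1} t \<partial>lborel) =
        (\<integral>\<^sup>+y. indicator B (y + t *\<^sub>R v) \<partial>lborel) * indicator {0..1} t"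
    proof (rule nn_integral_multc)
      have "(\<lambda>y. y + t *\<^sub>R v) \<in> borel_measurable borel"
        by (intro borel_measurable_continuous_onI continuous_intros)
      from measurable_compose[OF this iB] show "(\<lambda>y. indicator B (y + t *\<^sub>R v)) \<in> borel_measurable lborel" by simp
    qed
    then show "emeasure lborel B * indicator {0..1} t = (\<integral>\<^sup>+y. indicator B (y + t *\<^sub>R v) * indicator {0..1} t \<partial>lborel)"
      by (simp only: tr)
  qed
  also have "\<dots> = (\<integral>\<^sup>+y. \<integral>\<^sup>+t. indicator B (y + t *\<^sub>R v) * indicator {0..1} t \<partial>lborel \<partial>lborel)"
    by (rule lborel_pair.Fubini'[OF m])
  also have "\<dots> = 0" by (simp add: ln)
  finally have "B \<in> null_sets lborel" using B by (simp add: null_sets_def)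
  then have "AE y in lborel. y \<notin> B" by (rule AE_not_in)
  then show ?thesis by eventually_elim (simp add: B_def)
qed

definition diff_quotient :: "('a::real_normed_vector \<Rightarrow> real) \<Rightarrow> 'a \<Rightarrow> 'a \<Rightarrow> real \<Rightarrow> real" where
  "diff_quotient f v y t = (f (y + t *\<^sub>R v) - f y) / t"

text \<open>Only rational increments are used, so that the set of all \<open>y\<close> with this property is Borel;
  for continuous \<open>f\<close> this makes no difference.\<close>

definition diff_quotient_Cauchy :: "('a::real_normed_vector \<Rightarrow> real) \<Rightarrow> 'a \<Rightarrow> 'a \<Rightarrow> bool" where
  "diff_quotient_Cauchy f v y \<longleftrightarrow> (\<forall>k::nat. \<exists>m::nat. \<forall>s t :: rat.
     s \<noteq> 0 \<and> t \<noteq> 0 \<and> \<bar>real_of_rat s\<bar> < inverse (real (Suc m)) \<and> \<bar>real_of_rat t\<bar> < inverse (real (Suc m)) \<longrightarrow>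
     \<bar>diff_quotient f v y (real_of_rat s) - diff_quotient f v y (real_of_rat t)\<bar> \<le> inverse (real (Suc k)))"

lemma diff_quotient_Cauchy_borel:
  fixes f :: "'a::euclidean_space \<Rightarrow> real"
  assumes "continuous_on UNIV f"
  shows "{y. diff_quotient_Cauchy f v y} \<in> sets borel"
proof -
  have [measurable]: "f \<in> borel_measurable borel" using assms by (rule borel_measurable_continuous_onI)
  have "Measurable.pred borel (\<lambda>y. diff_quotient_Cauchy f v y)"
    unfolding diff_quotient_Cauchy_def diff_quotient_def by measurable
  then show ?thesis by (simp add: pred_def)
qed

lemma diff_quotient_Cauchy_iff:
  fixes f :: "'a::real_normed_vector \<Rightarrow> real"
  assumes "((diff_quotient f v y) \<longlongrightarrow> D) (at 0)"
  shows "diff_quotient_Cauchy f v y"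
  unfolding diff_quotient_Cauchy_def
proof
  fix k :: nat
  have "inverse (real (Suc k)) / 2 > 0" by simp
  with assms obtain d where d: "d > 0"
    "\<And>t. t \<noteq> 0 \<Longrightarrow> \<bar>t\<bar> < d \<Longrightarrow> \<bar>diff_quotient f v y t - D\<bar> < inverse (real (Suc k)) / 2"
    unfolding tendsto_iff eventually_at dist_real_def by (metis UNIV_I diff_zero)
  obtain m where m: "inverse (real (Suc m)) < d" using reals_Archimedean[OF d(1)] by blast
  show "\<exists>m::nat. \<forall>s t :: rat. s \<noteq> 0 \<and> t \<noteq> 0 \<and> \<bar>real_of_rat s\<bar> < inverse (real (Suc m)) \<and>
      \<bar>real_of_rat t\<bar> < inverse (real (Suc m)) \<longrightarrow>
     \<bar>diff_quotient f v y (real_of_rat s) - diff_quotient f v y (real_of_rat t)\<bar> \<le> inverse (real (Suc k))"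
  proof (intro exI[of _ m] allI impI)
    fix s t :: rat
    assume st: "s \<noteq> 0 \<and> t \<noteq> 0 \<and> \<bar>real_of_rat s\<bar> < inverse (real (Suc m)) \<and> \<bar>real_of_rat t\<bar> < inverse (real (Suc m))"
    have "\<bar>real_of_rat s\<bar> < d" "\<bar>real_of_rat t\<bar> < d" using st m by linarith+
    moreover have "real_of_rat s \<noteq> 0" "real_of_rat t \<noteq> 0" using st by simp_all
    ultimately have "\<bar>diff_quotient f v y (real_of_rat s) - D\<bar> < inverse (real (Suc k)) / 2"
      "\<bar>diff_quotient f v y (real_of_rat t) - D\<bar> < inverse (real (Suc k)) / 2"
      using d(2)[of "real_of_rat s"] d(2)[of "real_of_rat t"] by blast+
    then show "\<bar>diff_quotient f v y (real_of_rat s) - diff_quotient f v y (real_of_rat t)\<bar> \<le> inverse (real (Suc k))"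
      by linarith
  qed
qed

text \<open>The limit is taken along one fixed sequence, which makes it total and, for continuous
  \<open>f\<close>, Borel measurable in \<open>y\<close>; for such \<open>f\<close> it is the true
  directional derivative wherever the quotients are Cauchy.\<close>

definition dir_deriv :: "('a::real_normed_vector \<Rightarrow> real) \<Rightarrow> 'a \<Rightarrow> 'a \<Rightarrow> real" where
  "dir_deriv f v y = lim (\<lambda>n. diff_quotient f v y (inverse (real (Suc n))))"

text \<open>Real increments are approximated by nonzero rational ones below the same threshold, and
  continuity of \<open>f\<close> carries the Cauchy estimate over. The limit along 1/(n+1) then
  serves all increments.\<close>

lemma diff_quotient_Cauchy_tendsto:
  fixes f :: "'a::real_normed_vector \<Rightarrow> real"
  assumes c: "continuous_on UNIV f" and C: "diff_quotient_Cauchy f v y"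
  shows "((diff_quotient f v y) \<longlongrightarrow> dir_deriv f v y) (at 0)"
proof -
  let ?q = "diff_quotient f v y"
  have key: "\<exists>m::nat. \<forall>s t :: real. s \<noteq> 0 \<and> t \<noteq> 0 \<and> \<bar>s\<bar> < inverse (real (Suc m)) \<and> \<bar>t\<bar> < inverse (real (Suc m)) \<longrightarrow>
     \<bar>?q s - ?q t\<bar> \<le> inverse (real (Suc k))" for k
  proof -
    obtain m where m: "\<And>s t :: rat. s \<noteq> 0 \<Longrightarrow> t \<noteq> 0 \<Longrightarrow> \<bar>real_of_rat s\<bar> < inverse (real (Suc m)) \<Longrightarrow>
        \<bar>real_of_rat t\<bar> < inverse (real (Suc m)) \<Longrightarrow>
        \<bar>?q (real_of_rat s) - ?q (real_of_rat t)\<bar> \<le> inverse (real (Suc k))"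
      using C unfolding diff_quotient_Cauchy_def by blast
    let ?r = "inverse (real (Suc m))"
    have approx: "\<exists>\<sigma>::nat \<Rightarrow> rat. (\<lambda>n. real_of_rat (\<sigma> n)) \<longlonglongrightarrow> s \<and> (\<forall>n. \<sigma> n \<noteq> 0 \<and> \<bar>real_of_rat (\<sigma> n)\<bar> < ?r)"
      if s: "s \<noteq> 0" "\<bar>s\<bar> < ?r" for s :: real
    proof -
      \<comment> \<open>The first two terms keep the rational away from 0 and below the threshold;
        the last one forces convergence.\<close>
      define e where "e n = min (min \<bar>s\<bar> (?r - \<bar>s\<bar>)) (inverse (real (Suc n)))" for n
      have e0: "e n > 0" for n using s by (simp add: e_def)
      have "\<exists>\<rho>::rat. \<bar>real_of_rat \<rho> - s\<bar> < e n" for n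
      proof -
        obtain \<rho> where "s < real_of_rat \<rho>" "real_of_rat \<rho> < s + e n"
          using of_rat_dense[of s "s + e n"] e0[of n] by auto
        then show ?thesis by (intro exI[of _ \<rho>]) auto
      qed
      then obtain \<sigma> :: "nat \<Rightarrow> rat" where \<sigma>: "\<And>n. \<bar>real_of_rat (\<sigma> n) - s\<bar> < e n" by metis
      have "(\<lambda>n. real_of_rat (\<sigma> n) - s) \<longlonglongrightarrow> 0"
      proof (rule tendsto_0_le[OF LIMSEQ_inverse_real_of_nat, where K=1], intro always_eventually allI)
        fix n
        have "\<bar>real_of_rat (\<sigma> n) - s\<bar> < inverse (real (Suc n))" using \<sigma>[of n] by (simp add: e_def)
        then show "norm (real_of_rat (\<sigma> n) - s) \<le> norm (inverse (real (Suc n))) * 1" by simp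
      qed
      then have "(\<lambda>n. real_of_rat (\<sigma> n)) \<longlonglongrightarrow> s" by (simp add: LIM_zero_iff)
      moreover have "\<sigma> n \<noteq> 0 \<and> \<bar>real_of_rat (\<sigma> n)\<bar> < ?r" for n
      proof -
        have "\<bar>real_of_rat (\<sigma> n) - s\<bar> < \<bar>s\<bar>" "\<bar>real_of_rat (\<sigma> n) - s\<bar> < ?r - \<bar>s\<bar>"
          using \<sigma>[of n] by (simp_all add: e_def)
        then have "\<bar>real_of_rat (\<sigma> n)\<bar> < ?r" "real_of_rat (\<sigma> n) \<noteq> 0" by (linarith, auto)
        then show ?thesis by (metis of_rat_0)
      qed
      ultimately show ?thesis by blast
    qed
    have qc: "(\<lambda>n. ?q (\<tau> n)) \<longlonglongrightarrow> ?q s" if "\<tau> \<longlonglongrightarrow> s" "s \<noteq> 0" for \<tau> s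
    proof -
      have "(\<lambda>n. f (y + \<tau> n *\<^sub>R v)) \<longlonglongrightarrow> f (y + s *\<^sub>R v)"
        by (rule continuous_on_tendsto_compose[OF c]) (intro tendsto_intros that, auto)
      then show ?thesis unfolding diff_quotient_def by (intro tendsto_intros that)
    qed
    have "\<bar>?q s - ?q t\<bar> \<le> inverse (real (Suc k))" if st: "s \<noteq> 0" "t \<noteq> 0" "\<bar>s\<bar> < ?r" "\<bar>t\<bar> < ?r" for s t :: real
    proof -
      obtain \<sigma> where \<sigma>: "(\<lambda>n. real_of_rat (\<sigma> n)) \<longlonglongrightarrow> s" "\<And>n. \<sigma> n \<noteq> 0" "\<And>n. \<bar>real_of_rat (\<sigma> n)\<bar> < ?r"
        using approx[OF st(1,3)] by blast
      obtain \<tau> where \<tau>: "(\<lambda>n. real_of_rat (\<tau> n)) \<longlonglongrightarrow> t" "\<And>n. \<tau> n \<noteq> 0" "\<And>n. \<bar>real_of_rat (\<tau> n)\<bar> < ?r"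
        using approx[OF st(2,4)] by blast
      have "(\<lambda>n. \<bar>?q (real_of_rat (\<sigma> n)) - ?q (real_of_rat (\<tau> n))\<bar>) \<longlonglongrightarrow> \<bar>?q s - ?q t\<bar>"
        by (intro tendsto_rabs tendsto_diff qc \<sigma> \<tau> st)
      then show ?thesis
        by (rule LIMSEQ_le_const2) (use m \<sigma> \<tau> in blast)
    qed
    then show ?thesis by blast
  qed
  have "Cauchy (\<lambda>n. ?q (inverse (real (Suc n))))"
  proof (rule metric_CauchyI)
    fix e :: real assume "0 < e"
    then obtain k where k: "inverse (real (Suc k)) < e" using reals_Archimedean by blast
    obtain m where m: "\<And>s t :: real. s \<noteq> 0 \<Longrightarrow> t \<noteq> 0 \<Longrightarrow> \<bar>s\<bar> < inverse (real (Suc m)) \<Longrightarrow> \<bar>t\<bar> < inverse (real (Suc m)) \<Longrightarrow>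
       \<bar>?q s - ?q t\<bar> \<le> inverse (real (Suc k))" using key[of k] by blast
    have "dist (?q (inverse (real (Suc i)))) (?q (inverse (real (Suc j)))) < e" if "i \<ge> Suc m" "j \<ge> Suc m" for i j
    proof -
      have "\<bar>inverse (real (Suc i))\<bar> < inverse (real (Suc m))" "\<bar>inverse (real (Suc j))\<bar> < inverse (real (Suc m))"
        using that by (simp_all add: field_simps)
      then show ?thesis using m[of "inverse (real (Suc i))" "inverse (real (Suc j))"] k
        unfolding dist_real_def by (simp del: of_nat_Suc)
    qed
    then show "\<exists>M. \<forall>i\<ge>M. \<forall>j\<ge>M. dist (?q (inverse (real (Suc i)))) (?q (inverse (real (Suc j)))) < e" by blast
  qed
  then have lim: "(\<lambda>n. ?q (inverse (real (Suc n)))) \<longlonglongrightarrow> dir_deriv f v y"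
    unfolding dir_deriv_def by (simp add: Cauchy_convergent_iff convergent_LIMSEQ_iff)
  show ?thesis
    unfolding tendsto_iff
  proof (intro allI impI)
    fix e :: real assume "0 < e"
    then obtain k where k: "inverse (real (Suc k)) < e" using reals_Archimedean by blast
    obtain m where m: "\<And>s t :: real. s \<noteq> 0 \<Longrightarrow> t \<noteq> 0 \<Longrightarrow> \<bar>s\<bar> < inverse (real (Suc m)) \<Longrightarrow> \<bar>t\<bar> < inverse (real (Suc m)) \<Longrightarrow>
       \<bar>?q s - ?q t\<bar> \<le> inverse (real (Suc k))" using key[of k] by blast
    have "dist (?q t) (dir_deriv f v y) < e" if t: "t \<noteq> 0" "\<bar>t\<bar> < inverse (real (Suc m))" for t
    proof -
      have "(\<lambda>n. \<bar>?q t - ?q (inverse (real (Suc n)))\<bar>) \<longlonglongrightarrow> \<bar>?q t - dir_deriv f v y\<bar>"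
        by (intro tendsto_rabs tendsto_diff tendsto_const lim)
      then have "\<bar>?q t - dir_deriv f v y\<bar> \<le> inverse (real (Suc k))"
      proof (rule LIMSEQ_le_const2)
        have "\<bar>?q t - ?q (inverse (real (Suc n)))\<bar> \<le> inverse (real (Suc k))" if "n \<ge> Suc m" for n
        proof -
          have "\<bar>inverse (real (Suc n))\<bar> < inverse (real (Suc m))" using that by (simp add: field_simps)
          then show ?thesis using m[OF t(1) _ t(2), of "inverse (real (Suc n))"] by (simp del: of_nat_Suc)
        qed
        then show "\<exists>N. \<forall>n\<ge>N. \<bar>?q t - ?q (inverse (real (Suc n)))\<bar> \<le> inverse (real (Suc k))" by blast
      qed
      then show ?thesis using k by (simp add: dist_real_def del: of_nat_Suc)
    qed
    then show "\<forall>\<^sub>F t in at 0. dist (?q t) (dir_deriv f v y) < e"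
      unfolding eventually_at by (intro exI[of _ "inverse (real (Suc m))"]) (auto simp: dist_real_def)
  qed
qed

lemma dir_deriv_measurable:
  fixes f :: "'a::euclidean_space \<Rightarrow> real"
  assumes "continuous_on UNIV f"
  shows "dir_deriv f v \<in> borel_measurable borel"
proof -
  have [measurable]: "f \<in> borel_measurable borel" using assms by (rule borel_measurable_continuous_onI)
  show ?thesis unfolding dir_deriv_def[abs_def] diff_quotient_def
    by (intro borel_measurable_lim_metric) measurable
qed

lemma Lipschitz_continuous_on:
  fixes f :: "'a::real_normed_vector \<Rightarrow> real"
  assumes L: "\<And>x y. \<bar>f x - f y\<bar> \<le> L * norm (x - y)"
  shows "continuous_on A f"
proof (rule continuous_on_subset[OF lipschitz_on_continuous_on subset_UNIV])
  show "\<bar>L\<bar>-lipschitz_on UNIV f"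
  proof (rule lipschitz_onI)
    fix x y :: 'a
    have "L * norm (x - y) \<le> \<bar>L\<bar> * norm (x - y)" by (intro mult_right_mono) auto
    then show "dist (f x) (f y) \<le> \<bar>L\<bar> * dist x y"
      using L[of x y] by (simp add: dist_norm)
  qed simp
qed

lemma diff_quotient_Cauchy_AE:
  fixes f :: "'a::euclidean_space \<Rightarrow> real"
  assumes L: "\<And>x y. \<bar>f x - f y\<bar> \<le> L * norm (x - y)"
  shows "AE y in lborel. diff_quotient_Cauchy f v y"
proof -
  have "AE y in lborel. y \<in> {y. diff_quotient_Cauchy f v y}"
  proof (rule AE_directional[of _ v])
    show "{y. diff_quotient_Cauchy f v y} \<in> sets borel"
      by (rule diff_quotient_Cauchy_borel[OF Lipschitz_continuous_on[OF L]])
    fix y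
    have "AE t in lborel. \<exists>D. ((\<lambda>t. f (y + t *\<^sub>R v)) has_real_derivative D) (at t)"
    proof (rule Lipschitz_differentiable_AE_real)
      fix s t :: real
      have "(y + s *\<^sub>R v) - (y + t *\<^sub>R v) = (s - t) *\<^sub>R v" by (simp add: scaleR_diff_left)
      then show "\<bar>f (y + s *\<^sub>R v) - f (y + t *\<^sub>R v)\<bar> \<le> (L * norm v) * \<bar>s - t\<bar>"
        using L[of "y + s *\<^sub>R v" "y + t *\<^sub>R v"] by (simp add: mult.commute mult.left_commute)
    qed
    then show "AE t in lborel. y + t *\<^sub>R v \<in> {y. diff_quotient_Cauchy f v y}"
    proof eventually_elim
      case (elim t)
      then obtain D where "((\<lambda>t. f (y + t *\<^sub>R v)) has_real_derivative D) (at t)" by blast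
      then have "((\<lambda>h. (f (y + (t + h) *\<^sub>R v) - f (y + t *\<^sub>R v)) / h) \<longlongrightarrow> D) (at 0)"
        by (simp only: DERIV_def)
      then have "((diff_quotient f v (y + t *\<^sub>R v)) \<longlongrightarrow> D) (at 0)"
        unfolding diff_quotient_def[abs_def] by (simp add: scaleR_add_left add.assoc)
      then show ?case by (simp add: diff_quotient_Cauchy_iff)
    qed
  qed
  then show ?thesis by simp
qed

lemma dir_deriv_bounded:
  fixes f :: "'a::euclidean_space \<Rightarrow> real"
  assumes L: "\<And>x y. \<bar>f x - f y\<bar> \<le> L * norm (x - y)" and C: "diff_quotient_Cauchy f v y"
  shows "\<bar>dir_deriv f v y\<bar> \<le> L * norm v"
    "(\<lambda>n. real (Suc n) * (f (y + v /\<^sub>R real (Suc n)) - f y)) \<longlonglongrightarrow> dir_deriv f v y"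
    "\<bar>real (Suc n) * (f (y + v /\<^sub>R real (Suc n)) - f y)\<bar> \<le> L * norm v"
proof -
  have b: "\<bar>real (Suc n) * (f (y + v /\<^sub>R real (Suc n)) - f y)\<bar> \<le> L * norm v" for n
  proof -
    have "\<bar>f (y + v /\<^sub>R real (Suc n)) - f y\<bar> \<le> L * norm (v /\<^sub>R real (Suc n))"
      using L[of "y + v /\<^sub>R real (Suc n)" y] by simp
    also have "\<dots> = inverse (real (Suc n)) * (L * norm v)" by (simp del: of_nat_Suc)
    finally have "real (Suc n) * \<bar>f (y + v /\<^sub>R real (Suc n)) - f y\<bar>
        \<le> real (Suc n) * (inverse (real (Suc n)) * (L * norm v))" by (intro mult_left_mono) auto
    also have "\<dots> = L * norm v" by simp
    finally show ?thesis by (simp add: abs_mult del: of_nat_Suc)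
  qed
  then show "\<bar>real (Suc n) * (f (y + v /\<^sub>R real (Suc n)) - f y)\<bar> \<le> L * norm v" .
  have "filterlim (\<lambda>n. inverse (real (Suc n))) (at 0) sequentially"
    using LIMSEQ_inverse_real_of_nat by (simp add: filterlim_at del: of_nat_Suc)
  from filterlim_compose[OF diff_quotient_Cauchy_tendsto[OF Lipschitz_continuous_on[OF L] C] this]
  show lim: "(\<lambda>n. real (Suc n) * (f (y + v /\<^sub>R real (Suc n)) - f y)) \<longlonglongrightarrow> dir_deriv f v y"
    by (simp add: diff_quotient_def divide_inverse mult.commute)
  show "\<bar>dir_deriv f v y\<bar> \<le> L * norm v"
    by (rule LIMSEQ_le_const2[OF tendsto_rabs[OF lim]]) (use b in blast)
qed

text \<open>A translation moves the difference quotient from \<open>f\<close> to the smooth factor,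
  with \<open>v\<close> replaced by \<open>- v\<close>. Both sides converge by domination, and the
  limit on the smooth side is linear in \<open>v\<close>: this is the source of linearity in
  Rademacher's theorem.\<close>

lemma dir_deriv_weak:
  fixes f \<zeta> :: "'a::euclidean_space \<Rightarrow> real"
  assumes L: "\<And>x y. \<bar>f x - f y\<bar> \<le> L * norm (x - y)"
    and \<zeta>: "smooth \<zeta>" "\<And>x. R < norm x \<Longrightarrow> \<zeta> x = 0"
  shows "integrable lborel (\<lambda>y. dir_deriv f v y * \<zeta> y)"
    "(LINT y|lborel. dir_deriv f v y * \<zeta> y) = - (\<Sum>i\<in>Basis. (v \<bullet> i) * (LINT y|lborel. partial i \<zeta> y * f y))"
proof -
  have cf: "continuous_on UNIV f" by (rule Lipschitz_continuous_on[OF L])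
  have mf: "f \<in> borel_measurable borel" using cf by (rule borel_measurable_continuous_onI)
  have m\<zeta>: "\<zeta> \<in> borel_measurable borel" using \<zeta>(1) by (rule smooth_borel_measurable)
  note md = dir_deriv_measurable[OF cf, of v]
  obtain B where B: "B \<ge> 0" "\<And>x. \<bar>\<zeta> x\<bar> \<le> B" using smooth_compact_support_bounded[where R=R, OF \<zeta>] by auto
  have L0: "0 \<le> L * norm v"
    using L[of v 0] by simp
  note AE = diff_quotient_Cauchy_AE[of f L v, OF L]
  let ?w = "\<lambda>y. indicator (cball 0 R) y * (L * norm v * B) :: real"
  have iw: "integrable lborel ?w"
    by (intro integrable_mult_left integrable_real_indicator emeasure_bounded_finite) auto
  have bd: "norm (a * \<zeta> y) \<le> ?w y" if "\<bar>a\<bar> \<le> L * norm v" for a y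
  proof (cases "R < norm y")
    case True
    then show ?thesis using \<zeta>(2)[OF True] by simp
  next
    case False
    then show ?thesis using mult_mono[OF that B(2)[of y] L0 abs_ge_zero] by (simp add: abs_mult)
  qed
  have mq: "(\<lambda>y. real (Suc n) * (f (y + v /\<^sub>R real (Suc n)) - f y) * \<zeta> y) \<in> borel_measurable borel" for n
    using cf smooth_continuous_on[OF \<zeta>(1), of UNIV]
    by (intro borel_measurable_continuous_onI continuous_intros continuous_on_compose2[OF cf]) auto
  show "integrable lborel (\<lambda>y. dir_deriv f v y * \<zeta> y)"
  proof (rule Bochner_Integration.integrable_bound[OF iw])
    show "(\<lambda>y. dir_deriv f v y * \<zeta> y) \<in> borel_measurable lborel" using md m\<zeta> by simp
    show "AE y in lborel. norm (dir_deriv f v y * \<zeta> y) \<le> norm (?w y)"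
      using AE
    proof eventually_elim
      case (elim y)
      show ?case using bd[OF dir_deriv_bounded(1)[OF L elim], of y]
        by (rule order_trans) (simp only: real_norm_def abs_ge_self)
    qed
  qed
  have 1: "(\<lambda>n. LINT y|lborel. real (Suc n) * (f (y + v /\<^sub>R real (Suc n)) - f y) * \<zeta> y)
      \<longlonglongrightarrow> (LINT y|lborel. dir_deriv f v y * \<zeta> y)"
  proof (rule integral_dominated_convergence[where w="?w"])
    show "AE y in lborel. (\<lambda>n. real (Suc n) * (f (y + v /\<^sub>R real (Suc n)) - f y) * \<zeta> y)
        \<longlonglongrightarrow> dir_deriv f v y * \<zeta> y"
      using AE by eventually_elim (intro tendsto_mult tendsto_const dir_deriv_bounded(2)[OF L])
    show "AE y in lborel. norm (real (Suc n) * (f (y + v /\<^sub>R real (Suc n)) - f y) * \<zeta> y) \<le> ?w y" for n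
      using AE by eventually_elim (intro bd dir_deriv_bounded(3)[OF L])
  qed (use iw md m\<zeta> mq in simp_all)
  define M where "M = \<bar>f 0\<bar> + \<bar>L\<bar> * (R + norm v)"
  have fM: "\<bar>f x\<bar> \<le> M" if "norm x \<le> R + norm v" for x
  proof -
    have "L * norm x \<le> \<bar>L\<bar> * (R + norm v)" using that by (intro mult_mono) auto
    then show ?thesis using L[of x 0] unfolding M_def by simp
  qed
  have 2: "(\<lambda>n. LINT x|lborel. real (Suc n) * (\<zeta> (x + (- v) /\<^sub>R real (Suc n)) - \<zeta> x) * f x)
    \<longlonglongrightarrow> (LINT x|lborel. (\<Sum>i\<in>Basis. ((- v) \<bullet> i) * partial i \<zeta> x) * f x)"
    by (rule difference_quotient_integral_tendsto[where R=R and M=M, OF \<zeta> mf]) (use fM in simp_all)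
  have int: "integrable lborel (\<lambda>x. g x * h x)"
    if g: "continuous_on UNIV g" and h: "continuous_on UNIV h" "\<And>x. R' < norm x \<Longrightarrow> h x = 0" for g h :: "'a \<Rightarrow> real" and R'
  proof -
    have "continuous_on (cball 0 R') (\<lambda>x. g x * h x)"
      by (intro continuous_intros continuous_on_subset[OF g] continuous_on_subset[OF h(1)]) auto
    then have "integrable lborel (\<lambda>x. indicator (cball 0 R') x *\<^sub>R (g x * h x))"
      by (rule borel_integrable_compact[OF compact_cball])
    moreover have "(\<lambda>x. indicator (cball 0 R') x *\<^sub>R (g x * h x)) = (\<lambda>x. g x * h x)"
      using h(2) by (auto simp: indicator_def not_le fun_eq_iff)
    ultimately show ?thesis by simp
  qed
  have c\<zeta>: "continuous_on UNIV \<zeta>" using \<zeta>(1) by (rule smooth_continuous_on)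
  have eq: "(LINT y|lborel. real (Suc n) * (f (y + v /\<^sub>R real (Suc n)) - f y) * \<zeta> y) =
      (LINT x|lborel. real (Suc n) * (\<zeta> (x + (- v) /\<^sub>R real (Suc n)) - \<zeta> x) * f x)" for n
  proof -
    let ?u = "v /\<^sub>R real (Suc n)"
    have nu: "norm ?u \<le> norm v" by (auto simp: field_simps mult_le_cancel_left1)
    have z: "\<zeta> (x - ?u) = 0" if "R + norm v < norm x" for x
    proof (rule \<zeta>(2))
      show "R < norm (x - ?u)" using norm_triangle_ineq2[of x ?u] nu that by linarith
    qed
    have cs: "continuous_on UNIV (\<lambda>x. \<zeta> (x - ?u))" "continuous_on UNIV (\<lambda>x. f (x + ?u))"
      by (intro continuous_on_compose2[OF c\<zeta>] continuous_on_compose2[OF cf] continuous_intros; simp)+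
    have i1: "integrable lborel (\<lambda>x. f (x + ?u) * \<zeta> x)" by (rule int[OF cs(2) c\<zeta> \<zeta>(2)])
    have i2: "integrable lborel (\<lambda>x. f x * \<zeta> x)" by (rule int[OF cf c\<zeta> \<zeta>(2)])
    have i3: "integrable lborel (\<lambda>x. f x * \<zeta> (x - ?u))" by (rule int[OF cf cs(1) z])
    have "(LINT y|lborel. f (y + ?u) * \<zeta> y) = (LINT y|lborel. f (y + ?u) * \<zeta> ((y + ?u) - ?u))" by simp
    also have "\<dots> = (LINT x|lborel. f x * \<zeta> (x - ?u))"
      by (rule integral_translate_lborel[of "\<lambda>x. f x * \<zeta> (x - ?u)"])
        (intro borel_measurable_times mf borel_measurable_continuous_onI cs)
    finally have t: "(LINT y|lborel. f (y + ?u) * \<zeta> y) = (LINT x|lborel. f x * \<zeta> (x - ?u))" .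
    have "(LINT y|lborel. real (Suc n) * (f (y + ?u) - f y) * \<zeta> y) =
        (LINT y|lborel. real (Suc n) * (f (y + ?u) * \<zeta> y - f y * \<zeta> y))"
      by (intro Bochner_Integration.integral_cong refl) (simp add: algebra_simps)
    also have "\<dots> = real (Suc n) * ((LINT y|lborel. f (y + ?u) * \<zeta> y) - (LINT y|lborel. f y * \<zeta> y))"
      using i1 i2 by simp
    also have "\<dots> = real (Suc n) * ((LINT y|lborel. f y * \<zeta> (y - ?u)) - (LINT y|lborel. f y * \<zeta> y))"
      by (simp only: t)
    also have "\<dots> = (LINT y|lborel. real (Suc n) * (f y * \<zeta> (y - ?u) - f y * \<zeta> y))"
      using i3 i2 by simp
    also have "\<dots> = (LINT x|lborel. real (Suc n) * (\<zeta> (x + (- v) /\<^sub>R real (Suc n)) - \<zeta> x) * f x)"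
      by (intro Bochner_Integration.integral_cong refl) (simp add: algebra_simps)
    finally show ?thesis .
  qed
  have "(LINT y|lborel. dir_deriv f v y * \<zeta> y) = (LINT x|lborel. (\<Sum>i\<in>Basis. ((- v) \<bullet> i) * partial i \<zeta> x) * f x)"
    using 1 2 unfolding eq by (rule LIMSEQ_unique)
  also have "\<dots> = (LINT x|lborel. (\<Sum>i\<in>Basis. ((- v) \<bullet> i) * (partial i \<zeta> x * f x)))"
    by (simp only: sum_distrib_right mult.assoc)
  also have "\<dots> = (\<Sum>i\<in>Basis. (LINT x|lborel. ((- v) \<bullet> i) * (partial i \<zeta> x * f x)))"
  proof (rule Bochner_Integration.integral_sum)
    fix i :: 'a assume i: "i \<in> Basis"
    have "integrable lborel (\<lambda>x. f x * partial i \<zeta> x)"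
      by (rule int[OF cf smooth_continuous_on[OF smooth_partial[OF \<zeta>(1) i]] partial_eq_0_outside[where R=R, OF \<zeta>(2)]])
    then show "integrable lborel (\<lambda>x. ((- v) \<bullet> i) * (partial i \<zeta> x * f x))" by (simp add: mult.commute)
  qed
  also have "\<dots> = - (\<Sum>i\<in>Basis. (v \<bullet> i) * (LINT y|lborel. partial i \<zeta> y * f y))"
    by (simp add: sum_negf)
  finally show "(LINT y|lborel. dir_deriv f v y * \<zeta> y) =
      - (\<Sum>i\<in>Basis. (v \<bullet> i) * (LINT y|lborel. partial i \<zeta> y * f y))" .
qed

text \<open>Difference quotients are linear in the direction when tested against smooth functions.\<close>

lemma dir_deriv_linear_AE:
  fixes f :: "'a::euclidean_space \<Rightarrow> real"
  assumes L: "\<And>x y. \<bar>f x - f y\<bar> \<le> L * norm (x - y)"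
  shows "AE y in lborel. dir_deriv f v y = (\<Sum>i\<in>Basis. (v \<bullet> i) * dir_deriv f i y)"
proof -
  have cf: "continuous_on UNIV f" by (rule Lipschitz_continuous_on[OF L])
  define g where "g y = dir_deriv f v y - (\<Sum>i\<in>Basis. (v \<bullet> i) * dir_deriv f i y)" for y
  have mg: "g \<in> borel_measurable borel"
    unfolding g_def by (intro borel_measurable_diff borel_measurable_sum borel_measurable_times
        borel_measurable_const dir_deriv_measurable[OF cf])
  have Z: "AE y in lebesgue_on (ball 0 R). g y = 0" for R
  proof (rule fundamental_lemma)
    show "open (ball 0 R)" by simp
    have AE1: "AE y in lborel. \<bar>dir_deriv f w y\<bar> \<le> L * norm w" for w
      using diff_quotient_Cauchy_AE[of f L w, OF L] by eventually_elim (rule dir_deriv_bounded(1)[OF L])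
    have "AE y in lborel. \<forall>i\<in>Basis. \<bar>dir_deriv f i y\<bar> \<le> L * norm i"
      by (intro AE_finite_allI AE1 finite_Basis)
    with AE1[of v] have "AE y in lborel. \<bar>g y\<bar> \<le> L * norm v + (\<Sum>i\<in>Basis. \<bar>v \<bullet> i\<bar> * (L * norm i))"
    proof eventually_elim
      case (elim y)
      have "\<bar>\<Sum>i\<in>Basis. (v \<bullet> i) * dir_deriv f i y\<bar> \<le> (\<Sum>i\<in>Basis. \<bar>v \<bullet> i\<bar> * (L * norm i))"
        using elim(2) by (intro order_trans[OF sum_abs] sum_mono) (simp add: abs_mult mult_left_mono)
      then show ?case using elim(1) unfolding g_def by linarith
    qed
    then obtain K where K: "AE y in lborel. \<bar>g y\<bar> \<le> K" by blast
    have "AE y in lebesgue_on (ball 0 R). norm (g y) \<le> norm K"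
    proof -
      have "AE y in lebesgue. \<bar>g y\<bar> \<le> K" using K by (rule AE_completion)
      then have "AE y in lebesgue. y \<in> ball 0 R \<longrightarrow> norm (g y) \<le> norm K" by eventually_elim simp
      then show ?thesis by (subst AE_lebesgue_on_iff) auto
    qed
    moreover have "integrable (lebesgue_on (ball (0::'a) R)) (\<lambda>y. K)"
    proof -
      interpret finite_measure "lebesgue_on (ball (0::'a) R)" by (rule finite_measure_lebesgue_on) simp
      show ?thesis by simp
    qed
    ultimately show "integrable (lebesgue_on (ball 0 R)) g"
      by (intro Bochner_Integration.integrable_bound[of _ "\<lambda>y. K" g] lebesgue_on_measurable mg)
    fix \<phi> :: "'a \<Rightarrow> real" assume \<phi>: "\<phi> \<in> test_functions (ball 0 R)"
    note sm = test_functions_compact_support(1)[OF \<phi>]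
    have z: "\<phi> x = 0" if "R < norm x" for x
      by (rule test_functions_compact_support(3)[OF \<phi>]) (use that in simp)
    note W = dir_deriv_weak[OF L sm z]
    have "(LINT y|lebesgue_on (ball 0 R). g y * \<phi> y) = (LINT y|lborel. g y * \<phi> y)"
    proof (rule integral_lebesgue_on_eq_lborel)
      show "(\<lambda>y. g y * \<phi> y) \<in> borel_measurable borel"
        by (intro borel_measurable_times mg smooth_borel_measurable sm)
    qed (use test_functions_compact_support(3)[OF \<phi>] in auto)
    also have "\<dots> = (LINT y|lborel. dir_deriv f v y * \<phi> y - (\<Sum>i\<in>Basis. (v \<bullet> i) * (dir_deriv f i y * \<phi> y)))"
      by (simp only: g_def left_diff_distrib sum_distrib_right mult.assoc)
    also have "\<dots> = (LINT y|lborel. dir_deriv f v y * \<phi> y) - (LINT y|lborel. (\<Sum>i\<in>Basis. (v \<bullet> i) * (dir_deriv f i y * \<phi> y)))"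
      by (intro Bochner_Integration.integral_diff W Bochner_Integration.integrable_sum integrable_mult_right)
    also have "(LINT y|lborel. (\<Sum>i\<in>Basis. (v \<bullet> i) * (dir_deriv f i y * \<phi> y))) =
        (\<Sum>i\<in>Basis. (LINT y|lborel. (v \<bullet> i) * (dir_deriv f i y * \<phi> y)))"
      by (intro Bochner_Integration.integral_sum integrable_mult_right W)
    also have "\<dots> = (\<Sum>i\<in>Basis. (v \<bullet> i) * - (LINT y|lborel. partial i \<phi> y * f y))"
      by (intro sum.cong refl) (simp add: W(2) sum_inner_Basis)
    finally show "(LINT y|lebesgue_on (ball 0 R). g y * \<phi> y) = 0"
      by (simp add: W(2) sum_negf)
  qed
  have "AE y in lebesgue. \<forall>n::nat. y \<in> ball 0 (real n) \<longrightarrow> g y = 0"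
    unfolding AE_all_countable using Z by (subst (asm) AE_lebesgue_on_iff) auto
  then have "AE y in lebesgue. g y = 0"
  proof eventually_elim
    case (elim y)
    obtain n where "norm y < real n" using reals_Archimedean2 by blast
    then show ?case using elim by auto
  qed
  then show ?thesis unfolding AE_completion_iff by eventually_elim (simp add: g_def)
qed

text \<open>At almost every point the derivatives in all directions of a countable dense set exist
  at once and depend linearly on the direction. Finitely many of these directions come within \<eta>
  of every unit vector, and the Lipschitz bound transfers the expansion to all of them
  uniformly.\<close>

theorem Rademacher:
  fixes f :: "'a::euclidean_space \<Rightarrow> real"
  assumes L: "\<And>x y. \<bar>f x - f y\<bar> \<le> L * norm (x - y)"
  shows "AE y in lborel. (f has_derivative (\<lambda>h. h \<bullet> (\<Sum>i\<in>Basis. dir_deriv f i y *\<^sub>R i))) (at y)"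
proof -
  have cf: "continuous_on UNIV f" by (rule Lipschitz_continuous_on[OF L])
  obtain Q :: "'a set" where Q: "countable Q" "\<And>X. open X \<Longrightarrow> X \<noteq> {} \<Longrightarrow> \<exists>d\<in>Q. d \<in> X"
    using countable_dense_exists by blast
  have "AE y in lborel. \<forall>v\<in>Q. diff_quotient_Cauchy f v y \<and> dir_deriv f v y = (\<Sum>i\<in>Basis. (v \<bullet> i) * dir_deriv f i y)"
  proof (intro AE_ball_countable[THEN iffD2] ballI Q(1))
    fix v
    show "AE y in lborel. diff_quotient_Cauchy f v y \<and> dir_deriv f v y = (\<Sum>i\<in>Basis. (v \<bullet> i) * dir_deriv f i y)"
      using diff_quotient_Cauchy_AE[of f L v, OF L] dir_deriv_linear_AE[of f L v, OF L] by eventually_elim blast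
  qed
  then show ?thesis
  proof eventually_elim
    case (elim y)
    define g where "g = (\<Sum>i\<in>Basis. dir_deriv f i y *\<^sub>R i)"
    have vg: "v \<bullet> g = (\<Sum>i\<in>Basis. (v \<bullet> i) * dir_deriv f i y)" for v
      unfolding g_def by (simp add: inner_sum_right mult.commute)
    have dq: "((diff_quotient f v y) \<longlongrightarrow> v \<bullet> g) (at 0)" if "v \<in> Q" for v
      using diff_quotient_Cauchy_tendsto[OF cf, of v y] elim[rule_format, OF that] by (simp add: vg)
    have L0: "L \<ge> 0"
    proof -
      obtain b :: 'a where "b \<in> Basis" using nonempty_Basis by blast
      then show ?thesis using L[of b 0] by simp
    qed
    have "(f has_derivative (\<lambda>h. h \<bullet> g)) (at y)"
      unfolding has_derivative_at_alt
    proof (intro conjI allI impI)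
      show "bounded_linear (\<lambda>h. h \<bullet> g)" by (rule bounded_linear_inner_left)
      fix e :: real assume e: "0 < e"
      \<comment> \<open>Replacing a unit direction by one at distance below \<eta> costs L \<eta> in
        the increment of \<open>f\<close> and |g| \<eta> in the linear term, together at most
        e/2.\<close>
      define \<eta> where "\<eta> = e / (2 * (L + norm g + 1))"
      have pos: "L + norm g + 1 > 0" using L0 by (simp add: add_nonneg_pos)
      then have \<eta>: "\<eta> > 0" "(L + norm g) * \<eta> \<le> e / 2"
        using e L0 by (simp_all add: \<eta>_def field_simps)
      have "compact (sphere (0::'a) 1)" by simp
      moreover have "sphere (0::'a) 1 \<subseteq> (\<Union>v\<in>Q. ball v \<eta>)"
      proof
        fix u :: 'a
        obtain v where "v \<in> Q" "v \<in> ball u \<eta>" using Q(2)[of "ball u \<eta>"] \<eta> by auto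
        then show "u \<in> (\<Union>v\<in>Q. ball v \<eta>)" by (auto simp: dist_commute)
      qed
      ultimately obtain F where F: "F \<subseteq> Q" "finite F" "sphere (0::'a) 1 \<subseteq> (\<Union>v\<in>F. ball v \<eta>)"
        using compactE_image[of "sphere (0::'a) 1" Q "\<lambda>v. ball v \<eta>"] by (metis open_ball)
      have "\<exists>d>0. \<forall>t. 0 < t \<longrightarrow> t < d \<longrightarrow> \<bar>f (y + t *\<^sub>R v) - f y - t * (v \<bullet> g)\<bar> \<le> e / 2 * t" if "v \<in> F" for v
      proof -
        have "v \<in> Q" using that F by auto
        from dq[OF this, unfolded tendsto_iff eventually_at dist_real_def, rule_format, of "e / 2"] e
        obtain d where d: "d > 0" "\<And>t. t \<noteq> 0 \<Longrightarrow> \<bar>t\<bar> < d \<Longrightarrow> \<bar>diff_quotient f v y t - v \<bullet> g\<bar> < e / 2" by auto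
        have "\<bar>f (y + t *\<^sub>R v) - f y - t * (v \<bullet> g)\<bar> \<le> e / 2 * t" if t: "0 < t" "t < d" for t
        proof -
          have "f (y + t *\<^sub>R v) - f y - t * (v \<bullet> g) = t * (diff_quotient f v y t - v \<bullet> g)"
          proof -
            have "t * diff_quotient f v y t = f (y + t *\<^sub>R v) - f y"
              using t by (simp add: diff_quotient_def)
            then show ?thesis by (simp only: right_diff_distrib)
          qed
          then have "\<bar>f (y + t *\<^sub>R v) - f y - t * (v \<bullet> g)\<bar> = t * \<bar>diff_quotient f v y t - v \<bullet> g\<bar>"
            using t by (simp add: abs_mult)
          also have "\<dots> \<le> t * (e / 2)" using d(2)[of t] t by (intro mult_left_mono) auto
          finally show ?thesis by (simp add: mult.commute)
        qed
        then show ?thesis using d(1) by blast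
      qed
      then obtain d where d: "\<And>v. v \<in> F \<Longrightarrow> d v > 0"
        "\<And>v t. v \<in> F \<Longrightarrow> 0 < t \<Longrightarrow> t < d v \<Longrightarrow> \<bar>f (y + t *\<^sub>R v) - f y - t * (v \<bullet> g)\<bar> \<le> e / 2 * t" by metis
      define \<delta> where "\<delta> = Min (insert 1 (d ` F))"
      have \<delta>: "\<delta> > 0" "\<And>v. v \<in> F \<Longrightarrow> \<delta> \<le> d v" unfolding \<delta>_def using F(2) d(1) by auto
      have "norm (f z - f y - (z - y) \<bullet> g) \<le> e * norm (z - y)" if z: "norm (z - y) < \<delta>" for z
      proof (cases "z = y")
        case False
        define t where "t = norm (z - y)"
        define u where "u = (z - y) /\<^sub>R t"
        have t: "t > 0" "t < \<delta>" using False z by (simp_all add: t_def)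
        have u: "norm u = 1" "z = y + t *\<^sub>R u" using t False by (simp_all add: u_def t_def)
        then obtain v where v: "v \<in> F" "norm (u - v) < \<eta>" using F(3) by (force simp: dist_norm norm_minus_commute)
        have "\<bar>f (y + t *\<^sub>R u) - f (y + t *\<^sub>R v)\<bar> \<le> L * (t * \<eta>)"
        proof -
          have "(y + t *\<^sub>R u) - (y + t *\<^sub>R v) = t *\<^sub>R (u - v)" by (simp add: scaleR_diff_right)
          then have "\<bar>f (y + t *\<^sub>R u) - f (y + t *\<^sub>R v)\<bar> \<le> L * (t * norm (u - v))"
            using L[of "y + t *\<^sub>R u" "y + t *\<^sub>R v"] t by simp
          also have "\<dots> \<le> L * (t * \<eta>)" using v t L0 by (intro mult_left_mono) auto
          finally show ?thesis .
        qed
        moreover have "\<bar>t * (v \<bullet> g) - t * (u \<bullet> g)\<bar> \<le> norm g * (t * \<eta>)"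
        proof -
          have "\<bar>t * (v \<bullet> g) - t * (u \<bullet> g)\<bar> = t * \<bar>(v - u) \<bullet> g\<bar>"
            using t by (simp add: inner_diff_left right_diff_distrib[symmetric] abs_mult)
          also have "\<dots> \<le> t * (norm (v - u) * norm g)"
            using t by (intro mult_left_mono Cauchy_Schwarz_ineq2) auto
          also have "\<dots> \<le> t * (\<eta> * norm g)"
            using t v by (intro mult_left_mono mult_right_mono) (auto simp: norm_minus_commute)
          finally show ?thesis by (simp add: mult_ac)
        qed
        moreover have "\<bar>f (y + t *\<^sub>R v) - f y - t * (v \<bullet> g)\<bar> \<le> e / 2 * t"
          using d(2)[OF v(1) t(1)] \<delta>(2)[OF v(1)] t by simp
        ultimately have "\<bar>f (y + t *\<^sub>R u) - f y - t * (u \<bullet> g)\<bar> \<le> L * (t * \<eta>) + norm g * (t * \<eta>) + e / 2 * t"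
          by arith
        also have "\<dots> = e / 2 * t + (L + norm g) * \<eta> * t" by (simp add: algebra_simps)
        finally have "\<bar>f (y + t *\<^sub>R u) - f y - t * (u \<bullet> g)\<bar> \<le> e / 2 * t + (L + norm g) * \<eta> * t" .
        also have "\<dots> \<le> e / 2 * t + e / 2 * t"
          using \<eta>(2) t by (intro add_left_mono mult_right_mono) auto
        also have "\<dots> = e * t" by simp
        finally show ?thesis using u(2) unfolding t_def[symmetric] by simp
      qed simp
      then show "\<exists>d>0. \<forall>z. norm (z - y) < d \<longrightarrow> norm (f z - f y - (z - y) \<bullet> g) \<le> e * norm (z - y)"
        using \<delta>(1) by blast
    qed
    then show ?case by (simp only: g_def)
  qed
qed

section \<open>The divergence theorem below a Lipschitz graph\<close>

lemma integrable_bounded_support: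
  fixes g :: "'a::euclidean_space \<Rightarrow> real"
  assumes "g \<in> borel_measurable borel" "\<And>x. \<bar>g x\<bar> \<le> M" "\<And>x. R < norm x \<Longrightarrow> g x = 0"
  shows "integrable lborel g"
proof (rule Bochner_Integration.integrable_bound)
  show "integrable lborel (\<lambda>x. indicator (cball 0 R) x * M :: real)"
    by (intro integrable_mult_left integrable_real_indicator emeasure_bounded_finite) auto
  show "AE x in lborel. norm (g x) \<le> norm (indicator (cball 0 R) x * M :: real)"
  proof (rule AE_I2)
    fix x
    show "norm (g x) \<le> norm (indicator (cball 0 R) x * M :: real)"
      using assms(2)[of x] assms(3)[of x] by (cases "R < norm x") auto
  qed
qed (use assms(1) in simp)

section \<open>Integration along the lines parallel to a unit vector\<close>

locale unit_direction =
  fixes e :: "'a::euclidean_space"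
  assumes norm_e: "norm e = 1"
begin

definition proj :: "'a \<Rightarrow> 'a" where
  "proj y = y - (y \<bullet> e) *\<^sub>R e"

text \<open>Every line parallel to \<open>e\<close> meets the slab in a unit interval. Hence Lebesgue measure on the slab
  replaces the measure on the hyperplane orthogonal to \<open>e\<close>, and no coordinates have to be chosen.\<close>

definition slab :: "'a set" where
  "slab = {y. 0 < y \<bullet> e \<and> y \<bullet> e < 1}"

lemma ee: "e \<bullet> e = 1"
  using norm_e by (simp add: norm_eq_1)

lemma proj_add: "proj (y + s *\<^sub>R e) = proj y"
  by (simp add: proj_def inner_add_left ee algebra_simps)

lemma proj_inner: "proj y \<bullet> e = 0"
  by (simp add: proj_def inner_diff_left ee)

lemma proj_decomp: "y = proj y + (y \<bullet> e) *\<^sub>R e"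
  by (simp add: proj_def)

lemma norm_proj_le: "norm (proj y) \<le> norm (proj y + s *\<^sub>R e)"
proof -
  have "(norm (proj y + s *\<^sub>R e))\<^sup>2 = (norm (proj y))\<^sup>2 + s\<^sup>2"
    unfolding power2_norm_eq_inner
    by (simp add: inner_add_left inner_add_right inner_commute[of e "proj y"] proj_inner ee power2_eq_square)
  then have "(norm (proj y))\<^sup>2 \<le> (norm (proj y + s *\<^sub>R e))\<^sup>2" by simp
  then show ?thesis by (rule power2_le_imp_le) simp
qed

lemma norm_proj_le': "norm (proj y) \<le> norm y"
  using norm_proj_le[of y "y \<bullet> e"] proj_decomp[of y] by simp

lemma proj_diff: "proj x - proj y = proj (x - y)"
  by (simp add: proj_def inner_diff_left algebra_simps)

lemma proj_continuous: "continuous_on A proj"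
  unfolding proj_def[abs_def] by (intro continuous_intros)

lemma slab_borel: "slab \<in> sets borel"
proof -
  have "open slab" unfolding slab_def
    by (intro open_Collect_conj open_Collect_less continuous_intros)
  then show ?thesis by simp
qed

lemma slab_section: "(LINT s|lborel. indicator slab (y - s *\<^sub>R e)) = (1::real)"
proof -
  have "(\<lambda>s. indicator slab (y - s *\<^sub>R e)) = (indicator {y \<bullet> e - 1<..<y \<bullet> e} :: real \<Rightarrow> real)"
    by (auto simp: indicator_def slab_def inner_diff_left ee fun_eq_iff)
  then show ?thesis by simp
qed

text \<open>Shifting s by y . e turns the integrand into g(y + s e). For fixed s a translation of y
  moves this shift onto the indicator of the slab, whose section along every line has length
  1.\<close>

lemma slice_integral:
  fixes g :: "'a \<Rightarrow> real"
  assumes g: "g \<in> borel_measurable borel" "\<And>x. \<bar>g x\<bar> \<le> M" "\<And>x. R < norm x \<Longrightarrow> g x = 0"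
  shows "(LINT y|lborel. indicator slab y * (LINT s|lborel. g (proj y + s *\<^sub>R e))) = (LINT y|lborel. g y)"
proof -
  have M: "0 \<le> M" using g(2)[of 0] by simp
  have islab: "(indicator slab :: 'a \<Rightarrow> real) \<in> borel_measurable borel" using slab_borel by simp
  have int1: "integrable (lborel \<Otimes>\<^sub>M lborel) (\<lambda>(s, y). indicator slab y * g (y + s *\<^sub>R e))"
    unfolding lborel_prod
  \<comment> \<open>On the support |y + s e| \<le> |R| and 0 < y . e < 1, hence |s| \<le> |R| + 1
    and |y| \<le> 2 |R| + 1.\<close>
  proof (rule integrable_bounded_support[where R="(2 * \<bar>R\<bar> + 2) + (\<bar>R\<bar> + 1)" and M=M])
    have "(\<lambda>z. snd z + fst z *\<^sub>R e) \<in> borel_measurable (borel :: (real \<times> 'a) measure)"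
      by (intro borel_measurable_continuous_onI continuous_intros)
    from measurable_compose[OF this g(1)]
    have 1: "(\<lambda>z. g (snd z + fst z *\<^sub>R e)) \<in> borel_measurable (borel :: (real \<times> 'a) measure)" .
    have "snd \<in> borel_measurable (borel :: (real \<times> 'a) measure)"
      by (intro borel_measurable_continuous_onI continuous_intros)
    from measurable_compose[OF this islab]
    have 2: "(\<lambda>z. indicator slab (snd z) :: real) \<in> borel_measurable (borel :: (real \<times> 'a) measure)" .
    from borel_measurable_times[OF 2 1]
    show "(\<lambda>(s, y). indicator slab y * g (y + s *\<^sub>R e)) \<in> borel_measurable borel"
      by (simp add: case_prod_unfold)
    show "\<bar>case z of (s, y) \<Rightarrow> indicator slab y * g (y + s *\<^sub>R e)\<bar> \<le> M" for z
      using g(2) M by (auto simp: case_prod_unfold indicator_def abs_mult)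
    fix z :: "real \<times> 'a"
    assume z: "(2 * \<bar>R\<bar> + 2) + (\<bar>R\<bar> + 1) < norm z"
    obtain s y where sy: "z = (s, y)" by (cases z)
    show "(case z of (s, y) \<Rightarrow> indicator slab y * g (y + s *\<^sub>R e)) = 0"
    proof (rule ccontr)
      assume "(case z of (s, y) \<Rightarrow> indicator slab y * g (y + s *\<^sub>R e)) \<noteq> 0"
      then have "y \<in> slab" "g (y + s *\<^sub>R e) \<noteq> 0" unfolding sy by (auto simp: indicator_def split: if_splits)
      then have n: "norm (y + s *\<^sub>R e) \<le> \<bar>R\<bar>" using g(3)[of "y + s *\<^sub>R e"] by (metis abs_ge_self not_less order_trans)
      have "\<bar>(y + s *\<^sub>R e) \<bullet> e\<bar> \<le> norm (y + s *\<^sub>R e) * norm e" by (rule Cauchy_Schwarz_ineq2)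
      then have "\<bar>y \<bullet> e + s\<bar> \<le> \<bar>R\<bar>" using n by (simp add: inner_add_left ee norm_e)
      then have s: "\<bar>s\<bar> \<le> \<bar>R\<bar> + 1" using \<open>y \<in> slab\<close> by (auto simp: slab_def)
      have "norm y \<le> norm (y + s *\<^sub>R e) + norm (s *\<^sub>R e)"
        using norm_triangle_ineq4[of "y + s *\<^sub>R e" "s *\<^sub>R e"] by simp
      then have "norm y \<le> 2 * \<bar>R\<bar> + 1" using n s by (simp add: norm_e)
      moreover have "norm z \<le> norm s + norm y" unfolding sy by (rule norm_Pair_le)
      ultimately show False using z s by simp
    qed
  qed
  have int2: "integrable (lborel \<Otimes>\<^sub>M lborel) (\<lambda>(s, y). indicator slab (y - s *\<^sub>R e) * g y)"
    unfolding lborel_prod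
  proof (rule integrable_bounded_support[where R="\<bar>R\<bar> + (\<bar>R\<bar> + 1)" and M=M])
    have "(\<lambda>z. snd z - fst z *\<^sub>R e) \<in> borel_measurable (borel :: (real \<times> 'a) measure)"
      by (intro borel_measurable_continuous_onI continuous_intros)
    from measurable_compose[OF this islab]
    have 1: "(\<lambda>z. indicator slab (snd z - fst z *\<^sub>R e) :: real) \<in> borel_measurable (borel :: (real \<times> 'a) measure)" .
    have "snd \<in> borel_measurable (borel :: (real \<times> 'a) measure)"
      by (intro borel_measurable_continuous_onI continuous_intros)
    from measurable_compose[OF this g(1)]
    have 2: "(\<lambda>z. g (snd z)) \<in> borel_measurable (borel :: (real \<times> 'a) measure)" .
    from borel_measurable_times[OF 1 2]
    show "(\<lambda>(s, y). indicator slab (y - s *\<^sub>R e) * g y) \<in> borel_measurable borel"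
      by (simp add: case_prod_unfold)
    show "\<bar>case z of (s, y) \<Rightarrow> indicator slab (y - s *\<^sub>R e) * g y\<bar> \<le> M" for z
      using g(2) M by (auto simp: case_prod_unfold indicator_def abs_mult)
    fix z :: "real \<times> 'a"
    assume z: "\<bar>R\<bar> + (\<bar>R\<bar> + 1) < norm z"
    obtain s y where sy: "z = (s, y)" by (cases z)
    show "(case z of (s, y) \<Rightarrow> indicator slab (y - s *\<^sub>R e) * g y) = 0"
    proof (rule ccontr)
      assume "(case z of (s, y) \<Rightarrow> indicator slab (y - s *\<^sub>R e) * g y) \<noteq> 0"
      then have sl: "y - s *\<^sub>R e \<in> slab" "g y \<noteq> 0" unfolding sy by (auto simp: indicator_def split: if_splits)
      then have n: "norm y \<le> \<bar>R\<bar>" using g(3)[of y] by (metis abs_ge_self not_less order_trans)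
      have "\<bar>y \<bullet> e\<bar> \<le> norm y * norm e" by (rule Cauchy_Schwarz_ineq2)
      then have "\<bar>y \<bullet> e\<bar> \<le> \<bar>R\<bar>" using n by (simp add: norm_e)
      then have s: "\<bar>s\<bar> \<le> \<bar>R\<bar> + 1" using sl(1) by (auto simp: slab_def inner_diff_left ee)
      moreover have "norm z \<le> norm s + norm y" unfolding sy by (rule norm_Pair_le)
      ultimately show False using z n by simp
    qed
  qed
  have shift: "(LINT s|lborel. g (proj y + s *\<^sub>R e)) = (LINT s|lborel. g (y + s *\<^sub>R e))" for y
  proof -
    have "(\<lambda>s. proj y + s *\<^sub>R e) \<in> borel_measurable borel"
      by (intro borel_measurable_continuous_onI continuous_intros)
    from integral_translate_lborel[OF measurable_compose[OF this g(1)], of "y \<bullet> e"]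
    show ?thesis by (simp add: proj_def algebra_simps)
  qed
  have "(LINT y|lborel. indicator slab y * (LINT s|lborel. g (proj y + s *\<^sub>R e))) =
      (LINT y|lborel. LINT s|lborel. indicator slab y * g (y + s *\<^sub>R e))"
    by (simp only: shift integral_mult_right_zero)
  also have "\<dots> = (LINT s|lborel. LINT y|lborel. indicator slab y * g (y + s *\<^sub>R e))"
    by (rule lborel_pair.Fubini_integral[OF int1])
  also have "\<dots> = (LINT s|lborel. LINT y|lborel. indicator slab (y - s *\<^sub>R e) * g y)"
  proof (rule Bochner_Integration.integral_cong[OF refl])
    fix s :: real
    have "(\<lambda>y. y - s *\<^sub>R e) \<in> borel_measurable borel"
      by (intro borel_measurable_continuous_onI continuous_intros)
    from borel_measurable_times[OF measurable_compose[OF this islab] g(1)]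
    have "(\<lambda>y. indicator slab (y - s *\<^sub>R e) * g y) \<in> borel_measurable borel" .
    from integral_translate_lborel[OF this, of "s *\<^sub>R e"]
    show "(LINT y|lborel. indicator slab y * g (y + s *\<^sub>R e)) = (LINT y|lborel. indicator slab (y - s *\<^sub>R e) * g y)"
      by simp
  qed
  also have "\<dots> = (LINT y|lborel. LINT s|lborel. indicator slab (y - s *\<^sub>R e) * g y)"
    by (rule lborel_pair.Fubini_integral[OF int2, symmetric])
  also have "\<dots> = (LINT y|lborel. g y)"
    by (simp only: integral_mult_left_zero slab_section mult_1)
  finally show ?thesis .
qed

end

text \<open>The difference of the two half-line indicators is the indicator of the interval between
  a and b with the sign of b - a, so a graph that moves up and one that moves down are treated
  alike. The first bound is the error of freezing \<open>k\<close> at a.\<close>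

lemma integral_interval_diff_estimate:
  fixes k :: "real \<Rightarrow> real"
  assumes k: "k \<in> borel_measurable borel" and L: "\<And>s t. \<bar>k s - k t\<bar> \<le> L * \<bar>s - t\<bar>" and M: "\<And>s. \<bar>k s\<bar> \<le> M"
  shows "\<bar>(LINT s|lborel. k s * (indicator {..<b} s - indicator {..<a} s)) - k a * (b - a)\<bar> \<le> L * (b - a)\<^sup>2"
    "\<bar>LINT s|lborel. k s * (indicator {..<b} s - indicator {..<a} s)\<bar> \<le> M * \<bar>b - a\<bar>"
proof -
  have L0: "L \<ge> 0" using L[of 0 1] by simp
  have M0: "M \<ge> 0" using M[of 0] by simp
  have ik: "integrable lborel (\<lambda>s. h s * indicator {c..<d} s)" if "h \<in> borel_measurable borel" "\<And>s. s \<in> {c..<d} \<Longrightarrow> \<bar>h s\<bar> \<le> K"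
    for c d K and h :: "real \<Rightarrow> real"
  proof (rule Bochner_Integration.integrable_bound)
    show "integrable lborel (\<lambda>s. indicator {c..<d} s * K :: real)"
      by (intro integrable_mult_left integrable_real_indicator emeasure_bounded_finite) auto
    show "AE s in lborel. norm (h s * indicator {c..<d} s) \<le> norm (indicator {c..<d} s * K :: real)"
    proof (rule AE_I2)
      fix s show "norm (h s * indicator {c..<d} s) \<le> norm (indicator {c..<d} s * K :: real)"
        using that(2)[of s] by (cases "s \<in> {c..<d}") auto
    qed
  qed (use that in measurable)
  have est: "\<bar>LINT s|lborel. h s * indicator {c..<d} s\<bar> \<le> K * (d - c)"
    if h: "h \<in> borel_measurable borel" "\<And>s. s \<in> {c..<d} \<Longrightarrow> \<bar>h s\<bar> \<le> K" and cd: "c \<le> d"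
    for c d K and h :: "real \<Rightarrow> real"
  proof -
    have "\<bar>LINT s|lborel. h s * indicator {c..<d} s\<bar> \<le> (LINT s|lborel. \<bar>h s * indicator {c..<d} s\<bar>)"
      by (rule integral_abs_bound)
    also have "\<dots> \<le> (LINT s|lborel. K * indicator {c..<d} s)"
    proof (rule integral_mono)
      show "integrable lborel (\<lambda>s. \<bar>h s * indicator {c..<d} s\<bar>)" by (rule integrable_abs[OF ik[OF h]])
      show "integrable lborel (\<lambda>s. K * indicator {c..<d} s)"
        by (intro integrable_mult_right integrable_real_indicator emeasure_bounded_finite) auto
      show "\<bar>h s * indicator {c..<d} s\<bar> \<le> K * indicator {c..<d} s" for s
        using h(2)[of s] by (cases "s \<in> {c..<d}") auto
    qed
    also have "\<dots> = K * (d - c)" using cd by simp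
    finally show ?thesis .
  qed
  have meas: "(\<lambda>s. k s - k a) \<in> borel_measurable borel" using k by simp
  have one: "(LINT s|lborel. k a * indicator {c..<d} s) = k a * (d - c)" if "c \<le> d" for c d :: real
    using that by simp
  have sub: "(LINT s|lborel. k s * indicator {c..<d} s) - k a * (d - c) = (LINT s|lborel. (k s - k a) * indicator {c..<d} s)"
    if "c \<le> d" for c d
  proof -
    have "(LINT s|lborel. (k s - k a) * indicator {c..<d} s) =
        (LINT s|lborel. k s * indicator {c..<d} s - k a * indicator {c..<d} s)"
      by (simp only: left_diff_distrib)
    also have "\<dots> = (LINT s|lborel. k s * indicator {c..<d} s) - (LINT s|lborel. k a * indicator {c..<d} s)"
      by (rule Bochner_Integration.integral_diff[OF ik[OF k, of c d M] ik[of "\<lambda>s. k a" c d M]]) (use M in auto)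
    finally show ?thesis unfolding one[OF that] by (rule sym)
  qed
  show "\<bar>(LINT s|lborel. k s * (indicator {..<b} s - indicator {..<a} s)) - k a * (b - a)\<bar> \<le> L * (b - a)\<^sup>2"
  proof (cases "a \<le> b")
    case True
    have "(\<lambda>s. k s * (indicator {..<b} s - indicator {..<a} s)) = (\<lambda>s. k s * indicator {a..<b} s)"
      using True by (auto simp: indicator_def fun_eq_iff)
    moreover have "\<bar>LINT s|lborel. (k s - k a) * indicator {a..<b} s\<bar> \<le> (L * (b - a)) * (b - a)"
    proof (rule est[OF meas _ True])
      fix s assume "s \<in> {a..<b}"
      then have "L * \<bar>s - a\<bar> \<le> L * (b - a)" using L0 by (intro mult_left_mono) auto
      then show "\<bar>k s - k a\<bar> \<le> L * (b - a)" using L[of s a] by linarith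
    qed
    ultimately show ?thesis using sub[OF True] by (simp add: power2_eq_square mult.assoc)
  next
    case False
    then have ba: "b \<le> a" by simp
    have "(\<lambda>s. k s * (indicator {..<b} s - indicator {..<a} s)) = (\<lambda>s. - (k s * indicator {b..<a} s))"
      using ba by (auto simp: indicator_def fun_eq_iff)
    then have eq: "(LINT s|lborel. k s * (indicator {..<b} s - indicator {..<a} s)) = - (LINT s|lborel. k s * indicator {b..<a} s)"
      by simp
    have "\<bar>LINT s|lborel. (k s - k a) * indicator {b..<a} s\<bar> \<le> (L * (a - b)) * (a - b)"
    proof (rule est[OF meas _ ba])
      fix s assume "s \<in> {b..<a}"
      then have "L * \<bar>s - a\<bar> \<le> L * (a - b)" using L0 by (intro mult_left_mono) auto
      then show "\<bar>k s - k a\<bar> \<le> L * (a - b)" using L[of s a] by linarith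
    qed
    moreover have "(LINT s|lborel. k s * (indicator {..<b} s - indicator {..<a} s)) - k a * (b - a) =
        - (LINT s|lborel. (k s - k a) * indicator {b..<a} s)"
      unfolding eq sub[OF ba, symmetric] by (simp add: algebra_simps)
    moreover have "(L * (a - b)) * (a - b) = L * (b - a)\<^sup>2" by (simp add: power2_eq_square algebra_simps)
    ultimately show ?thesis by simp
  qed
  show "\<bar>LINT s|lborel. k s * (indicator {..<b} s - indicator {..<a} s)\<bar> \<le> M * \<bar>b - a\<bar>"
  proof (cases "a \<le> b")
    case True
    have "(\<lambda>s. k s * (indicator {..<b} s - indicator {..<a} s)) = (\<lambda>s. k s * indicator {a..<b} s)"
      using True by (auto simp: indicator_def fun_eq_iff)
    then show ?thesis using est[OF k M True] True by simp
  next
    case False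
    then have ba: "b \<le> a" by simp
    have "(\<lambda>s. k s * (indicator {..<b} s - indicator {..<a} s)) = (\<lambda>s. - (k s * indicator {b..<a} s))"
      using ba by (auto simp: indicator_def fun_eq_iff)
    then show ?thesis using est[OF k M ba] ba by simp
  qed
qed

text \<open>The graph function lives on the whole space and is constant along \<open>e\<close>,
  instead of being defined on the hyperplane orthogonal to \<open>e\<close>; Rademacher's theorem
  then applies to it directly.\<close>

locale Lipschitz_graph = unit_direction e for e :: "'a::euclidean_space" +
  fixes \<Phi> :: "'a \<Rightarrow> real" and L :: real
  assumes \<Phi>_Lipschitz: "\<And>x y. \<bar>\<Phi> x - \<Phi> y\<bar> \<le> L * norm (x - y)"
    and \<Phi>_invariant: "\<And>y s. \<Phi> (y + s *\<^sub>R e) = \<Phi> y"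
begin

definition graph :: "'a \<Rightarrow> 'a" where
  "graph y = proj y + \<Phi> y *\<^sub>R e"

definition below :: "'a set" where
  "below = {y. y \<bullet> e < \<Phi> y}"

text \<open>The gradient of x . e - \<Phi>(x) wherever \<Phi> is differentiable. It is not
  normalised: its length is the surface element of the graph over the hyperplane.\<close>

definition normal :: "'a \<Rightarrow> 'a" where
  "normal y = e - (\<Sum>i\<in>Basis. dir_deriv \<Phi> i y *\<^sub>R i)"

lemma \<Phi>_continuous: "continuous_on A \<Phi>"
  by (rule Lipschitz_continuous_on[OF \<Phi>_Lipschitz])

lemma L_nonneg: "0 \<le> L"
  using \<Phi>_Lipschitz[of e 0] norm_e by simp

lemma \<Phi>_proj: "\<Phi> (proj y + s *\<^sub>R e) = \<Phi> y"
  using \<Phi>_invariant[of "proj y" s] \<Phi>_invariant[of "proj y" "y \<bullet> e"] proj_decomp[of y] by simp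

lemma graph_continuous: "continuous_on A graph"
  unfolding graph_def[abs_def] by (intro continuous_intros proj_continuous \<Phi>_continuous)

lemma below_open: "open below"
  unfolding below_def by (intro open_Collect_less continuous_intros \<Phi>_continuous)

lemma graph_translate: "graph y = y + (\<Phi> y - y \<bullet> e) *\<^sub>R e"
  by (simp add: graph_def proj_def algebra_simps)

lemma graph_inner: "graph y \<bullet> e = \<Phi> y" and \<Phi>_graph: "\<Phi> (graph y) = \<Phi> y"
  by (simp_all add: graph_def inner_add_left proj_inner ee \<Phi>_proj)

lemma normal_measurable: "normal \<in> borel_measurable borel"
  unfolding normal_def[abs_def]
  by (intro borel_measurable_diff borel_measurable_const borel_measurable_sum borel_measurable_scaleR
      dir_deriv_measurable[OF \<Phi>_continuous])

lemma \<Phi>_derivative_AE: "AE y in lborel. (\<Phi> has_derivative (\<lambda>h. h \<bullet> (e - normal y))) (at y)"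
  using Rademacher[OF \<Phi>_Lipschitz] unfolding normal_def by simp

text \<open>The difference quotient of \<open>f\<close> is moved onto the indicator of the region.
  On each line the region and its translate differ by the interval between the heights \<Phi> and
  \<beta>_n, so the line integral is f(graph) (\<beta>_n - \<Phi>) up to a quadratic error. After
  division by h_n the limit is f(graph) times the component of \<open>normal\<close> along
  \<open>v\<close>, because \<beta>_n - \<Phi> collects both the change of \<Phi> and the vertical
  part of \<open>v\<close>.\<close>

lemma divergence_below_graph:
  fixes f :: "'a \<Rightarrow> real"
  assumes f: "smooth f" "\<And>x. R < norm x \<Longrightarrow> f x = 0" and v: "v \<in> Basis"
  shows "(LINT y|lborel. partial v f y * indicator below y) =
    (LINT y|lborel. indicator slab y * (f (graph y) * (normal y \<bullet> v)))"
proof -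
  obtain M where M: "M \<ge> 0" "\<And>x. \<bar>f x\<bar> \<le> M" using smooth_compact_support_bounded[where R=R, OF f] by auto
  obtain K where K: "K \<ge> 0" "\<And>x y. \<bar>f x - f y\<bar> \<le> K * norm (x - y)"
    using smooth_compact_support_Lipschitz[where R=R, OF f] by auto
  have cf: "continuous_on A f" for A using f(1) by (rule smooth_continuous_on)
  have mf: "f \<in> borel_measurable borel" using f(1) by (rule smooth_borel_measurable)
  have ib: "(indicator below :: 'a \<Rightarrow> real) \<in> borel_measurable borel"
    using below_open by simp
  define h where "h n = inverse (real (Suc n))" for n
  have h0: "h n > 0" for n by (simp add: h_def)
  have hlim: "h \<longlonglongrightarrow> 0" unfolding h_def by (rule LIMSEQ_inverse_real_of_nat)
  \<comment> \<open>The height at which the line through \<open>y\<close> leaves the region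
    translated by h_n v.\<close>
  define \<beta> where "\<beta> n y = \<Phi> (y - h n *\<^sub>R v) + h n * (v \<bullet> e)" for n y
  define J where "J n y = (LINT s|lborel. f (proj y + s *\<^sub>R e) * (indicator {..<\<beta> n y} s - indicator {..<\<Phi> y} s))" for n y
  have tm: "(\<lambda>y. F (y + c)) \<in> borel_measurable borel" if "F \<in> borel_measurable borel" for F :: "'a \<Rightarrow> real" and c
  proof -
    have "(\<lambda>y. y + c) \<in> borel_measurable borel" by (intro borel_measurable_continuous_onI continuous_intros)
    then show ?thesis by (rule measurable_compose) (rule that)
  qed
  define G where "G n y = f y * (indicator below (y - h n *\<^sub>R v) - indicator below y)" for n y
  have mG: "G n \<in> borel_measurable borel" for n
    unfolding G_def[abs_def] using tm[OF ib, of "- h n *\<^sub>R v"] mf ib by simp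
  have bG: "\<bar>G n y\<bar> \<le> M" for n y
    unfolding G_def using M by (auto simp: indicator_def)
  have sG: "G n y = 0" if "R < norm y" for n y using f(2)[OF that] by (simp add: G_def)
  have slice: "(LINT s|lborel. G n (proj y + s *\<^sub>R e)) = J n y" for n y
  proof -
    have "proj y + s *\<^sub>R e - h n *\<^sub>R v \<in> below \<longleftrightarrow> s < \<beta> n y" for s
    proof -
      have "\<Phi> (proj y + s *\<^sub>R e - h n *\<^sub>R v) = \<Phi> (y - h n *\<^sub>R v + (s - y \<bullet> e) *\<^sub>R e)"
        by (simp add: proj_def algebra_simps)
      also have "\<dots> = \<Phi> (y - h n *\<^sub>R v)" by (rule \<Phi>_invariant)
      finally show ?thesis unfolding below_def \<beta>_def
        by (auto simp: inner_diff_left inner_add_left proj_inner ee)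
    qed
    moreover have "proj y + s *\<^sub>R e \<in> below \<longleftrightarrow> s < \<Phi> y" for s
      unfolding below_def by (simp add: inner_add_left proj_inner ee \<Phi>_proj)
    ultimately show ?thesis unfolding J_def G_def
      by (intro Bochner_Integration.integral_cong refl) (simp add: indicator_def)
  qed
  have kL: "\<bar>f (proj y + s *\<^sub>R e) - f (proj y + t *\<^sub>R e)\<bar> \<le> K * \<bar>s - t\<bar>" for y s t
  proof -
    have "(proj y + s *\<^sub>R e) - (proj y + t *\<^sub>R e) = (s - t) *\<^sub>R e" by (simp add: scaleR_diff_left)
    then show ?thesis using K(2)[of "proj y + s *\<^sub>R e" "proj y + t *\<^sub>R e"] by (simp add: norm_e)
  qed
  have km: "(\<lambda>s. f (proj y + s *\<^sub>R e)) \<in> borel_measurable borel" for y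
    by (intro borel_measurable_continuous_onI continuous_on_compose2[OF cf[of UNIV]] continuous_intros) auto
  have est1: "\<bar>J n y - f (graph y) * (\<beta> n y - \<Phi> y)\<bar> \<le> K * (\<beta> n y - \<Phi> y)\<^sup>2" for n y
    unfolding J_def graph_def by (rule integral_interval_diff_estimate(1)[OF km kL]) (rule M)
  have est2: "\<bar>J n y\<bar> \<le> M * \<bar>\<beta> n y - \<Phi> y\<bar>" for n y
    unfolding J_def by (rule integral_interval_diff_estimate(2)[OF km kL]) (rule M)
  have \<beta>b: "\<bar>\<beta> n y - \<Phi> y\<bar> \<le> h n * (L + 1)" for n y
  proof -
    have "\<bar>\<Phi> (y - h n *\<^sub>R v) - \<Phi> y\<bar> \<le> L * h n"
      using \<Phi>_Lipschitz[of "y - h n *\<^sub>R v" y] v h0[of n] by simp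
    moreover have "\<bar>h n * (v \<bullet> e)\<bar> \<le> h n * 1"
      using Basis_le_norm[OF v, of e] h0[of n] by (simp add: abs_mult norm_e inner_commute)
    ultimately show ?thesis unfolding \<beta>_def by (simp add: algebra_simps)
  qed
  have lhs: "(\<lambda>n. inverse (h n) * (LINT y|lborel. G n y)) \<longlonglongrightarrow> (LINT y|lborel. partial v f y * indicator below y)"
  proof -
    have "(\<lambda>n. LINT x|lborel. real (Suc n) * (f (x + v /\<^sub>R real (Suc n)) - f x) * indicator below x)
      \<longlonglongrightarrow> (LINT x|lborel. (\<Sum>i\<in>Basis. (v \<bullet> i) * partial i f x) * indicator below x)"
      by (rule difference_quotient_integral_tendsto[where R=R and M=1, OF f ib]) auto
    moreover have "(LINT x|lborel. real (Suc n) * (f (x + v /\<^sub>R real (Suc n)) - f x) * indicator below x)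
        = inverse (h n) * (LINT y|lborel. G n y)" for n
    proof -
      define k where "k = h n *\<^sub>R v"
      have fk: "(\<lambda>x. f (x + k) * indicator below x) \<in> borel_measurable borel"
        by (intro borel_measurable_times tm mf ib)
      have i1: "integrable lborel (\<lambda>x. f (x + k) * indicator below x)"
      proof (rule integrable_bounded_support[OF fk, of M "R + norm k"])
        show "\<bar>f (x + k) * indicator below x\<bar> \<le> M" for x using M by (auto simp: indicator_def)
        show "f (x + k) * indicator below x = 0" if "R + norm k < norm x" for x
          using f(2)[of "x + k"] norm_diff_ineq[of x k] that by simp
      qed
      have i2: "integrable lborel (\<lambda>x. f x * indicator below x)"
      proof (rule integrable_bounded_support[of _ M R])
        show "(\<lambda>x. f x * indicator below x) \<in> borel_measurable borel" by (intro borel_measurable_times mf ib)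
        show "\<bar>f x * indicator below x\<bar> \<le> M" for x using M by (auto simp: indicator_def)
      qed (use f(2) in simp)
      have fk3: "(\<lambda>x. f x * indicator below (x - k)) \<in> borel_measurable borel"
        using tm[OF ib, of "- k"] mf by simp
      have i3: "integrable lborel (\<lambda>x. f x * indicator below (x - k))"
      proof (rule integrable_bounded_support[OF fk3, of M R])
        show "\<bar>f x * indicator below (x - k)\<bar> \<le> M" for x using M by (auto simp: indicator_def)
      qed (use f(2) in simp)
      have "(LINT x|lborel. f (x + k) * indicator below x) = (LINT x|lborel. f x * indicator below (x - k))"
        using integral_translate_lborel[OF fk3, of k] by simp
      then have "(LINT y|lborel. G n y) = (LINT x|lborel. f (x + k) * indicator below x) - (LINT x|lborel. f x * indicator below x)"
        unfolding G_def k_def[symmetric] right_diff_distrib using i3 i2 by simp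
      also have "\<dots> = (LINT x|lborel. (f (x + k) - f x) * indicator below x)"
        unfolding left_diff_distrib using i1 i2 by simp
      finally show ?thesis unfolding k_def h_def by (simp add: mult.assoc)
    qed
    ultimately show ?thesis using sum_inner_Basis[OF v] by simp
  qed
  have rhs: "(\<lambda>n. LINT y|lborel. indicator slab y * (inverse (h n) * J n y)) \<longlonglongrightarrow>
      (LINT y|lborel. indicator slab y * (f (graph y) * (normal y \<bullet> v)))"
  proof (rule integral_dominated_convergence[where w="\<lambda>y. indicator (cball 0 (\<bar>R\<bar> + 1)) y * (M * (L + 1))"])
    have mJ: "J n \<in> borel_measurable borel" for n
    proof -
      have c\<beta>: "continuous_on UNIV (\<beta> n)"
        unfolding \<beta>_def[abs_def] by (intro continuous_intros continuous_on_compose2[OF \<Phi>_continuous[of UNIV]]) auto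
      have "(\<lambda>(y, s). G n (proj y + s *\<^sub>R e)) \<in> borel_measurable (borel \<Otimes>\<^sub>M lborel)"
      proof -
        have "(\<lambda>z. proj (fst z) + snd z *\<^sub>R e) \<in> borel_measurable (borel :: ('a \<times> real) measure)"
          by (intro borel_measurable_continuous_onI continuous_intros continuous_on_compose2[OF proj_continuous[of UNIV]]) auto
        from measurable_compose[OF this mG[of n]]
        have "(\<lambda>z. G n (proj (fst z) + snd z *\<^sub>R e)) \<in> borel_measurable ((borel :: 'a measure) \<Otimes>\<^sub>M (borel :: real measure))"
          by (simp add: borel_prod)
        then show ?thesis by (simp add: case_prod_unfold measurable_cong_sets[OF sets_pair_measure_cong[OF refl sets_lborel] refl])
      qed
      then have "(\<lambda>y. LINT s|lborel. G n (proj y + s *\<^sub>R e)) \<in> borel_measurable borel"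
        by (rule lborel.borel_measurable_lebesgue_integral)
      then show ?thesis by (simp only: slice)
    qed
    have isl: "(indicator slab :: 'a \<Rightarrow> real) \<in> borel_measurable borel" using slab_borel by simp
    show "(\<lambda>y. indicator slab y * (inverse (h n) * J n y)) \<in> borel_measurable lborel" for n
      using mJ[of n] isl by simp
    have fg: "(\<lambda>y. f (graph y)) \<in> borel_measurable borel"
      by (intro borel_measurable_continuous_onI continuous_on_compose2[OF cf[of UNIV] graph_continuous]) auto
    have nv: "(\<lambda>y. normal y \<bullet> v) \<in> borel_measurable borel"
      by (intro borel_measurable_inner normal_measurable borel_measurable_const)
    show "(\<lambda>y. indicator slab y * (f (graph y) * (normal y \<bullet> v))) \<in> borel_measurable lborel"
      using isl fg nv by simp
    show "integrable lborel (\<lambda>y. indicator (cball 0 (\<bar>R\<bar> + 1)) y * (M * (L + 1)) :: real)"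
      by (intro integrable_mult_left integrable_real_indicator emeasure_bounded_finite) auto
    show "AE y in lborel. norm (indicator slab y * (inverse (h n) * J n y)) \<le> indicator (cball 0 (\<bar>R\<bar> + 1)) y * (M * (L + 1))" for n
    proof (rule AE_I2)
      fix y
      show "norm (indicator slab y * (inverse (h n) * J n y)) \<le> indicator (cball 0 (\<bar>R\<bar> + 1)) y * (M * (L + 1))"
      proof (cases "y \<in> slab \<and> J n y \<noteq> 0")
        case True
        have "norm (proj y) \<le> \<bar>R\<bar>"
        proof (rule ccontr)
          assume "\<not> norm (proj y) \<le> \<bar>R\<bar>"
          then have "R < norm (proj y + s *\<^sub>R e)" for s using norm_proj_le[of y s] by linarith
          then have "J n y = 0" unfolding J_def by (simp add: f(2))
          then show False using True by simp
        qed
        moreover have "norm y \<le> norm (proj y) + norm ((y \<bullet> e) *\<^sub>R e)"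
          using norm_triangle_ineq[of "proj y" "(y \<bullet> e) *\<^sub>R e"] proj_decomp[of y] by simp
        moreover have "norm ((y \<bullet> e) *\<^sub>R e) \<le> 1" using True by (simp add: norm_e slab_def)
        ultimately have cb: "y \<in> cball 0 (\<bar>R\<bar> + 1)" by simp
        have "inverse (h n) * \<bar>J n y\<bar> \<le> inverse (h n) * (M * (h n * (L + 1)))"
          using est2[of n y] \<beta>b[of n y] M h0[of n]
          by (intro mult_left_mono) (auto intro: order_trans mult_left_mono)
        also have "\<dots> = M * (L + 1)" using h0[of n] by simp
        finally show ?thesis using cb True h0[of n] by (simp add: abs_mult)
      next
        case False
        then have "indicator slab y * (inverse (h n) * J n y) = 0" by auto
        moreover have "0 \<le> indicator (cball 0 (\<bar>R\<bar> + 1)) y * (M * (L + 1))"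
          using M(1) L_nonneg by (intro mult_nonneg_nonneg) auto
        ultimately show ?thesis by (simp only: norm_zero)
      qed
    qed
    show "AE y in lborel. (\<lambda>n. indicator slab y * (inverse (h n) * J n y))
        \<longlonglongrightarrow> indicator slab y * (f (graph y) * (normal y \<bullet> v))"
      using \<Phi>_derivative_AE
    proof eventually_elim
      case (elim y)
      have "(\<lambda>n. real (Suc n) * (\<Phi> (y + (- v) /\<^sub>R real (Suc n)) - \<Phi> y)) \<longlonglongrightarrow> (- v) \<bullet> (e - normal y)"
        by (rule difference_quotient_tendsto[OF elim])
      then have "(\<lambda>n. real (Suc n) * (\<Phi> (y + (- v) /\<^sub>R real (Suc n)) - \<Phi> y) + v \<bullet> e) \<longlonglongrightarrow> (- v) \<bullet> (e - normal y) + v \<bullet> e"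
        by (intro tendsto_add tendsto_const)
      also have "(- v) \<bullet> (e - normal y) + v \<bullet> e = normal y \<bullet> v" by (simp add: inner_diff_right inner_commute)
      also have "(\<lambda>n. real (Suc n) * (\<Phi> (y + (- v) /\<^sub>R real (Suc n)) - \<Phi> y) + v \<bullet> e) = (\<lambda>n. inverse (h n) * (\<beta> n y - \<Phi> y))"
        using h0 by (auto simp: \<beta>_def h_def right_diff_distrib distrib_left fun_eq_iff simp del: of_nat_Suc)
      finally have q: "(\<lambda>n. inverse (h n) * (\<beta> n y - \<Phi> y)) \<longlonglongrightarrow> normal y \<bullet> v" .
      \<comment> \<open>Freezing \<open>f\<close> on the graph costs at most K (h_n (L + 1))^2, so
        one factor h_n survives the division.\<close>
      have "(\<lambda>n. inverse (h n) * J n y - f (graph y) * (inverse (h n) * (\<beta> n y - \<Phi> y))) \<longlonglongrightarrow> 0"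
      proof (rule tendsto_0_le[OF hlim, where K="K * (L + 1)\<^sup>2"], intro always_eventually allI)
        fix n
        have "inverse (h n) * J n y - f (graph y) * (inverse (h n) * (\<beta> n y - \<Phi> y)) =
            inverse (h n) * (J n y - f (graph y) * (\<beta> n y - \<Phi> y))" by (simp add: algebra_simps)
        then have "norm (inverse (h n) * J n y - f (graph y) * (inverse (h n) * (\<beta> n y - \<Phi> y)))
            = inverse (h n) * \<bar>J n y - f (graph y) * (\<beta> n y - \<Phi> y)\<bar>" using h0[of n] by (simp add: abs_mult)
        also have "\<dots> \<le> inverse (h n) * (K * (h n * (L + 1))\<^sup>2)"
        proof (rule mult_left_mono)
          have "(\<beta> n y - \<Phi> y)\<^sup>2 \<le> (h n * (L + 1))\<^sup>2"
            using \<beta>b[of n y] by (metis abs_ge_zero power2_abs power_mono)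
          then show "\<bar>J n y - f (graph y) * (\<beta> n y - \<Phi> y)\<bar> \<le> K * (h n * (L + 1))\<^sup>2"
            using est1[of n y] K(1) by (meson mult_left_mono order_trans)
        qed (use h0[of n] in simp)
        also have "\<dots> = norm (h n) * (K * (L + 1)\<^sup>2)" using h0[of n] by (simp add: power2_eq_square)
        finally show "norm (inverse (h n) * J n y - f (graph y) * (inverse (h n) * (\<beta> n y - \<Phi> y))) \<le> norm (h n) * (K * (L + 1)\<^sup>2)" .
      qed
      from tendsto_add[OF this tendsto_mult[OF tendsto_const q, of "f (graph y)"]]
      have "(\<lambda>n. inverse (h n) * J n y) \<longlonglongrightarrow> f (graph y) * (normal y \<bullet> v)" by simp
      then show ?case by (rule tendsto_mult[OF tendsto_const])
    qed
  qed
  have "inverse (h n) * (LINT y|lborel. G n y) = (LINT y|lborel. indicator slab y * (inverse (h n) * J n y))" for n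
  proof -
    have "(LINT y|lborel. G n y) = (LINT y|lborel. indicator slab y * J n y)"
      using slice_integral[where M=M and R=R, OF mG[of n] bG sG] by (simp only: slice)
    then have "inverse (h n) * (LINT y|lborel. G n y) = (LINT y|lborel. inverse (h n) * (indicator slab y * J n y))"
      by simp
    then show ?thesis by (simp only: mult.left_commute)
  qed
  then show ?thesis using lhs rhs by (auto intro: LIMSEQ_unique)
qed

end

section \<open>Boundary charts and Green's formula\<close>

lemma integral_lebesgue_on_indicator:
  fixes f :: "'a::euclidean_space \<Rightarrow> real"
  assumes "\<Omega> \<in> sets borel" "f \<in> borel_measurable borel"
  shows "(LINT x|lebesgue_on \<Omega>. f x) = (LINT x|lborel. f x * indicator \<Omega> x)"
proof -
  have "(LINT x|lebesgue_on \<Omega>. f x) = (LINT x|lebesgue. indicator \<Omega> x *\<^sub>R f x)"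
    by (rule integral_restrict_space) (use assms in simp)
  also have "\<dots> = (LINT x|lborel. indicator \<Omega> x *\<^sub>R f x)"
    by (rule integral_completion) (use assms in simp)
  finally show ?thesis by (simp add: mult.commute)
qed

section \<open>Hausdorff measure of a graph and Lebesgue measure of its base\<close>

context unit_direction
begin

text \<open>The cylinder has height 1 and radius d. Balls of radius 2 d with centres spaced by d
  along the axis cover it; at most 2/d of them are used, each of volume proportional to (2 d)^n for
  n the dimension, which leaves the power n - 1.\<close>

lemma emeasure_cylinder_le_pos:
  assumes d: "0 < d" "d \<le> 1"
  shows "emeasure lborel {y \<in> slab. norm (proj y - c) \<le> d}
    \<le> ennreal (2 * unit_ball_vol (real DIM('a)) * 2 ^ DIM('a) * d ^ (DIM('a) - 1))"
proof -
  let ?n = "DIM('a)"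
  let ?J = "{0..nat \<lfloor>1 / d\<rfloor>}"
  have sub: "{y \<in> slab. norm (proj y - c) \<le> d} \<subseteq> (\<Union>j\<in>?J. cball (c + (real j * d) *\<^sub>R e) (2 * d))"
  proof clarify
    fix y assume y: "y \<in> slab" "norm (proj y - c) \<le> d"
    define t where "t = y \<bullet> e"
    have t: "0 < t" "t < 1" using y(1) by (simp_all add: slab_def t_def)
    define j where "j = nat \<lfloor>t / d\<rfloor>"
    have "0 \<le> \<lfloor>t / d\<rfloor>" using t d by simp
    then have rj: "real j = of_int \<lfloor>t / d\<rfloor>" by (simp add: j_def)
    have "real j \<le> t / d" "t / d < real j + 1" unfolding rj by linarith+
    then have jd: "real j * d \<le> t" "t < real j * d + d" using d by (simp_all add: field_simps)
    have "t / d \<le> 1 / d" using t d by (simp add: divide_right_mono)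
    then have "j \<in> ?J" unfolding j_def by (simp add: nat_mono floor_mono)
    moreover have "y \<in> cball (c + (real j * d) *\<^sub>R e) (2 * d)"
    proof -
      have "(c + (real j * d) *\<^sub>R e) - y = (c - proj y) + (real j * d - t) *\<^sub>R e"
        unfolding proj_def t_def by (simp add: algebra_simps)
      then have "norm ((c + (real j * d) *\<^sub>R e) - y) \<le> norm (c - proj y) + norm ((real j * d - t) *\<^sub>R e)"
        by (metis norm_triangle_ineq)
      also have "\<dots> \<le> d + d"
        using y(2) jd by (intro add_mono) (auto simp: norm_e norm_minus_commute)
      finally show ?thesis by (simp add: dist_norm)
    qed
    ultimately show "y \<in> (\<Union>j\<in>?J. cball (c + (real j * d) *\<^sub>R e) (2 * d))" by blast
  qed
  have n: "?n = Suc (?n - 1)" by simp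
  have "emeasure lborel {y \<in> slab. norm (proj y - c) \<le> d}
      \<le> emeasure lborel (\<Union>j\<in>?J. cball (c + (real j * d) *\<^sub>R e) (2 * d))"
    by (rule emeasure_mono[OF sub]) simp
  also have "\<dots> \<le> (\<Sum>j\<in>?J. emeasure lborel (cball (c + (real j * d) *\<^sub>R e) (2 * d)))"
    by (rule emeasure_subadditive_finite) auto
  also have "\<dots> = (\<Sum>j\<in>?J. ennreal (unit_ball_vol (real ?n) * (2 * d) ^ ?n))"
    using d by (intro sum.cong refl emeasure_cball) simp
  also have "\<dots> = ennreal (real (nat \<lfloor>1 / d\<rfloor> + 1) * (unit_ball_vol (real ?n) * (2 * d) ^ ?n))"
    using d by (subst sum_ennreal) simp_all
  also have "\<dots> \<le> ennreal ((2 / d) * (unit_ball_vol (real ?n) * (2 * d) ^ ?n))"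
  proof (intro ennreal_leI mult_right_mono)
    have "real (nat \<lfloor>1 / d\<rfloor>) \<le> 1 / d" using d by simp
    moreover have "1 \<le> 1 / d" using d by simp
    ultimately show "real (nat \<lfloor>1 / d\<rfloor> + 1) \<le> 2 / d" by simp
  qed (use d in simp)
  also have "(2 / d) * (unit_ball_vol (real ?n) * (2 * d) ^ ?n) = 2 * unit_ball_vol (real ?n) * 2 ^ ?n * d ^ (?n - 1)"
  proof -
    define X where "X = d ^ (?n - 1)"
    have "d ^ ?n = d * X" using n unfolding X_def by (metis power_Suc)
    then have "(2 * d) ^ ?n = 2 ^ ?n * (d * X)" by (simp only: power_mult_distrib)
    then show ?thesis unfolding X_def[symmetric] using d by simp
  qed
  finally show ?thesis .
qed

text \<open>Sets of diameter 0 occur in coverings, so d = 0 is reached as a limit of positive radii;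
  d \<le> 1/2 leaves room for the added 1/(k+1).\<close>

lemma emeasure_cylinder_le:
  assumes d: "0 \<le> d" "d \<le> 1 / 2"
  shows "emeasure lborel {y \<in> slab. norm (proj y - c) \<le> d}
    \<le> ennreal (2 * unit_ball_vol (real DIM('a)) * 2 ^ DIM('a) * d ^ (DIM('a) - 1))"
proof (rule LIMSEQ_le_const)
  let ?K = "2 * unit_ball_vol (real DIM('a)) * 2 ^ DIM('a)"
  let ?s = "\<lambda>k. inverse (real (Suc k))"
  have "(\<lambda>k. ?K * (d + ?s k) ^ (DIM('a) - 1)) \<longlonglongrightarrow> ?K * (d + 0) ^ (DIM('a) - 1)"
    by (intro tendsto_intros LIMSEQ_inverse_real_of_nat)
  then show "(\<lambda>k. ennreal (?K * (d + ?s k) ^ (DIM('a) - 1))) \<longlonglongrightarrow> ennreal (?K * d ^ (DIM('a) - 1))"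
    by (intro tendsto_ennrealI) simp
  have "emeasure lborel {y \<in> slab. norm (proj y - c) \<le> d} \<le> ennreal (?K * (d + ?s k) ^ (DIM('a) - 1))" if "k \<ge> 1" for k
  proof -
    have s: "0 < ?s k" "?s k \<le> 1 / 2" using that by (simp_all add: field_simps)
    have cl: "closed {y. norm (proj y - c) \<le> d + ?s k}"
      by (intro closed_Collect_le continuous_intros proj_continuous)
    have "{y \<in> slab. norm (proj y - c) \<le> d + ?s k} = slab \<inter> {y. norm (proj y - c) \<le> d + ?s k}" by auto
    then have "{y \<in> slab. norm (proj y - c) \<le> d + ?s k} \<in> sets lborel"
      using cl slab_borel by (simp del: of_nat_Suc)
    moreover have "{y \<in> slab. norm (proj y - c) \<le> d} \<subseteq> {y \<in> slab. norm (proj y - c) \<le> d + ?s k}"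
    proof -
      have "d \<le> d + ?s k" using s(1) by simp
      then show ?thesis using order_trans[of _ d "d + ?s k"] by blast
    qed
    ultimately have "emeasure lborel {y \<in> slab. norm (proj y - c) \<le> d} \<le> emeasure lborel {y \<in> slab. norm (proj y - c) \<le> d + ?s k}"
      by (intro emeasure_mono)
    also have "\<dots> \<le> ennreal (?K * (d + ?s k) ^ (DIM('a) - 1))"
      by (rule emeasure_cylinder_le_pos) (use s d in linarith)+
    finally show ?thesis .
  qed
  then show "\<exists>N. \<forall>k\<ge>N. emeasure lborel {y \<in> slab. norm (proj y - c) \<le> d} \<le> ennreal (?K * (d + ?s k) ^ (DIM('a) - 1))"
    by blast
qed

text \<open>Not sharp: all that matters is that Lebesgue measure of the base is bounded by a multiple of the
  Hausdorff measure of the graph.\<close>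

definition chart_const :: real where
  "chart_const = unit_ball_vol (real (DIM('a) - 1)) /
     (2 * unit_ball_vol (real DIM('a)) * 2 ^ DIM('a) * 2 ^ (DIM('a) - 1))"

lemma chart_const_pos: "chart_const > 0"
  unfolding chart_const_def by (intro divide_pos_pos mult_pos_pos) (auto intro!: unit_ball_vol_pos)

end

context Lipschitz_graph
begin

lemma graph_borel: "graph \<in> borel_measurable borel"
  by (intro borel_measurable_continuous_onI graph_continuous)

text \<open>Projection along \<open>e\<close> does not increase distances. A covering set of
  diameter d therefore projects into a ball of radius d about the projection of one of its points,
  and the part of the base it serves lies in a cylinder of that radius. \<open>chart_const\<close>
  is the ratio of the Hausdorff gauge to the cylinder bound.\<close>

lemma hausdorff_graph_ge:
  assumes A: "A \<in> sets borel"
  shows "ennreal chart_const * emeasure lborel (slab \<inter> graph -` A) \<le> hausdorff_outer (DIM('a) - 1) A"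
proof -
  let ?n = "DIM('a) - 1"
  let ?K = "2 * unit_ball_vol (real DIM('a)) * 2 ^ DIM('a)"
  have K0: "?K > 0" using unit_ball_vol_pos[of "real DIM('a)"] by simp
  \<comment> \<open>The single scale 1/2, the largest one allowed in the cylinder bound, suffices:
    its content is at most the outer measure.\<close>
  have "ennreal chart_const * emeasure lborel (slab \<inter> graph -` A) \<le> hausdorff_content ?n (1 / 2) A"
    unfolding hausdorff_content_def
  proof (rule INF_greatest, clarify)
    fix C :: "nat \<Rightarrow> 'a set"
    assume cov: "A \<subseteq> (\<Union>i. C i)" and C: "\<forall>i. bounded (C i) \<and> diameter (C i) \<le> 1 / 2"
    define c where "c i = (SOME x. x \<in> C i)" for i
    define T where "T i = (if C i = {} then {} else {y \<in> slab. norm (proj y - proj (c i)) \<le> diameter (C i)})" for i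
    have c: "c i \<in> C i" if "C i \<noteq> {}" for i unfolding c_def using that by (auto intro: someI)
    have d0: "0 \<le> diameter (C i)" for i using C by (intro diameter_ge_0) blast
    have Tb: "T i \<in> sets lborel" for i
    proof -
      have "closed {y. norm (proj y - proj (c i)) \<le> diameter (C i)}"
        by (intro closed_Collect_le continuous_intros proj_continuous)
      moreover have "{y \<in> slab. norm (proj y - proj (c i)) \<le> diameter (C i)} =
          slab \<inter> {y. norm (proj y - proj (c i)) \<le> diameter (C i)}" by auto
      ultimately show ?thesis unfolding T_def using slab_borel by simp
    qed
    have sub: "slab \<inter> graph -` A \<subseteq> (\<Union>i. T i)"
    proof
      fix y assume "y \<in> slab \<inter> graph -` A"
      then obtain i where y: "y \<in> slab" "graph y \<in> C i" using cov by auto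
      then have ci: "c i \<in> C i" using c by auto
      have "proj (graph y) = proj y" unfolding graph_translate by (rule proj_add)
      then have "norm (proj y - proj (c i)) = norm (proj (graph y - c i))" by (simp only: proj_diff[symmetric])
      also have "\<dots> \<le> norm (graph y - c i)" by (rule norm_proj_le')
      also have "\<dots> \<le> diameter (C i)"
        using C y(2) ci diameter_bounded_bound[of "C i" "graph y" "c i"] by (auto simp: dist_norm)
      finally have "y \<in> T i" using y ci unfolding T_def by auto
      then show "y \<in> (\<Union>i. T i)" by blast
    qed
    have le: "ennreal chart_const * emeasure lborel (T i) \<le> hausdorff_gauge ?n (C i)" for i
    proof (cases "C i = {}")
      case False
      have "ennreal chart_const * emeasure lborel (T i) \<le> ennreal chart_const * ennreal (?K * diameter (C i) ^ ?n)"
      proof (rule mult_left_mono)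
        have "diameter (C i) \<le> 1 / 2" using C by blast
        from emeasure_cylinder_le[OF d0[of i] this, of "proj (c i)"]
        show "emeasure lborel (T i) \<le> ennreal (?K * diameter (C i) ^ ?n)" using False by (simp only: T_def if_False)
      qed simp
      also have "\<dots> = ennreal (chart_const * (?K * diameter (C i) ^ ?n))"
        using chart_const_pos K0 d0[of i] by (simp add: ennreal_mult)
      also have "chart_const * (?K * diameter (C i) ^ ?n) = unit_ball_vol (real ?n) * (diameter (C i) / 2) ^ ?n"
      proof -
        have "unit_ball_vol (real DIM('a)) \<noteq> 0"
          using unit_ball_vol_pos[of "real DIM('a)", OF of_nat_0_le_iff] by linarith
        then show ?thesis unfolding chart_const_def by (simp add: power_divide)
      qed
      also have "ennreal \<dots> = hausdorff_gauge ?n (C i)" using False by (simp add: hausdorff_gauge_def)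
      finally show ?thesis .
    qed (simp add: T_def)
    have "range T \<subseteq> sets lborel" using Tb by blast
    then have "(\<Union>i. T i) \<in> sets lborel" by (rule sets.countable_UN)
    then have "emeasure lborel (slab \<inter> graph -` A) \<le> emeasure lborel (\<Union>i. T i)"
      by (rule emeasure_mono[OF sub])
    also have "\<dots> \<le> (\<Sum>i. emeasure lborel (T i))"
      by (rule emeasure_subadditive_countably) (use Tb in blast)
    finally have "ennreal chart_const * emeasure lborel (slab \<inter> graph -` A) \<le> ennreal chart_const * (\<Sum>i. emeasure lborel (T i))"
      by (rule mult_left_mono) simp
    also have "\<dots> = (\<Sum>i. ennreal chart_const * emeasure lborel (T i))" by simp
    also have "\<dots> \<le> (\<Sum>i. hausdorff_gauge ?n (C i))" by (intro suminf_le summableI le)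
    finally show "ennreal chart_const * emeasure lborel (slab \<inter> graph -` A) \<le> (\<Sum>i. hausdorff_gauge ?n (C i))" .
  qed
  also have "\<dots> \<le> hausdorff_outer ?n A"
    unfolding hausdorff_outer_def by (rule SUP_upper) simp
  finally show ?thesis .
qed

lemma derivative_at_graph:
  assumes "(\<Phi> has_derivative D) (at y)"
  shows "(\<Phi> has_derivative D) (at (graph y))"
proof -
  let ?c = "(\<Phi> y - y \<bullet> e) *\<^sub>R e"
  have "((\<lambda>x. x - ?c) has_derivative (\<lambda>h. h)) (at (graph y))"
    by (auto intro!: derivative_eq_intros)
  moreover have "graph y - ?c = y" by (simp add: graph_translate)
  ultimately have "((\<lambda>x. \<Phi> (x - ?c)) has_derivative D) (at (graph y))"
    using has_derivative_compose[of "\<lambda>x. x - ?c" "\<lambda>h. h" "graph y" UNIV \<Phi> D] assms by simp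
  moreover have "\<Phi> (x - ?c) = \<Phi> x" for x
    using \<Phi>_invariant[of x "- (\<Phi> y - y \<bullet> e)"] by (simp only: scaleR_minus_left add_uminus_conv_diff)
  ultimately show ?thesis by simp
qed

text \<open>\<Phi> is constant along \<open>e\<close>, so its gradient is orthogonal to
  \<open>e\<close>. In particular the normal does not vanish.\<close>

lemma normal_inner_e:
  assumes "(\<Phi> has_derivative (\<lambda>h. h \<bullet> (e - normal y))) (at y)"
  shows "normal y \<bullet> e = 1"
proof -
  have "(\<lambda>n. real (Suc n) * (\<Phi> (y + e /\<^sub>R real (Suc n)) - \<Phi> y)) \<longlonglongrightarrow> e \<bullet> (e - normal y)"
    by (rule difference_quotient_tendsto[OF assms])
  then have "(\<lambda>n. 0::real) \<longlonglongrightarrow> e \<bullet> (e - normal y)" by (simp only: \<Phi>_invariant) simp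
  then have "e \<bullet> (e - normal y) = 0" by (simp add: LIMSEQ_const_iff)
  then show ?thesis by (simp add: inner_diff_right ee inner_commute)
qed

end

section \<open>The outward normal in a boundary chart\<close>

lemma is_outward_normal_unique:
  assumes a: "is_outward_normal \<Omega> q a" and b: "is_outward_normal \<Omega> q b"
  shows "a = b"
proof (rule ccontr)
  assume ne: "a \<noteq> b"
  have n: "norm a = 1" "norm b = 1" using a b by (simp_all add: is_outward_normal_def)
  then have n': "a \<bullet> a = 1" "b \<bullet> b = 1" by (simp_all add: norm_eq_1)
  define d where "d = b - a"
  have "0 < (norm (b - a))\<^sup>2" using ne by simp
  also have "(norm (b - a))\<^sup>2 = 2 - 2 * (a \<bullet> b)"
    unfolding power2_norm_eq_inner by (simp add: n' inner_diff_left inner_diff_right inner_commute)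
  finally have ab: "a \<bullet> b < 1" by simp
  define c where "c = 1 - a \<bullet> b"
  have c: "c > 0" using ab by (simp add: c_def)
  have da: "d \<bullet> a = - c" and db: "d \<bullet> b = c"
    by (simp_all add: d_def c_def n' inner_diff_left inner_commute[of b a])
  have d0: "norm d > 0" using ne by (simp add: d_def)
  \<comment> \<open>Along d = b - a the inner products with a and b are -c and c. For this
    \<epsilon> a short step in direction d lies in both test cones: it must be inside \<Omega>
    because of a and outside because of b.\<close>
  define \<epsilon> where "\<epsilon> = c / norm d"
  have \<epsilon>: "\<epsilon> > 0" using c d0 by (simp add: \<epsilon>_def)
  have ev: "\<forall>\<^sub>F y in at q. ((y - q) \<bullet> a \<le> - \<epsilon> * norm (y - q) \<longrightarrow> y \<in> \<Omega>) \<and> ((y - q) \<bullet> b \<ge> \<epsilon> * norm (y - q) \<longrightarrow> y \<notin> \<Omega>)"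
  proof -
    have "\<forall>\<^sub>F y in at q. ((y - q) \<bullet> a \<le> - \<epsilon> * norm (y - q) \<longrightarrow> y \<in> \<Omega>) \<and> ((y - q) \<bullet> a \<ge> \<epsilon> * norm (y - q) \<longrightarrow> y \<notin> \<Omega>)"
      using a \<epsilon> unfolding is_outward_normal_def by blast
    moreover have "\<forall>\<^sub>F y in at q. ((y - q) \<bullet> b \<le> - \<epsilon> * norm (y - q) \<longrightarrow> y \<in> \<Omega>) \<and> ((y - q) \<bullet> b \<ge> \<epsilon> * norm (y - q) \<longrightarrow> y \<notin> \<Omega>)"
      using b \<epsilon> unfolding is_outward_normal_def by blast
    ultimately show ?thesis by eventually_elim blast
  qed
  have "filterlim (\<lambda>n. q + inverse (real (Suc n)) *\<^sub>R d) (at q) sequentially"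
  proof (rule filterlim_atI)
    have "(\<lambda>n. q + inverse (real (Suc n)) *\<^sub>R d) \<longlonglongrightarrow> q + 0 *\<^sub>R d"
      by (intro tendsto_intros LIMSEQ_inverse_real_of_nat)
    then show "(\<lambda>n. q + inverse (real (Suc n)) *\<^sub>R d) \<longlonglongrightarrow> q" by simp
    show "\<forall>\<^sub>F n in sequentially. q + inverse (real (Suc n)) *\<^sub>R d \<noteq> q" using d0 by simp
  qed
  then have "\<forall>\<^sub>F n in sequentially. (let y = q + inverse (real (Suc n)) *\<^sub>R d in
      ((y - q) \<bullet> a \<le> - \<epsilon> * norm (y - q) \<longrightarrow> y \<in> \<Omega>) \<and> ((y - q) \<bullet> b \<ge> \<epsilon> * norm (y - q) \<longrightarrow> y \<notin> \<Omega>))"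
    using ev unfolding filterlim_iff Let_def by blast
  then obtain k where "let y = q + inverse (real (Suc k)) *\<^sub>R d in
      ((y - q) \<bullet> a \<le> - \<epsilon> * norm (y - q) \<longrightarrow> y \<in> \<Omega>) \<and> ((y - q) \<bullet> b \<ge> \<epsilon> * norm (y - q) \<longrightarrow> y \<notin> \<Omega>)"
    unfolding eventually_sequentially by blast
  moreover have "inverse (real (Suc k)) * c = \<epsilon> * norm (inverse (real (Suc k)) *\<^sub>R d)"
    using d0 by (simp add: \<epsilon>_def)
  ultimately show False using da db by (simp add: Let_def)
qed

locale boundary_chart = Lipschitz_graph e \<Phi> L for e :: "'a::euclidean_space" and \<Phi> L +
  fixes \<Omega> :: "'a set" and p :: 'a and r :: real
  assumes open_\<Omega>: "open \<Omega>" and r_pos: "r > 0" and chart: "\<Omega> \<inter> ball p r = below \<inter> ball p r"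
begin

lemma graph_frontier:
  assumes "graph y \<in> ball p r"
  shows "graph y \<in> frontier \<Omega>"
proof -
  let ?q = "graph y"
  have "?q \<notin> below" by (simp add: below_def graph_inner \<Phi>_graph)
  then have "?q \<notin> \<Omega>" using assms chart by blast
  moreover have "?q \<in> closure \<Omega>"
  proof (rule closure_sequential[THEN iffD2])
    let ?x = "\<lambda>n. ?q + (- inverse (real (Suc n))) *\<^sub>R e"
    have "?x \<longlonglongrightarrow> ?q + (- 0) *\<^sub>R e" by (intro tendsto_intros LIMSEQ_inverse_real_of_nat)
    then have lim: "?x \<longlonglongrightarrow> ?q" by simp
    then have "\<forall>\<^sub>F n in sequentially. ?x n \<in> ball p r"
      using assms by (intro topological_tendstoD) auto
    then obtain N where N: "\<And>n. n \<ge> N \<Longrightarrow> ?x n \<in> ball p r" by (auto simp: eventually_sequentially)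
    have b: "?x n \<in> below" for n
      unfolding below_def by (simp add: \<Phi>_invariant inner_add_left graph_inner \<Phi>_graph ee inner_diff_left del: scaleR_minus_left)
    have "?x (n + N) \<in> \<Omega>" for n
    proof -
      have "?x (n + N) \<in> ball p r" by (rule N) simp
      then show ?thesis using b[of "n + N"] chart by blast
    qed
    moreover have "(\<lambda>n. ?x (n + N)) \<longlonglongrightarrow> ?q" by (rule LIMSEQ_ignore_initial_segment[OF lim])
    ultimately show "\<exists>x. (\<forall>n. x n \<in> \<Omega>) \<and> x \<longlonglongrightarrow> ?q" by (intro exI[of _ "\<lambda>n. ?x (n + N)"]) blast
  qed
  ultimately show ?thesis using open_\<Omega> by (simp add: frontier_def interior_open)
qed

text \<open>With N = |N| \<nu>, the height of x over the graph is |N| ((x - q) . \<nu>) - E, where E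
  is the error of linearising \<Phi> at the graph point q. A bound for E with half the constant
  \<epsilon> |N| keeps it strictly below the main term in both cones, so the sign of the height is
  that of (x - q) . \<nu>.\<close>

lemma normal_outward:
  assumes q: "graph y \<in> ball p r" and D: "(\<Phi> has_derivative (\<lambda>h. h \<bullet> (e - normal y))) (at y)"
  shows "normal y = norm (normal y) *\<^sub>R outward_normal \<Omega> (graph y)"
proof -
  let ?q = "graph y" and ?N = "normal y"
  have N0: "norm ?N > 0" using normal_inner_e[OF D] by auto
  define \<nu> where "\<nu> = ?N /\<^sub>R norm ?N"
  have \<nu>N: "?N = norm ?N *\<^sub>R \<nu>" using N0 by (simp add: \<nu>_def)
  have \<nu>: "is_outward_normal \<Omega> ?q \<nu>"
    unfolding is_outward_normal_def
  proof (intro conjI allI impI)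
    show "norm \<nu> = 1" using N0 by (simp add: \<nu>_def)
    fix \<epsilon> :: real assume \<epsilon>: "\<epsilon> > 0"
    have pos: "\<epsilon> * norm ?N / 2 > 0" using \<epsilon> N0 by simp
    obtain d where d: "d > 0" "\<And>x. norm (x - ?q) < d \<Longrightarrow>
        norm (\<Phi> x - \<Phi> ?q - (x - ?q) \<bullet> (e - ?N)) \<le> \<epsilon> * norm ?N / 2 * norm (x - ?q)"
      using derivative_at_graph[OF D] pos unfolding has_derivative_at_alt by blast
    have e1: "\<forall>\<^sub>F x in at ?q. norm (x - ?q) < d"
      unfolding eventually_at using d(1) by (intro exI[of _ d]) (auto simp: dist_norm)
    have e2: "\<forall>\<^sub>F x in at ?q. x \<in> ball p r"
      using q by (intro eventually_at_in_open') auto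
    have e3: "\<forall>\<^sub>F x in at ?q. x \<noteq> ?q" by (simp add: eventually_at_filter)
    show "\<forall>\<^sub>F x in at ?q. ((x - ?q) \<bullet> \<nu> \<le> - \<epsilon> * norm (x - ?q) \<longrightarrow> x \<in> \<Omega>) \<and>
        ((x - ?q) \<bullet> \<nu> \<ge> \<epsilon> * norm (x - ?q) \<longrightarrow> x \<notin> \<Omega>)"
      using e1 e2 e3
    proof eventually_elim
      case (elim x)
      define t where "t = norm (x - ?q)"
      have t: "t > 0" using elim(3) by (simp add: t_def)
      define E where "E = \<Phi> x - \<Phi> ?q - (x - ?q) \<bullet> (e - ?N)"
      have E: "\<bar>E\<bar> \<le> \<epsilon> * norm ?N / 2 * t" using d(2)[OF elim(1)] by (simp add: E_def t_def)
      have key: "x \<bullet> e - \<Phi> x = norm ?N * ((x - ?q) \<bullet> \<nu>) - E"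
      proof -
        have "norm ?N * ((x - ?q) \<bullet> \<nu>) = (x - ?q) \<bullet> ?N" by (subst \<nu>N) simp
        then show ?thesis unfolding E_def
          by (simp add: inner_diff_left inner_diff_right graph_inner \<Phi>_graph)
      qed
      have half: "\<epsilon> * norm ?N / 2 * t < \<epsilon> * norm ?N * t" using \<epsilon> N0 t by simp
      have "x \<in> \<Omega> \<longleftrightarrow> x \<in> below" using chart elim(2) by blast
      then have mem: "x \<in> \<Omega> \<longleftrightarrow> x \<bullet> e - \<Phi> x < 0" by (simp add: below_def)
      show ?case
      proof (intro conjI impI)
        assume "(x - ?q) \<bullet> \<nu> \<le> - \<epsilon> * norm (x - ?q)"
        then have "norm ?N * ((x - ?q) \<bullet> \<nu>) \<le> norm ?N * (- \<epsilon> * t)" unfolding t_def by (rule mult_left_mono) simp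
        also have "\<dots> = - (\<epsilon> * norm ?N * t)" by simp
        finally show "x \<in> \<Omega>" unfolding mem key using E half by linarith
      next
        assume "(x - ?q) \<bullet> \<nu> \<ge> \<epsilon> * norm (x - ?q)"
        then have "norm ?N * (\<epsilon> * t) \<le> norm ?N * ((x - ?q) \<bullet> \<nu>)" unfolding t_def by (rule mult_left_mono) simp
        moreover have "norm ?N * (\<epsilon> * t) = \<epsilon> * norm ?N * t" by simp
        ultimately show "x \<notin> \<Omega>" unfolding mem key using E half by linarith
      qed
    qed
  qed
  have "outward_normal \<Omega> ?q = \<nu>"
    unfolding outward_normal_def
    by (rule the_equality[where P="is_outward_normal \<Omega> ?q", OF \<nu>]) (rule is_outward_normal_unique[OF _ \<nu>])
  then show ?thesis using \<nu>N by simp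
qed

definition base :: "'a set" where
  "base = slab \<inter> graph -` ball p r"

lemma base_borel: "base \<in> sets borel"
  unfolding base_def using measurable_sets[OF graph_borel, of "ball p r"] slab_borel by simp

lemma base_bounded: "bounded base"
  unfolding bounded_iff
proof (intro exI[of _ "norm p + r + 1"] ballI)
  fix y assume y: "y \<in> base"
  have "norm (proj y) = norm (proj (graph y))" unfolding graph_translate proj_add ..
  also have "\<dots> \<le> norm (graph y)" by (rule norm_proj_le')
  also have "\<dots> \<le> norm p + r"
    using y norm_triangle_ineq2[of "graph y" p] by (simp add: base_def dist_norm norm_minus_commute)
  finally have "norm (proj y) \<le> norm p + r" .
  moreover have "norm y \<le> norm (proj y) + norm ((y \<bullet> e) *\<^sub>R e)"
    using norm_triangle_ineq[of "proj y" "(y \<bullet> e) *\<^sub>R e"] proj_decomp[of y] by simp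
  moreover have "norm ((y \<bullet> e) *\<^sub>R e) \<le> 1" using y by (simp add: norm_e slab_def base_def)
  ultimately show "norm y \<le> norm p + r + 1" by simp
qed

text \<open>A density rather than a restriction, so that its measurable sets are all Borel sets and
  the charts share one measurable space.\<close>

definition base_measure :: "'a measure" where
  "base_measure = density lborel (\<lambda>y. ennreal (indicator base y))"

lemma sets_base_measure [simp]: "sets base_measure = sets borel"
  by (simp add: base_measure_def)

lemma AE_base_measure: "(AE y in base_measure. P y) \<longleftrightarrow> (AE y in lborel. y \<in> base \<longrightarrow> P y)"
  unfolding base_measure_def using base_borel
  by (subst AE_density) (auto simp: indicator_def)

lemma emeasure_base_measure:
  assumes "A \<in> sets borel"
  shows "emeasure base_measure A = emeasure lborel (base \<inter> A)"
proof -
  have "emeasure base_measure A = (\<integral>\<^sup>+y. ennreal (indicator base y) * indicator A y \<partial>lborel)"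
    unfolding base_measure_def using assms base_borel by (intro emeasure_density) auto
  also have "\<dots> = (\<integral>\<^sup>+y. indicator (base \<inter> A) y \<partial>lborel)"
    by (intro nn_integral_cong) (simp add: indicator_def)
  also have "\<dots> = emeasure lborel (base \<inter> A)" using assms base_borel by simp
  finally show ?thesis .
qed

lemma finite_base_measure: "finite_measure base_measure"
proof (rule finite_measureI)
  have "emeasure base_measure (space base_measure) = emeasure lborel base"
    using emeasure_base_measure[of UNIV] by (simp add: base_measure_def)
  then show "emeasure base_measure (space base_measure) \<noteq> \<infinity>"
    using emeasure_bounded_finite[OF base_bounded] by auto
qed

lemma integral_base_measure:
  fixes h :: "'a \<Rightarrow> real"
  assumes "h \<in> borel_measurable borel"
  shows "(LINT y|base_measure. h y) = (LINT y|lborel. indicator base y * h y)"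
  unfolding base_measure_def using assms base_borel by (subst integral_density) auto

lemma chart_hausdorff:
  assumes A: "A \<in> sets borel"
  shows "ennreal chart_const * emeasure base_measure (graph -` A) \<le> hausdorff_outer (DIM('a) - 1) A"
proof -
  have gA: "graph -` A \<in> sets borel" using measurable_sets[OF graph_borel A] by simp
  have "emeasure base_measure (graph -` A) \<le> emeasure lborel (slab \<inter> graph -` A)"
    unfolding emeasure_base_measure[OF gA] by (rule emeasure_mono) (use gA slab_borel in \<open>auto simp: base_def\<close>)
  then have "ennreal chart_const * emeasure base_measure (graph -` A) \<le> ennreal chart_const * emeasure lborel (slab \<inter> graph -` A)"
    by (rule mult_left_mono) simp
  also have "\<dots> \<le> hausdorff_outer (DIM('a) - 1) A" by (rule hausdorff_graph_ge[OF A])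
  finally show ?thesis .
qed

lemma chart_normal_AE:
  "AE y in base_measure. graph y \<in> frontier \<Omega> \<and> normal y = norm (normal y) *\<^sub>R outward_normal \<Omega> (graph y)"
  unfolding AE_base_measure using \<Phi>_derivative_AE
  by eventually_elim (auto simp: base_def intro: graph_frontier normal_outward)

lemma chart_normal_bounded: "\<exists>K. AE y in base_measure. norm (normal y) \<le> K"
proof -
  have "AE y in lborel. \<forall>i\<in>Basis. \<bar>dir_deriv \<Phi> i y\<bar> \<le> L * norm i"
  proof (intro AE_finite_allI finite_Basis)
    fix i
    show "AE y in lborel. \<bar>dir_deriv \<Phi> i y\<bar> \<le> L * norm i"
      using diff_quotient_Cauchy_AE[of \<Phi> L i, OF \<Phi>_Lipschitz] by eventually_elim (rule dir_deriv_bounded(1)[OF \<Phi>_Lipschitz])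
  qed
  then have "AE y in lborel. norm (normal y) \<le> 1 + (\<Sum>i\<in>(Basis :: 'a set). L)"
  proof eventually_elim
    case (elim y)
    have "norm (\<Sum>i\<in>Basis. dir_deriv \<Phi> i y *\<^sub>R i) \<le> (\<Sum>i\<in>(Basis :: 'a set). L)"
      by (rule sum_norm_le) (use elim in auto)
    then show ?case unfolding normal_def
      using norm_triangle_ineq4[of e "\<Sum>i\<in>Basis. dir_deriv \<Phi> i y *\<^sub>R i"] norm_e by linarith
  qed
  then show ?thesis unfolding AE_base_measure by (intro exI[of _ "1 + (\<Sum>i\<in>(Basis :: 'a set). L)"]) auto
qed

text \<open>\<open>f\<close> vanishes off the ball of half the radius, and within the full ball
  \<Omega> is the region below the graph; so both the volume integral and the surface integral may
  be taken for that model region.\<close>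

lemma chart_divergence:
  assumes f: "smooth f" "\<And>x. x \<notin> cball p (r / 2) \<Longrightarrow> f x = 0" and i: "i \<in> Basis"
  shows "(LINT x|lebesgue_on \<Omega>. partial i f x) = (LINT y|base_measure. f (graph y) * (normal y \<bullet> i))"
proof -
  have z: "f x = 0" if "norm p + r < norm x" for x
  proof (rule f(2))
    have "norm x - norm p \<le> norm (p - x)" using norm_triangle_ineq3[of x p] by (simp add: norm_minus_commute)
    then show "x \<notin> cball p (r / 2)" using that r_pos by (simp add: dist_norm)
  qed
  have cf: "continuous_on UNIV f" using f(1) by (rule smooth_continuous_on)
  have "(LINT x|lebesgue_on \<Omega>. partial i f x) = (LINT x|lborel. partial i f x * indicator \<Omega> x)"
    using open_\<Omega> by (intro integral_lebesgue_on_indicator smooth_borel_measurable smooth_partial f(1) i) auto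
  also have "(\<lambda>x. partial i f x * indicator \<Omega> x) = (\<lambda>x. partial i f x * indicator below x)"
  proof
    fix x
    show "partial i f x * indicator \<Omega> x = partial i f x * indicator below x"
    proof (cases "x \<in> ball p r")
      case True
      then have "x \<in> \<Omega> \<longleftrightarrow> x \<in> below" using chart by blast
      then show ?thesis by (simp add: indicator_def)
    next
      case False
      have "open (- cball p (r / 2))" "x \<in> - cball p (r / 2)" using False r_pos by auto
      then have "(f has_derivative (\<lambda>h. 0)) (at x)"
        using f(2) by (intro has_derivative_transform_within_open[OF has_derivative_const[of 0]]) auto
      then have "partial i f x = 0" by (rule partial_eqI)
      then show ?thesis by simp
    qed
  qed
  also have "(LINT x|lborel. partial i f x * indicator below x) =
      (LINT y|lborel. indicator slab y * (f (graph y) * (normal y \<bullet> i)))"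
    by (rule divergence_below_graph[where R="norm p + r", OF f(1) z i])
  also have "(\<lambda>y. indicator slab y * (f (graph y) * (normal y \<bullet> i))) =
      (\<lambda>y. indicator base y * (f (graph y) * (normal y \<bullet> i)))"
  proof
    fix y
    show "indicator slab y * (f (graph y) * (normal y \<bullet> i)) = indicator base y * (f (graph y) * (normal y \<bullet> i))"
    proof (cases "graph y \<in> ball p r")
      case True
      then show ?thesis by (simp add: base_def indicator_def)
    next
      case False
      then have "f (graph y) = 0" using r_pos by (intro f(2)) auto
      then show ?thesis by simp
    qed
  qed
  also have "(LINT y|lborel. indicator base y * (f (graph y) * (normal y \<bullet> i))) =
      (LINT y|base_measure. f (graph y) * (normal y \<bullet> i))"
  proof (rule integral_base_measure[symmetric])
    show "(\<lambda>y. f (graph y) * (normal y \<bullet> i)) \<in> borel_measurable borel"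
      by (intro borel_measurable_times borel_measurable_inner normal_measurable borel_measurable_const
          measurable_compose[OF graph_borel] smooth_borel_measurable f(1))
  qed
  finally show ?thesis .
qed

end

section \<open>Localisation near the boundary\<close>

lemma has_derivative_cut:
  fixes h :: "'a::euclidean_space \<Rightarrow> real"
  assumes \<Omega>: "open \<Omega>" and U: "open U" "frontier \<Omega> \<subseteq> U" "\<And>x. x \<in> U \<Longrightarrow> h x = 0"
    and D: "\<And>x. (h has_derivative D x) (at x)"
  shows "((\<lambda>x. if x \<in> \<Omega> then h x else 0) has_derivative (if x \<in> \<Omega> then D x else (\<lambda>v. 0))) (at x)"
proof (cases "x \<in> \<Omega>")
  case True
  then show ?thesis
    by simp (rule has_derivative_transform_within_open[OF D \<Omega> True], simp)
next
  case False
  let ?V = "U \<union> - closure \<Omega>"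
  have "x \<in> ?V" using False U(2) \<Omega> by (auto simp: frontier_def interior_open)
  moreover have "open ?V" using U(1) by auto
  ultimately have "((\<lambda>x. if x \<in> \<Omega> then h x else 0) has_derivative (\<lambda>v. 0)) (at x)"
    using U(3) closure_subset[of \<Omega>]
    by (intro has_derivative_transform_within_open[OF has_derivative_const[of 0], of ?V]) auto
  then show ?thesis using False by simp
qed

text \<open>As \<open>h\<close> vanishes near the frontier, cutting it off at \<Omega> creates no
  jump, and the derivatives of the cut function are the cut derivatives. One order is given away so
  that continuity can be read off from differentiability.\<close>

lemma C_k_cut:
  fixes h :: "'a::euclidean_space \<Rightarrow> real"
  assumes \<Omega>: "open \<Omega>" and U: "open U" "frontier \<Omega> \<subseteq> U"
  shows "C_k (Suc k) h \<Longrightarrow> (\<And>x. x \<in> U \<Longrightarrow> h x = 0) \<Longrightarrow> C_k k (\<lambda>x. if x \<in> \<Omega> then h x else 0)"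
proof (induction k arbitrary: h)
  case 0
  have "isCont (\<lambda>x. if x \<in> \<Omega> then h x else 0) x" for x
    by (rule has_derivative_continuous[OF has_derivative_cut[OF \<Omega> U 0(2) C_k_Suc_has_derivative[OF 0(1)]]])
  then show ?case by (simp add: continuous_on_eq_continuous_at)
next
  case (Suc k)
  show ?case
  proof (rule C_k_SucI[OF has_derivative_cut[OF \<Omega> U Suc.prems(2) C_k_Suc_has_derivative[OF Suc.prems(1)]]])
    fix i :: 'a assume i: "i \<in> Basis"
    have "C_k k (\<lambda>x. if x \<in> \<Omega> then partial i h x else 0)"
    proof (rule Suc.IH[OF C_k_Suc_partial[OF Suc.prems(1) i]])
      fix x assume "x \<in> U"
      then have "(h has_derivative (\<lambda>v. 0)) (at x)"
        using Suc.prems(2) U(1)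
        by (intro has_derivative_transform_within_open[OF has_derivative_const[of 0], of U]) auto
      then show "partial i h x = 0" by (rule partial_eqI)
    qed
    also have "(\<lambda>x. if x \<in> \<Omega> then partial i h x else 0) =
        (\<lambda>x. (if x \<in> \<Omega> then (\<lambda>v. \<Sum>j\<in>Basis. v \<bullet> j * partial j h x) else (\<lambda>v. 0)) i)"
      using sum_inner_Basis[OF i] by auto
    finally show "C_k k (\<lambda>x. (if x \<in> \<Omega> then (\<lambda>v. \<Sum>j\<in>Basis. v \<bullet> j * partial j h x) else (\<lambda>v. 0)) i)" .
  qed
qed

text \<open>Extension by zero from \<Omega> yields a smooth function of bounded support, whose
  partial derivatives integrate to 0 over the whole space.\<close>

lemma (in bounded_open) divergence_interior:
  assumes h: "smooth h" and U: "open U" "frontier \<Omega> \<subseteq> U" "\<And>x. x \<in> U \<Longrightarrow> h x = 0" and i: "i \<in> Basis"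
  shows "(LINT x|\<L>. partial i h x) = 0"
proof -
  let ?g = "\<lambda>x. if x \<in> \<Omega> then h x else 0"
  have g: "smooth ?g" unfolding smooth_def
  proof
    fix k
    show "C_k k ?g" by (rule C_k_cut[OF open_\<Omega> U(1,2) _ U(3)]) (use h in \<open>simp add: smooth_def del: C_k.simps\<close>)
  qed
  have pg: "partial i ?g x = (if x \<in> \<Omega> then partial i h x else 0)" for x
    by (rule partial_eqI[OF has_derivative_cut[OF open_\<Omega> U smooth_has_derivative[OF h]], THEN trans])
      (cases "x \<in> \<Omega>", simp_all add: sum_inner_Basis[OF i])
  obtain R where R: "\<And>x. x \<in> \<Omega> \<Longrightarrow> norm x \<le> R" using bounded_\<Omega> unfolding bounded_iff by blast
  have "(LINT x|\<L>. partial i h x) = (LINT x|\<L>. partial i ?g x)"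
    by (intro Bochner_Integration.integral_cong refl) (simp add: pg)
  also have "\<dots> = (LINT x|lborel. partial i ?g x)"
    by (rule integral_lebesgue_on_eq_lborel[OF \<Omega>_sets smooth_borel_measurable[OF smooth_partial[OF g i]]])
      (simp add: pg)
  also have "\<dots> = 0"
    by (rule integral_partial_eq_0[where R=R, OF g _ i]) (use R in fastforce)
  finally show ?thesis .
qed

lemma smooth_cutoff:
  assumes "r > 0"
  obtains \<zeta> :: "'a::euclidean_space \<Rightarrow> real" where "smooth \<zeta>" "\<And>x. x \<in> ball p (r / 4) \<Longrightarrow> \<zeta> x = 1"
    "\<And>x. x \<notin> cball p (r / 2) \<Longrightarrow> \<zeta> x = 0"
proof
  \<comment> \<open>Rescales the squared distance so that the step runs exactly between the radii
    r/4 and r/2.\<close>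
  define k where "k = inverse ((r / 2)\<^sup>2 - (r / 4)\<^sup>2)"
  have k: "k > 0" "((r / 2)\<^sup>2 - (r / 4)\<^sup>2) * k = 1"
    using assms by (simp_all add: k_def power2_eq_square)
  let ?\<zeta> = "\<lambda>x. 1 - smooth_step (((norm (x - p))\<^sup>2 - (r / 4)\<^sup>2) * k)"
  show "smooth ?\<zeta>"
    by (rule smooth_diff[OF smooth_const smooth_compose[OF smooth_smooth_step
          smooth_mult[OF smooth_diff[OF smooth_norm_sq smooth_const] smooth_const]]])
  show "?\<zeta> x = 1" if "x \<in> ball p (r / 4)" for x
  proof -
    have "norm (x - p) \<le> r / 4" using that by (simp add: dist_norm norm_minus_commute)
    then have "(norm (x - p))\<^sup>2 \<le> (r / 4)\<^sup>2" by (intro power_mono) auto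
    then show ?thesis using k by (simp add: smooth_step_eq_0 mult_nonpos_nonneg)
  qed
  show "?\<zeta> x = 0" if "x \<notin> cball p (r / 2)" for x
  proof -
    have "r / 2 \<le> norm (x - p)" using that by (simp add: dist_norm norm_minus_commute)
    then have "(r / 2)\<^sup>2 \<le> (norm (x - p))\<^sup>2" using assms by (intro power_mono) auto
    then have "((r / 2)\<^sup>2 - (r / 4)\<^sup>2) * k \<le> ((norm (x - p))\<^sup>2 - (r / 4)\<^sup>2) * k"
      using k by (intro mult_right_mono) auto
    then show ?thesis using k(2) by (simp only: smooth_step_eq_1)
  qed
qed

text \<open>When the ball of \<open>q\<close> is added, the old functions are multiplied by 1 -
  \<zeta>. The new sum \<zeta> + (1 - \<zeta>) \<Sum>\<eta>_p equals 1 both where \<zeta> = 1 and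
  where the old sum was 1, so no normalising division occurs.\<close>

lemma smooth_partition:
  fixes \<rho> :: "'a::euclidean_space \<Rightarrow> real"
  assumes "finite F" "\<And>p. p \<in> F \<Longrightarrow> \<rho> p > 0"
  shows "\<exists>\<eta>. (\<forall>p\<in>F. smooth (\<eta> p) \<and> (\<forall>x. x \<notin> cball p (\<rho> p / 2) \<longrightarrow> \<eta> p x = (0::real))) \<and>
    (\<forall>x\<in>(\<Union>p\<in>F. ball p (\<rho> p / 4)). (\<Sum>p\<in>F. \<eta> p x) = 1)"
  using assms
proof (induction F rule: finite_induct)
  case empty
  show ?case by auto
next
  case (insert q F)
  have "\<exists>\<eta>. (\<forall>p\<in>F. smooth (\<eta> p) \<and> (\<forall>x. x \<notin> cball p (\<rho> p / 2) \<longrightarrow> \<eta> p x = (0::real))) \<and>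
    (\<forall>x\<in>(\<Union>p\<in>F. ball p (\<rho> p / 4)). (\<Sum>p\<in>F. \<eta> p x) = 1)"
    by (rule insert.IH[OF insert.prems[OF insertI2]])
  then obtain \<eta> where \<eta>': "\<forall>p\<in>F. smooth (\<eta> p) \<and> (\<forall>x. x \<notin> cball p (\<rho> p / 2) \<longrightarrow> \<eta> p x = (0::real))"
      "\<forall>x\<in>(\<Union>p\<in>F. ball p (\<rho> p / 4)). (\<Sum>p\<in>F. \<eta> p x) = 1" by (elim exE conjE)
  note \<eta> = \<eta>'(1)[THEN bspec, THEN conjunct1] \<eta>'(1)[THEN bspec, THEN conjunct2, rule_format] \<eta>'(2)[THEN bspec]
  obtain \<zeta> :: "'a \<Rightarrow> real" where \<zeta>: "smooth \<zeta>" "\<And>x. x \<in> ball q (\<rho> q / 4) \<Longrightarrow> \<zeta> x = 1"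
    "\<And>x. x \<notin> cball q (\<rho> q / 2) \<Longrightarrow> \<zeta> x = 0"
    by (rule smooth_cutoff[OF insert.prems[OF insertI1], where p=q]) blast
  define \<eta>' where "\<eta>' p = (if p = q then \<zeta> else (\<lambda>x. (1 - \<zeta> x) * \<eta> p x))" for p
  have sum: "(\<Sum>p\<in>insert q F. \<eta>' p x) = \<zeta> x + (1 - \<zeta> x) * (\<Sum>p\<in>F. \<eta> p x)" for x
  proof -
    have "(\<Sum>p\<in>F. \<eta>' p x) = (\<Sum>p\<in>F. (1 - \<zeta> x) * \<eta> p x)"
      using insert.hyps by (intro sum.cong refl) (auto simp: \<eta>'_def)
    then show ?thesis using insert.hyps by (simp add: \<eta>'_def sum_distrib_left)
  qed
  show ?case
  proof (intro exI[of _ \<eta>'] conjI ballI allI impI)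
    fix p assume p: "p \<in> insert q F"
    show "smooth (\<eta>' p)"
    proof (cases "p = q")
      case True
      then show ?thesis using \<zeta>(1) by (simp add: \<eta>'_def)
    next
      case False
      then have pF: "p \<in> F" using p by blast
      have "smooth (\<lambda>x. (1 - \<zeta> x) * \<eta> p x)"
        by (rule smooth_mult[OF smooth_diff[OF smooth_const \<zeta>(1)] \<eta>(1)[OF pF]])
      then show ?thesis using False by (simp add: \<eta>'_def)
    qed
    show "\<eta>' p x = 0" if "x \<notin> cball p (\<rho> p / 2)" for x
    proof (cases "p = q")
      case True
      then show ?thesis using \<zeta>(3)[of x] that by (simp add: \<eta>'_def)
    next
      case False
      then have pF: "p \<in> F" using p by blast
      show ?thesis using \<eta>(2)[OF pF that] False by (simp add: \<eta>'_def)
    qed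
  next
    fix x assume x: "x \<in> (\<Union>p\<in>insert q F. ball p (\<rho> p / 4))"
    show "(\<Sum>p\<in>insert q F. \<eta>' p x) = 1"
    proof (cases "x \<in> ball q (\<rho> q / 4)")
      case True
      then show ?thesis unfolding sum using \<zeta>(2) by simp
    next
      case False
      then have "x \<in> (\<Union>p\<in>F. ball p (\<rho> p / 4))" using x by auto
      then show ?thesis unfolding sum using \<eta>(3) by simp
    qed
  qed
qed

section \<open>Transfer of the surface measure to the charts\<close>

context bounded_open
begin

text \<open>A piece of the boundary is parametrised by \<open>\<gamma>\<close> over the measure space \<open>\<nu>\<close>, and the surface element
  is contained in the length of the normal field \<open>N\<close>.\<close>

definition boundary_data :: "'a measure \<Rightarrow> ('a \<Rightarrow> 'a) \<Rightarrow> ('a \<Rightarrow> 'a) \<Rightarrow> real \<Rightarrow> bool" where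
  "boundary_data \<nu> \<gamma> N \<kappa> \<longleftrightarrow> sets \<nu> = sets borel \<and> finite_measure \<nu> \<and>
     \<gamma> \<in> borel_measurable borel \<and> N \<in> borel_measurable borel \<and> (\<exists>K. AE y in \<nu>. norm (N y) \<le> K) \<and>
     0 < \<kappa> \<and> (\<forall>A\<in>sets borel. ennreal \<kappa> * emeasure \<nu> (\<gamma> -` A) \<le> hausdorff_outer (DIM('a) - 1) A) \<and>
     (AE y in \<nu>. \<gamma> y \<in> frontier \<Omega> \<and> N y = norm (N y) *\<^sub>R outward_normal \<Omega> (\<gamma> y))"

lemma boundary_dataD:
  assumes b: "boundary_data \<nu> \<gamma> N \<kappa>"
  shows "sets \<nu> = sets borel" "finite_measure \<nu>" "\<gamma> \<in> measurable \<nu> borel" "N \<in> measurable \<nu> borel"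
    "\<exists>K. AE y in \<nu>. norm (N y) \<le> K" "0 < \<kappa>"
    "\<And>A. A \<in> sets borel \<Longrightarrow> ennreal \<kappa> * emeasure \<nu> (\<gamma> -` A) \<le> hausdorff_outer (DIM('a) - 1) A"
    "AE y in \<nu>. \<gamma> y \<in> frontier \<Omega>" "AE y in \<nu>. N y = norm (N y) *\<^sub>R outward_normal \<Omega> (\<gamma> y)"
proof -
  note b = b[unfolded boundary_data_def]
  show s: "sets \<nu> = sets borel" and "finite_measure \<nu>" "\<exists>K. AE y in \<nu>. norm (N y) \<le> K" "0 < \<kappa>"
    using b by - (elim conjE, assumption)+
  have "\<gamma> \<in> measurable borel borel" "N \<in> measurable borel borel" using b by - (elim conjE, assumption)+
  then show "\<gamma> \<in> measurable \<nu> borel" "N \<in> measurable \<nu> borel"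
    by (simp_all only: measurable_cong_sets[OF s refl])
  have "\<forall>A\<in>sets borel. ennreal \<kappa> * emeasure \<nu> (\<gamma> -` A) \<le> hausdorff_outer (DIM('a) - 1) A"
    using b by - (elim conjE, assumption)
  then show "\<And>A. A \<in> sets borel \<Longrightarrow> ennreal \<kappa> * emeasure \<nu> (\<gamma> -` A) \<le> hausdorff_outer (DIM('a) - 1) A"
    by (rule bspec)
  have "AE y in \<nu>. \<gamma> y \<in> frontier \<Omega> \<and> N y = norm (N y) *\<^sub>R outward_normal \<Omega> (\<gamma> y)"
    using b by - (elim conjE, assumption)
  then show "AE y in \<nu>. \<gamma> y \<in> frontier \<Omega>" "AE y in \<nu>. N y = norm (N y) *\<^sub>R outward_normal \<Omega> (\<gamma> y)"
    by (eventually_elim, blast)+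
qed

text \<open>Composing the local graph function with the projection along \<open>e\<close> makes it
  constant in that direction and keeps its Lipschitz constant. The chart data are hidden behind
  existential quantifiers so that charts with different directions can be collected in one finite
  family.\<close>

lemma boundary_chart_exists:
  assumes \<Omega>: "bounded_Lipschitz_domain \<Omega>" and p: "p \<in> frontier \<Omega>"
  shows "\<exists>r>0. \<exists>\<nu> \<gamma> N \<kappa>. boundary_data \<nu> \<gamma> N \<kappa> \<and>
    (\<forall>f. smooth f \<longrightarrow> (\<forall>x. x \<notin> cball p (r / 2) \<longrightarrow> f x = 0) \<longrightarrow> (\<forall>i\<in>Basis.
      (LINT x|\<L>. partial i f x) = (LINT y|\<nu>. f (\<gamma> y) * (N y \<bullet> i))))"
proof -
  obtain r e \<phi> C where r: "r > 0" and e: "norm e = 1" and \<phi>: "C-lipschitz_on {y. y \<bullet> e = 0} \<phi>"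
    and eq: "\<Omega> \<inter> ball p r = {y \<in> ball p r. y \<bullet> e < \<phi> (y - (y \<bullet> e) *\<^sub>R e)}"
    using \<Omega> p unfolding bounded_Lipschitz_domain_def by blast
  interpret unit_direction e by standard (rule e)
  define \<Phi> where "\<Phi> y = \<phi> (proj y)" for y
  have C0: "0 \<le> C" using \<phi> by (rule lipschitz_on_nonneg)
  interpret Lipschitz_graph e \<Phi> C
  proof
    fix x y :: 'a and s :: real
    have "dist (\<phi> (proj x)) (\<phi> (proj y)) \<le> C * dist (proj x) (proj y)"
      by (rule lipschitz_onD[OF \<phi>]) (simp_all add: proj_inner)
    also have "\<dots> \<le> C * norm (x - y)"
      using norm_proj_le'[of "x - y"] C0 by (intro mult_left_mono) (simp_all add: dist_norm proj_diff)
    finally show "\<bar>\<Phi> x - \<Phi> y\<bar> \<le> C * norm (x - y)" by (simp add: \<Phi>_def dist_real_def)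
    show "\<Phi> (y + s *\<^sub>R e) = \<Phi> y" by (simp add: \<Phi>_def proj_add)
  qed
  interpret boundary_chart e \<Phi> C \<Omega> p r
  proof
    show "\<Omega> \<inter> ball p r = below \<inter> ball p r" unfolding eq by (auto simp: below_def \<Phi>_def proj_def)
  qed (fact open_\<Omega> r)+
  have "boundary_data base_measure graph normal chart_const"
    unfolding boundary_data_def
    using finite_base_measure graph_borel normal_measurable chart_normal_bounded chart_const_pos
      chart_hausdorff chart_normal_AE by auto
  then show ?thesis using r chart_divergence by blast
qed

text \<open>The measure of a preimage under the parametrisation is at most a multiple of the
  Hausdorff measure, so surface null sets pull back to null sets. This brings boundary conditions
  into the charts.\<close>

lemma boundary_data_AE:
  assumes b: "boundary_data \<nu> \<gamma> N \<kappa>" and P: "AE x in \<S>. P x"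
  shows "AE y in \<nu>. P (\<gamma> y)"
proof -
  have fr: "frontier \<Omega> \<in> sets borel" by simp
  obtain Z where Z: "{x \<in> space \<S>. \<not> P x} \<subseteq> Z" "emeasure \<S> Z = 0"
      "Z \<in> sets \<S>"
    using P by (rule AE_E)
  have Zb: "Z \<in> sets borel" "Z \<subseteq> frontier \<Omega>"
    using Z(3) fr unfolding surface_measure_def by (auto simp: sets_restrict_space_iff)
  have "hausdorff_outer (DIM('a) - 1) Z = emeasure \<S> Z"
    unfolding surface_measure_def using Zb fr
    by (subst emeasure_restrict_space) (simp_all add: emeasure_hausdorff_measure)
  then have "ennreal \<kappa> * emeasure \<nu> (\<gamma> -` Z) = 0"
    using boundary_dataD(7)[OF b Zb(1)] Z(2) by simp
  then have "emeasure \<nu> (\<gamma> -` Z) = 0" using boundary_dataD(6)[OF b] by simp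
  moreover have "\<gamma> -` Z \<in> sets \<nu>"
    using measurable_sets[OF boundary_dataD(3)[OF b] Zb(1)] sets_eq_imp_space_eq[OF boundary_dataD(1)[OF b]] by simp
  ultimately have "AE y in \<nu>. y \<notin> \<gamma> -` Z" by (intro AE_not_in null_setsI)
  moreover have "AE y in \<nu>. \<gamma> y \<in> frontier \<Omega>" by (rule boundary_dataD(8)[OF b])
  ultimately show ?thesis
  proof eventually_elim
    case (elim y)
    then show ?case using Z(1) by (auto simp: surface_measure_def space_restrict_space)
  qed
qed

lemma boundary_data_nn_integral:
  fixes h :: "'a \<Rightarrow> ennreal"
  assumes b: "boundary_data \<nu> \<gamma> N \<kappa>" and h: "h \<in> borel_measurable \<S>"
  shows "ennreal \<kappa> * (\<integral>\<^sup>+y. h (\<gamma> y) \<partial>\<nu>) \<le> (\<integral>\<^sup>+x. h x \<partial>\<S>)"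
proof -
  let ?H = "hausdorff_measure (DIM('a) - 1) :: 'a measure"
  have fr: "frontier \<Omega> \<inter> space ?H \<in> sets ?H" by simp
  define h' where "h' x = h x * indicator (frontier \<Omega>) x" for x
  have h': "h' \<in> borel_measurable borel"
    using h unfolding surface_measure_def borel_measurable_restrict_space_iff_ennreal[OF fr]
    by (simp add: h'_def[abs_def] measurable_cong_sets[OF sets_hausdorff_measure refl])
  note g = boundary_dataD(3)[OF b] and sn = boundary_dataD(1)[OF b]
  let ?D = "distr \<nu> borel \<gamma>"
  have "AE y in \<nu>. h (\<gamma> y) = h' (\<gamma> y)"
  proof -
    have "AE y in \<nu>. \<gamma> y \<in> frontier \<Omega>" by (rule boundary_dataD(8)[OF b])
    then show ?thesis by eventually_elim (simp add: h'_def)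
  qed
  then have "(\<integral>\<^sup>+y. h (\<gamma> y) \<partial>\<nu>) = (\<integral>\<^sup>+y. h' (\<gamma> y) \<partial>\<nu>)" by (rule nn_integral_cong_AE)
  also have "\<dots> = (\<integral>\<^sup>+x. h' x \<partial>?D)" by (rule nn_integral_distr[OF g, symmetric]) (simp add: h')
  finally have "ennreal \<kappa> * (\<integral>\<^sup>+y. h (\<gamma> y) \<partial>\<nu>) = (\<integral>\<^sup>+x. h' x \<partial>scale_measure (ennreal \<kappa>) ?D)"
    using h' by (subst nn_integral_scale_measure) simp_all
  also have "\<dots> \<le> (\<integral>\<^sup>+x. h' x \<partial>?H)"
  proof (rule nn_integral_mono_measure)
    show s: "sets (scale_measure (ennreal \<kappa>) ?D) = sets ?H" by simp
    have spn: "space \<nu> = UNIV" using sets_eq_imp_space_eq[OF sn] by simp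
    show "scale_measure (ennreal \<kappa>) ?D \<le> ?H"
      unfolding le_measure[OF s]
    proof
      fix A assume "A \<in> sets (scale_measure (ennreal \<kappa>) ?D)"
      then have A: "A \<in> sets borel" by simp
      have "emeasure (scale_measure (ennreal \<kappa>) ?D) A = ennreal \<kappa> * emeasure \<nu> (\<gamma> -` A)"
        using A by (simp add: emeasure_distr[OF g] spn)
      also have "\<dots> \<le> hausdorff_outer (DIM('a) - 1) A" by (rule boundary_dataD(7)[OF b A])
      also have "\<dots> = emeasure ?H A" using A by (rule emeasure_hausdorff_measure[symmetric])
      finally show "emeasure (scale_measure (ennreal \<kappa>) ?D) A \<le> emeasure ?H A" .
    qed
  qed
  also have "\<dots> = (\<integral>\<^sup>+x. h x \<partial>\<S>)"
    unfolding surface_measure_def h'_def by (rule nn_integral_restrict_space[OF fr, symmetric])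
  finally show ?thesis .
qed

lemma boundary_data_L2_sqnorm:
  fixes f :: "'a \<Rightarrow> real"
  assumes b: "boundary_data \<nu> \<gamma> N \<kappa>" and f: "f \<in> borel_measurable \<S>"
  shows "L2_sqnorm \<nu> (\<lambda>y. f (\<gamma> y)) \<le> ennreal (inverse \<kappa>) * L2_sqnorm \<S> f"
proof -
  note \<kappa> = boundary_dataD(6)[OF b]
  have "L2_sqnorm \<nu> (\<lambda>y. f (\<gamma> y)) = ennreal (inverse \<kappa>) * (ennreal \<kappa> * L2_sqnorm \<nu> (\<lambda>y. f (\<gamma> y)))"
    using \<kappa> by (simp add: mult.assoc[symmetric] ennreal_mult[symmetric])
  also have "\<dots> \<le> ennreal (inverse \<kappa>) * L2_sqnorm \<S> f"
  proof (rule mult_left_mono)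
    have "(\<lambda>x. ennreal ((norm (f x))\<^sup>2)) \<in> borel_measurable \<S>" using f by measurable
    from boundary_data_nn_integral[OF b this]
    show "ennreal \<kappa> * L2_sqnorm \<nu> (\<lambda>y. f (\<gamma> y)) \<le> L2_sqnorm \<S> f"
      unfolding L2_sqnorm_def .
  qed simp
  finally show ?thesis .
qed

text \<open>A boundary function is measurable only on the frontier. Extended by zero it is Borel on
  the whole space and can be composed with a parametrisation, which hits the frontier only almost
  everywhere.\<close>

definition boundary_ext :: "('a \<Rightarrow> real) \<Rightarrow> 'a \<Rightarrow> real" where
  "boundary_ext g x = g x * indicator (frontier \<Omega>) x"

lemma boundary_ext_measurable:
  assumes "g \<in> borel_measurable \<S>"
  shows "boundary_ext g \<in> borel_measurable borel"
proof -
  let ?H = "hausdorff_measure (DIM('a) - 1) :: 'a::euclidean_space measure"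
  have fr: "frontier \<Omega> \<inter> space ?H \<in> sets ?H" by simp
  show ?thesis
    using assms unfolding surface_measure_def borel_measurable_restrict_space_iff[OF fr]
    by (simp add: boundary_ext_def[abs_def] measurable_cong_sets[OF sets_hausdorff_measure refl] mult.commute)
qed

lemma boundary_data_L2_conv:
  assumes b: "boundary_data \<nu> \<gamma> N \<kappa>" and g: "g \<in> L2 \<S>"
    and \<phi>: "\<And>k. \<phi> k \<in> borel_measurable \<S>" and c: "L2_conv \<S> \<phi> g"
  shows "(\<lambda>y. boundary_ext g (\<gamma> y)) \<in> L2 \<nu>"
    "L2_conv \<nu> (\<lambda>k y. \<phi> k (\<gamma> y)) (\<lambda>y. boundary_ext g (\<gamma> y))"
proof -
  note mg = L2_measurable[OF g]
  have "AE y in \<nu>. \<gamma> y \<in> frontier \<Omega>" by (rule boundary_dataD(8)[OF b])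
  then have ae: "AE y in \<nu>. boundary_ext g (\<gamma> y) = g (\<gamma> y)"
    by eventually_elim (simp add: boundary_ext_def)
  note \<gamma> = boundary_dataD(3)[OF b]
  have "L2_sqnorm \<nu> (\<lambda>y. boundary_ext g (\<gamma> y)) = L2_sqnorm \<nu> (\<lambda>y. g (\<gamma> y))"
    by (rule L2_sqnorm_cong_AE[OF ae])
  also have "\<dots> \<le> ennreal (inverse \<kappa>) * L2_sqnorm \<S> g"
    by (rule boundary_data_L2_sqnorm[OF b mg])
  also have "\<dots> < \<infinity>" using g by (simp add: L2_iff ennreal_mult_less_top)
  finally show "(\<lambda>y. boundary_ext g (\<gamma> y)) \<in> L2 \<nu>"
    using measurable_compose[OF \<gamma> boundary_ext_measurable[OF mg]] by (simp add: L2_iff)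
  have le: "L2_sqnorm \<nu> (\<lambda>y. \<phi> k (\<gamma> y) - boundary_ext g (\<gamma> y))
      \<le> ennreal (inverse \<kappa>) * L2_sqnorm \<S> (\<lambda>x. \<phi> k x - g x)" for k
  proof -
    have "L2_sqnorm \<nu> (\<lambda>y. \<phi> k (\<gamma> y) - boundary_ext g (\<gamma> y)) = L2_sqnorm \<nu> (\<lambda>y. \<phi> k (\<gamma> y) - g (\<gamma> y))"
      by (rule L2_sqnorm_cong_AE) (use ae in eventually_elim, simp)
    also have "\<dots> \<le> ennreal (inverse \<kappa>) * L2_sqnorm \<S> (\<lambda>x. \<phi> k x - g x)"
      by (rule boundary_data_L2_sqnorm[OF b borel_measurable_diff[OF \<phi> mg]])
    finally show ?thesis .
  qed
  show "L2_conv \<nu> (\<lambda>k y. \<phi> k (\<gamma> y)) (\<lambda>y. boundary_ext g (\<gamma> y))"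
  proof (rule tendsto_sandwich[OF _ _ tendsto_const])
    have "(\<lambda>k. ennreal (inverse \<kappa>) * L2_sqnorm \<S> (\<lambda>x. \<phi> k x - g x)) \<longlonglongrightarrow> ennreal (inverse \<kappa>) * 0"
      by (intro ennreal_tendsto_cmult c) simp
    then show "(\<lambda>k. ennreal (inverse \<kappa>) * L2_sqnorm \<S> (\<lambda>x. \<phi> k x - g x)) \<longlonglongrightarrow> 0" by simp
  qed (use le in simp_all)
qed

lemma L2_bounded_mult:
  fixes f m :: "'b \<Rightarrow> real"
  assumes m: "m \<in> borel_measurable M" "AE y in M. \<bar>m y\<bar> \<le> K" and f: "f \<in> L2 M"
  shows "(\<lambda>y. m y * f y) \<in> L2 M"
proof (rule L2_bound[OF L2_scale[OF f, of K]])
  show "(\<lambda>y. m y * f y) \<in> borel_measurable M"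
    by (intro borel_measurable_times m L2_measurable f)
  show "AE y in M. norm (m y * f y) \<le> norm (K *\<^sub>R f y)"
    using m(2) by eventually_elim (simp add: abs_mult mult_right_mono)
qed

lemma L2_conv_bounded_mult:
  fixes f m :: "'b \<Rightarrow> real"
  assumes m: "AE y in M. \<bar>m y\<bar> \<le> K" and F: "\<And>k. F k \<in> borel_measurable M" "f \<in> borel_measurable M"
    and c: "L2_conv M F f"
  shows "L2_conv M (\<lambda>k y. m y * F k y) (\<lambda>y. m y * f y)"
proof (rule tendsto_sandwich[OF _ _ tendsto_const L2_conv_scale[OF c F, of K]])
  have "L2_sqnorm M (\<lambda>y. m y * F k y - m y * f y) \<le> L2_sqnorm M (\<lambda>x. K *\<^sub>R F k x - K *\<^sub>R f x)" for k
  proof (rule L2_sqnorm_mono)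
    show "AE y in M. norm (m y * F k y - m y * f y) \<le> norm (K *\<^sub>R F k y - K *\<^sub>R f y)"
      using m
    proof eventually_elim
      case (elim y)
      have "norm (m y * F k y - m y * f y) = \<bar>m y\<bar> * \<bar>F k y - f y\<bar>"
        by (simp add: abs_mult right_diff_distrib[symmetric])
      also have "\<dots> \<le> \<bar>K\<bar> * \<bar>F k y - f y\<bar>" using elim by (intro mult_right_mono) auto
      also have "\<dots> = norm (K *\<^sub>R F k y - K *\<^sub>R f y)"
        by (simp add: abs_mult right_diff_distrib[symmetric])
      finally show ?case .
    qed
  qed
  then show "\<forall>\<^sub>F k in sequentially. L2_sqnorm M (\<lambda>y. m y * F k y - m y * f y) \<le> L2_sqnorm M (\<lambda>x. K *\<^sub>R F k x - K *\<^sub>R f x)"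
    by simp
qed simp

lemma smooth_bounded_on_frontier:
  assumes f: "smooth f" and b: "boundary_data \<nu> \<gamma> N \<kappa>"
  shows "\<exists>M. AE y in \<nu>. \<bar>f (\<gamma> y)\<bar> \<le> M" "(\<lambda>y. f (\<gamma> y)) \<in> borel_measurable \<nu>" "(\<lambda>y. f (\<gamma> y)) \<in> L2 \<nu>"
proof -
  have "compact (frontier \<Omega>)" using bounded_\<Omega> by (rule compact_frontier_bounded)
  then have "bounded (f ` frontier \<Omega>)"
    by (intro compact_imp_bounded compact_continuous_image smooth_continuous_on f)
  then obtain M where M: "\<And>x. x \<in> frontier \<Omega> \<Longrightarrow> norm (f x) \<le> M" unfolding bounded_iff by blast
  have "AE y in \<nu>. \<gamma> y \<in> frontier \<Omega>" by (rule boundary_dataD(8)[OF b])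
  then have ae: "AE y in \<nu>. \<bar>f (\<gamma> y)\<bar> \<le> M" by eventually_elim (use M in auto)
  then show "\<exists>M. AE y in \<nu>. \<bar>f (\<gamma> y)\<bar> \<le> M" by blast
  note \<gamma> = boundary_dataD(3)[OF b]
  show m: "(\<lambda>y. f (\<gamma> y)) \<in> borel_measurable \<nu>"
    by (rule measurable_compose[OF \<gamma> smooth_borel_measurable[OF f]])
  interpret finite_measure \<nu> by (rule boundary_dataD(2)[OF b])
  show "(\<lambda>y. f (\<gamma> y)) \<in> L2 \<nu>"
  proof (rule L2_bound[OF _ m])
    show "(\<lambda>y. M) \<in> L2 \<nu>" by (simp add: L2_def)
    show "AE y in \<nu>. norm (f (\<gamma> y)) \<le> norm M" using ae by eventually_elim simp
  qed
qed

text \<open>By compactness finitely many cutoffs sum to 1 near the frontier. What they leave of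
  \<open>f\<close> vanishes there and contributes nothing by the interior case; each remaining piece
  lives in one chart.\<close>

lemma divergence_partition:
  assumes \<Omega>: "bounded_Lipschitz_domain \<Omega>"
  shows "\<exists>F \<nu> \<gamma> N \<kappa> \<eta>. finite F \<and> (\<forall>p\<in>F. boundary_data (\<nu> p) (\<gamma> p) (N p) (\<kappa> p) \<and> smooth (\<eta> p)) \<and>
    (\<forall>f. smooth f \<longrightarrow> (\<forall>i\<in>Basis. (LINT x|\<L>. partial i f x) =
      (\<Sum>p\<in>(F :: 'a set). LINT y|\<nu> p. \<eta> p (\<gamma> p y) * f (\<gamma> p y) * (N p y \<bullet> i))))"
proof -
  have "\<forall>p\<in>frontier \<Omega>. \<exists>r>0. \<exists>\<nu> \<gamma> N \<kappa>. boundary_data \<nu> \<gamma> N \<kappa> \<and>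
    (\<forall>f. smooth f \<longrightarrow> (\<forall>x. x \<notin> cball p (r / 2) \<longrightarrow> f x = 0) \<longrightarrow> (\<forall>i\<in>Basis.
      (LINT x|\<L>. partial i f x) = (LINT y|\<nu>. f (\<gamma> y) * (N y \<bullet> i))))"
    using boundary_chart_exists[OF \<Omega>] by blast
  from bchoice[OF this] obtain \<rho> where \<rho>: "\<forall>p\<in>frontier \<Omega>. \<rho> p > 0 \<and> (\<exists>\<nu> \<gamma> N \<kappa>. boundary_data \<nu> \<gamma> N \<kappa> \<and>
    (\<forall>f. smooth f \<longrightarrow> (\<forall>x. x \<notin> cball p (\<rho> p / 2) \<longrightarrow> f x = 0) \<longrightarrow> (\<forall>i\<in>Basis.
      (LINT x|\<L>. partial i f x) = (LINT y|\<nu>. f (\<gamma> y) * (N y \<bullet> i)))))" by blast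
  then have "\<forall>p\<in>frontier \<Omega>. \<exists>z. (case z of (\<nu>, \<gamma>, N, \<kappa>) \<Rightarrow> boundary_data \<nu> \<gamma> N \<kappa> \<and>
    (\<forall>f. smooth f \<longrightarrow> (\<forall>x. x \<notin> cball p (\<rho> p / 2) \<longrightarrow> f x = 0) \<longrightarrow> (\<forall>i\<in>Basis.
      (LINT x|\<L>. partial i f x) = (LINT y|\<nu>. f (\<gamma> y) * (N y \<bullet> i)))))" by fast
  from bchoice[OF this] obtain z where z: "\<forall>p\<in>frontier \<Omega>. (case z p of (\<nu>, \<gamma>, N, \<kappa>) \<Rightarrow> boundary_data \<nu> \<gamma> N \<kappa> \<and>
    (\<forall>f. smooth f \<longrightarrow> (\<forall>x. x \<notin> cball p (\<rho> p / 2) \<longrightarrow> f x = 0) \<longrightarrow> (\<forall>i\<in>Basis.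
      (LINT x|\<L>. partial i f x) = (LINT y|\<nu>. f (\<gamma> y) * (N y \<bullet> i)))))" by blast
  define \<nu> \<gamma> N \<kappa> where "\<nu> p = fst (z p)" and "\<gamma> p = fst (snd (z p))" and "N p = fst (snd (snd (z p)))"
    and "\<kappa> p = snd (snd (snd (z p)))" for p
  have bd: "boundary_data (\<nu> p) (\<gamma> p) (N p) (\<kappa> p)" if "p \<in> frontier \<Omega>" for p
    using z that unfolding \<nu>_def \<gamma>_def N_def \<kappa>_def by (auto simp: case_prod_unfold)
  have dv: "(LINT x|\<L>. partial i f x) = (LINT y|\<nu> p. f (\<gamma> p y) * (N p y \<bullet> i))"
    if "p \<in> frontier \<Omega>" "smooth f" "\<And>x. x \<notin> cball p (\<rho> p / 2) \<Longrightarrow> f x = 0" "i \<in> Basis" for p f i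
    using z that unfolding \<nu>_def \<gamma>_def N_def by (simp add: case_prod_unfold)
  have "compact (frontier \<Omega>)" using bounded_\<Omega> by (rule compact_frontier_bounded)
  moreover have "frontier \<Omega> \<subseteq> (\<Union>p\<in>frontier \<Omega>. ball p (\<rho> p / 4))" using \<rho> by force
  ultimately obtain F where F: "F \<subseteq> frontier \<Omega>" "finite F" "frontier \<Omega> \<subseteq> (\<Union>p\<in>F. ball p (\<rho> p / 4))"
    using compactE_image[of "frontier \<Omega>" "frontier \<Omega>" "\<lambda>p. ball p (\<rho> p / 4)"] by (metis open_ball)
  have \<rho>F: "\<rho> p > 0" if "p \<in> F" for p using \<rho> F(1) that by blast
  obtain \<eta> where \<eta>: "\<And>p. p \<in> F \<Longrightarrow> smooth (\<eta> p)"
      "\<And>p x. p \<in> F \<Longrightarrow> x \<notin> cball p (\<rho> p / 2) \<Longrightarrow> \<eta> p x = (0::real)"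
      "\<And>x. x \<in> (\<Union>p\<in>F. ball p (\<rho> p / 4)) \<Longrightarrow> (\<Sum>p\<in>F. \<eta> p x) = 1"
    using smooth_partition[where F=F and \<rho>=\<rho>, OF F(2) \<rho>F] by blast
  have "(LINT x|\<L>. partial i f x) =
      (\<Sum>p\<in>F. LINT y|\<nu> p. \<eta> p (\<gamma> p y) * f (\<gamma> p y) * (N p y \<bullet> i))" if f: "smooth f" and i: "i \<in> Basis" for f i
  proof -
    define h where "h x = f x - (\<Sum>p\<in>F. \<eta> p x * f x)" for x
    have s\<eta>: "smooth (\<lambda>x. \<eta> p x * f x)" if "p \<in> F" for p by (intro smooth_mult \<eta>(1) that f)
    have sS: "smooth (\<lambda>x. \<Sum>p\<in>F. \<eta> p x * f x)" by (intro smooth_sum s\<eta>)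
    have sh: "smooth h" unfolding h_def[abs_def] by (intro smooth_diff f sS)
    have "(LINT x|\<L>. partial i h x) = 0"
    proof (rule divergence_interior[OF sh _ F(3) _ i])
      show "open (\<Union>p\<in>F. ball p (\<rho> p / 4))" by auto
      show "h x = 0" if "x \<in> (\<Union>p\<in>F. ball p (\<rho> p / 4))" for x
        using \<eta>(3)[OF that] by (simp add: h_def sum_distrib_right[symmetric])
    qed
    moreover have ps: "partial i (\<lambda>x. \<Sum>p\<in>F. \<eta> p x * f x) x = (\<Sum>p\<in>F. partial i (\<lambda>x. \<eta> p x * f x) x)" for x
    proof (rule partial_eqI[THEN trans])
      show "((\<lambda>x. \<Sum>p\<in>F. \<eta> p x * f x) has_derivative
          (\<lambda>v. \<Sum>p\<in>F. \<Sum>j\<in>Basis. (v \<bullet> j) * partial j (\<lambda>x. \<eta> p x * f x) x)) (at x)"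
        by (intro has_derivative_sum smooth_has_derivative s\<eta>)
    qed (simp add: sum_inner_Basis[OF i])
    have "partial i h x = partial i f x - (\<Sum>p\<in>F. partial i (\<lambda>x. \<eta> p x * f x) x)" for x
      unfolding h_def[abs_def] partial_diff[OF f sS i] ps ..
    moreover have L1: "integrable \<L> (partial i g)" if "smooth g" for g
    proof -
      have "(\<lambda>x. 1::real) \<in> L2 \<L>" by (intro continuous_L2 continuous_intros)
      from L2_integrable_mult[OF smooth_L2[OF smooth_partial[OF that i]] this] show ?thesis by simp
    qed
    ultimately have "0 = (LINT x|\<L>. partial i f x) - (LINT x|\<L>. (\<Sum>p\<in>F. partial i (\<lambda>x. \<eta> p x * f x) x))"
      using L1[OF f] L1[OF s\<eta>] by simp
    also have "(LINT x|\<L>. (\<Sum>p\<in>F. partial i (\<lambda>x. \<eta> p x * f x) x)) =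
        (\<Sum>p\<in>F. LINT x|\<L>. partial i (\<lambda>x. \<eta> p x * f x) x)"
      by (rule Bochner_Integration.integral_sum) (rule L1[OF s\<eta>])
    also have "\<dots> = (\<Sum>p\<in>F. LINT y|\<nu> p. \<eta> p (\<gamma> p y) * f (\<gamma> p y) * (N p y \<bullet> i))"
    proof (rule sum.cong[OF refl])
      fix p assume p: "p \<in> F"
      then have "p \<in> frontier \<Omega>" using F(1) by blast
      then show "(LINT x|\<L>. partial i (\<lambda>x. \<eta> p x * f x) x) = (LINT y|\<nu> p. \<eta> p (\<gamma> p y) * f (\<gamma> p y) * (N p y \<bullet> i))"
        by (rule dv[OF _ s\<eta>[OF p] _ i]) (simp add: \<eta>(2)[OF p])
    qed
    finally show ?thesis by simp
  qed
  then show ?thesis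
    using F(2) bd[OF subsetD[OF F(1)]] \<eta>(1)
    by (intro exI[of _ F] exI[of _ \<nu>] exI[of _ \<gamma>] exI[of _ N] exI[of _ \<kappa>] exI[of _ \<eta>] conjI ballI allI impI)
qed

text \<open>For smooth approximations of \<open>d\<close> and of a component of \<open>W\<close>
  this is the divergence theorem applied to their product. In every chart both factors converge in
  mean square, hence so do the boundary integrals. Summed over the components, the limiting boundary
  integrand contains \<delta> (g . N) with N a multiple of the outward normal, and one of the two
  factors vanishes almost everywhere.\<close>

theorem Green_formula:
  assumes \<Omega>: "bounded_Lipschitz_domain \<Omega>"
    and d: "trace_triple d D \<delta>"
    and W: "\<And>i. i \<in> Basis \<Longrightarrow> trace_triple (\<lambda>x. W x \<bullet> i) (H i) (\<lambda>x. g x \<bullet> i)"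
    and bc: "AE x in \<S>. \<delta> x = 0 \<or> g x \<bullet> outward_normal \<Omega> x = 0"
  shows "(LINT x|\<L>. D x \<bullet> W x) = - (LINT x|\<L>. (\<Sum>i\<in>Basis. H i x \<bullet> i) * d x)"
proof -
  obtain F :: "'a set" and \<nu> \<gamma> N \<kappa> \<eta> where F: "finite F"
    "\<And>p. p \<in> F \<Longrightarrow> boundary_data (\<nu> p) (\<gamma> p) (N p) (\<kappa> p)" "\<And>p. p \<in> F \<Longrightarrow> smooth (\<eta> p)"
    "\<And>f i. smooth f \<Longrightarrow> i \<in> Basis \<Longrightarrow> (LINT x|\<L>. partial i f x) =
      (\<Sum>p\<in>F. LINT y|\<nu> p. \<eta> p (\<gamma> p y) * f (\<gamma> p y) * (N p y \<bullet> i))"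
    using divergence_partition[OF \<Omega>] by blast
  obtain \<phi> where \<phi>: "\<And>k::nat. smooth (\<phi> k)" "L2_conv \<L> \<phi> d"
        "L2_conv \<L> (\<lambda>k. grad (\<phi> k)) D" "L2_conv \<S> \<phi> \<delta>"
        "\<And>k. \<phi> k \<in> borel_measurable \<S>"
    by (rule trace_tripleE[OF d]) blast
  let ?d = "boundary_ext \<delta>" and ?g = "\<lambda>i. boundary_ext (\<lambda>x. g x \<bullet> i)"
  have comp: "(LINT x|\<L>. (D x \<bullet> i) * (W x \<bullet> i)) + (LINT x|\<L>. (H i x \<bullet> i) * d x) =
      (\<Sum>p\<in>F. LINT y|\<nu> p. \<eta> p (\<gamma> p y) * (N p y \<bullet> i) * ?d (\<gamma> p y) * ?g i (\<gamma> p y))"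
    if i: "i \<in> Basis" for i
  proof -
    obtain \<psi> where \<psi>: "\<And>k::nat. smooth (\<psi> k)" "L2_conv \<L> \<psi> (\<lambda>x. W x \<bullet> i)"
        "L2_conv \<L> (\<lambda>k. grad (\<psi> k)) (H i)" "L2_conv \<S> \<psi> (\<lambda>x. g x \<bullet> i)"
        "\<And>k. \<psi> k \<in> borel_measurable \<S>"
      by (rule trace_tripleE[OF W[OF i]]) blast
    note Ld = trace_tripleD[OF d] and LW = trace_tripleD[OF W[OF i]]
    have 1: "(\<lambda>k. LINT x|\<L>. (grad (\<phi> k) x \<bullet> i) * \<psi> k x) \<longlonglongrightarrow> (LINT x|\<L>. (D x \<bullet> i) * (W x \<bullet> i))"
      by (rule L2_mult_tendsto[OF L2_inner_component[OF smooth_grad_L2[OF \<phi>(1)] i] L2_inner_component[OF Ld(2) i]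
            smooth_L2[OF \<psi>(1)] LW(1) L2_conv_component[OF \<phi>(3) i] \<psi>(2)])
    have 2: "(\<lambda>k. LINT x|\<L>. (grad (\<psi> k) x \<bullet> i) * \<phi> k x) \<longlonglongrightarrow> (LINT x|\<L>. (H i x \<bullet> i) * d x)"
      by (rule L2_mult_tendsto[OF L2_inner_component[OF smooth_grad_L2[OF \<psi>(1)] i] L2_inner_component[OF LW(2) i]
            smooth_L2[OF \<phi>(1)] Ld(1) L2_conv_component[OF \<psi>(3) i] \<phi>(2)])
    have 3: "(\<lambda>k. LINT y|\<nu> p. \<eta> p (\<gamma> p y) * (N p y \<bullet> i) * \<phi> k (\<gamma> p y) * \<psi> k (\<gamma> p y)) \<longlonglongrightarrow>
        (LINT y|\<nu> p. \<eta> p (\<gamma> p y) * (N p y \<bullet> i) * ?d (\<gamma> p y) * ?g i (\<gamma> p y))" if p: "p \<in> F" for p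
    proof -
      note b = F(2)[OF p]
      obtain M where M: "AE y in \<nu> p. \<bar>\<eta> p (\<gamma> p y)\<bar> \<le> M"
        using smooth_bounded_on_frontier(1)[OF F(3)[OF p] b] by blast
      obtain K where K: "AE y in \<nu> p. norm (N p y) \<le> K" using boundary_dataD(5)[OF b] by blast
      have bm: "AE y in \<nu> p. \<bar>\<eta> p (\<gamma> p y) * (N p y \<bullet> i)\<bar> \<le> \<bar>M\<bar> * \<bar>K\<bar>"
        using M K
      proof eventually_elim
        case (elim y)
        have "\<bar>N p y \<bullet> i\<bar> \<le> \<bar>K\<bar>" using elim(2) Basis_le_norm[OF i, of "N p y"] by linarith
        then show ?case using elim(1) unfolding abs_mult by (intro mult_mono) auto
      qed
      have mN: "(\<lambda>y. N p y \<bullet> i) \<in> borel_measurable (\<nu> p)"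
        by (rule borel_measurable_inner[OF boundary_dataD(4)[OF b] borel_measurable_const])
      have mm: "(\<lambda>y. \<eta> p (\<gamma> p y) * (N p y \<bullet> i)) \<in> borel_measurable (\<nu> p)"
        by (intro borel_measurable_times mN smooth_bounded_on_frontier(2)[OF F(3)[OF p] b])
      note cd = boundary_data_L2_conv[OF b Ld(3) \<phi>(5,4)] and cg = boundary_data_L2_conv[OF b LW(3) \<psi>(5,4)]
      note s\<phi> = smooth_bounded_on_frontier(2,3)[OF \<phi>(1) b] and s\<psi> = smooth_bounded_on_frontier(2,3)[OF \<psi>(1) b]
      show ?thesis
        by (rule L2_mult_tendsto[OF L2_bounded_mult[OF mm bm s\<phi>(2)] L2_bounded_mult[OF mm bm cd(1)] s\<psi>(2) cg(1)
            L2_conv_bounded_mult[OF bm s\<phi>(1) L2_measurable[OF cd(1)] cd(2)] cg(2)])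
    qed
    have eq: "(LINT x|\<L>. (grad (\<phi> k) x \<bullet> i) * \<psi> k x) + (LINT x|\<L>. (grad (\<psi> k) x \<bullet> i) * \<phi> k x) =
        (\<Sum>p\<in>F. LINT y|\<nu> p. \<eta> p (\<gamma> p y) * (N p y \<bullet> i) * \<phi> k (\<gamma> p y) * \<psi> k (\<gamma> p y))" for k
    proof -
      have i1: "integrable \<L> (\<lambda>x. (grad (\<phi> k) x \<bullet> i) * \<psi> k x)"
        "integrable \<L> (\<lambda>x. (grad (\<psi> k) x \<bullet> i) * \<phi> k x)"
        by (intro L2_integrable_mult L2_inner_component smooth_grad_L2 smooth_L2 \<phi>(1) \<psi>(1) i)+
      have "(LINT x|\<L>. (grad (\<phi> k) x \<bullet> i) * \<psi> k x) + (LINT x|\<L>. (grad (\<psi> k) x \<bullet> i) * \<phi> k x) =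
          (LINT x|\<L>. (grad (\<phi> k) x \<bullet> i) * \<psi> k x + (grad (\<psi> k) x \<bullet> i) * \<phi> k x)"
        by (rule Bochner_Integration.integral_add[OF i1, symmetric])
      also have "\<dots> = (LINT x|\<L>. partial i (\<lambda>x. \<phi> k x * \<psi> k x) x)"
        by (intro Bochner_Integration.integral_cong refl)
          (simp add: partial_mult[OF \<phi>(1) \<psi>(1) i] grad_inner[OF i])
      also have "\<dots> = (\<Sum>p\<in>F. LINT y|\<nu> p. \<eta> p (\<gamma> p y) * (\<phi> k (\<gamma> p y) * \<psi> k (\<gamma> p y)) * (N p y \<bullet> i))"
        by (rule F(4)[OF smooth_mult[OF \<phi>(1) \<psi>(1)] i])
      finally show ?thesis by (simp only: mult_ac)
    qed
    have "(\<lambda>k. \<Sum>p\<in>F. LINT y|\<nu> p. \<eta> p (\<gamma> p y) * (N p y \<bullet> i) * \<phi> k (\<gamma> p y) * \<psi> k (\<gamma> p y)) \<longlonglongrightarrow>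
        (\<Sum>p\<in>F. LINT y|\<nu> p. \<eta> p (\<gamma> p y) * (N p y \<bullet> i) * ?d (\<gamma> p y) * ?g i (\<gamma> p y))"
      by (intro tendsto_sum 3)
    with tendsto_add[OF 1 2] show ?thesis unfolding eq by (rule LIMSEQ_unique)
  qed
  \<comment> \<open>The boundary condition concerns the normal component, so the terms cancel only
    after summation over \<open>i\<close>.\<close>
  have zero: "(\<Sum>i\<in>Basis. LINT y|\<nu> p. \<eta> p (\<gamma> p y) * (N p y \<bullet> i) * ?d (\<gamma> p y) * ?g i (\<gamma> p y)) = 0" if p: "p \<in> F" for p
  proof -
    note b = F(2)[OF p]
    obtain M where M: "AE y in \<nu> p. \<bar>\<eta> p (\<gamma> p y)\<bar> \<le> M"
      using smooth_bounded_on_frontier(1)[OF F(3)[OF p] b] by blast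
    obtain K where K: "AE y in \<nu> p. norm (N p y) \<le> K" using boundary_dataD(5)[OF b] by blast
    have int: "integrable (\<nu> p) (\<lambda>y. \<eta> p (\<gamma> p y) * (N p y \<bullet> i) * ?d (\<gamma> p y) * ?g i (\<gamma> p y))" if i: "i \<in> Basis" for i
    proof -
      have bm: "AE y in \<nu> p. \<bar>\<eta> p (\<gamma> p y) * (N p y \<bullet> i)\<bar> \<le> \<bar>M\<bar> * \<bar>K\<bar>"
        using M K
      proof eventually_elim
        case (elim y)
        have "\<bar>N p y \<bullet> i\<bar> \<le> \<bar>K\<bar>" using elim(2) Basis_le_norm[OF i, of "N p y"] by linarith
        then show ?case using elim(1) unfolding abs_mult by (intro mult_mono) auto
      qed
      have mN: "(\<lambda>y. N p y \<bullet> i) \<in> borel_measurable (\<nu> p)"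
        by (rule borel_measurable_inner[OF boundary_dataD(4)[OF b] borel_measurable_const])
      have mm: "(\<lambda>y. \<eta> p (\<gamma> p y) * (N p y \<bullet> i)) \<in> borel_measurable (\<nu> p)"
        by (intro borel_measurable_times mN smooth_bounded_on_frontier(2)[OF F(3)[OF p] b])
      obtain \<psi> where \<psi>: "L2_conv \<S> \<psi> (\<lambda>x. g x \<bullet> i)"
          "\<And>k::nat. \<psi> k \<in> borel_measurable \<S>"
        by (rule trace_tripleE[OF W[OF i]]) blast
      show ?thesis
        by (rule L2_integrable_mult[OF L2_bounded_mult[OF mm bm boundary_data_L2_conv(1)[OF b trace_tripleD(3)[OF d] \<phi>(5,4)]]
            boundary_data_L2_conv(1)[OF b trace_tripleD(3)[OF W[OF i]] \<psi>(2,1)]])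
    qed
    have "(\<Sum>i\<in>Basis. LINT y|\<nu> p. \<eta> p (\<gamma> p y) * (N p y \<bullet> i) * ?d (\<gamma> p y) * ?g i (\<gamma> p y)) =
        (LINT y|\<nu> p. (\<Sum>i\<in>Basis. \<eta> p (\<gamma> p y) * (N p y \<bullet> i) * ?d (\<gamma> p y) * ?g i (\<gamma> p y)))"
      by (rule Bochner_Integration.integral_sum[symmetric]) (rule int)
    also have "\<dots> = (LINT y|\<nu> p. 0)"
    proof (rule integral_cong_AE)
      show "(\<lambda>y. \<Sum>i\<in>Basis. \<eta> p (\<gamma> p y) * (N p y \<bullet> i) * ?d (\<gamma> p y) * ?g i (\<gamma> p y)) \<in> borel_measurable (\<nu> p)"
        using int by (intro borel_measurable_sum) (blast dest: borel_measurable_integrable)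
      have "AE y in \<nu> p. N p y = norm (N p y) *\<^sub>R outward_normal \<Omega> (\<gamma> p y)"
        by (rule boundary_dataD(9)[OF b])
      with boundary_data_AE[OF b bc]
      show "AE y in \<nu> p. (\<Sum>i\<in>Basis. \<eta> p (\<gamma> p y) * (N p y \<bullet> i) * ?d (\<gamma> p y) * ?g i (\<gamma> p y)) = 0"
      proof eventually_elim
        case (elim y)
        let ?x = "\<gamma> p y"
        have "N p y \<bullet> g ?x = norm (N p y) * (g ?x \<bullet> outward_normal \<Omega> ?x)"
          by (subst elim(2)) (simp add: inner_commute)
        then have z: "\<delta> ?x * (N p y \<bullet> g ?x) = 0" using elim(1) by auto
        have "(\<Sum>i\<in>Basis. \<eta> p ?x * (N p y \<bullet> i) * ?d ?x * ?g i ?x) =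
            \<eta> p ?x * indicator (frontier \<Omega>) ?x * indicator (frontier \<Omega>) ?x * (\<delta> ?x * (\<Sum>i\<in>Basis. (N p y \<bullet> i) * (g ?x \<bullet> i)))"
          by (simp add: boundary_ext_def sum_distrib_left mult_ac)
        also have "\<dots> = 0" using z by (simp add: euclidean_inner[symmetric])
        finally show ?case .
      qed
    qed simp
    finally show ?thesis by simp
  qed
  have iDW: "integrable \<L> (\<lambda>x. (D x \<bullet> i) * (W x \<bullet> i))"
    "integrable \<L> (\<lambda>x. (H i x \<bullet> i) * d x)" if i: "i \<in> Basis" for i
    by (intro L2_integrable_mult L2_inner_component trace_tripleD(2)[OF d] trace_tripleD(1)[OF W[OF i]]
        trace_tripleD(2)[OF W[OF i]] trace_tripleD(1)[OF d] i)+
  have "(LINT x|\<L>. D x \<bullet> W x) + (LINT x|\<L>. (\<Sum>i\<in>Basis. H i x \<bullet> i) * d x) =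
      (LINT x|\<L>. (\<Sum>i\<in>Basis. (D x \<bullet> i) * (W x \<bullet> i))) + (LINT x|\<L>. (\<Sum>i\<in>Basis. (H i x \<bullet> i) * d x))"
    by (simp only: sum_distrib_right euclidean_inner[of "D _" "W _"])
  also have "\<dots> = (\<Sum>i\<in>Basis. (LINT x|\<L>. (D x \<bullet> i) * (W x \<bullet> i)) + (LINT x|\<L>. (H i x \<bullet> i) * d x))"
    using iDW by (simp add: Bochner_Integration.integral_sum sum.distrib)
  also have "\<dots> = (\<Sum>i\<in>Basis. \<Sum>p\<in>F. LINT y|\<nu> p. \<eta> p (\<gamma> p y) * (N p y \<bullet> i) * ?d (\<gamma> p y) * ?g i (\<gamma> p y))"
    by (intro sum.cong refl comp)
  also have "\<dots> = (\<Sum>p\<in>F. \<Sum>i\<in>Basis. LINT y|\<nu> p. \<eta> p (\<gamma> p y) * (N p y \<bullet> i) * ?d (\<gamma> p y) * ?g i (\<gamma> p y))"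
    by (rule sum.swap)
  also have "\<dots> = 0" by (intro sum.neutral ballI zero)
  finally show ?thesis by simp
qed

end

section \<open>Functions on the cylinder\<close>

lemma AE_lebesgue_on_slices:
  fixes A :: "('a::euclidean_space \<times> 'b::euclidean_space) set"
  assumes A: "A \<in> sets lebesgue" and P: "AE z in lebesgue_on A. P z"
  shows "AE x in lborel. AE t in lborel. (x, t) \<in> A \<longrightarrow> P (x, t)"
    "AE t in lborel. AE x in lborel. (x, t) \<in> A \<longrightarrow> P (x, t)"
proof -
  have "AE z in lborel. z \<in> A \<longrightarrow> P z"
    using P unfolding AE_lebesgue_on_iff[OF A] AE_completion_iff .
  then obtain N where N: "{z \<in> space lborel. \<not> (z \<in> A \<longrightarrow> P z)} \<subseteq> N" "emeasure lborel N = 0"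
      "N \<in> sets (lborel :: ('a \<times> 'b) measure)"
    by (rule AE_E)
  have "AE z in (lborel :: ('a \<times> 'b) measure). z \<notin> N" by (rule AE_not_in[OF null_setsI[OF N(2,3)]])
  then have "AE z in lborel \<Otimes>\<^sub>M lborel. z \<notin> N" unfolding lborel_prod .
  then have 1: "AE x in lborel. AE t in lborel. (x, t) \<notin> N" by (rule lborel_pair.AE_pair)
  have "{z \<in> space (lborel \<Otimes>\<^sub>M lborel). (fst z, snd z) \<notin> N} = space lborel - N"
    unfolding lborel_prod by auto
  then have "{z \<in> space (lborel \<Otimes>\<^sub>M lborel). (fst z, snd z) \<notin> N} \<in> sets (lborel \<Otimes>\<^sub>M lborel)"
    using sets.compl_sets[OF N(3)] unfolding lborel_prod by simp
  from lborel_pair.AE_commute[OF this] 1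
  have 2: "AE t in lborel. AE x in lborel. (x, t) \<notin> N" by simp
  have out: "z \<in> A \<longrightarrow> P z" if "z \<notin> N" for z
    using N(1) that by auto
  show "AE x in lborel. AE t in lborel. (x, t) \<in> A \<longrightarrow> P (x, t)"
    using 1 by (rule AE_mp) (rule AE_I2, rule impI, erule AE_mp, rule AE_I2, rule impI, erule out)
  show "AE t in lborel. AE x in lborel. (x, t) \<in> A \<longrightarrow> P (x, t)"
    using 2 by (rule AE_mp) (rule AE_I2, rule impI, erule AE_mp, rule AE_I2, rule impI, erule out)
qed

text \<open>Lebesgue measurability on a product says nothing about an individual slice. A Borel
  representative that is 0 outside \<open>A\<close> permits Fubini arguments on the whole
  space.\<close>

lemma borel_representative:
  fixes F :: "'a::euclidean_space \<Rightarrow> real"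
  assumes A: "A \<in> sets borel" and F: "F \<in> L2 (lebesgue_on A)"
  obtains F' where "F' \<in> borel_measurable borel" "F' \<in> L2 lborel" "\<And>z. z \<notin> A \<Longrightarrow> F' z = 0"
    "AE z in lebesgue_on A. F z = F' z"
proof -
  have As: "A \<in> sets lebesgue" using A by simp
  then have As': "A \<inter> space lebesgue \<in> sets lebesgue" by simp
  have "(\<lambda>z. F z * indicator A z) \<in> borel_measurable lebesgue"
    using L2_measurable[OF F] unfolding borel_measurable_restrict_space_iff[OF As']
    by (simp add: mult.commute)
  from completion_ex_borel_measurable_real[OF this] obtain g where
    g: "g \<in> borel_measurable lborel" "AE z in lborel. F z * indicator A z = g z" by blast
  define F' where "F' z = g z * indicator A z" for z
  have m: "F' \<in> borel_measurable borel"
    unfolding F'_def[abs_def] using g(1) A by (intro borel_measurable_times borel_measurable_indicator) simp_all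
  have ae: "AE z in lebesgue. F z * indicator A z = F' z"
    unfolding AE_completion_iff using g(2)
  proof eventually_elim
    case (elim z)
    then show ?case by (cases "z \<in> A") (simp_all add: F'_def)
  qed
  then have "AE z in lebesgue. z \<in> A \<longrightarrow> F z = F' z"
    by eventually_elim auto
  then have ae': "AE z in lebesgue_on A. F z = F' z" unfolding AE_lebesgue_on_iff[OF As] .
  have "L2_sqnorm lborel F' = (\<integral>\<^sup>+z. ennreal ((norm (F' z))\<^sup>2) \<partial>lebesgue)"
    unfolding L2_sqnorm_def by (rule nn_integral_completion[symmetric])
  also have "\<dots> = (\<integral>\<^sup>+z. ennreal ((norm (F z))\<^sup>2) * indicator A z \<partial>lebesgue)"
    by (rule nn_integral_cong_AE) (use ae in eventually_elim, auto simp: indicator_def)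
  also have "\<dots> = L2_sqnorm (lebesgue_on A) F"
    unfolding L2_sqnorm_def by (rule nn_integral_restrict_space[OF As', symmetric])
  also have "\<dots> < \<infinity>" using F by (simp add: L2_iff)
  finally have "F' \<in> L2 lborel" using m by (simp add: L2_iff)
  then show thesis by (rule that[OF m _ _ ae']) (simp add: F'_def)
qed

lemma indicator_L2:
  fixes A :: "'a::euclidean_space set"
  assumes "bounded A" "A \<in> sets borel"
  shows "(indicator A :: 'a \<Rightarrow> real) \<in> L2 lborel"
proof -
  have "integrable lborel (indicator A :: 'a \<Rightarrow> real)"
    using emeasure_bounded_finite[OF assms(1)] assms(2) by (intro integrable_real_indicator) simp_all
  moreover have "(\<lambda>z. (norm (indicator A z :: real))\<^sup>2) = indicator A" by (auto simp: indicator_def)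
  ultimately show ?thesis using assms(2) by (simp add: L2_def borel_measurable_indicator)
qed

lemma L2_bounded_support_integrable:
  fixes F :: "'a::euclidean_space \<Rightarrow> real"
  assumes F: "F \<in> L2 lborel" and A: "bounded A" "A \<in> sets borel" "\<And>z. z \<notin> A \<Longrightarrow> F z = 0"
  shows "integrable lborel F"
proof -
  from L2_integrable_mult[OF F indicator_L2[OF A(1,2)]]
  have "integrable lborel (\<lambda>x. F x * indicator A x)" .
  moreover have "(\<lambda>x. F x * indicator A x) = F"
  proof
    show "F x * indicator A x = F x" for x using A(3)[of x] by (cases "x \<in> A") simp_all
  qed
  ultimately show ?thesis by simp
qed

section \<open>Products with small translates\<close>

lemma L2_sqnorm_translate:
  fixes H :: "'a::euclidean_space \<Rightarrow> real"
  assumes "H \<in> borel_measurable borel"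
  shows "(\<integral>\<^sup>+z. (ennreal (H (z - d)))\<^sup>2 \<partial>lborel) = (\<integral>\<^sup>+z. (ennreal (H z))\<^sup>2 \<partial>lborel)"
proof -
  have "(\<integral>\<^sup>+z. (ennreal (H z))\<^sup>2 \<partial>lborel) = (\<integral>\<^sup>+z. (ennreal (H z))\<^sup>2 \<partial>distr lborel borel ((+) (- d)))"
    by (simp add: lborel_distr_plus)
  also have "\<dots> = (\<integral>\<^sup>+z. (ennreal (H (- d + z)))\<^sup>2 \<partial>lborel)"
    using assms by (subst nn_integral_distr) auto
  finally show ?thesis by (simp add: add.commute)
qed

lemma ennreal_less_of_square_less:
  fixes a b :: ennreal
  assumes "a\<^sup>2 \<le> b * b" "b < c"
  shows "a < c"
proof (rule ccontr)
  assume "\<not> a < c"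
  obtain d where d: "b < d" "d < c" using dense[OF assms(2)] by blast
  have d0: "0 < d" "d < top"
    using d by (auto intro: le_less_trans[OF zero_le] less_le_trans[OF _ top_greatest])
  have "b * b \<le> d * b" using d(1) by (intro mult_right_mono) auto
  also have "\<dots> < d * d" by (rule ennreal_mult_strict_left_mono[OF d(1) d0])
  also have "\<dots> \<le> a * a" using d(2) \<open>\<not> a < c\<close> by (intro mult_mono) auto
  finally show False using assms(1) by (simp add: power2_eq_square)
qed

text \<open>Inner regularity of the finite measure with density H^2, applied to {H \<noteq> 0}.
  Keeping \<open>K\<close> inside this set matters: there every function whose product with
  \<open>H\<close> is 0 must vanish.\<close>

lemma compact_support_approximation:
  fixes H :: "'a::euclidean_space \<Rightarrow> real"
  assumes H: "H \<in> borel_measurable borel" "\<And>z. 0 \<le> H z" "(\<integral>\<^sup>+z. (ennreal (H z))\<^sup>2 \<partial>lborel) < \<infinity>" and e: "e > 0"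
  obtains K where "compact K" "\<And>z. z \<in> K \<Longrightarrow> H z \<noteq> 0"
    "(\<integral>\<^sup>+z. (ennreal (H z))\<^sup>2 * indicator (- K) z \<partial>lborel) \<le> ennreal e"
proof -
  let ?\<mu> = "density lborel (\<lambda>z. (ennreal (H z))\<^sup>2)"
  let ?A = "{z. H z \<noteq> 0}"
  have m: "(\<lambda>z. (ennreal (H z))\<^sup>2) \<in> borel_measurable lborel" using H(1) by simp
  have A: "?A \<in> sets borel" using H(1) by measurable
  have sb: "sets ?\<mu> = sets borel" by simp
  have fin: "emeasure ?\<mu> (space ?\<mu>) \<noteq> \<infinity>"
    using H(3) by (simp add: emeasure_density[OF m])
  interpret \<mu>: finite_measure ?\<mu> by (rule finite_measureI[OF fin])
  have ne: "{K. K \<subseteq> ?A \<and> compact K} \<noteq> {}" using compact_empty by blast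
  have "emeasure ?\<mu> ?A \<noteq> \<infinity>" using \<mu>.emeasure_finite by simp
  from SUP_approx_ennreal[OF e ne inner_regular[OF sb fin A] this]
  obtain K where K: "K \<subseteq> ?A" "compact K" "emeasure ?\<mu> ?A < emeasure ?\<mu> K + ennreal e" by blast
  have Kb: "K \<in> sets borel" using K(2) by (simp add: compact_imp_closed)
  have "(ennreal (H z))\<^sup>2 * indicator (- ?A) z = 0" for z by (cases "H z = 0") simp_all
  moreover have "- ?A \<in> sets lborel" using A by (simp only: sets_lborel borel_comp)
  ultimately have 0: "emeasure ?\<mu> (- ?A) = 0" by (simp only: emeasure_density[OF m] nn_integral_const mult_zero_left)
  have "emeasure ?\<mu> K + emeasure ?\<mu> (- K) = emeasure ?\<mu> ?A + emeasure ?\<mu> (- ?A)"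
    using A Kb by (subst (1 2) plus_emeasure) (auto simp: Compl_partition)
  also have "\<dots> \<le> emeasure ?\<mu> K + ennreal e" using K(3) 0 by (simp add: less_imp_le)
  finally have "emeasure ?\<mu> (- K) \<le> ennreal e"
    using \<mu>.emeasure_finite[of K] by (simp only: ennreal_add_left_cancel_le infinity_ennreal_def simp_thms)
  then show thesis
    using K Kb by (intro that[of K]) (auto simp: emeasure_density[OF m])
qed

text \<open>\<open>H\<close> is cut down to a compact K inside {H \<noteq> 0}, on which R = 0 almost
  everywhere. For z outside K the point z - d_n is eventually outside K too, since K is closed; so
  the part of the product coming from K tends to 0 by domination. The rest is small by
  Cauchy-Schwarz.\<close>

lemma translate_orthogonal:
  fixes R H :: "'a::euclidean_space \<Rightarrow> real"
  assumes R: "R \<in> borel_measurable borel" "\<And>z. 0 \<le> R z" "(\<integral>\<^sup>+z. (ennreal (R z))\<^sup>2 \<partial>lborel) < \<infinity>"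
    and H: "H \<in> borel_measurable borel" "\<And>z. 0 \<le> H z" "(\<integral>\<^sup>+z. (ennreal (H z))\<^sup>2 \<partial>lborel) < \<infinity>"
    and RH: "AE z in lborel. R z * H z = 0" and d: "(d :: nat \<Rightarrow> 'a) \<longlonglongrightarrow> 0"
  shows "(\<lambda>n. \<integral>\<^sup>+z. ennreal (R z) * ennreal (H (z - d n)) \<partial>lborel) \<longlonglongrightarrow> 0"
proof -
  note [measurable] = R(1) H(1)
  let ?R = "\<lambda>z. ennreal (R z)" and ?H = "\<lambda>z. ennreal (H z)"
  let ?RR = "\<integral>\<^sup>+z. (?R z)\<^sup>2 \<partial>lborel" and ?HH = "\<integral>\<^sup>+z. (?H z)\<^sup>2 \<partial>lborel"
  have cut: "\<exists>a. a \<longlonglongrightarrow> 0 \<and> (\<forall>n. (\<integral>\<^sup>+z. ?R z * ?H (z - d n) \<partial>lborel) \<le> a n + ennreal e)"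
    if e: "e > 0" for e :: real
  proof -
    obtain \<rho> where \<rho>: "?RR = ennreal \<rho>" "\<rho> \<ge> 0" using R(3) by (cases ?RR) auto
    have "e\<^sup>2 / (\<rho> + 1) > 0" using e \<rho>(2) by (intro divide_pos_pos) auto
    \<comment> \<open>With a tail of at most e^2 / (\<rho> + 1) the Cauchy-Schwarz bound for the
      rest is \<rho> e^2 / (\<rho> + 1) \<le> e^2, also when \<rho> = 0.\<close>
    from compact_support_approximation[OF H this]
    obtain K where K: "compact K" "\<And>z. z \<in> K \<Longrightarrow> H z \<noteq> 0"
      "(\<integral>\<^sup>+z. (?H z)\<^sup>2 * indicator (- K) z \<partial>lborel) \<le> ennreal (e\<^sup>2 / (\<rho> + 1))" by blast
    have Kc: "closed K" using K(1) by (rule compact_imp_closed)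
    have [measurable]: "K \<in> sets borel" using Kc by simp
    define p where "p n = (\<integral>\<^sup>+z. (?R z * indicator K (z - d n)) * ?H (z - d n) \<partial>lborel)" for n
    define q where "q n = (\<integral>\<^sup>+z. ?R z * (?H (z - d n) * indicator (- K) (z - d n)) \<partial>lborel)" for n
    have split: "(\<integral>\<^sup>+z. ?R z * ?H (z - d n) \<partial>lborel) = p n + q n" for n
    proof -
      have "(\<integral>\<^sup>+z. ?R z * ?H (z - d n) \<partial>lborel) = (\<integral>\<^sup>+z. (?R z * indicator K (z - d n)) * ?H (z - d n) +
          ?R z * (?H (z - d n) * indicator (- K) (z - d n)) \<partial>lborel)"
        by (intro nn_integral_cong) (auto simp: indicator_def)
      also have "\<dots> = p n + q n"
        unfolding p_def q_def by (rule nn_integral_add) simp_all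
      finally show ?thesis .
    qed
    have "(\<lambda>n. (p n)\<^sup>2) \<longlonglongrightarrow> 0"
    proof (rule tendsto_sandwich[OF _ _ tendsto_const])
      have "(p n)\<^sup>2 \<le> ?HH * (\<integral>\<^sup>+z. (?R z * indicator K (z - d n))\<^sup>2 \<partial>lborel)" for n
      proof -
        have "(p n)\<^sup>2 \<le> (\<integral>\<^sup>+z. (?R z * indicator K (z - d n))\<^sup>2 \<partial>lborel) * (\<integral>\<^sup>+z. (?H (z - d n))\<^sup>2 \<partial>lborel)"
          unfolding p_def by (rule Cauchy_Schwarz_nn_integral) simp_all
        then show ?thesis unfolding L2_sqnorm_translate[OF H(1)] by (simp add: mult.commute)
      qed
      then show "\<forall>\<^sub>F n in sequentially. (p n)\<^sup>2 \<le> ?HH * (\<integral>\<^sup>+z. (?R z * indicator K (z - d n))\<^sup>2 \<partial>lborel)"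
        by simp
      have "(\<lambda>n. \<integral>\<^sup>+z. (?R z * indicator K (z - d n))\<^sup>2 \<partial>lborel) \<longlonglongrightarrow> (\<integral>\<^sup>+z. 0 \<partial>(lborel :: 'a measure))"
      proof (rule nn_integral_dominated_convergence[where w="\<lambda>z. (?R z)\<^sup>2"])
        show "AE z in lborel. (?R z * indicator K (z - d n))\<^sup>2 \<le> (?R z)\<^sup>2" for n
          by (auto simp: indicator_def)
        show "AE z in lborel. (\<lambda>n. (?R z * indicator K (z - d n))\<^sup>2) \<longlonglongrightarrow> 0"
          using RH
        proof eventually_elim
          case (elim z)
          show ?case
          proof (cases "z \<in> K")
            case True
            then have "R z = 0" using K(2)[of z] elim by simp
            then show ?thesis by simp
          next
            case False
            have "(\<lambda>n. z - d n) \<longlonglongrightarrow> z - 0" by (intro tendsto_diff tendsto_const d)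
            then have "\<forall>\<^sub>F n in sequentially. z - d n \<in> - K"
              using False Kc by (intro topological_tendstoD[where f="\<lambda>n. z - d n" and l=z]) auto
            then have "\<forall>\<^sub>F n in sequentially. (?R z * indicator K (z - d n))\<^sup>2 = 0"
              by eventually_elim simp
            then show ?thesis by (rule tendsto_eventually)
          qed
        qed
      qed (use R(3) in simp_all)
      then have "(\<lambda>n. ?HH * (\<integral>\<^sup>+z. (?R z * indicator K (z - d n))\<^sup>2 \<partial>lborel)) \<longlonglongrightarrow> ?HH * 0"
        using H(3) by (intro ennreal_tendsto_cmult) simp_all
      then show "(\<lambda>n. ?HH * (\<integral>\<^sup>+z. (?R z * indicator K (z - d n))\<^sup>2 \<partial>lborel)) \<longlonglongrightarrow> 0" by simp
    qed simp
    then have "p \<longlonglongrightarrow> 0" by (rule ennreal_tendsto_0_square)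
    moreover have "q n \<le> ennreal e" for n
    proof (rule ccontr)
      assume "\<not> q n \<le> ennreal e"
      have "(\<integral>\<^sup>+z. (?H (z - d n) * indicator (- K) (z - d n))\<^sup>2 \<partial>lborel) =
          (\<integral>\<^sup>+z. (ennreal (H (z - d n) * indicator (- K) (z - d n)))\<^sup>2 \<partial>lborel)"
        by (intro nn_integral_cong) (auto simp: indicator_def)
      also have "\<dots> = (\<integral>\<^sup>+z. (ennreal (H z * indicator (- K) z))\<^sup>2 \<partial>lborel)"
        by (rule L2_sqnorm_translate[where H="\<lambda>z. H z * indicator (- K) z"]) simp
      also have "\<dots> = (\<integral>\<^sup>+z. (?H z)\<^sup>2 * indicator (- K) z \<partial>lborel)"
        by (intro nn_integral_cong) (auto simp: indicator_def)
      finally have le: "(\<integral>\<^sup>+z. (?H (z - d n) * indicator (- K) (z - d n))\<^sup>2 \<partial>lborel) \<le> ennreal (e\<^sup>2 / (\<rho> + 1))"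
        using K(3) by simp
      have "(q n)\<^sup>2 \<le> ?RR * (\<integral>\<^sup>+z. (?H (z - d n) * indicator (- K) (z - d n))\<^sup>2 \<partial>lborel)"
        unfolding q_def by (rule Cauchy_Schwarz_nn_integral) simp_all
      also have "\<dots> \<le> ennreal \<rho> * ennreal (e\<^sup>2 / (\<rho> + 1))"
        unfolding \<rho>(1) by (intro mult_left_mono le) simp
      also have "\<dots> = ennreal (\<rho> * (e\<^sup>2 / (\<rho> + 1)))" using \<rho>(2) by (simp only: ennreal_mult'[symmetric])
      also have "\<dots> \<le> ennreal (e * e)"
        using \<rho>(2) by (intro ennreal_leI) (simp add: field_simps power2_eq_square)
      also have "\<dots> = ennreal e * ennreal e" using e by (simp only: ennreal_mult'[symmetric] less_imp_le)
      finally have "(q n)\<^sup>2 \<le> ennreal e * ennreal e" .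
      from ennreal_less_of_square_less[OF this, of "q n"] \<open>\<not> q n \<le> ennreal e\<close>
      show False by (meson not_le less_irrefl)
    qed
    ultimately show ?thesis unfolding split by (intro exI[of _ p] conjI allI add_left_mono)
  qed
  show ?thesis
  proof (rule order_tendstoI)
    fix \<epsilon> :: ennreal assume "0 < \<epsilon>"
    then obtain \<epsilon>' where \<epsilon>': "0 < \<epsilon>'" "\<epsilon>' < \<epsilon>" using dense by blast
    then obtain e where e: "\<epsilon>' = ennreal e" "e > 0"
      by (cases \<epsilon>') (auto simp: top.not_eq_extremum)
    obtain a where a: "a \<longlonglongrightarrow> 0" "\<And>n. (\<integral>\<^sup>+z. ?R z * ?H (z - d n) \<partial>lborel) \<le> a n + ennreal (e / 2)"
      using cut[of "e / 2"] e(2) by auto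
    have "\<forall>\<^sub>F n in sequentially. a n < ennreal (e / 2)"
      by (rule order_tendstoD(2)[OF a(1)]) (use e(2) in simp)
    then show "\<forall>\<^sub>F n in sequentially. (\<integral>\<^sup>+z. ?R z * ?H (z - d n) \<partial>lborel) < \<epsilon>"
    proof eventually_elim
      case (elim n)
      have "(\<integral>\<^sup>+z. ?R z * ?H (z - d n) \<partial>lborel) \<le> a n + ennreal (e / 2)" by (rule a(2))
      also have "\<dots> \<le> ennreal (e / 2) + ennreal (e / 2)" using elim by (intro add_right_mono) simp
      also have "\<dots> = \<epsilon>'" using e by (simp add: ennreal_plus[symmetric] del: ennreal_plus)
      finally show ?case using \<epsilon>'(2) by simp
    qed
  qed simp
qed

text \<open>A smooth step that rises between c + 1/(n+1) and c + 2/(n+1). The gap after c keeps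
  differences of ramps compactly supported in (0, T) even for c = 0; the derivative is an averaging
  kernel of mass 1 to the right of c.\<close>

definition ramp :: "nat \<Rightarrow> real \<Rightarrow> real \<Rightarrow> real" where
  "ramp n c t = smooth_step (real (Suc n) * (t - c) - 1)"

abbreviation ramp' :: "nat \<Rightarrow> real \<Rightarrow> real \<Rightarrow> real" where
  "ramp' n c \<equiv> partial 1 (ramp n c)"

lemma smooth_ramp: "smooth (ramp n c)"
  unfolding ramp_def[abs_def]
  by (rule smooth_compose[OF smooth_smooth_step
      smooth_diff[OF smooth_mult[OF smooth_const smooth_diff[OF smooth_id smooth_const]] smooth_const]])

lemma smooth_ramp': "smooth (ramp' n c)"
  by (rule smooth_partial[OF smooth_ramp]) simp

lemma ramp_has_derivative: "(ramp n c has_real_derivative ramp' n c t) (at t)"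
proof -
  have "(\<lambda>v. \<Sum>i\<in>Basis. (v \<bullet> i) * partial i (ramp n c) t) = (*) (ramp' n c t)"
    by (simp add: fun_eq_iff mult.commute)
  with smooth_has_derivative[OF smooth_ramp, of n c t] show ?thesis
    unfolding has_field_derivative_def by simp
qed

lemma ramp_bounds: "0 \<le> ramp n c t" "ramp n c t \<le> 1"
  by (simp_all add: ramp_def smooth_step_bounds)

lemma ramp_mono: "s \<le> t \<Longrightarrow> ramp n c s \<le> ramp n c t"
  unfolding ramp_def by (intro smooth_step_mono diff_mono mult_left_mono) simp_all

lemma ramp_eq_0: "t \<le> c + 1 / real (Suc n) \<Longrightarrow> ramp n c t = 0"
proof -
  assume "t \<le> c + 1 / real (Suc n)"
  then have "real (Suc n) * (t - c) \<le> real (Suc n) * (1 / real (Suc n))"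
    by (intro mult_left_mono) simp_all
  then show ?thesis unfolding ramp_def by (intro smooth_step_eq_0) simp
qed

lemma ramp_eq_0': "t \<le> c \<Longrightarrow> ramp n c t = 0"
  by (rule ramp_eq_0, rule order_trans[of _ c]) simp_all

lemma ramp_eq_1: "c + 2 / real (Suc n) \<le> t \<Longrightarrow> ramp n c t = 1"
proof -
  assume "c + 2 / real (Suc n) \<le> t"
  then have "real (Suc n) * (2 / real (Suc n)) \<le> real (Suc n) * (t - c)"
    by (intro mult_left_mono) simp_all
  moreover have "real (Suc n) * (2 / real (Suc n)) = 2" by (simp add: field_simps)
  ultimately show ?thesis unfolding ramp_def by (intro smooth_step_eq_1) linarith
qed

lemma ramp'_nonneg: "0 \<le> ramp' n c t"
proof (rule mono_on_imp_deriv_nonneg[OF _ ramp_has_derivative])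
  show "mono_on UNIV (ramp n c)" by (intro mono_onI ramp_mono)
qed simp

lemma ramp'_eq_0:
  assumes "t < c \<or> c + 2 / real (Suc n) < t"
  shows "ramp' n c t = 0"
proof -
  have "(ramp n c has_real_derivative 0) (at t)"
    using assms
  proof
    assume "t < c"
    have "(ramp n c has_real_derivative 0) (at t)"
      by (rule has_field_derivative_transform_within_open[where f="\<lambda>_. 0" and S="{..<c}", OF DERIV_const])
        (use \<open>t < c\<close> in \<open>simp_all add: ramp_eq_0'\<close>)
    then show ?thesis by blast
  next
    assume "c + 2 / real (Suc n) < t"
    have "(ramp n c has_real_derivative 0) (at t)"
      by (rule has_field_derivative_transform_within_open[where f="\<lambda>_. 1" and S="{c + 2 / real (Suc n)<..}", OF DERIV_const])
        (use \<open>c + 2 / real (Suc n) < t\<close> in \<open>simp_all add: ramp_eq_1 less_imp_le del: of_nat_Suc\<close>)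
    then show ?thesis by blast
  qed
  then show ?thesis by (rule DERIV_unique[OF ramp_has_derivative])
qed

lemma ramp'_bounded: "\<exists>M\<ge>0. \<forall>t. \<bar>ramp' n c t\<bar> \<le> M"
proof (rule smooth_compact_support_bounded[OF smooth_ramp'])
  fix t :: real assume "\<bar>c\<bar> + 2 / real (Suc n) < norm t"
  then have "t < c \<or> c + 2 / real (Suc n) < t" by (auto simp: abs_real_def split: if_splits)
  then show "ramp' n c t = 0" by (rule ramp'_eq_0)
qed

lemma ramp'_measurable: "ramp' n c \<in> borel_measurable borel"
  by (rule smooth_borel_measurable[OF smooth_ramp'])

lemma ramp'_integral: "(\<integral>\<^sup>+t. ennreal (ramp' n c t) \<partial>lborel) = 1"
proof -
  let ?d = "c + 2 / real (Suc n)"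
  have "ennreal (ramp' n c t) = ennreal (ramp' n c t) * indicator {c..?d} t" for t
    using ramp'_eq_0[of t c n] by (auto simp: indicator_def not_le simp del: of_nat_Suc)
  then have "(\<integral>\<^sup>+t. ennreal (ramp' n c t) \<partial>lborel) = (\<integral>\<^sup>+t. ennreal (ramp' n c t) * indicator {c..?d} t \<partial>lborel)"
    by simp
  also have "\<dots> = ennreal (ramp n c ?d - ramp n c c)"
    by (rule nn_integral_FTC_Icc[OF ramp'_measurable ramp_has_derivative ramp'_nonneg]) simp
  also have "\<dots> = 1" by (simp add: ramp_eq_1 ramp_eq_0' del: of_nat_Suc)
  finally show ?thesis .
qed

lemma ramp'_has_integral: "integrable lborel (ramp' n c)" "(LINT t|lborel. ramp' n c t) = 1"
proof -
  show i: "integrable lborel (ramp' n c)"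
    using ramp'_integral[of n c] ramp'_nonneg[of n c] ramp'_measurable[of n c]
    by (intro integrableI_bounded) simp_all
  have "ennreal (LINT t|lborel. ramp' n c t) = 1"
    using nn_integral_eq_integral[OF i] ramp'_nonneg ramp'_integral[of n c] by simp
  then show "(LINT t|lborel. ramp' n c t) = 1" by (metis ennreal_eq_1)
qed

lemma ramp_tendsto: "(\<lambda>n. ramp n c t) \<longlonglongrightarrow> indicator {c<..} t"
proof (cases "c < t")
  case True
  have "(\<lambda>n. 2 * inverse (real (Suc n))) \<longlonglongrightarrow> 2 * 0"
    by (intro tendsto_mult tendsto_const LIMSEQ_inverse_real_of_nat)
  then have "\<forall>\<^sub>F n in sequentially. 2 * inverse (real (Suc n)) < t - c"
    by (rule order_tendstoD) (use True in simp)
  then have "\<forall>\<^sub>F n in sequentially. ramp n c t = 1"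
    by eventually_elim (rule ramp_eq_1, simp add: divide_inverse del: of_nat_Suc)
  then show ?thesis using True by (simp add: tendsto_eventually)
next
  case False
  have "ramp n c t = 0" for n
    by (rule ramp_eq_0') (use False in simp)
  then show ?thesis using False by simp
qed

lemma slice_integral_eq:
  fixes f f' g :: "real \<Rightarrow> real"
  assumes f': "f' \<in> borel_measurable borel" "\<And>t. t \<notin> I \<Longrightarrow> f' t = 0" and I: "I \<in> sets borel"
    and ae: "AE t in lborel. t \<in> I \<longrightarrow> f t = f' t" and g: "g \<in> borel_measurable borel"
  shows "(LINT t|lebesgue_on I. f t * g t) = (LINT t|lborel. f' t * g t)"
proof -
  have m: "(\<lambda>t. f' t * g t) \<in> borel_measurable lborel" using f'(1) g by simp
  then have m': "(\<lambda>t. f' t * g t) \<in> borel_measurable lebesgue" by (rule measurable_completion)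
  have ae': "AE t in lebesgue. f' t * g t = indicator I t *\<^sub>R (f t * g t)"
    unfolding AE_completion_iff using ae
  proof eventually_elim
    case (elim t)
    then show ?case using f'(2)[of t] by (cases "t \<in> I") simp_all
  qed
  have "(LINT t|lebesgue_on I. f t * g t) = (LINT t|lebesgue. indicator I t *\<^sub>R (f t * g t))"
    by (rule integral_restrict_space) (use I in simp)
  also have "\<dots> = (LINT t|lebesgue. f' t * g t)"
  proof (rule integral_cong_AE[OF borel_measurable_AE[OF m' ae'] m'])
    show "AE t in lebesgue. indicator I t *\<^sub>R (f t * g t) = f' t * g t"
      using ae' by eventually_elim (rule sym)
  qed
  also have "\<dots> = (LINT t|lborel. f' t * g t)" by (rule integral_completion[OF m])
  finally show ?thesis .
qed

section \<open>Continuity in time and the weak time derivative\<close>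

context bounded_open
begin

lemma cylinder_sets: "cylinder \<Omega> T \<in> sets borel" "cylinder \<Omega> T \<in> sets lebesgue"
  using borel_open[OF open_Times[OF open_\<Omega> open_greaterThanLessThan[of 0 T]]] by simp_all

lemma L1_sq_le_L2:
  assumes "f \<in> borel_measurable \<L>"
  shows "(\<integral>\<^sup>+x. ennreal \<bar>f x\<bar> \<partial>\<L>)\<^sup>2 \<le> emeasure \<L> \<Omega> * L2_sqnorm \<L> f"
proof -
  have "(\<integral>\<^sup>+x. 1 * ennreal \<bar>f x\<bar> \<partial>\<L>)\<^sup>2 \<le>
      (\<integral>\<^sup>+x. 1\<^sup>2 \<partial>\<L>) * (\<integral>\<^sup>+x. (ennreal \<bar>f x\<bar>)\<^sup>2 \<partial>\<L>)"
    using assms by (intro Cauchy_Schwarz_nn_integral) simp_all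
  then show ?thesis
    by (simp add: L2_sqnorm_def ennreal_power nn_integral_const space_restrict_space)
qed

text \<open>As the kernel has mass 1, the distance in L^1 is at most the kernel average of the
  distances between u(t) and u(c). These are small near c, since continuity in L^2 over a bounded
  set gives continuity in L^1. The kernel looks only to the right, which admits c = 0.\<close>

lemma time_average_tendsto:
  assumes u: "u \<in> C_time_L2 \<Omega> T" and c: "0 \<le> c" "c < T"
    and u': "u' \<in> borel_measurable borel" "integrable lborel u'" "\<And>z. z \<notin> cylinder \<Omega> T \<Longrightarrow> u' z = 0"
      "AE z in lebesgue_on (cylinder \<Omega> T). u z = u' z"
    and uc: "uc \<in> borel_measurable borel" "\<And>x. x \<notin> \<Omega> \<Longrightarrow> uc x = 0" "AE x in \<L>. u (x, c) = uc x"
  shows "(\<lambda>n. \<integral>\<^sup>+x. ennreal \<bar>(LINT t|lborel. u' (x, t) * ramp' n c t) - uc x\<bar> \<partial>lborel) \<longlonglongrightarrow> 0"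
proof -
  note [measurable] = u'(1) uc(1) ramp'_measurable
  have u'm: "u' \<in> borel_measurable (lborel \<Otimes>\<^sub>M lborel)" using u'(1) unfolding lborel_prod by simp
  define g where "g t = (\<integral>\<^sup>+x. ennreal \<bar>u' (x, t) - uc x\<bar> \<partial>lborel)" for t
  have slice: "AE x in lborel. integrable lborel (\<lambda>t. u' (x, t))"
    using u'(2) unfolding lborel_prod[symmetric] by (rule lborel_pair.AE_integrable_fst')
  have um: "(\<lambda>z. ennreal \<bar>u' z - uc (fst z)\<bar> * ennreal (ramp' n c (snd z))) \<in> borel_measurable (lborel \<Otimes>\<^sub>M lborel)" for n
    using u'm by measurable
  have le: "(\<integral>\<^sup>+x. ennreal \<bar>(LINT t|lborel. u' (x, t) * ramp' n c t) - uc x\<bar> \<partial>lborel) \<le>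
      (\<integral>\<^sup>+t. g t * ennreal (ramp' n c t) \<partial>lborel)" for n
  proof -
    obtain M where M: "M \<ge> 0" "\<And>t. \<bar>ramp' n c t\<bar> \<le> M" using ramp'_bounded[of n c] by blast
    have "(\<integral>\<^sup>+x. ennreal \<bar>(LINT t|lborel. u' (x, t) * ramp' n c t) - uc x\<bar> \<partial>lborel) \<le>
      (\<integral>\<^sup>+x. (\<integral>\<^sup>+t. ennreal \<bar>u' (x, t) - uc x\<bar> * ennreal (ramp' n c t) \<partial>lborel) \<partial>lborel)"
    proof (rule nn_integral_mono_AE)
      show "AE x in lborel. ennreal \<bar>(LINT t|lborel. u' (x, t) * ramp' n c t) - uc x\<bar>
          \<le> (\<integral>\<^sup>+t. ennreal \<bar>u' (x, t) - uc x\<bar> * ennreal (ramp' n c t) \<partial>lborel)"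
        using slice
      proof eventually_elim
        case (elim x)
        have i1: "integrable lborel (\<lambda>t. u' (x, t) * ramp' n c t)"
        proof (rule Bochner_Integration.integrable_bound[of lborel "\<lambda>t. u' (x, t) * M"])
          show "integrable lborel (\<lambda>t. u' (x, t) * M)" by (rule integrable_mult_left) (rule elim)
          show "(\<lambda>t. u' (x, t) * ramp' n c t) \<in> borel_measurable lborel"
            using borel_measurable_integrable[OF elim] by simp
          show "AE t in lborel. norm (u' (x, t) * ramp' n c t) \<le> norm (u' (x, t) * M)"
            using M by (intro AE_I2) (simp add: abs_mult mult_left_mono)
        qed
        have i2: "integrable lborel (\<lambda>t. uc x * ramp' n c t)"
          by (rule integrable_mult_right) (rule ramp'_has_integral)
        have "(LINT t|lborel. u' (x, t) * ramp' n c t) - uc x = (LINT t|lborel. u' (x, t) * ramp' n c t - uc x * ramp' n c t)"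
          using i1 i2 by (simp add: Bochner_Integration.integral_diff ramp'_has_integral)
        then have "ennreal \<bar>(LINT t|lborel. u' (x, t) * ramp' n c t) - uc x\<bar> \<le>
            (\<integral>\<^sup>+t. ennreal (norm (u' (x, t) * ramp' n c t - uc x * ramp' n c t)) \<partial>lborel)"
          using integral_norm_bound_ennreal[OF Bochner_Integration.integrable_diff[OF i1 i2]] by simp
        also have "\<dots> = (\<integral>\<^sup>+t. ennreal \<bar>u' (x, t) - uc x\<bar> * ennreal (ramp' n c t) \<partial>lborel)"
        proof (rule nn_integral_cong)
          fix t
          have "norm (u' (x, t) * ramp' n c t - uc x * ramp' n c t) = \<bar>u' (x, t) - uc x\<bar> * ramp' n c t"
            by (simp add: left_diff_distrib[symmetric] abs_mult ramp'_nonneg)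
          then show "ennreal (norm (u' (x, t) * ramp' n c t - uc x * ramp' n c t)) =
              ennreal \<bar>u' (x, t) - uc x\<bar> * ennreal (ramp' n c t)"
            by (simp add: ennreal_mult ramp'_nonneg)
        qed
        finally show ?case .
      qed
    qed
    also have "\<dots> = (\<integral>\<^sup>+t. (\<integral>\<^sup>+x. ennreal \<bar>u' (x, t) - uc x\<bar> * ennreal (ramp' n c t) \<partial>lborel) \<partial>lborel)"
      by (rule lborel_pair.Fubini'[symmetric]) (use um[of n] in \<open>simp add: case_prod_unfold\<close>)
    also have "\<dots> = (\<integral>\<^sup>+t. g t * ennreal (ramp' n c t) \<partial>lborel)"
    proof (rule nn_integral_cong)
      fix t
      have "(\<lambda>x. u' (x, t)) \<in> borel_measurable lborel" using u'm by (rule measurable_Pair1) simp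
      then show "(\<integral>\<^sup>+x. ennreal \<bar>u' (x, t) - uc x\<bar> * ennreal (ramp' n c t) \<partial>lborel) = g t * ennreal (ramp' n c t)"
        unfolding g_def by (intro nn_integral_multc) simp
    qed
    finally show ?thesis .
  qed
  have g_eq: "AE t in lborel. t \<in> {0<..<T} \<longrightarrow> (g t)\<^sup>2 \<le> emeasure \<L> \<Omega> * L2_sqnorm \<L> (\<lambda>x. u (x, t) - u (x, c))"
    using AE_lebesgue_on_slices(2)[OF cylinder_sets(2) u'(4)]
  proof eventually_elim
    case (elim t)
    show ?case
    proof
      assume t: "t \<in> {0<..<T}"
      have "AE x in lborel. x \<in> \<Omega> \<longrightarrow> u (x, t) = u' (x, t)" using elim t by simp
      then have ae1: "AE x in \<L>. u (x, t) = u' (x, t)"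
        unfolding AE_lebesgue_on_iff[OF \<Omega>_sets] AE_completion_iff .
      have "(\<lambda>x. u (x, t)) \<in> L2 \<L>" "(\<lambda>x. u (x, c)) \<in> L2 \<L>"
        using u t c unfolding C_time_L2_def by auto
      then have m: "(\<lambda>x. u (x, t) - u (x, c)) \<in> borel_measurable \<L>"
        by (intro borel_measurable_diff L2_measurable)
      have z: "u' (x, t) - uc x = 0" if "x \<notin> \<Omega>" for x using that u'(3)[of "(x, t)"] uc(2) by simp
      have "g t = (\<integral>\<^sup>+x. ennreal \<bar>u' (x, t) - uc x\<bar> \<partial>lebesgue)"
        unfolding g_def by (rule nn_integral_completion[symmetric])
      also have "\<dots> = (\<integral>\<^sup>+x. ennreal \<bar>u' (x, t) - uc x\<bar> * indicator \<Omega> x \<partial>lebesgue)"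
        by (rule nn_integral_cong) (use z in \<open>simp add: indicator_def\<close>)
      also have "\<dots> = (\<integral>\<^sup>+x. ennreal \<bar>u' (x, t) - uc x\<bar> \<partial>\<L>)"
        by (rule nn_integral_restrict_space[symmetric]) (use \<Omega>_sets in simp)
      also have "\<dots> = (\<integral>\<^sup>+x. ennreal \<bar>u (x, t) - u (x, c)\<bar> \<partial>\<L>)"
        by (rule nn_integral_cong_AE) (use ae1 uc(3) in eventually_elim, simp)
      finally show "(g t)\<^sup>2 \<le> emeasure \<L> \<Omega> * L2_sqnorm \<L> (\<lambda>x. u (x, t) - u (x, c))"
        using L1_sq_le_L2[OF m] by simp
    qed
  qed
  show ?thesis
  proof (rule order_tendstoI)
    fix \<epsilon> :: ennreal assume "0 < \<epsilon>"
    then obtain e where e: "0 < e" "e < \<epsilon>" using dense by blast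
    let ?N = "\<lambda>s. L2_sqnorm \<L> (\<lambda>x. u (x, s) - u (x, c))"
    interpret finite_measure "\<L>" by (rule finite_measure_\<Omega>)
    have "(?N \<longlongrightarrow> 0) (at c within {0..T})" using u c unfolding C_time_L2_def by auto
    then have "((\<lambda>s. emeasure \<L> \<Omega> * ?N s) \<longlongrightarrow> emeasure \<L> \<Omega> * 0) (at c within {0..T})"
      by (intro ennreal_tendsto_cmult) (simp add: emeasure_finite less_top[symmetric])
    then have "\<forall>\<^sub>F s in at c within {0..T}. emeasure \<L> \<Omega> * ?N s < e * e"
      by (rule order_tendstoD(2)) (use e in \<open>simp add: ennreal_zero_less_mult_iff\<close>)
    then obtain \<delta> where \<delta>: "\<delta> > 0" "\<And>s. s \<in> {0..T} \<Longrightarrow> s \<noteq> c \<Longrightarrow> dist s c < \<delta> \<Longrightarrow> emeasure \<L> \<Omega> * ?N s < e * e"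
      unfolding eventually_at by blast
    have "(\<lambda>n. 2 * inverse (real (Suc n))) \<longlonglongrightarrow> 2 * 0"
      by (intro tendsto_mult tendsto_const LIMSEQ_inverse_real_of_nat)
    then have "\<forall>\<^sub>F n in sequentially. 2 * inverse (real (Suc n)) < min \<delta> (T - c)"
      by (rule order_tendstoD) (use \<delta>(1) c in simp)
    then show "\<forall>\<^sub>F n in sequentially. (\<integral>\<^sup>+x. ennreal \<bar>(LINT t|lborel. u' (x, t) * ramp' n c t) - uc x\<bar> \<partial>lborel) < \<epsilon>"
    proof eventually_elim
      case (elim n)
      have n: "2 / real (Suc n) < \<delta>" "2 / real (Suc n) < T - c"
        using elim by (simp_all add: divide_inverse del: of_nat_Suc)
      have "(\<integral>\<^sup>+t. g t * ennreal (ramp' n c t) \<partial>lborel) \<le> (\<integral>\<^sup>+t. e * ennreal (ramp' n c t) \<partial>lborel)"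
      proof (rule nn_integral_mono_AE)
        have "AE t in lborel. t \<noteq> c" by (rule AE_lborel_singleton)
        with g_eq show "AE t in lborel. g t * ennreal (ramp' n c t) \<le> e * ennreal (ramp' n c t)"
        proof eventually_elim
          case (elim t)
          show ?case
          proof (cases "t < c \<or> c + 2 / real (Suc n) < t")
            case True
            then show ?thesis by (simp only: ramp'_eq_0) simp
          next
            case False
            then have t: "t \<in> {0<..<T}" "dist t c < \<delta>" using n c elim(2) by (auto simp: dist_real_def simp del: of_nat_Suc)
            have "(g t)\<^sup>2 \<le> e * e"
              using elim(1) t(1) less_imp_le[OF \<delta>(2)[OF _ elim(2) t(2)]] by (auto intro: order_trans)
            then have "g t \<le> e"
              using ennreal_less_of_square_less[of "g t" e "g t"] by (meson not_le less_irrefl)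
            then show ?thesis by (rule mult_right_mono) simp
          qed
        qed
      qed
      also have "\<dots> = e" using ramp'_measurable by (simp add: nn_integral_cmult ramp'_integral)
      finally show ?case using le[of n] e(2) by (auto intro: le_less_trans order_trans)
    qed
  qed simp
qed

lemma integrable_representative:
  assumes "v \<in> L2 lborel" "\<And>z. z \<notin> cylinder \<Omega> T \<Longrightarrow> v z = (0 :: real)"
  shows "integrable lborel v"
  by (rule L2_bounded_support_integrable[OF assms(1) bounded_Times[OF bounded_\<Omega> bounded_box[of 0 T, unfolded box_real]]
      cylinder_sets(1) assms(2)])

text \<open>The weak derivative is tested with a ramp at a minus a ramp at b. For almost every x one
  side becomes the difference of time averages of \<open>u\<close> after a and after b, the other
  the integral of \<open>v'\<close> against an approximation of the indicator of (a, b]. The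
  exceptional null set depends on the test function, but only countably many test functions
  occur.\<close>

lemma time_increment:
  assumes u: "u \<in> C_time_L2 \<Omega> T" "u \<in> L2 (lebesgue_on (cylinder \<Omega> T))" and v: "is_time_deriv \<Omega> T u v"
    and v': "v' \<in> borel_measurable borel" "v' \<in> L2 lborel" "\<And>z. z \<notin> cylinder \<Omega> T \<Longrightarrow> v' z = 0"
      "AE z in lebesgue_on (cylinder \<Omega> T). v z = v' z"
    and ab: "0 \<le> a" "a < b" "b < T"
  shows "AE x in lborel. x \<in> \<Omega> \<longrightarrow> u (x, b) - u (x, a) = (LINT t|lborel. v' (x, t) * indicator {a<..b} t)"
proof -
  obtain u' where u': "u' \<in> borel_measurable borel" "u' \<in> L2 lborel" "\<And>z. z \<notin> cylinder \<Omega> T \<Longrightarrow> u' z = 0"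
      "AE z in lebesgue_on (cylinder \<Omega> T). u z = u' z"
    by (rule borel_representative[OF cylinder_sets(1) u(2)]) blast
  have \<Omega>b: "\<Omega> \<in> sets borel" using open_\<Omega> by simp
  have uL: "(\<lambda>x. u (x, t)) \<in> L2 \<L>" if "t \<in> {0..T}" for t
    using u(1) that unfolding C_time_L2_def by blast
  have tab: "a \<in> {0..T}" "b \<in> {0..T}" using ab by simp_all
  obtain ua where
    ua: "ua \<in> borel_measurable borel" "\<And>x. x \<notin> \<Omega> \<Longrightarrow> ua x = 0" "AE x in \<L>. u (x, a) = ua x"
    by (rule borel_representative[OF \<Omega>b uL[OF tab(1)]]) blast
  obtain ub where
    ub: "ub \<in> borel_measurable borel" "\<And>x. x \<notin> \<Omega> \<Longrightarrow> ub x = 0" "AE x in \<L>. u (x, b) = ub x"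
    by (rule borel_representative[OF \<Omega>b uL[OF tab(2)]]) blast
  have iu': "integrable lborel u'" by (rule integrable_representative[OF u'(2,3)])
  have iv': "integrable lborel v'" by (rule integrable_representative[OF v'(2,3)])
  define J where "J n c x = (LINT t|lborel. u' (x, t) * ramp' n c t)" for n c x
  note [measurable] = ua(1) ub(1) ramp'_measurable
  have Jm [measurable]: "J n c \<in> borel_measurable borel" for n c
  proof -
    have 1: "u' \<in> borel_measurable (lborel \<Otimes>\<^sub>M lborel)" using u'(1) unfolding lborel_prod by simp
    have 2: "(\<lambda>z. ramp' n c (snd z)) \<in> borel_measurable (lborel \<Otimes>\<^sub>M lborel)"
      by (rule measurable_compose[OF measurable_snd]) (use ramp'_measurable in simp)
    have "(\<lambda>z. u' z * ramp' n c (snd z)) \<in> borel_measurable (lborel \<Otimes>\<^sub>M lborel)"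
      by (rule borel_measurable_times[OF 1 2])
    then have "J n c \<in> borel_measurable lborel"
      unfolding J_def[abs_def]
      by (intro lborel.borel_measurable_lebesgue_integral) (simp add: case_prod_unfold)
    then show ?thesis by simp
  qed
  have ab': "0 \<le> b" "a < T" using ab by simp_all
  have conv1: "(\<lambda>n. \<integral>\<^sup>+x. ennreal \<bar>J n a x - ua x\<bar> \<partial>lborel) \<longlonglongrightarrow> 0"
    unfolding J_def by (rule time_average_tendsto[OF u(1) ab(1) ab'(2) u'(1) iu' u'(3,4) ua])
  have conv2: "(\<lambda>n. \<integral>\<^sup>+x. ennreal \<bar>J n b x - ub x\<bar> \<partial>lborel) \<longlonglongrightarrow> 0"
    unfolding J_def by (rule time_average_tendsto[OF u(1) ab'(1) ab(3) u'(1) iu' u'(3,4) ub])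
  define \<psi> where "\<psi> n t = ramp n a t - ramp n b t" for n t
  have \<psi>s: "smooth (\<psi> n)" for n unfolding \<psi>_def[abs_def] by (rule smooth_diff[OF smooth_ramp smooth_ramp])
  have \<psi>d: "deriv (\<psi> n) t = ramp' n a t - ramp' n b t" for n t
    unfolding \<psi>_def[abs_def] by (rule DERIV_imp_deriv[OF DERIV_diff[OF ramp_has_derivative ramp_has_derivative]])
  have \<psi>m [measurable]: "\<psi> n \<in> borel_measurable borel" for n by (rule smooth_borel_measurable[OF \<psi>s])
  have \<psi>b: "\<bar>\<psi> n t\<bar> \<le> 1" for n t
    using ramp_bounds[of n a t] ramp_bounds[of n b t] unfolding \<psi>_def by linarith
  have \<psi>lim: "(\<lambda>n. \<psi> n t) \<longlonglongrightarrow> indicator {a<..b} t" for t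
  proof -
    have "(\<lambda>n. \<psi> n t) \<longlonglongrightarrow> indicator {a<..} t - indicator {b<..} t"
      unfolding \<psi>_def by (intro tendsto_diff ramp_tendsto)
    moreover have "indicator {a<..} t - indicator {b<..} t = (indicator {a<..b} t :: real)"
      using ab(2) by (auto simp: indicator_def)
    ultimately show ?thesis by simp
  qed
  have "(\<lambda>n. 2 * inverse (real (Suc n))) \<longlonglongrightarrow> 2 * 0"
    by (intro tendsto_mult tendsto_const LIMSEQ_inverse_real_of_nat)
  then have ev: "\<forall>\<^sub>F n in sequentially. 2 * inverse (real (Suc n)) < T - b"
    by (rule order_tendstoD) (use ab in simp)
  \<comment> \<open>From this index on the ramp at b is complete before T.\<close>
  then obtain n0 where n0: "\<And>n. n \<ge> n0 \<Longrightarrow> 2 * inverse (real (Suc n)) < T - b"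
    unfolding eventually_sequentially by blast
  have test: "\<psi> n \<in> test_functions {0<..<T}" if "n \<ge> n0" for n
  proof -
    have n: "b + 2 / real (Suc n) < T" using n0[OF that] by (simp add: divide_inverse del: of_nat_Suc)
    have "\<psi> n t = 0" if "t \<notin> {a + 1 / real (Suc n)..b + 2 / real (Suc n)}" for t
    proof (cases "t < a + 1 / real (Suc n)")
      case True
      then show ?thesis using ab(2) by (simp add: \<psi>_def ramp_eq_0 del: of_nat_Suc)
    next
      case False
      then have "b + 2 / real (Suc n) \<le> t" using that by simp
      moreover then have "a + 2 / real (Suc n) \<le> t" using ab(2) by simp
      ultimately show ?thesis by (simp add: \<psi>_def ramp_eq_1 del: of_nat_Suc)
    qed
    then have cl: "closure {t. \<psi> n t \<noteq> 0} \<subseteq> {a + 1 / real (Suc n)..b + 2 / real (Suc n)}"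
      by (intro closure_minimal closed_atLeastAtMost) blast
    have "0 < a + 1 / real (Suc n)" using ab(1) by (intro add_nonneg_pos) simp_all
    then have "{a + 1 / real (Suc n)..b + 2 / real (Suc n)} \<subseteq> {0<..<T}"
      using n by (auto simp del: of_nat_Suc)
    then have sub: "closure {t. \<psi> n t \<noteq> 0} \<subseteq> {0<..<T}" using cl by (rule order_trans[rotated])
    have "compact ({a + 1 / real (Suc n)..b + 2 / real (Suc n)} \<inter> closure {t. \<psi> n t \<noteq> 0})"
      by (rule compact_Int_closed[OF compact_Icc closed_closure])
    also have "{a + 1 / real (Suc n)..b + 2 / real (Suc n)} \<inter> closure {t. \<psi> n t \<noteq> 0} = closure {t. \<psi> n t \<noteq> 0}"
      using cl by (rule Int_absorb1)
    finally show ?thesis using \<psi>s[of n] sub by (simp only: test_functions_def mem_Collect_eq simp_thms)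
  qed
  note sl = lborel_pair.AE_integrable_fst'[unfolded lborel_prod, OF iu'] lborel_pair.AE_integrable_fst'[unfolded lborel_prod, OF iv']
  have bm: "integrable lborel (\<lambda>t. f t * g t)"
    if "integrable lborel f" "g \<in> borel_measurable borel" "\<And>t. \<bar>g t\<bar> \<le> M" "M \<ge> 0" for f g :: "real \<Rightarrow> real" and M
  proof (rule Bochner_Integration.integrable_bound[of lborel "\<lambda>t. f t * M"])
    show "integrable lborel (\<lambda>t. f t * M)" by (rule integrable_mult_left) (rule that)
    show "(\<lambda>t. f t * g t) \<in> borel_measurable lborel"
      using borel_measurable_integrable[OF that(1)] that(2) by simp
    show "AE t in lborel. norm (f t * g t) \<le> norm (f t * M)"
      using that(3,4) by (intro AE_I2) (simp add: abs_mult mult_left_mono)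
  qed
  have eq: "AE x in lborel. x \<in> \<Omega> \<longrightarrow> J n a x - J n b x = - (LINT t|lborel. v' (x, t) * \<psi> n t)" if n: "n \<ge> n0" for n
  proof -
    have "AE x in \<L>. (LINT t|lebesgue_on {0<..<T}. u (x, t) * deriv (\<psi> n) t) =
        - (LINT t|lebesgue_on {0<..<T}. v (x, t) * \<psi> n t)"
      using v test[OF n] unfolding is_time_deriv_def by blast
    then have "AE x in lborel. x \<in> \<Omega> \<longrightarrow> (LINT t|lebesgue_on {0<..<T}. u (x, t) * deriv (\<psi> n) t) =
        - (LINT t|lebesgue_on {0<..<T}. v (x, t) * \<psi> n t)"
      unfolding AE_lebesgue_on_iff[OF \<Omega>_sets] AE_completion_iff .
    with AE_lebesgue_on_slices(1)[OF cylinder_sets(2) u'(4)] AE_lebesgue_on_slices(1)[OF cylinder_sets(2) v'(4)] sl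
    show ?thesis
    proof eventually_elim
      case (elim x)
      show ?case
      proof
        assume x: "x \<in> \<Omega>"
        have I: "{0<..<T} \<in> sets borel" by simp
        have ae: "AE t in lborel. t \<in> {0<..<T} \<longrightarrow> u (x, t) = u' (x, t)" "AE t in lborel. t \<in> {0<..<T} \<longrightarrow> v (x, t) = v' (x, t)"
          using elim(1,2) x by simp_all
        have m: "(\<lambda>t. u' (x, t)) \<in> borel_measurable borel" "(\<lambda>t. v' (x, t)) \<in> borel_measurable borel"
          using borel_measurable_integrable[OF elim(3)] borel_measurable_integrable[OF elim(4)] by simp_all
        have z: "u' (x, t) = 0" "v' (x, t) = 0" if "t \<notin> {0<..<T}" for t
          using that u'(3)[of "(x, t)"] v'(3)[of "(x, t)"] by auto
        have dm: "deriv (\<psi> n) \<in> borel_measurable borel" unfolding \<psi>d[abs_def] by measurable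
        have "(LINT t|lborel. u' (x, t) * deriv (\<psi> n) t) = - (LINT t|lborel. v' (x, t) * \<psi> n t)"
        proof -
          have "(LINT t|lebesgue_on {0<..<T}. u (x, t) * deriv (\<psi> n) t) = (LINT t|lborel. u' (x, t) * deriv (\<psi> n) t)"
            by (rule slice_integral_eq[OF m(1) _ I ae(1) dm]) (rule z(1))
          moreover have "(LINT t|lebesgue_on {0<..<T}. v (x, t) * \<psi> n t) = (LINT t|lborel. v' (x, t) * \<psi> n t)"
            by (rule slice_integral_eq[OF m(2) _ I ae(2) \<psi>m]) (rule z(2))
          ultimately show ?thesis using elim(5) x by simp
        qed
        moreover have "(LINT t|lborel. u' (x, t) * deriv (\<psi> n) t) = J n a x - J n b x"
        proof -
          have i: "integrable lborel (\<lambda>t. u' (x, t) * ramp' n c t)" for c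
          proof -
            obtain M where "M \<ge> 0" "\<forall>t. \<bar>ramp' n c t\<bar> \<le> M" using ramp'_bounded[of n c] by blast
            then show ?thesis by (intro bm[OF elim(3) ramp'_measurable, of n c M]) simp_all
          qed
          from i[of a] i[of b] show ?thesis unfolding \<psi>d J_def right_diff_distrib by (rule Bochner_Integration.integral_diff)
        qed
        ultimately show "J n a x - J n b x = - (LINT t|lborel. v' (x, t) * \<psi> n t)" by simp
      qed
    qed
  qed
  define V where "V x = (LINT t|lborel. v' (x, t) * indicator {a<..b} t)" for x
  have lim: "AE x in lborel. x \<in> \<Omega> \<longrightarrow> (\<lambda>n. J n a x - J n b x) \<longlonglongrightarrow> - V x"
  proof -
    have "AE x in lborel. \<forall>n. n \<ge> n0 \<longrightarrow> x \<in> \<Omega> \<longrightarrow> J n a x - J n b x = - (LINT t|lborel. v' (x, t) * \<psi> n t)"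
      unfolding AE_all_countable
    proof
      fix n
      show "AE x in lborel. n \<ge> n0 \<longrightarrow> x \<in> \<Omega> \<longrightarrow> J n a x - J n b x = - (LINT t|lborel. v' (x, t) * \<psi> n t)"
      proof (cases "n \<ge> n0")
        case True
        from eq[OF this] show ?thesis by eventually_elim simp
      qed simp
    qed
    with sl(2) show ?thesis
    proof eventually_elim
      case (elim x)
      show ?case
      proof
        assume x: "x \<in> \<Omega>"
        have "(\<lambda>n. LINT t|lborel. v' (x, t) * \<psi> n t) \<longlonglongrightarrow> V x"
          unfolding V_def
        proof (rule integral_dominated_convergence[where w="\<lambda>t. \<bar>v' (x, t)\<bar>"])
          show "integrable lborel (\<lambda>t. \<bar>v' (x, t)\<bar>)" using elim(1) by (rule integrable_abs)
          show "AE t in lborel. (\<lambda>n. v' (x, t) * \<psi> n t) \<longlonglongrightarrow> v' (x, t) * indicator {a<..b} t"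
            by (intro AE_I2 tendsto_mult tendsto_const \<psi>lim)
          show "AE t in lborel. norm (v' (x, t) * \<psi> n t) \<le> \<bar>v' (x, t)\<bar>" for n
            using \<psi>b by (intro AE_I2) (simp add: abs_mult mult_left_le)
          note [measurable] = borel_measurable_integrable[OF elim(1)]
          show "(\<lambda>t. v' (x, t) * indicator {a<..b} t) \<in> borel_measurable lborel" by measurable
          show "(\<lambda>t. v' (x, t) * \<psi> n t) \<in> borel_measurable lborel" for n by measurable
        qed
        then have "(\<lambda>n. - (LINT t|lborel. v' (x, t) * \<psi> n t)) \<longlonglongrightarrow> - V x" by (rule tendsto_minus)
        moreover have "\<forall>\<^sub>F n in sequentially. - (LINT t|lborel. v' (x, t) * \<psi> n t) = J n a x - J n b x"
          using elim(2) x unfolding eventually_sequentially by metis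
        ultimately show "(\<lambda>n. J n a x - J n b x) \<longlonglongrightarrow> - V x" by (rule Lim_transform_eventually)
      qed
    qed
  qed
  let ?E = "\<lambda>n x. ennreal \<bar>(J n a x - J n b x) - (ua x - ub x)\<bar> * indicator \<Omega> x"
  have "(\<lambda>n. \<integral>\<^sup>+x. ?E n x \<partial>lborel) \<longlonglongrightarrow> 0"
  proof (rule tendsto_sandwich[OF _ _ tendsto_const])
    have "(\<integral>\<^sup>+x. ?E n x \<partial>lborel) \<le> (\<integral>\<^sup>+x. ennreal \<bar>J n a x - ua x\<bar> \<partial>lborel) + (\<integral>\<^sup>+x. ennreal \<bar>J n b x - ub x\<bar> \<partial>lborel)" for n
    proof -
      have "(\<integral>\<^sup>+x. ?E n x \<partial>lborel) \<le> (\<integral>\<^sup>+x. ennreal \<bar>J n a x - ua x\<bar> + ennreal \<bar>J n b x - ub x\<bar> \<partial>lborel)"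
      proof (rule nn_integral_mono)
        fix x
        have "\<bar>(J n a x - J n b x) - (ua x - ub x)\<bar> \<le> \<bar>J n a x - ua x\<bar> + \<bar>J n b x - ub x\<bar>" by linarith
        then have "ennreal \<bar>(J n a x - J n b x) - (ua x - ub x)\<bar> \<le> ennreal \<bar>J n a x - ua x\<bar> + ennreal \<bar>J n b x - ub x\<bar>"
          by (simp add: ennreal_plus[symmetric] ennreal_leI del: ennreal_plus)
        then show "?E n x \<le> ennreal \<bar>J n a x - ua x\<bar> + ennreal \<bar>J n b x - ub x\<bar>"
          by (cases "x \<in> \<Omega>") simp_all
      qed
      also have "\<dots> = (\<integral>\<^sup>+x. ennreal \<bar>J n a x - ua x\<bar> \<partial>lborel) + (\<integral>\<^sup>+x. ennreal \<bar>J n b x - ub x\<bar> \<partial>lborel)"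
        by (rule nn_integral_add) measurable
      finally show ?thesis .
    qed
    then show "\<forall>\<^sub>F n in sequentially. (\<integral>\<^sup>+x. ?E n x \<partial>lborel) \<le>
        (\<integral>\<^sup>+x. ennreal \<bar>J n a x - ua x\<bar> \<partial>lborel) + (\<integral>\<^sup>+x. ennreal \<bar>J n b x - ub x\<bar> \<partial>lborel)" by simp
    show "(\<lambda>n. (\<integral>\<^sup>+x. ennreal \<bar>J n a x - ua x\<bar> \<partial>lborel) + (\<integral>\<^sup>+x. ennreal \<bar>J n b x - ub x\<bar> \<partial>lborel)) \<longlonglongrightarrow> 0"
      using tendsto_add[OF conv1 conv2] by simp
  qed simp
  \<comment> \<open>The time averages converge in L^1, the integrals of \<open>v'\<close> pointwise;
    Fatou's lemma identifies the two limits almost everywhere without a subsequence.\<close>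
  then have "liminf (\<lambda>n. \<integral>\<^sup>+x. ?E n x \<partial>lborel) = 0" by (intro lim_imp_Liminf) simp_all
  moreover have "(\<integral>\<^sup>+x. liminf (\<lambda>n. ?E n x) \<partial>lborel) \<le> liminf (\<lambda>n. \<integral>\<^sup>+x. ?E n x \<partial>lborel)"
    by (rule nn_integral_liminf) (use \<Omega>b in measurable)
  ultimately have "(\<integral>\<^sup>+x. liminf (\<lambda>n. ?E n x) \<partial>lborel) = 0" by simp
  then have "AE x in lborel. liminf (\<lambda>n. ?E n x) = 0"
    by (subst (asm) nn_integral_0_iff_AE) (use \<Omega>b in measurable)
  moreover have "AE x in lborel. x \<in> \<Omega> \<longrightarrow> u (x, a) = ua x" "AE x in lborel. x \<in> \<Omega> \<longrightarrow> u (x, b) = ub x"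
    using ua(3) ub(3) unfolding AE_lebesgue_on_iff[OF \<Omega>_sets] AE_completion_iff .
  ultimately show ?thesis using lim
  proof eventually_elim
    case (elim x)
    show ?case
    proof
      assume x: "x \<in> \<Omega>"
      have "(\<lambda>n. J n a x - J n b x) \<longlonglongrightarrow> - V x" using elim(4) x by blast
      then have "(\<lambda>n. ennreal \<bar>(J n a x - J n b x) - (ua x - ub x)\<bar>) \<longlonglongrightarrow> ennreal \<bar>- V x - (ua x - ub x)\<bar>"
        by (intro tendsto_ennrealI tendsto_rabs tendsto_diff tendsto_const)
      then have "liminf (\<lambda>n. ennreal \<bar>(J n a x - J n b x) - (ua x - ub x)\<bar>) = ennreal \<bar>- V x - (ua x - ub x)\<bar>"
        by (intro lim_imp_Liminf) simp_all
      then have "ennreal \<bar>- V x - (ua x - ub x)\<bar> = 0" using elim(1) x by simp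
      then show "u (x, b) - u (x, a) = (LINT t|lborel. v' (x, t) * indicator {a<..b} t)"
        using elim(2,3) x unfolding V_def by simp
    qed
  qed
qed

end

section \<open>The energy estimate\<close>

lemma ennreal_integral_le:
  assumes f: "integrable M f"
  shows "ennreal (LINT x|M. f x) \<le> (\<integral>\<^sup>+x. ennreal (f x) \<partial>M)"
proof -
  have m: "integrable M (\<lambda>x. max 0 (f x))" using f by (intro integrable_max) simp_all
  have "(LINT x|M. f x) \<le> (LINT x|M. max 0 (f x))" by (rule integral_mono[OF f m]) simp
  then have "ennreal (LINT x|M. f x) \<le> ennreal (LINT x|M. max 0 (f x))" by (rule ennreal_leI)
  also have "\<dots> = (\<integral>\<^sup>+x. ennreal (max 0 (f x)) \<partial>M)" by (rule nn_integral_eq_integral[OF m, symmetric]) simp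
  also have "\<dots> = (\<integral>\<^sup>+x. ennreal (f x) \<partial>M)" by (simp only: ennreal_max_0)
  finally show ?thesis .
qed

lemma AE_lborel_translate:
  assumes "AE t in lborel. P t"
  shows "AE t in lborel. P (t - c :: real)"
proof -
  obtain N where N: "{t \<in> space lborel. \<not> P t} \<subseteq> N" "emeasure lborel N = 0" "N \<in> sets (lborel :: real measure)"
    using assms by (rule AE_E)
  have "AE t in lborel. t \<notin> N" by (rule AE_not_in[OF null_setsI[OF N(2,3)]])
  then have "AE t in lborel. - c + 1 * t \<notin> N"
    by (rule AE_borel_affine[rotated 2]) (use N(3) in simp_all)
  then show ?thesis
  proof eventually_elim
    case (elim t)
    then show ?case using N(1) by auto
  qed
qed

context bounded_open
begin

lemma integrable_L2: "(f :: 'a \<Rightarrow> real) \<in> L2 \<L> \<Longrightarrow> integrable \<L> f"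
  using L2_integrable_mult[of f "\<L>" "\<lambda>x. 1"] continuous_L2[OF continuous_on_const[of UNIV "1::real"]]
  by simp

text \<open>Gradient, second derivatives and traces enter as witnesses and not through
  \<open>weak_grad\<close>, whose choice is additive only almost everywhere. In this form the
  property passes to differences, and \<open>L\<close> is the Laplacian up to null sets.\<close>

definition mixed_problem :: "'a set \<Rightarrow> 'a set \<Rightarrow> ('a \<Rightarrow> real) \<Rightarrow> ('a \<Rightarrow> real) \<Rightarrow> bool" where
  "mixed_problem \<Gamma>\<^sub>D \<Gamma>\<^sub>N w L \<longleftrightarrow> (\<exists>G \<gamma> H g. trace_triple w G \<gamma> \<and>
     (AE x in \<S>. x \<in> \<Gamma>\<^sub>D \<longrightarrow> \<gamma> x = 0) \<and>
     (\<forall>i\<in>Basis. trace_triple (\<lambda>x. G x \<bullet> i) (H i) (\<lambda>x. g x \<bullet> i)) \<and>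
     (AE x in \<S>. x \<in> \<Gamma>\<^sub>N \<longrightarrow> g x \<bullet> outward_normal \<Omega> x = 0) \<and>
     (AE x in \<L>. (\<Sum>i\<in>Basis. H i x \<bullet> i) = L x))"

lemma mixed_problem_diff:
  assumes v1: "v1 \<in> space_X \<Omega> \<Gamma>\<^sub>N \<inter> space_V \<Omega> \<Gamma>\<^sub>D" and v2: "v2 \<in> space_X \<Omega> \<Gamma>\<^sub>N \<inter> space_V \<Omega> \<Gamma>\<^sub>D"
    and L: "AE x in \<L>. laplacian \<Omega> v1 x - laplacian \<Omega> v2 x = L x"
  shows "mixed_problem \<Gamma>\<^sub>D \<Gamma>\<^sub>N (\<lambda>x. v1 x - v2 x) L"
proof -
  obtain \<gamma>1 where 1: "has_trace \<Omega> v1 \<gamma>1" "AE x in \<S>. x \<in> \<Gamma>\<^sub>D \<longrightarrow> \<gamma>1 x = 0"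
    using v1 unfolding space_V_def by blast
  obtain \<gamma>2 where 2: "has_trace \<Omega> v2 \<gamma>2" "AE x in \<S>. x \<in> \<Gamma>\<^sub>D \<longrightarrow> \<gamma>2 x = 0"
    using v2 unfolding space_V_def by blast
  obtain g1 where g1: "\<forall>i\<in>Basis. has_trace \<Omega> (\<lambda>x. weak_grad \<Omega> v1 x \<bullet> i) (\<lambda>x. g1 x \<bullet> i)"
      "AE x in \<S>. x \<in> \<Gamma>\<^sub>N \<longrightarrow> g1 x \<bullet> outward_normal \<Omega> x = 0"
    using v1 unfolding space_X_def by blast
  obtain g2 where g2: "\<forall>i\<in>Basis. has_trace \<Omega> (\<lambda>x. weak_grad \<Omega> v2 x \<bullet> i) (\<lambda>x. g2 x \<bullet> i)"
      "AE x in \<S>. x \<in> \<Gamma>\<^sub>N \<longrightarrow> g2 x \<bullet> outward_normal \<Omega> x = 0"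
    using v2 unfolding space_X_def by blast
  let ?H = "\<lambda>v i. weak_grad \<Omega> (\<lambda>y. weak_grad \<Omega> v y \<bullet> i)"
  show ?thesis
    unfolding mixed_problem_def
  proof (intro exI conjI ballI)
    show "trace_triple (\<lambda>x. v1 x - v2 x) (\<lambda>x. weak_grad \<Omega> v1 x - weak_grad \<Omega> v2 x) (\<lambda>x. \<gamma>1 x - \<gamma>2 x)"
      by (rule trace_triple_diff[OF has_trace_triple[OF 1(1)] has_trace_triple[OF 2(1)]])
    show "AE x in \<S>. x \<in> \<Gamma>\<^sub>D \<longrightarrow> \<gamma>1 x - \<gamma>2 x = 0"
      using 1(2) 2(2) by eventually_elim simp
    show "trace_triple (\<lambda>x. (weak_grad \<Omega> v1 x - weak_grad \<Omega> v2 x) \<bullet> i)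
        (\<lambda>x. ?H v1 i x - ?H v2 i x) (\<lambda>x. (g1 x - g2 x) \<bullet> i)" if "i \<in> Basis" for i
      unfolding inner_diff_left
      by (rule trace_triple_diff[OF has_trace_triple[OF bspec[OF g1(1) that]] has_trace_triple[OF bspec[OF g2(1) that]]])
    show "AE x in \<S>. x \<in> \<Gamma>\<^sub>N \<longrightarrow> (g1 x - g2 x) \<bullet> outward_normal \<Omega> x = 0"
      using g1(2) g2(2) by eventually_elim (simp add: inner_diff_left)
    show "AE x in \<L>. (\<Sum>i\<in>Basis. (?H v1 i x - ?H v2 i x) \<bullet> i) = L x"
      using L by eventually_elim (simp add: laplacian_def inner_diff_left sum_subtractf)
  qed
qed

text \<open>The invariant of the time stepping: \<open>m\<close> is the running maximum,
  \<open>M\<close> its gradient, \<open>z\<close> the last value entered into it, and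
  \<open>S\<close> collects the errors so far.\<close>

definition energy_bound :: "'a set \<Rightarrow> real \<Rightarrow> ('a \<Rightarrow> real) \<Rightarrow> ennreal \<Rightarrow> bool" where
  "energy_bound \<Gamma>\<^sub>D \<epsilon> z S \<longleftrightarrow> (\<exists>m M \<mu>. trace_triple m M \<mu> \<and>
     (AE x in \<S>. x \<in> \<Gamma>\<^sub>D \<longrightarrow> \<mu> x = 0) \<and> (AE x in \<L>. 0 \<le> m x) \<and> (AE x in \<L>. z x \<le> m x) \<and>
     ennreal ((LINT x|\<L>. (norm (M x))\<^sup>2) / 2 + \<epsilon> * (LINT x|\<L>. m x)) \<le> S)"

text \<open>The next increment d = (w - c - m)_+ has gradient D = s (G - M) with 0 \<le> s \<le> 1.
  Then |M + D|^2 \<le> |M|^2 + 2 D . G, and Green's formula turns the integral of D . G into that of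
  -(\<Delta>w) d. Its boundary term vanishes: on \<Gamma>_D the traces of w and m are 0, and c \<ge>
  0 passes this on to d; on \<Gamma>_N the normal derivative of w is 0.\<close>

lemma energy_step:
  assumes Lip: "bounded_Lipschitz_domain \<Omega>" and fr: "\<Gamma>\<^sub>D \<union> \<Gamma>\<^sub>N = frontier \<Omega>"
    and w: "mixed_problem \<Gamma>\<^sub>D \<Gamma>\<^sub>N w L" and z: "energy_bound \<Gamma>\<^sub>D \<epsilon> z S"
    and c: "c \<ge> 0" and r: "AE x in \<L>. \<epsilon> - L x \<le> r x"
    and h: "AE x in \<L>. ennreal (w x - c - z x) \<le> h x"
  shows "energy_bound \<Gamma>\<^sub>D \<epsilon> (\<lambda>x. w x - c) (S + (\<integral>\<^sup>+x. ennreal (r x) * h x \<partial>\<L>))"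
proof -
  obtain m M \<mu> where m: "trace_triple m M \<mu>" "AE x in \<S>. x \<in> \<Gamma>\<^sub>D \<longrightarrow> \<mu> x = 0"
      "AE x in \<L>. 0 \<le> m x" "AE x in \<L>. z x \<le> m x"
    and S: "ennreal ((LINT x|\<L>. (norm (M x))\<^sup>2) / 2 + \<epsilon> * (LINT x|\<L>. m x)) \<le> S"
    using z unfolding energy_bound_def by blast
  obtain G \<gamma> H g where w: "trace_triple w G \<gamma>" "AE x in \<S>. x \<in> \<Gamma>\<^sub>D \<longrightarrow> \<gamma> x = 0"
    and G: "\<forall>i\<in>Basis. trace_triple (\<lambda>x. G x \<bullet> i) (H i) (\<lambda>x. g x \<bullet> i)"
    and g: "AE x in \<S>. x \<in> \<Gamma>\<^sub>N \<longrightarrow> g x \<bullet> outward_normal \<Omega> x = 0"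
    and H: "AE x in \<L>. (\<Sum>i\<in>Basis. H i x \<bullet> i) = L x"
    using w unfolding mixed_problem_def by blast
  let ?L = "\<lambda>x. \<Sum>i\<in>Basis. H i x \<bullet> i"
  define s where "s x = (1 + sgn (w x - m x - c)) / 2" for x
  define d where "d x = max (w x - m x - c) 0" for x
  define D where "D x = s x *\<^sub>R (G x - M x)" for x
  define \<delta> where "\<delta> x = max (\<gamma> x - \<mu> x - c) 0" for x
  have s: "0 \<le> s x" "s x \<le> 1" for x by (auto simp: s_def sgn_real_def)
  have td: "trace_triple d D \<delta>"
    unfolding d_def[abs_def] D_def[abs_def] \<delta>_def[abs_def] s_def
    by (rule trace_triple_pos_part[OF trace_triple_diff[OF w(1) m(1)] c])
  have tm: "trace_triple (\<lambda>x. m x + d x) (\<lambda>x. M x + D x) (\<lambda>x. \<mu> x + \<delta> x)"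
    by (rule trace_triple_add[OF m(1) td])
  have \<delta>0: "AE x in \<S>. x \<in> \<Gamma>\<^sub>D \<longrightarrow> \<delta> x = 0"
    using w(2) m(2) by eventually_elim (use c in \<open>simp add: \<delta>_def\<close>)
  have bc: "AE x in \<S>. \<delta> x = 0 \<or> g x \<bullet> outward_normal \<Omega> x = 0"
  proof -
    have "AE x in \<S>. x \<in> frontier \<Omega>"
      by (rule AE_I2) (simp add: surface_measure_def space_restrict_space)
    with \<delta>0 g show ?thesis by eventually_elim (use fr in blast)
  qed
  have green: "(LINT x|\<L>. D x \<bullet> G x) = - (LINT x|\<L>. ?L x * d x)"
    by (rule Green_formula[OF Lip td bspec[OF G] bc])
  have iM: "integrable \<L> (\<lambda>x. (norm (M x))\<^sup>2)" "integrable \<L> (\<lambda>x. D x \<bullet> G x)"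
    using trace_tripleD(2)[OF m(1)] L2_integrable_inner[OF trace_tripleD(2)[OF td] trace_tripleD(2)[OF w(1)]]
    by (simp_all add: L2_def)
  have "(LINT x|\<L>. (norm (M x + D x))\<^sup>2) \<le> (LINT x|\<L>. (norm (M x))\<^sup>2 + 2 * (D x \<bullet> G x))"
  proof (rule integral_mono)
    show "integrable \<L> (\<lambda>x. (norm (M x + D x))\<^sup>2)"
      using trace_tripleD(2)[OF tm] by (simp add: L2_def)
    show "integrable \<L> (\<lambda>x. (norm (M x))\<^sup>2 + 2 * (D x \<bullet> G x))" using iM by simp
    fix x
    \<comment> \<open>The quantity |M + D|^2 - |M|^2 - 2 D . G equals (s^2 - 2 s) |G - M|^2.\<close>
    have "s x * s x \<le> 2 * s x" by (rule mult_right_mono) (use s[of x] in simp_all)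
    then have "(s x * s x) * ((G x - M x) \<bullet> (G x - M x)) \<le> (2 * s x) * ((G x - M x) \<bullet> (G x - M x))"
      by (rule mult_right_mono) simp
    then have "D x \<bullet> D x \<le> 2 * (D x \<bullet> (G x - M x))" by (simp add: D_def mult.assoc)
    then show "(norm (M x + D x))\<^sup>2 \<le> (norm (M x))\<^sup>2 + 2 * (D x \<bullet> G x)"
      by (simp add: power2_norm_eq_inner inner_add_left inner_add_right inner_diff_right inner_commute)
  qed
  then have grad: "(LINT x|\<L>. (norm (M x + D x))\<^sup>2) / 2 \<le> (LINT x|\<L>. (norm (M x))\<^sup>2) / 2 - (LINT x|\<L>. ?L x * d x)"
    using iM green by simp
  have im: "integrable \<L> m" "integrable \<L> d"
    by (intro integrable_L2 trace_tripleD(1)[OF m(1)] trace_tripleD(1)[OF td])+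
  have iL: "integrable \<L> (\<lambda>x. ?L x * d x)"
  proof -
    have "integrable \<L> (\<lambda>x. \<Sum>i\<in>Basis. (H i x \<bullet> i) * d x)"
      by (intro Bochner_Integration.integrable_sum L2_integrable_mult L2_inner_component
          trace_tripleD(1)[OF td] trace_tripleD(2)[OF bspec[OF G]])
    then show ?thesis by (simp only: sum_distrib_right)
  qed
  have ie: "integrable \<L> (\<lambda>x. (\<epsilon> - ?L x) * d x)"
    unfolding left_diff_distrib by (intro Bochner_Integration.integrable_diff integrable_mult_right im iL)
  have "(LINT x|\<L>. (\<epsilon> - ?L x) * d x) = \<epsilon> * (LINT x|\<L>. d x) - (LINT x|\<L>. ?L x * d x)"
    unfolding left_diff_distrib using im iL by (simp add: Bochner_Integration.integral_diff)
  moreover have "(LINT x|\<L>. m x + d x) = (LINT x|\<L>. m x) + (LINT x|\<L>. d x)"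
    by (rule Bochner_Integration.integral_add[OF im])
  ultimately have "(LINT x|\<L>. (norm (M x + D x))\<^sup>2) / 2 + \<epsilon> * (LINT x|\<L>. m x + d x) \<le>
      ((LINT x|\<L>. (norm (M x))\<^sup>2) / 2 + \<epsilon> * (LINT x|\<L>. m x)) + (LINT x|\<L>. (\<epsilon> - ?L x) * d x)"
    using grad by (simp add: distrib_left)
  then have "ennreal ((LINT x|\<L>. (norm (M x + D x))\<^sup>2) / 2 + \<epsilon> * (LINT x|\<L>. m x + d x)) \<le>
      ennreal (((LINT x|\<L>. (norm (M x))\<^sup>2) / 2 + \<epsilon> * (LINT x|\<L>. m x)) + (LINT x|\<L>. (\<epsilon> - ?L x) * d x))"
    by (rule ennreal_leI)
  also have "\<dots> \<le> ennreal ((LINT x|\<L>. (norm (M x))\<^sup>2) / 2 + \<epsilon> * (LINT x|\<L>. m x)) +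
      ennreal (LINT x|\<L>. (\<epsilon> - ?L x) * d x)"
  proof -
    have "ennreal (a + b) \<le> ennreal a + ennreal b" for a b :: real
      by (cases "0 \<le> a"; cases "0 \<le> b") (simp_all add: ennreal_neg ennreal_leI add_increasing add_increasing2)
    then show ?thesis .
  qed
  also have "\<dots> \<le> S + (\<integral>\<^sup>+x. ennreal (r x) * h x \<partial>\<L>)"
  proof (rule add_mono[OF S])
    have "ennreal (LINT x|\<L>. (\<epsilon> - ?L x) * d x) \<le> (\<integral>\<^sup>+x. ennreal ((\<epsilon> - ?L x) * d x) \<partial>\<L>)"
      by (rule ennreal_integral_le[OF ie])
    also have "\<dots> \<le> (\<integral>\<^sup>+x. ennreal (r x) * h x \<partial>\<L>)"
    proof (rule nn_integral_mono_AE)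
      show "AE x in \<L>. ennreal ((\<epsilon> - ?L x) * d x) \<le> ennreal (r x) * h x"
        using r h H m(4)
      proof eventually_elim
        case (elim x)
        \<comment> \<open>Since m dominates the last value z, the increment of the maximum is at
          most the positive part of w - c - z.\<close>
        have "d x = max 0 (w x - c - m x)" by (simp add: d_def max.commute algebra_simps)
        then have "ennreal (d x) = ennreal (w x - c - m x)" by (simp only: ennreal_max_0)
        also have "\<dots> \<le> ennreal (w x - c - z x)" using elim(4) by (intro ennreal_leI) simp
        finally have dh: "ennreal (d x) \<le> h x" using elim(2) by simp
        have "0 \<le> d x" by (simp add: d_def)
        then have "ennreal ((\<epsilon> - ?L x) * d x) = ennreal (\<epsilon> - ?L x) * ennreal (d x)" by (rule ennreal_mult'')
        also have "\<dots> \<le> ennreal (r x) * h x" using elim(1,3) by (intro mult_mono dh ennreal_leI) simp_all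
        finally show ?case .
      qed
    qed
    finally show "ennreal (LINT x|\<L>. (\<epsilon> - ?L x) * d x) \<le> (\<integral>\<^sup>+x. ennreal (r x) * h x \<partial>\<L>)" .
  qed
  finally have e: "ennreal ((LINT x|\<L>. (norm (M x + D x))\<^sup>2) / 2 + \<epsilon> * (LINT x|\<L>. m x + d x))
      \<le> S + (\<integral>\<^sup>+x. ennreal (r x) * h x \<partial>\<L>)" .
  have "AE x in \<S>. x \<in> \<Gamma>\<^sub>D \<longrightarrow> \<mu> x + \<delta> x = 0" using m(2) \<delta>0 by eventually_elim simp
  moreover have "AE x in \<L>. 0 \<le> m x + d x" using m(3) by eventually_elim (simp add: d_def)
  moreover have "AE x in \<L>. w x - c \<le> m x + d x" by (rule AE_I2) (simp add: d_def)
  ultimately show ?thesis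
    unfolding energy_bound_def using tm e
    by (intro exI[of _ "\<lambda>x. m x + d x"] exI[of _ "\<lambda>x. M x + D x"] exI[of _ "\<lambda>x. \<mu> x + \<delta> x"] conjI)
qed

text \<open>Induction on the number of grid points t, t - \<tau>, ..., run backwards until one lies
  in (0, \<tau>]. There the maximum starts from 0, which is why \<open>h0\<close> compares with 0
  and not with an earlier value. The set \<open>A\<close> of admissible times is closed under the
  backward steps.\<close>

lemma discrete_energy:
  assumes Lip: "bounded_Lipschitz_domain \<Omega>" and fr: "\<Gamma>\<^sub>D \<union> \<Gamma>\<^sub>N = frontier \<Omega>" and \<epsilon>: "\<epsilon> \<ge> 0"
    and A: "\<And>t. t \<in> A \<Longrightarrow> 0 < t" "\<And>t. t \<in> A \<Longrightarrow> \<tau> < t \<Longrightarrow> t - \<tau> \<in> A"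
    and mp: "\<And>t. t \<in> A \<Longrightarrow> mixed_problem \<Gamma>\<^sub>D \<Gamma>\<^sub>N (\<lambda>x. w (x, t)) (\<lambda>x. L (x, t))"
    and r: "\<And>t. t \<in> A \<Longrightarrow> AE x in \<L>. \<epsilon> - L (x, t) \<le> r (x, t)"
    and h0: "\<And>t. t \<in> A \<Longrightarrow> t \<le> \<tau> \<Longrightarrow> AE x in \<L>. ennreal (w (x, t) - \<epsilon> * t) \<le> h x t"
    and h1: "\<And>t. t \<in> A \<Longrightarrow> \<tau> < t \<Longrightarrow>
      AE x in \<L>. ennreal ((w (x, t) - \<epsilon> * t) - (w (x, t - \<tau>) - \<epsilon> * (t - \<tau>))) \<le> h x t"
    and t: "t \<in> A" "t \<le> real n * \<tau>"
  shows "ennreal \<epsilon> * (\<integral>\<^sup>+x. ennreal (w (x, t) - \<epsilon> * t) \<partial>\<L>)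
    \<le> (\<Sum>j<n. \<integral>\<^sup>+x. ennreal (r (x, t - real j * \<tau>)) * h x (t - real j * \<tau>) \<partial>\<L>)"
proof -
  let ?P = "\<lambda>t. \<integral>\<^sup>+x. ennreal (r (x, t)) * h x t \<partial>\<L>"
  have "energy_bound \<Gamma>\<^sub>D \<epsilon> (\<lambda>x. w (x, t) - \<epsilon> * t) (\<Sum>j<n. ?P (t - real j * \<tau>))"
    using t
  proof (induction n arbitrary: t)
    case 0
    \<comment> \<open>Without grid points t \<le> 0, which is impossible for t in
      \<open>A\<close>.\<close>
    then show ?case using A(1) by fastforce
  next
    case (Suc n)
    note t = Suc.prems(1)
    have c: "0 \<le> \<epsilon> * t" using \<epsilon> A(1)[OF t] by simp
    note step = energy_step[OF Lip fr mp[OF t] _ c r[OF t]]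
    have "(\<Sum>j<Suc n. ?P (t - real j * \<tau>)) = (\<Sum>j<n. ?P (t - \<tau> - real j * \<tau>)) + ?P t"
      unfolding sum.lessThan_Suc_shift by (simp add: algebra_simps)
    moreover have "energy_bound \<Gamma>\<^sub>D \<epsilon> (\<lambda>x. w (x, t) - \<epsilon> * t) ((\<Sum>j<n. ?P (t - \<tau> - real j * \<tau>)) + ?P t)"
    proof (cases "\<tau> < t")
      case True
      have "t - \<tau> \<le> real n * \<tau>" using Suc.prems(2) by (simp add: algebra_simps)
      from step[OF Suc.IH[OF A(2)[OF t True] this] h1[OF t True]] show ?thesis .
    next
      case False
      have "energy_bound \<Gamma>\<^sub>D \<epsilon> (\<lambda>x. 0) (\<Sum>j<n. ?P (t - \<tau> - real j * \<tau>))"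
        unfolding energy_bound_def using trace_triple_0 by (intro exI[of _ "\<lambda>x. 0"]) simp
      from step[OF this] h0[OF t] False show ?thesis by simp
    qed
    ultimately show ?case by simp
  qed
  then obtain m M \<mu> where m: "trace_triple m M \<mu>" "AE x in \<L>. 0 \<le> m x" "AE x in \<L>. w (x, t) - \<epsilon> * t \<le> m x"
    "ennreal ((LINT x|\<L>. (norm (M x))\<^sup>2) / 2 + \<epsilon> * (LINT x|\<L>. m x)) \<le> (\<Sum>j<n. ?P (t - real j * \<tau>))"
    unfolding energy_bound_def by blast
  have "(\<integral>\<^sup>+x. ennreal (w (x, t) - \<epsilon> * t) \<partial>\<L>) \<le> (\<integral>\<^sup>+x. ennreal (m x) \<partial>\<L>)"
    by (rule nn_integral_mono_AE) (use m(3) in eventually_elim, rule ennreal_leI)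
  also have "\<dots> = ennreal (LINT x|\<L>. m x)"
    by (rule nn_integral_eq_integral[OF integrable_L2[OF trace_tripleD(1)[OF m(1)]] m(2)])
  finally have "ennreal \<epsilon> * (\<integral>\<^sup>+x. ennreal (w (x, t) - \<epsilon> * t) \<partial>\<L>) \<le> ennreal \<epsilon> * ennreal (LINT x|\<L>. m x)"
    by (rule mult_left_mono) simp
  also have "\<dots> = ennreal (\<epsilon> * (LINT x|\<L>. m x))" using \<epsilon> by (rule ennreal_mult'[symmetric])
  also have "\<dots> \<le> ennreal ((LINT x|\<L>. (norm (M x))\<^sup>2) / 2 + \<epsilon> * (LINT x|\<L>. m x))"
    by (rule ennreal_leI) simp
  finally show ?thesis using m(4) by (rule order_trans)
qed

end

text \<open>Substituting s = t - \<tau> q shows that the time integral of P is \<tau> times the mean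
  over 0 \<le> q < 1 of the correlation C(\<tau> q). The N + 1 steps of length T/(N+1) turn the
  factor \<tau> into T, and the correlation tends to 0 with the delay because R H = 0.\<close>

lemma delayed_product:
  fixes R H :: "'a::euclidean_space \<times> real \<Rightarrow> real"
  assumes R: "R \<in> borel_measurable borel" "\<And>z. 0 \<le> R z" "(\<integral>\<^sup>+z. (ennreal (R z))\<^sup>2 \<partial>lborel) < \<infinity>"
    and H: "H \<in> borel_measurable borel" "\<And>z. 0 \<le> H z" "(\<integral>\<^sup>+z. (ennreal (H z))\<^sup>2 \<partial>lborel) < \<infinity>"
    and RH: "AE z in lborel. R z * H z = 0" and T: "T > 0"
  defines "P \<equiv> \<lambda>\<tau> t. \<integral>\<^sup>+x. ennreal (R (x, t)) * (\<integral>\<^sup>+s. ennreal (H (x, s)) * indicator {t - \<tau><..t} s \<partial>lborel) \<partial>lborel"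
  shows "\<And>\<tau>. \<tau> > 0 \<Longrightarrow> P \<tau> \<in> borel_measurable borel"
    "(\<lambda>N. of_nat (Suc N) * (\<integral>\<^sup>+t. P (T / real (Suc N)) t \<partial>lborel)) \<longlonglongrightarrow> 0"
proof -
  define C where "C s = (\<integral>\<^sup>+z. ennreal (R z) * ennreal (H (z - (0, s))) \<partial>lborel)" for s
  define k where "k \<tau> y = ennreal (R (fst y)) * ennreal (H (fst y - (0, \<tau> * snd y))) * indicator {0..<1} (snd y)"
    for \<tau> :: real and y :: "('a \<times> real) \<times> real"
  have km: "k \<tau> \<in> borel_measurable (lborel \<Otimes>\<^sub>M lborel)" for \<tau>
  proof -
    have c: "continuous_on UNIV (\<lambda>y :: ('a \<times> real) \<times> real. fst y - (0, \<tau> * snd y))"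
      by (intro continuous_intros)
    have 1: "(\<lambda>y :: ('a \<times> real) \<times> real. H (fst y - (0, \<tau> * snd y))) \<in> borel_measurable borel"
      by (rule measurable_compose[OF borel_measurable_continuous_onI[OF c] H(1)])
    have 2: "(\<lambda>y :: ('a \<times> real) \<times> real. R (fst y)) \<in> borel_measurable borel"
      by (rule measurable_compose[OF borel_measurable_continuous_onI[OF continuous_on_fst[OF continuous_on_id]] R(1)])
    have 3: "(\<lambda>y :: ('a \<times> real) \<times> real. indicator {0..<1} (snd y) :: ennreal) \<in> borel_measurable borel"
      by (rule measurable_compose[OF borel_measurable_continuous_onI[OF continuous_on_snd[OF continuous_on_id]]
          borel_measurable_indicator]) simp
    have "k \<tau> \<in> borel_measurable borel"
      unfolding k_def[abs_def] by (intro borel_measurable_times_ennreal measurable_compose[OF _ measurable_ennreal] 1 2 3)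
    then show ?thesis unfolding lborel_prod by simp
  qed
  define K where "K \<tau> z = (\<integral>\<^sup>+q. k \<tau> (z, q) \<partial>lborel)" for \<tau> z
  have Km: "K \<tau> \<in> borel_measurable (lborel \<Otimes>\<^sub>M lborel)" for \<tau>
    using lborel.borel_measurable_nn_integral_fst[OF km[of \<tau>]] unfolding K_def[abs_def] lborel_prod .
  have P_eq: "P \<tau> t = (\<integral>\<^sup>+x. ennreal \<tau> * K \<tau> (x, t) \<partial>lborel)" if \<tau>: "\<tau> > 0" for \<tau> t
    unfolding P_def
  proof (rule nn_integral_cong)
    fix x
    have Hx: "(\<lambda>s. H (x, s)) \<in> borel_measurable borel"
      by (rule measurable_compose[OF borel_measurable_continuous_onI H(1)]) (intro continuous_intros)
    have "(\<integral>\<^sup>+s. ennreal (H (x, s)) * indicator {t - \<tau><..t} s \<partial>lborel) =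
        ennreal \<bar>- \<tau>\<bar> * (\<integral>\<^sup>+q. ennreal (H (x, t + (- \<tau>) * q)) * indicator {t - \<tau><..t} (t + (- \<tau>) * q) \<partial>lborel)"
      by (rule nn_integral_real_affine[where f="\<lambda>s. ennreal (H (x, s)) * indicator {t - \<tau><..t} s"])
        (use Hx \<tau> in simp_all)
    also have "\<dots> = ennreal \<tau> * (\<integral>\<^sup>+q. ennreal (H (x, t - \<tau> * q)) * indicator {0..<1} q \<partial>lborel)"
      using \<tau> by (simp add: indicator_def mult_less_cancel_left1 zero_le_mult_iff conj_commute)
    finally have e: "(\<integral>\<^sup>+s. ennreal (H (x, s)) * indicator {t - \<tau><..t} s \<partial>lborel) =
        ennreal \<tau> * (\<integral>\<^sup>+q. ennreal (H (x, t - \<tau> * q)) * indicator {0..<1} q \<partial>lborel)" .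
    have "K \<tau> (x, t) = (\<integral>\<^sup>+q. ennreal (R (x, t)) * (ennreal (H (x, t - \<tau> * q)) * indicator {0..<1} q) \<partial>lborel)"
      unfolding K_def k_def by (simp add: mult.assoc)
    also have "\<dots> = ennreal (R (x, t)) * (\<integral>\<^sup>+q. ennreal (H (x, t - \<tau> * q)) * indicator {0..<1} q \<partial>lborel)"
    proof (rule nn_integral_cmult)
      have "(\<lambda>q. H (x, t - \<tau> * q)) \<in> borel_measurable borel"
        by (rule measurable_compose[OF _ Hx]) (intro borel_measurable_continuous_onI continuous_intros)
      then show "(\<lambda>q. ennreal (H (x, t - \<tau> * q)) * indicator {0..<1} q) \<in> borel_measurable lborel" by simp
    qed
    finally show "ennreal (R (x, t)) * (\<integral>\<^sup>+s. ennreal (H (x, s)) * indicator {t - \<tau><..t} s \<partial>lborel) = ennreal \<tau> * K \<tau> (x, t)"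
      unfolding e by (simp add: mult.left_commute)
  qed
  have Pm: "P \<tau> \<in> borel_measurable borel" if "\<tau> > 0" for \<tau>
  proof -
    have "(\<lambda>y. ennreal \<tau> * K \<tau> (snd y, fst y)) \<in> borel_measurable (lborel \<Otimes>\<^sub>M lborel)"
      by (rule borel_measurable_times_ennreal[OF borel_measurable_const measurable_compose[OF measurable_Pair[OF measurable_snd measurable_fst] Km]])
    then have "(\<lambda>t. \<integral>\<^sup>+x. ennreal \<tau> * K \<tau> (x, t) \<partial>lborel) \<in> borel_measurable lborel"
      by (intro lborel.borel_measurable_nn_integral) (simp add: case_prod_unfold)
    then show ?thesis unfolding P_eq[OF that, abs_def] by simp
  qed
  then show "\<And>\<tau>. \<tau> > 0 \<Longrightarrow> P \<tau> \<in> borel_measurable borel" .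
  have P_int: "(\<integral>\<^sup>+t. P \<tau> t \<partial>lborel) = ennreal \<tau> * (\<integral>\<^sup>+q. C (\<tau> * q) * indicator {0..<1} q \<partial>lborel)" if \<tau>: "\<tau> > 0" for \<tau>
  proof -
    have "(\<integral>\<^sup>+t. P \<tau> t \<partial>lborel) = (\<integral>\<^sup>+z. ennreal \<tau> * K \<tau> z \<partial>(lborel \<Otimes>\<^sub>M lborel))"
      unfolding P_eq[OF \<tau>] by (rule lborel_pair.nn_integral_snd) (intro borel_measurable_times_ennreal borel_measurable_const Km)
    also have "\<dots> = ennreal \<tau> * (\<integral>\<^sup>+z. K \<tau> z \<partial>(lborel \<Otimes>\<^sub>M lborel))" by (rule nn_integral_cmult[OF Km])
    also have "(\<integral>\<^sup>+z. K \<tau> z \<partial>(lborel \<Otimes>\<^sub>M lborel)) = (\<integral>\<^sup>+z. (\<integral>\<^sup>+q. k \<tau> (z, q) \<partial>lborel) \<partial>lborel)"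
      unfolding K_def lborel_prod ..
    also have "\<dots> = (\<integral>\<^sup>+q. (\<integral>\<^sup>+z. k \<tau> (z, q) \<partial>lborel) \<partial>lborel)"
      by (rule lborel_pair.Fubini'[symmetric]) (use km in simp)
    also have "\<dots> = (\<integral>\<^sup>+q. C (\<tau> * q) * indicator {0..<1} q \<partial>lborel)"
    proof (rule nn_integral_cong)
      fix q
      have "(\<lambda>z. H (z - (0, \<tau> * q))) \<in> borel_measurable borel"
        by (rule measurable_compose[OF _ H(1)]) (intro borel_measurable_continuous_onI continuous_intros)
      then show "(\<integral>\<^sup>+z. k \<tau> (z, q) \<partial>lborel) = C (\<tau> * q) * indicator {0..<1} q"
        unfolding k_def C_def fst_conv snd_conv using R(1) by (intro nn_integral_multc) simp
    qed
    finally show ?thesis .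
  qed
  let ?RR = "\<integral>\<^sup>+z. (ennreal (R z))\<^sup>2 \<partial>lborel" and ?HH = "\<integral>\<^sup>+z. (ennreal (H z))\<^sup>2 \<partial>lborel"
  \<comment> \<open>Cauchy-Schwarz bounds the square of C; the added 1 covers C \<le> 1, and
    otherwise C is at most its square.\<close>
  have C_le: "C s \<le> 1 + ?RR * ?HH" for s
  proof -
    have sq: "(C s)\<^sup>2 \<le> ?RR * ?HH"
    proof -
      have "(\<lambda>z. H (z - (0, s))) \<in> borel_measurable borel"
        by (rule measurable_compose[OF _ H(1)]) (intro borel_measurable_continuous_onI continuous_intros)
      then have "(C s)\<^sup>2 \<le> ?RR * (\<integral>\<^sup>+z. (ennreal (H (z - (0, s))))\<^sup>2 \<partial>lborel)"
        unfolding C_def using R(1) by (intro Cauchy_Schwarz_nn_integral) simp_all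
      then show ?thesis unfolding L2_sqnorm_translate[OF H(1)] .
    qed
    show ?thesis
    proof (cases "C s \<le> 1")
      case True
      then show ?thesis by (rule order_trans) simp
    next
      case False
      then have "1 * C s \<le> C s * C s" by (intro mult_right_mono) simp_all
      also have "\<dots> \<le> ?RR * ?HH" using sq by (simp add: power2_eq_square)
      finally show ?thesis by (simp add: add_increasing)
    qed
  qed
  define \<tau> where "\<tau> N = T / real (Suc N)" for N
  have \<tau>0: "\<tau> N > 0" for N using T by (simp add: \<tau>_def)
  have Cm: "(\<lambda>q. C (s * q)) \<in> borel_measurable borel" for s
  proof -
    have c: "continuous_on UNIV (\<lambda>y :: real \<times> ('a \<times> real). snd y - (0, s * fst y))"
      by (intro continuous_intros)
    have 1: "(\<lambda>y :: real \<times> ('a \<times> real). H (snd y - (0, s * fst y))) \<in> borel_measurable borel"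
      by (rule measurable_compose[OF borel_measurable_continuous_onI[OF c] H(1)])
    have 2: "(\<lambda>y :: real \<times> ('a \<times> real). R (snd y)) \<in> borel_measurable borel"
      by (rule measurable_compose[OF borel_measurable_continuous_onI[OF continuous_on_snd[OF continuous_on_id]] R(1)])
    have "(\<lambda>y :: real \<times> ('a \<times> real). ennreal (R (snd y)) * ennreal (H (snd y - (0, s * fst y)))) \<in> borel_measurable borel"
      by (intro borel_measurable_times_ennreal measurable_compose[OF _ measurable_ennreal] 1 2)
    then have "(\<lambda>y :: real \<times> ('a \<times> real). ennreal (R (snd y)) * ennreal (H (snd y - (0, s * fst y)))) \<in> borel_measurable (lborel \<Otimes>\<^sub>M lborel)"
      unfolding lborel_prod by simp
    then have "(\<lambda>q. C (s * q)) \<in> borel_measurable lborel"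
      unfolding C_def by (intro lborel.borel_measurable_nn_integral) (simp add: case_prod_unfold)
    then show ?thesis by simp
  qed
  have \<tau>_lim: "\<tau> \<longlonglongrightarrow> 0"
  proof -
    have "(\<lambda>N. T * inverse (real (Suc N))) \<longlonglongrightarrow> T * 0"
      by (intro tendsto_mult tendsto_const LIMSEQ_inverse_real_of_nat)
    then show ?thesis by (simp add: \<tau>_def[abs_def] divide_inverse del: of_nat_Suc)
  qed
  have "(\<lambda>N. \<integral>\<^sup>+q. C (\<tau> N * q) * indicator {0..<1} q \<partial>lborel) \<longlonglongrightarrow> (\<integral>\<^sup>+q. 0 \<partial>(lborel :: real measure))"
  proof (rule nn_integral_dominated_convergence[where w="\<lambda>q. (1 + ?RR * ?HH) * indicator {0..<1} q"])
    show "(\<lambda>q. C (\<tau> N * q) * indicator {0..<1} q) \<in> borel_measurable lborel" for N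
      using Cm[of "\<tau> N"] by simp
    show "AE q in lborel. C (\<tau> N * q) * indicator {0..<1} q \<le> (1 + ?RR * ?HH) * indicator {0..<1} q" for N
      by (intro AE_I2 mult_right_mono C_le) simp
    have "(\<integral>\<^sup>+q. (1 + ?RR * ?HH) * indicator {0..<1} q \<partial>(lborel :: real measure)) = (1 + ?RR * ?HH) * emeasure lborel {0..<1::real}"
      by (rule nn_integral_cmult_indicator) simp
    also have "\<dots> < \<infinity>" using R(3) H(3) by (simp add: ennreal_mult_less_top)
    finally show "(\<integral>\<^sup>+q. (1 + ?RR * ?HH) * indicator {0..<1} q \<partial>(lborel :: real measure)) < \<infinity>" .
    show "AE q in lborel. (\<lambda>N. C (\<tau> N * q) * indicator {0..<1} q) \<longlonglongrightarrow> 0"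
    proof (rule AE_I2)
      fix q :: real
      have "(\<lambda>N. (0, \<tau> N * q)) \<longlonglongrightarrow> (0 :: 'a, 0 * q)"
        by (intro tendsto_Pair tendsto_const tendsto_mult \<tau>_lim)
      then have "(\<lambda>N. (0, \<tau> N * q)) \<longlonglongrightarrow> (0 :: 'a \<times> real)" by (simp add: zero_prod_def)
      then have "(\<lambda>N. C (\<tau> N * q)) \<longlonglongrightarrow> 0" unfolding C_def by (rule translate_orthogonal[OF R H RH])
      then show "(\<lambda>N. C (\<tau> N * q) * indicator {0..<1} q) \<longlonglongrightarrow> 0"
        by (cases "q \<in> {0..<1}") simp_all
    qed
  qed simp_all
  then have "(\<lambda>N. ennreal T * (\<integral>\<^sup>+q. C (\<tau> N * q) * indicator {0..<1} q \<partial>lborel)) \<longlonglongrightarrow> ennreal T * 0"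
    by (intro ennreal_tendsto_cmult) simp_all
  moreover have "of_nat (Suc N) * (\<integral>\<^sup>+t. P (\<tau> N) t \<partial>lborel) = ennreal T * (\<integral>\<^sup>+q. C (\<tau> N * q) * indicator {0..<1} q \<partial>lborel)" for N
  proof -
    have "of_nat (Suc N) * ennreal (\<tau> N) = ennreal (real (Suc N) * \<tau> N)"
      by (simp only: ennreal_of_nat_eq_real_of_nat ennreal_mult'[OF of_nat_0_le_iff])
    also have "\<dots> = ennreal T" by (simp add: \<tau>_def del: of_nat_Suc)
    finally show ?thesis unfolding P_int[OF \<tau>0] by (simp only: mult.assoc[symmetric])
  qed
  ultimately show "(\<lambda>N. of_nat (Suc N) * (\<integral>\<^sup>+t. P (T / real (Suc N)) t \<partial>lborel)) \<longlonglongrightarrow> 0"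
    unfolding \<tau>_def by simp
qed

section \<open>The comparison principle\<close>

context bounded_open
begin

lemma nn_integral_lebesgue_on_eq_lborel:
  assumes "\<And>x. x \<notin> \<Omega> \<Longrightarrow> f x = 0"
  shows "(\<integral>\<^sup>+x. f x \<partial>\<L>) = (\<integral>\<^sup>+x. f x \<partial>lborel)"
proof -
  have "(\<integral>\<^sup>+x. f x \<partial>\<L>) = (\<integral>\<^sup>+x. f x * indicator \<Omega> x \<partial>lebesgue)"
    by (rule nn_integral_restrict_space) (use \<Omega>_sets in simp)
  also have "\<dots> = (\<integral>\<^sup>+x. f x \<partial>lebesgue)"
    by (rule nn_integral_cong) (use assms in \<open>simp add: indicator_def\<close>)
  also have "\<dots> = (\<integral>\<^sup>+x. f x \<partial>lborel)" by (rule nn_integral_completion)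
  finally show ?thesis .
qed

lemma AE_lebesgue_on_\<Omega>_iff: "(AE x in \<L>. P x) \<longleftrightarrow> (AE x in lborel. x \<in> \<Omega> \<longrightarrow> P x)"
  unfolding AE_lebesgue_on_iff[OF \<Omega>_sets] AE_completion_iff ..

text \<open>The term \<epsilon> (b - a) is drawn under the integral, where taking positive parts can
  only increase the value. In this way the shift of the function by \<epsilon> t becomes a
  truncation of its time derivative at \<epsilon>.\<close>

lemma increment_bound:
  fixes V :: "'a \<times> real \<Rightarrow> real"
  assumes V: "integrable lborel (\<lambda>t. V (x, t))" and x: "x \<in> \<Omega>" and ab: "0 \<le> a" "a < b" "b < T"
  shows "ennreal ((LINT t|lborel. V (x, t) * indicator {a<..b} t) - \<epsilon> * (b - a)) \<le>
    (\<integral>\<^sup>+s. ennreal (max (V (x, s) - \<epsilon>) 0 * indicator (cylinder \<Omega> T) (x, s)) * indicator {a<..b} s \<partial>lborel)"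
proof -
  have i1: "integrable lborel (\<lambda>t. V (x, t) * indicator {a<..b} t)"
    using integrable_mult_indicator[OF _ V, of "{a<..b}"] by (simp add: mult.commute)
  have i2: "integrable lborel (\<lambda>t. \<epsilon> * indicator {a<..b} t)"
    by (intro integrable_mult_right integrable_real_indicator) (use ab in simp_all)
  have "(LINT t|lborel. \<epsilon> * indicator {a<..b} t) = \<epsilon> * (b - a)" using ab by simp
  then have "(LINT t|lborel. V (x, t) * indicator {a<..b} t) - \<epsilon> * (b - a) =
      (LINT t|lborel. V (x, t) * indicator {a<..b} t - \<epsilon> * indicator {a<..b} t)"
    using Bochner_Integration.integral_diff[OF i1 i2] by (simp only:)
  then have "ennreal ((LINT t|lborel. V (x, t) * indicator {a<..b} t) - \<epsilon> * (b - a)) \<le>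
      (\<integral>\<^sup>+t. ennreal (V (x, t) * indicator {a<..b} t - \<epsilon> * indicator {a<..b} t) \<partial>lborel)"
    using ennreal_integral_le[OF Bochner_Integration.integrable_diff[OF i1 i2]] by simp
  also have "\<dots> = (\<integral>\<^sup>+s. ennreal (max (V (x, s) - \<epsilon>) 0 * indicator (cylinder \<Omega> T) (x, s)) * indicator {a<..b} s \<partial>lborel)"
  proof (rule nn_integral_cong)
    fix s
    show "ennreal (V (x, s) * indicator {a<..b} s - \<epsilon> * indicator {a<..b} s) =
      ennreal (max (V (x, s) - \<epsilon>) 0 * indicator (cylinder \<Omega> T) (x, s)) * indicator {a<..b} s"
    proof (cases "s \<in> {a<..b}")
      case True
      then have "(x, s) \<in> cylinder \<Omega> T" using x ab by simp
      then show ?thesis using True by (simp add: max.commute[of _ 0] ennreal_max_0)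
    qed simp
  qed
  finally show ?thesis .
qed

text \<open>The discrete estimate holds for almost every end point t with the grid t - j \<tau>.
  Integrated over t, its N + 1 error terms become equal by translation, and their sum tends to 0 as
  \<tau> = T/(N+1) shrinks, while the left-hand side does not depend on N.\<close>

lemma maximum_principle:
  fixes w w' W V :: "'a \<times> real \<Rightarrow> real"
  assumes Lip: "bounded_Lipschitz_domain \<Omega>" and fr: "\<Gamma>\<^sub>D \<union> \<Gamma>\<^sub>N = frontier \<Omega>" and T: "T > 0"
    and W: "W \<in> borel_measurable borel" "W \<in> L2 lborel"
    and V: "V \<in> borel_measurable borel" "V \<in> L2 lborel" "\<And>z. z \<notin> cylinder \<Omega> T \<Longrightarrow> V z = 0"
    and w': "w' \<in> borel_measurable borel" "AE z in lebesgue_on (cylinder \<Omega> T). w z = w' z"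
    and mp: "AE t in lborel. t \<in> {0<..<T} \<longrightarrow> mixed_problem \<Gamma>\<^sub>D \<Gamma>\<^sub>N (\<lambda>x. w (x, t)) (\<lambda>x. W (x, t))"
    and inc: "\<And>a b. 0 \<le> a \<Longrightarrow> a < b \<Longrightarrow> b < T \<Longrightarrow>
      AE x in \<L>. w (x, b) - w (x, a) = (LINT t|lborel. V (x, t) * indicator {a<..b} t)"
    and w0: "AE x in \<L>. w (x, 0) \<le> 0"
    and sub: "AE z in lborel. V z \<le> max (W z) 0"
  shows "AE z in lebesgue_on (cylinder \<Omega> T). w z \<le> 0"
proof -
  let ?Q = "cylinder \<Omega> T"
  have rep: "AE t in lborel. t \<in> {0<..<T} \<longrightarrow> (AE x in \<L>. w (x, t) = w' (x, t))"
    using AE_lebesgue_on_slices(2)[OF cylinder_sets(2) w'(2)]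
  proof eventually_elim
    case (elim t)
    show ?case
    proof
      assume "t \<in> {0<..<T}"
      then have "AE x in lborel. x \<in> \<Omega> \<longrightarrow> w (x, t) = w' (x, t)" using elim by simp
      then show "AE x in \<L>. w (x, t) = w' (x, t)" unfolding AE_lebesgue_on_\<Omega>_iff .
    qed
  qed
  have sm: "(\<lambda>z :: 'a \<times> real. snd z) \<in> borel_measurable borel"
    by (intro borel_measurable_continuous_onI continuous_intros)
  have vanish: "(\<integral>\<^sup>+z. ennreal (w' z - \<epsilon> * snd z) * indicator ?Q z \<partial>lborel) = 0" if \<epsilon>: "\<epsilon> > 0" for \<epsilon>
  proof -
    define R where "R z = max (\<epsilon> - W z) 0 * indicator ?Q z" for z
    define H where "H z = max (V z - \<epsilon>) 0 * indicator ?Q z" for z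
    have Qb: "bounded ?Q" by (rule bounded_Times[OF bounded_\<Omega> bounded_box[of 0 T, unfolded box_real]])
    note iQ = borel_measurable_indicator[OF cylinder_sets(1)[of T]]
    have Rm: "R \<in> borel_measurable borel" unfolding R_def[abs_def]
      by (intro borel_measurable_times borel_measurable_max borel_measurable_diff borel_measurable_const W iQ)
    have Hm: "H \<in> borel_measurable borel" unfolding H_def[abs_def]
      by (intro borel_measurable_times borel_measurable_max borel_measurable_diff borel_measurable_const V iQ)
    have R0: "0 \<le> R z" and H0: "0 \<le> H z" for z by (simp_all add: R_def H_def)
    have fin: "(\<integral>\<^sup>+z. (ennreal (F z))\<^sup>2 \<partial>lborel) < \<infinity>"
      if F: "F \<in> borel_measurable borel" "\<And>z. 0 \<le> F z" and G: "G \<in> L2 lborel"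
        and le: "\<And>z. F z \<le> \<bar>\<epsilon> * indicator ?Q z - G z\<bar>" for F G :: "'a \<times> real \<Rightarrow> real"
    proof -
      have "(\<lambda>z. \<epsilon> *\<^sub>R indicator ?Q z - G z) \<in> L2 lborel"
        by (intro L2_diff L2_scale indicator_L2[OF Qb cylinder_sets(1)] G)
      then have "F \<in> L2 lborel"
        by (rule L2_bound) (use F le in \<open>simp_all add: abs_of_nonneg\<close>)
      then have "L2_sqnorm lborel F < \<infinity>" by (simp add: L2_iff)
      then show ?thesis using F(2) by (simp add: L2_sqnorm_def ennreal_power)
    qed
    have Rfin: "(\<integral>\<^sup>+z. (ennreal (R z))\<^sup>2 \<partial>lborel) < \<infinity>"
      by (rule fin[OF Rm R0 W(2)]) (auto simp: R_def indicator_def)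
    have Hfin: "(\<integral>\<^sup>+z. (ennreal (H z))\<^sup>2 \<partial>lborel) < \<infinity>"
      by (rule fin[OF Hm H0 V(2)]) (auto simp: H_def indicator_def)
    have RH: "AE z in lborel. R z * H z = 0"
      using sub
    proof eventually_elim
      case (elim z)
      \<comment> \<open>If V > \<epsilon> then V is positive, so V \<le> W and hence W >
        \<epsilon>.\<close>
      have "\<epsilon> - W z \<le> 0 \<or> V z - \<epsilon> \<le> 0" using elim \<epsilon> by (auto simp: max_def split: if_splits)
      then show ?case by (auto simp: R_def H_def)
    qed
    define h where "h \<tau> x t = (\<integral>\<^sup>+s. ennreal (H (x, s)) * indicator {t - \<tau><..t} s \<partial>lborel)" for \<tau> x t
    define P where "P \<tau> t = (\<integral>\<^sup>+x. ennreal (R (x, t)) * h \<tau> x t \<partial>lborel)" for \<tau> t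
    note delayed = delayed_product[OF Rm R0 Rfin Hm H0 Hfin RH T, folded h_def, folded P_def]
    have P_eq: "(\<integral>\<^sup>+x. ennreal (R (x, t)) * h \<tau> x t \<partial>\<L>) = P \<tau> t" for \<tau> t
      unfolding P_def by (rule nn_integral_lebesgue_on_eq_lborel) (simp add: R_def)
    define f where "f z = ennreal (w' z - \<epsilon> * snd z) * indicator ?Q z" for z
    have fm: "f \<in> borel_measurable (lborel \<Otimes>\<^sub>M lborel)"
    proof -
      have "f \<in> borel_measurable borel"
        unfolding f_def[abs_def] using w'(1) sm cylinder_sets(1)[of T]
        by (intro borel_measurable_times_ennreal borel_measurable_indicator measurable_compose[OF _ measurable_ennreal]
            borel_measurable_diff borel_measurable_times borel_measurable_const)
      then show ?thesis unfolding lborel_prod by simp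
    qed
    have iV: "AE x in lborel. integrable lborel (\<lambda>t. V (x, t))"
      by (rule lborel_pair.AE_integrable_fst'[unfolded lborel_prod]) (rule integrable_representative[OF V(2,3)])
    have inc': "AE x in \<L>. ennreal ((w (x, b) - w (x, a)) - \<epsilon> * (b - a)) \<le>
        (\<integral>\<^sup>+s. ennreal (H (x, s)) * indicator {a<..b} s \<partial>lborel)" if "0 \<le> a" "a < b" "b < T" for a b
      using inc[OF that] iV unfolding AE_lebesgue_on_\<Omega>_iff
    proof eventually_elim
      case (elim x)
      show ?case
      proof
        assume x: "x \<in> \<Omega>"
        from increment_bound[OF elim(2) x that, of \<epsilon>] elim(1) x
        show "ennreal ((w (x, b) - w (x, a)) - \<epsilon> * (b - a)) \<le> (\<integral>\<^sup>+s. ennreal (H (x, s)) * indicator {a<..b} s \<partial>lborel)"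
          unfolding H_def by simp
      qed
    qed
    have bound: "ennreal \<epsilon> * (\<integral>\<^sup>+z. f z \<partial>lborel) \<le> of_nat (Suc N) * (\<integral>\<^sup>+t. P (T / real (Suc N)) t \<partial>lborel)" for N
    proof -
      define \<tau> where "\<tau> = T / real (Suc N)"
      have \<tau>: "\<tau> > 0" "real (Suc N) * \<tau> = T" using T by (simp_all add: \<tau>_def del: of_nat_Suc)
      define B where "B t \<longleftrightarrow> mixed_problem \<Gamma>\<^sub>D \<Gamma>\<^sub>N (\<lambda>x. w (x, t)) (\<lambda>x. W (x, t)) \<and>
        (AE x in \<L>. w (x, t) = w' (x, t))" for t
      \<comment> \<open>The times whose whole backward grid is good. Almost every time belongs to
        \<open>A\<close>, since only countably many translates of one null set are excluded.\<close>
      define A where "A = {t \<in> {0<..<T}. \<forall>j::nat. real j * \<tau> < t \<longrightarrow> B (t - real j * \<tau>)}"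
      have A1: "0 < t" "t < T" "B t" if "t \<in> A" for t
        using that unfolding A_def by (auto dest: spec[of _ 0])
      have A2: "t - \<tau> \<in> A" if t: "t \<in> A" "\<tau> < t" for t
      proof -
        have "B (t - \<tau> - real j * \<tau>)" if "real j * \<tau> < t - \<tau>" for j
        proof -
          have "real (Suc j) * \<tau> < t" using that by (simp add: algebra_simps)
          then have "B (t - real (Suc j) * \<tau>)" using t(1) unfolding A_def by blast
          then show ?thesis by (simp add: algebra_simps)
        qed
        then show ?thesis using t A1(2)[OF t(1)] \<tau>(1) unfolding A_def by simp
      qed
      have AE_A: "AE t in lborel. t \<in> {0<..<T} \<longrightarrow> t \<in> A"
      proof -
        have B: "AE t in lborel. t \<in> {0<..<T} \<longrightarrow> B t"
          using mp rep unfolding B_def by eventually_elim blast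
        have "AE t in lborel. \<forall>j::nat. t - real j * \<tau> \<in> {0<..<T} \<longrightarrow> B (t - real j * \<tau>)"
          unfolding AE_all_countable by (intro allI AE_lborel_translate[OF B])
        then show ?thesis
        proof eventually_elim
          case (elim t)
          show ?case
          proof
            assume t: "t \<in> {0<..<T}"
            have "B (t - real j * \<tau>)" if "real j * \<tau> < t" for j
            proof -
              have "0 \<le> real j * \<tau>" using \<tau>(1) by simp
              then have "t - real j * \<tau> \<in> {0<..<T}" using that t by auto
              then show ?thesis using elim by blast
            qed
            then show "t \<in> A" using t unfolding A_def by blast
          qed
        qed
      qed
      have slice: "ennreal \<epsilon> * (\<integral>\<^sup>+x. f (x, t) \<partial>lborel) \<le> (\<Sum>j<Suc N. P \<tau> (t - real j * \<tau>))" if t: "t \<in> A" for t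
      proof -
        have "ennreal \<epsilon> * (\<integral>\<^sup>+x. ennreal (w (x, t) - \<epsilon> * t) \<partial>\<L>) \<le>
            (\<Sum>j<Suc N. \<integral>\<^sup>+x. ennreal (R (x, t - real j * \<tau>)) * h \<tau> x (t - real j * \<tau>) \<partial>\<L>)"
        proof (rule discrete_energy[where A=A and L=W, OF Lip fr less_imp_le[OF \<epsilon>]])
          show "0 < t" if "t \<in> A" for t using A1 that by blast
          show "t - \<tau> \<in> A" if "t \<in> A" "\<tau> < t" for t using A2 that by blast
          show "mixed_problem \<Gamma>\<^sub>D \<Gamma>\<^sub>N (\<lambda>x. w (x, t)) (\<lambda>x. W (x, t))" if "t \<in> A" for t
            using A1(3)[OF that] unfolding B_def by blast
          show "AE x in \<L>. \<epsilon> - W (x, t) \<le> R (x, t)" if "t \<in> A" for t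
            unfolding AE_lebesgue_on_\<Omega>_iff
            by (rule AE_I2) (use A1(1,2)[OF that] in \<open>simp add: R_def\<close>)
          show "AE x in \<L>. ennreal (w (x, t) - \<epsilon> * t) \<le> h \<tau> x t" if "t \<in> A" "t \<le> \<tau>" for t
            using inc'[OF order_refl A1(1,2)[OF that(1)]] w0
          proof eventually_elim
            case (elim x)
            \<comment> \<open>The initial value is nonpositive and may be subtracted; moreover, as t
              \<le> \<tau>, the window (t - \<tau>, t] contains (0, t].\<close>
            have "ennreal (w (x, t) - \<epsilon> * t) \<le> ennreal ((w (x, t) - w (x, 0)) - \<epsilon> * (t - 0))"
              using elim(2) by (intro ennreal_leI) simp
            also note elim(1)
            also have "(\<integral>\<^sup>+s. ennreal (H (x, s)) * indicator {0<..t} s \<partial>lborel) \<le> h \<tau> x t"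
              unfolding h_def by (intro nn_integral_mono mult_left_mono) (use that(2) in \<open>auto simp: indicator_def\<close>)
            finally show ?case .
          qed
          show "AE x in \<L>. ennreal ((w (x, t) - \<epsilon> * t) - (w (x, t - \<tau>) - \<epsilon> * (t - \<tau>))) \<le> h \<tau> x t"
            if "t \<in> A" "\<tau> < t" for t
          proof -
            have "0 \<le> t - \<tau>" "t - \<tau> < t" using that(2) \<tau>(1) by simp_all
            from inc'[OF this A1(2)[OF that(1)]] show ?thesis
              unfolding h_def by eventually_elim (simp add: algebra_simps)
          qed
          show "t \<in> A" by fact
          show "t \<le> real (Suc N) * \<tau>" using A1(2)[OF t] \<tau>(2) by simp
        qed
        also have "\<dots> = (\<Sum>j<Suc N. P \<tau> (t - real j * \<tau>))" by (simp only: P_eq)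
        also have "(\<integral>\<^sup>+x. ennreal (w (x, t) - \<epsilon> * t) \<partial>\<L>) = (\<integral>\<^sup>+x. f (x, t) \<partial>\<L>)"
        proof (rule nn_integral_cong_AE)
          have "AE x in \<L>. w (x, t) = w' (x, t)" using A1(3)[OF t] unfolding B_def by blast
          then show "AE x in \<L>. ennreal (w (x, t) - \<epsilon> * t) = f (x, t)"
            unfolding AE_lebesgue_on_\<Omega>_iff
            by eventually_elim (use A1(1,2)[OF t] in \<open>simp add: f_def\<close>)
        qed
        also have "\<dots> = (\<integral>\<^sup>+x. f (x, t) \<partial>lborel)"
          by (rule nn_integral_lebesgue_on_eq_lborel) (simp add: f_def)
        finally show ?thesis .
      qed
      \<comment> \<open>Integration over the whole line removes the delay j \<tau>, so all grid
        points contribute the same amount.\<close>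
      have P_shift: "(\<integral>\<^sup>+t. P \<tau> (t - real j * \<tau>) \<partial>lborel) = (\<integral>\<^sup>+t. P \<tau> t \<partial>lborel)" for j
        using nn_integral_real_affine[OF delayed(1)[OF \<tau>(1)], of 1 "- (real j * \<tau>)"] by simp
      have "ennreal \<epsilon> * (\<integral>\<^sup>+z. f z \<partial>lborel) = ennreal \<epsilon> * (\<integral>\<^sup>+t. (\<integral>\<^sup>+x. f (x, t) \<partial>lborel) \<partial>lborel)"
        using lborel_pair.nn_integral_snd[OF fm] unfolding lborel_prod by simp
      also have "\<dots> = (\<integral>\<^sup>+t. ennreal \<epsilon> * (\<integral>\<^sup>+x. f (x, t) \<partial>lborel) \<partial>lborel)"
      proof (rule nn_integral_cmult[symmetric])
        have "(\<lambda>y. f (snd y, fst y)) \<in> borel_measurable (lborel \<Otimes>\<^sub>M lborel)"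
          by (rule measurable_compose[OF measurable_Pair[OF measurable_snd measurable_fst] fm])
        then show "(\<lambda>t. \<integral>\<^sup>+x. f (x, t) \<partial>lborel) \<in> borel_measurable lborel"
          by (intro lborel.borel_measurable_nn_integral) (simp add: case_prod_unfold)
      qed
      also have "\<dots> \<le> (\<integral>\<^sup>+t. (\<Sum>j<Suc N. P \<tau> (t - real j * \<tau>)) \<partial>lborel)"
      proof (rule nn_integral_mono_AE)
        show "AE t in lborel. ennreal \<epsilon> * (\<integral>\<^sup>+x. f (x, t) \<partial>lborel) \<le> (\<Sum>j<Suc N. P \<tau> (t - real j * \<tau>))"
          using AE_A
        proof eventually_elim
          case (elim t)
          show ?case
          proof (cases "t \<in> {0<..<T}")
            case True
            then show ?thesis using elim slice by blast
          next
            case False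
            then have "f (x, t) = 0" for x by (auto simp: f_def indicator_def)
            then show ?thesis by simp
          qed
        qed
      qed
      also have "\<dots> = (\<Sum>j<Suc N. \<integral>\<^sup>+t. P \<tau> (t - real j * \<tau>) \<partial>lborel)"
      proof (rule nn_integral_sum)
        fix j
        show "(\<lambda>t. P \<tau> (t - real j * \<tau>)) \<in> borel_measurable lborel"
          using measurable_compose[OF _ delayed(1)[OF \<tau>(1)], of "\<lambda>t. t - real j * \<tau>" borel] by simp
      qed
      also have "\<dots> = of_nat (Suc N) * (\<integral>\<^sup>+t. P \<tau> t \<partial>lborel)" unfolding P_shift by simp
      finally show ?thesis unfolding \<tau>_def .
    qed
    have "ennreal \<epsilon> * (\<integral>\<^sup>+z. f z \<partial>lborel) \<le> 0"
      by (rule LIMSEQ_le_const[OF delayed(2)]) (use bound in blast)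
    then show ?thesis using \<epsilon> unfolding f_def by simp
  qed
  have "AE z in lborel. \<forall>n. ennreal (w' z - inverse (real (Suc n)) * snd z) * indicator ?Q z = 0"
    unfolding AE_all_countable
  proof
    fix n
    have m: "(\<lambda>z. ennreal (w' z - inverse (real (Suc n)) * snd z) * indicator ?Q z) \<in> borel_measurable lborel"
      using w'(1) sm cylinder_sets(1)[of T]
      by (intro borel_measurable_times_ennreal borel_measurable_indicator measurable_compose[OF _ measurable_ennreal]
          borel_measurable_diff borel_measurable_times borel_measurable_const) simp_all
    have pos: "0 < inverse (real (Suc n))" by simp
    from vanish[OF pos]
    show "AE z in lborel. ennreal (w' z - inverse (real (Suc n)) * snd z) * indicator ?Q z = 0"
      by (simp only: nn_integral_0_iff_AE[OF m])
  qed
  then have "AE z in lborel. z \<in> ?Q \<longrightarrow> w' z \<le> 0"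
  proof eventually_elim
    case (elim z)
    show ?case
    proof
      assume z: "z \<in> ?Q"
      have "w' z \<le> inverse (real (Suc n)) * snd z" for n
        using spec[OF elim, of n] z by (simp add: ennreal_eq_0_iff del: of_nat_Suc)
      moreover have "(\<lambda>n. inverse (real (Suc n)) * snd z) \<longlonglongrightarrow> 0 * snd z"
        by (intro tendsto_mult tendsto_const LIMSEQ_inverse_real_of_nat)
      ultimately have "w' z \<le> 0 * snd z" by (intro LIMSEQ_le_const[where X="\<lambda>n. inverse (real (Suc n)) * snd z"]) blast+
      then show "w' z \<le> 0" by simp
    qed
  qed
  then have "AE z in lebesgue_on ?Q. w' z \<le> 0"
    unfolding AE_lebesgue_on_iff[OF cylinder_sets(2)] AE_completion_iff .
  with w'(2) show ?thesis by eventually_elim simp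
qed

end

text \<open>This is where the order of the forcing terms enters: with b \<le> d the difference of
  the two right-hand sides is bounded by the positive part of the difference of the
  Laplacians.\<close>

lemma max_add_diff_le: "b \<le> d \<Longrightarrow> max (a + b) 0 - max (c + d) 0 \<le> max (a - c) (0::real)"
  by (auto simp: max_def)

theorem theorem2p8:
  fixes \<Omega> \<Gamma>\<^sub>D \<Gamma>\<^sub>N :: "'a::euclidean_space set"
    and T :: real
    and u01 u02 :: "'a \<Rightarrow> real"
    and f1 f2 u1 u2 :: "'a \<times> real \<Rightarrow> real"
  assumes "bounded_Lipschitz_domain \<Omega>"
    and "\<Gamma>\<^sub>D \<union> \<Gamma>\<^sub>N = frontier \<Omega>" and "\<Gamma>\<^sub>D \<inter> \<Gamma>\<^sub>N = {}"
    and "openin (top_of_set (frontier \<Omega>)) \<Gamma>\<^sub>D"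
    and "T > 0"
    and "\<forall>g\<in>L2 (lebesgue_on \<Omega>). \<exists>u\<in>H2 \<Omega>. is_A1_inv \<Omega> \<Gamma>\<^sub>D g u"
    and "u01 \<in> space_X \<Omega> \<Gamma>\<^sub>N \<inter> space_V \<Omega> \<Gamma>\<^sub>D"
    and "u02 \<in> space_X \<Omega> \<Gamma>\<^sub>N \<inter> space_V \<Omega> \<Gamma>\<^sub>D"
    and "f1 \<in> L2 (lebesgue_on (cylinder \<Omega> T))"
    and "f2 \<in> L2 (lebesgue_on (cylinder \<Omega> T))"
    and "\<exists>fs\<in>L2 (lebesgue_on \<Omega>). AE (x, t) in lebesgue_on (cylinder \<Omega> T). f1 (x, t) \<le> fs x"
    and "\<exists>fs\<in>L2 (lebesgue_on \<Omega>). AE (x, t) in lebesgue_on (cylinder \<Omega> T). f2 (x, t) \<le> fs x"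
    and "strong_solution \<Omega> \<Gamma>\<^sub>D \<Gamma>\<^sub>N T u01 f1 u1"
    and "strong_solution \<Omega> \<Gamma>\<^sub>D \<Gamma>\<^sub>N T u02 f2 u2"
    and "AE x in lebesgue_on \<Omega>. u01 x \<le> u02 x"
    and "AE z in lebesgue_on (cylinder \<Omega> T). f1 z \<le> f2 z"
  shows "AE z in lebesgue_on (cylinder \<Omega> T). u1 z \<le> u2 z"
proof -
  interpret bounded_open \<Omega>
    using assms(1) by unfold_locales (simp_all add: bounded_Lipschitz_domain_def)
  let ?Q = "cylinder \<Omega> T"
  note s1 = assms(13)[unfolded strong_solution_def] and s2 = assms(14)[unfolded strong_solution_def]
  from s1 obtain v1 w1 where 1: "u1 \<in> C_time_L2 \<Omega> T" "u1 \<in> W12_time_L2 \<Omega> T"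
    "u1 \<in> L2_time T (space_X \<Omega> \<Gamma>\<^sub>N \<inter> space_V \<Omega> \<Gamma>\<^sub>D) (H2_sqnorm \<Omega>)"
    "is_time_deriv \<Omega> T u1 v1" "w1 \<in> L2 (lebesgue_on ?Q)"
    "AE t in lebesgue_on {0<..<T}. AE x in lebesgue_on \<Omega>. w1 (x, t) = laplacian \<Omega> (\<lambda>y. u1 (y, t)) x"
    "AE z in lebesgue_on ?Q. v1 z = max (w1 z + f1 z) 0" "AE x in lebesgue_on \<Omega>. u1 (x, 0) = u01 x"
    by (elim conjE exE)
  from s2 obtain v2 w2 where 2: "u2 \<in> C_time_L2 \<Omega> T" "u2 \<in> W12_time_L2 \<Omega> T"
    "u2 \<in> L2_time T (space_X \<Omega> \<Gamma>\<^sub>N \<inter> space_V \<Omega> \<Gamma>\<^sub>D) (H2_sqnorm \<Omega>)"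
    "is_time_deriv \<Omega> T u2 v2" "w2 \<in> L2 (lebesgue_on ?Q)"
    "AE t in lebesgue_on {0<..<T}. AE x in lebesgue_on \<Omega>. w2 (x, t) = laplacian \<Omega> (\<lambda>y. u2 (y, t)) x"
    "AE z in lebesgue_on ?Q. v2 z = max (w2 z + f2 z) 0" "AE x in lebesgue_on \<Omega>. u2 (x, 0) = u02 x"
    by (elim conjE exE)
  have u1L: "u1 \<in> L2 (lebesgue_on ?Q)" and u2L: "u2 \<in> L2 (lebesgue_on ?Q)"
    using 1(2) 2(2) by (simp_all add: W12_time_L2_def)
  have v1L: "v1 \<in> L2 (lebesgue_on ?Q)" and v2L: "v2 \<in> L2 (lebesgue_on ?Q)"
    using 1(4) 2(4) by (simp_all add: is_time_deriv_def)
  \<comment> \<open>Slices in x and slices in t are both integrated below, so all functions on the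
    cylinder are replaced by Borel representatives that vanish outside it.\<close>
  note rep = borel_representative[OF cylinder_sets(1)[of T]]
  obtain u1' where u1': "u1' \<in> borel_measurable borel" "AE z in lebesgue_on ?Q. u1 z = u1' z"
    by (rule rep[OF u1L]) blast
  obtain u2' where u2': "u2' \<in> borel_measurable borel" "AE z in lebesgue_on ?Q. u2 z = u2' z"
    by (rule rep[OF u2L]) blast
  obtain v1' where v1': "v1' \<in> borel_measurable borel" "v1' \<in> L2 lborel" "\<And>z. z \<notin> ?Q \<Longrightarrow> v1' z = 0"
      "AE z in lebesgue_on ?Q. v1 z = v1' z"
    by (rule rep[OF v1L]) blast
  obtain v2' where v2': "v2' \<in> borel_measurable borel" "v2' \<in> L2 lborel" "\<And>z. z \<notin> ?Q \<Longrightarrow> v2' z = 0"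
      "AE z in lebesgue_on ?Q. v2 z = v2' z"
    by (rule rep[OF v2L]) blast
  obtain w1' where w1': "w1' \<in> borel_measurable borel" "w1' \<in> L2 lborel" "AE z in lebesgue_on ?Q. w1 z = w1' z"
    by (rule rep[OF 1(5)]) blast
  obtain w2' where w2': "w2' \<in> borel_measurable borel" "w2' \<in> L2 lborel" "AE z in lebesgue_on ?Q. w2 z = w2' z"
    by (rule rep[OF 2(5)]) blast
  have time: "AE t in lborel. t \<in> {0<..<T} \<longrightarrow> P t" if "AE t in lebesgue_on {0<..<T}. P t" for P
  proof -
    have "{0<..<T} \<in> sets lebesgue" by simp
    from that[unfolded AE_lebesgue_on_iff[OF this] AE_completion_iff] show ?thesis .
  qed
  have "AE z in lebesgue_on ?Q. u1 z - u2 z \<le> 0"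
  proof (rule maximum_principle[OF assms(1,2,5), where w="\<lambda>z. u1 z - u2 z" and w'="\<lambda>z. u1' z - u2' z"
        and W="\<lambda>z. w1' z - w2' z" and V="\<lambda>z. v1' z - v2' z"])
    show "(\<lambda>z. w1' z - w2' z) \<in> borel_measurable borel" "(\<lambda>z. v1' z - v2' z) \<in> borel_measurable borel"
      "(\<lambda>z. u1' z - u2' z) \<in> borel_measurable borel"
      using u1'(1) u2'(1) v1'(1) v2'(1) w1'(1) w2'(1) by (simp_all add: borel_measurable_diff)
    show "(\<lambda>z. w1' z - w2' z) \<in> L2 lborel" "(\<lambda>z. v1' z - v2' z) \<in> L2 lborel"
      using v1'(2) v2'(2) w1'(2) w2'(2) by (simp_all add: L2_diff)
    show "v1' z - v2' z = 0" if "z \<notin> ?Q" for z using v1'(3)[OF that] v2'(3)[OF that] by simp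
    show "AE z in lebesgue_on ?Q. u1 z - u2 z = u1' z - u2' z"
      using u1'(2) u2'(2) by eventually_elim simp
    show "AE x in lebesgue_on \<Omega>. u1 (x, 0) - u2 (x, 0) \<le> 0"
      using 1(8) 2(8) assms(15) by eventually_elim simp
    show "AE t in lborel. t \<in> {0<..<T} \<longrightarrow> mixed_problem \<Gamma>\<^sub>D \<Gamma>\<^sub>N (\<lambda>x. u1 (x, t) - u2 (x, t)) (\<lambda>x. w1' (x, t) - w2' (x, t))"
    proof -
      have "AE t in lebesgue_on {0<..<T}. (\<lambda>x. u1 (x, t)) \<in> space_X \<Omega> \<Gamma>\<^sub>N \<inter> space_V \<Omega> \<Gamma>\<^sub>D"
        "AE t in lebesgue_on {0<..<T}. (\<lambda>x. u2 (x, t)) \<in> space_X \<Omega> \<Gamma>\<^sub>N \<inter> space_V \<Omega> \<Gamma>\<^sub>D"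
        using 1(3) 2(3) unfolding L2_time_def by blast+
      from this[THEN time] time[OF 1(6)] time[OF 2(6)]
        AE_lebesgue_on_slices(2)[OF cylinder_sets(2) w1'(3)] AE_lebesgue_on_slices(2)[OF cylinder_sets(2) w2'(3)]
      show ?thesis
      proof eventually_elim
        case (elim t)
        show ?case
        proof
          assume t: "t \<in> {0<..<T}"
          show "mixed_problem \<Gamma>\<^sub>D \<Gamma>\<^sub>N (\<lambda>x. u1 (x, t) - u2 (x, t)) (\<lambda>x. w1' (x, t) - w2' (x, t))"
          proof (rule mixed_problem_diff[OF mp[OF elim(1) t] mp[OF elim(2) t]])
            have "AE x in lebesgue_on \<Omega>. w1 (x, t) = w1' (x, t)" "AE x in lebesgue_on \<Omega>. w2 (x, t) = w2' (x, t)"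
              using elim(5,6) t unfolding AE_lebesgue_on_\<Omega>_iff by simp_all
            with mp[OF elim(3) t] mp[OF elim(4) t]
            show "AE x in lebesgue_on \<Omega>. laplacian \<Omega> (\<lambda>x. u1 (x, t)) x - laplacian \<Omega> (\<lambda>x. u2 (x, t)) x = w1' (x, t) - w2' (x, t)"
              by eventually_elim simp
          qed
        qed
      qed
    qed
    show "AE x in lebesgue_on \<Omega>. (u1 (x, b) - u2 (x, b)) - (u1 (x, a) - u2 (x, a)) =
        (LINT t|lborel. (v1' (x, t) - v2' (x, t)) * indicator {a<..b} t)" if "0 \<le> a" "a < b" "b < T" for a b
    proof -
      have i: "AE x in lborel. integrable lborel (\<lambda>t. v1' (x, t))" "AE x in lborel. integrable lborel (\<lambda>t. v2' (x, t))"
        by (rule lborel_pair.AE_integrable_fst'[unfolded lborel_prod, OF integrable_representative[OF v1'(2,3)]], assumption,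
          rule lborel_pair.AE_integrable_fst'[unfolded lborel_prod, OF integrable_representative[OF v2'(2,3)]], assumption)
      have t1: "AE x in lborel. x \<in> \<Omega> \<longrightarrow> u1 (x, b) - u1 (x, a) = (LINT t|lborel. v1' (x, t) * indicator {a<..b} t)"
        by (rule time_increment[OF 1(1) u1L 1(4) v1'(1,2) _ v1'(4) that]) (rule v1'(3))
      have t2: "AE x in lborel. x \<in> \<Omega> \<longrightarrow> u2 (x, b) - u2 (x, a) = (LINT t|lborel. v2' (x, t) * indicator {a<..b} t)"
        by (rule time_increment[OF 2(1) u2L 2(4) v2'(1,2) _ v2'(4) that]) (rule v2'(3))
      show ?thesis
        unfolding AE_lebesgue_on_\<Omega>_iff
        using t1 t2 i
      proof eventually_elim
        case (elim x)
        have j: "integrable lborel (\<lambda>t. v1' (x, t) * indicator {a<..b} t)" "integrable lborel (\<lambda>t. v2' (x, t) * indicator {a<..b} t)"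
          using integrable_mult_indicator[OF _ elim(3), of "{a<..b}"] integrable_mult_indicator[OF _ elim(4), of "{a<..b}"]
          by (simp_all add: mult.commute)
        show ?case
          unfolding left_diff_distrib Bochner_Integration.integral_diff[OF j]
        proof
          assume "x \<in> \<Omega>"
          with elim(1,2) show "u1 (x, b) - u2 (x, b) - (u1 (x, a) - u2 (x, a)) =
              (LINT t|lborel. v1' (x, t) * indicator {a<..b} t) - (LINT t|lborel. v2' (x, t) * indicator {a<..b} t)"
            by (simp only: simp_thms)
        qed
      qed
    qed
    have "AE z in lebesgue_on ?Q. v1' z - v2' z \<le> max (w1' z - w2' z) 0"
      using 1(7) 2(7) v1'(4) v2'(4) w1'(3) w2'(3) assms(16)
    proof eventually_elim
      case (elim z)
      then show ?case using max_add_diff_le[of "f1 z" "f2 z" "w1 z" "w2 z"] by simp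
    qed
    then have "AE z in lborel. z \<in> ?Q \<longrightarrow> v1' z - v2' z \<le> max (w1' z - w2' z) 0"
      unfolding AE_lebesgue_on_iff[OF cylinder_sets(2)] AE_completion_iff .
    then show "AE z in lborel. v1' z - v2' z \<le> max (w1' z - w2' z) 0"
    proof eventually_elim
      case (elim z)
      then show ?case using v1'(3)[of z] v2'(3)[of z] by (cases "z \<in> ?Q") simp_all
    qed
  qed
  then show ?thesis by eventually_elim simp
qed

end
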